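(* Let $\mathbb{M}$ be a monster model of a complete $C$-minimal expansion of ACVF whose language contains a constant symbol $t$ with $v(t)>0$. Let $D\subseteq\mathrm{RV}^2$ be definable and small over $\Gamma^2$, i.e. $\dim(D\cap(\mathrm{RV}_a\times\mathrm{RV}_b))\le 1$ for all $(a,b)\in\Gamma^2$. Let $\overline{D}\subseteq\Gamma^2$ be the image of $D$ under $\mathrm{RV}^2\to\Gamma^2$, and for $(x,y)\in\Gamma^2$ let $D_{x,y}=D\cap(\mathrm{RV}_x\times\mathrm{RV}_y)$. Then: (1) $\overline{D}$ is a union of finitely many points and line segments; (2) if $k^\times$ has no exotic automorphisms, then $\overline{D}$ is a union of finitely many points and line segments with rational slopes; (3) for all but finitely many $(x,y)\in\overline{D}$, the set $D_{x,y}$ is a finite union of translates of a $1$-dimensional definable subgroup of $(k^\times)^2$.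
   Context: ACVF is the theory of algebraically closed non-trivially valued fields; $C$-minimal means every definable subset of the home sort is a finite boolean combination of balls and points. "Definable" means with parameters. $v$ is the valuation, $\Gamma$ the value group, $\mathfrak m$ the maximal ideal, $k$ the residue field; the induced structure on $k$ is strongly minimal. $\mathrm{RV}=\mathbb{M}^\times/(1+\mathfrak m)$ (a multiplicative group); $v$ induces a surjective homomorphism $\mathrm{RV}\to\Gamma$ with kernel $\mathrm{RV}_0=k^\times$, and $\mathrm{RV}_\gamma$ denotes the fiber over $\gamma$ (a coset of $k^\times$). Each $\mathrm{RV}_a\times\mathrm{RV}_b$ is in definable bijection with $(k^\times)^2$ by translation, and $\dim$ of a definable subset of $\mathrm{RV}_a\times\mathrm{RV}_b$ is the Morley rank (strongly minimal dimension) of its image in $(k^\times)^2$. A line segment in $\Gamma^2$ is either a vertical segment $\{a\}\times I$ with $I$ an open interval, or the graph of a definable linear function $f:I\to\Gamma$ on an open interval $I$ (intervals may be unbounded), where $f$ is linear if $f(a)+f(a+\epsilon_1+\epsilon_2)=f(a+\epsilon_1)+f(a+\epsilon_2)$ whenever all four points lie in $I$. A line segment has rational slope if it is vertical or of the form $\{(x,qx+c):x\in I\}$ with $q\in\mathbb Q$, $c\in\Gamma$. "$k^\times$ has no exotic automorphisms": every definable automorphism of $k^\times$ is definable in the pure ring language on $k$. *)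

theory Defs
  imports
    "HOL-Computational_Algebra.Polynomial"
    "HOL-Algebra.Multiplicative_Group"
    "HOL-Algebra.QuotRing"
    "HOL-Library.Disjoint_Sets"
begin

unbundle cardinal_syntax

section \<open>First-order logic\<close>

record ('f, 'r) lang =
  funs :: "'f set"
  rels :: "'r set"
  farity :: "'f \<Rightarrow> nat"
  rarity :: "'r \<Rightarrow> nat"

datatype 'f tm = Var nat | Fn 'f "'f tm list"

text \<open>De Bruijn indices: in \<open>Ex \<phi>\<close> the bound variable is \<open>Var 0\<close>.\<close>

datatype ('f, 'r) fm =
    Eq "'f tm" "'f tm"
  | Rel 'r "'f tm list"
  | Neg "('f, 'r) fm"
  | Conj "('f, 'r) fm" "('f, 'r) fm"
  | Ex "('f, 'r) fm"

fun wf_tm :: "('f, 'r) lang \<Rightarrow> 'f tm \<Rightarrow> bool" where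
  "wf_tm L (Var i) \<longleftrightarrow> True"
| "wf_tm L (Fn f ts) \<longleftrightarrow> f \<in> funs L \<and> length ts = farity L f \<and> (\<forall>t\<in>set ts. wf_tm L t)"

fun wf_fm :: "('f, 'r) lang \<Rightarrow> ('f, 'r) fm \<Rightarrow> bool" where
  "wf_fm L (Eq s t) \<longleftrightarrow> wf_tm L s \<and> wf_tm L t"
| "wf_fm L (Rel r ts) \<longleftrightarrow> r \<in> rels L \<and> length ts = rarity L r \<and> (\<forall>t\<in>set ts. wf_tm L t)"
| "wf_fm L (Neg \<phi>) \<longleftrightarrow> wf_fm L \<phi>"
| "wf_fm L (Conj \<phi> \<psi>) \<longleftrightarrow> wf_fm L \<phi> \<and> wf_fm L \<psi>"
| "wf_fm L (Ex \<phi>) \<longleftrightarrow> wf_fm L \<phi>"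

record ('f, 'r, 'u) fo_struct =
  univ :: "'u set"
  fint :: "'f \<Rightarrow> 'u list \<Rightarrow> 'u"
  rint :: "'r \<Rightarrow> 'u list \<Rightarrow> bool"

definition is_struct :: "('f, 'r) lang \<Rightarrow> ('f, 'r, 'u) fo_struct \<Rightarrow> bool" where
  "is_struct L M \<longleftrightarrow> univ M \<noteq> {} \<and>
     (\<forall>f\<in>funs L. \<forall>xs. length xs = farity L f \<and> set xs \<subseteq> univ M \<longrightarrow> fint M f xs \<in> univ M)"

fun tm_val :: "('f, 'r, 'u) fo_struct \<Rightarrow> (nat \<Rightarrow> 'u) \<Rightarrow> 'f tm \<Rightarrow> 'u" where
  "tm_val M e (Var i) = e i"
| "tm_val M e (Fn f ts) = fint M f (map (tm_val M e) ts)"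

fun sat :: "('f, 'r, 'u) fo_struct \<Rightarrow> (nat \<Rightarrow> 'u) \<Rightarrow> ('f, 'r) fm \<Rightarrow> bool" where
  "sat M e (Eq s t) \<longleftrightarrow> tm_val M e s = tm_val M e t"
| "sat M e (Rel r ts) \<longleftrightarrow> rint M r (map (tm_val M e) ts)"
| "sat M e (Neg \<phi>) \<longleftrightarrow> \<not> sat M e \<phi>"
| "sat M e (Conj \<phi> \<psi>) \<longleftrightarrow> sat M e \<phi> \<and> sat M e \<psi>"
| "sat M e (Ex \<phi>) \<longleftrightarrow> (\<exists>x\<in>univ M. sat M (case_nat x e) \<phi>)"

text \<open>
  Definability with parameters, for subsets of the \<open>n\<close>-th power of the universe (lists of
  length \<open>n\<close>). Variables \<open>0, \<dots>, n - 1\<close> are the coordinates, the remaining ones carry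
  the parameters.
\<close>

definition definable ::
  "('f, 'r) lang \<Rightarrow> ('f, 'r, 'u) fo_struct \<Rightarrow> nat \<Rightarrow> 'u list set \<Rightarrow> bool" where
  "definable L M n X \<longleftrightarrow> (\<exists>\<phi> e. wf_fm L \<phi> \<and> range e \<subseteq> univ M \<and>
     X = {xs. length xs = n \<and> set xs \<subseteq> univ M \<and>
              sat M (\<lambda>i. if i < n then xs ! i else e (i - n)) \<phi>})"

text \<open>
  \<open>q\<close> maps a definable subset \<open>S\<close> of the universe onto an imaginary sort (a quotient of \<open>S\<close>
  by a definable equivalence relation); a subset of the square of that sort is definable iff
  its preimage in the square of the universe is.
\<close>

definition definable_quot2 ::
  "('f, 'r) lang \<Rightarrow> ('f, 'r, 'u) fo_struct \<Rightarrow> 'u set \<Rightarrow> ('u \<Rightarrow> 's) \<Rightarrow> ('s \<times> 's) set \<Rightarrow> bool" where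
  "definable_quot2 L M S q X \<longleftrightarrow> X \<subseteq> q ` S \<times> q ` S \<and>
     definable L M 2 {[x, y] | x y. x \<in> S \<and> y \<in> S \<and> (q x, q y) \<in> X}"


section \<open>Monster models\<close>

text \<open>
  A partial type in one variable over \<open>A\<close> is given as a set of pairs \<open>(\<phi>, e)\<close>, where \<open>e\<close>
  assigns elements of \<open>A\<close> to the variables of \<open>\<phi>\<close> other than \<open>Var 0\<close>. Types over the empty
  set are covered by taking \<open>A\<close> to be a singleton.
\<close>

definition saturated ::
  "('f, 'r) lang \<Rightarrow> ('f, 'r, 'u) fo_struct \<Rightarrow> 'c rel \<Rightarrow> bool" where
  "saturated L M \<kappa> \<longleftrightarrow>
     (\<forall>A p. A \<subseteq> univ M \<and> |A| <o \<kappa> \<and> p \<subseteq> {(\<phi>, e). wf_fm L \<phi> \<and> range e \<subseteq> A} \<and>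
        (\<forall>p0. p0 \<subseteq> p \<and> finite p0 \<longrightarrow>
           (\<exists>x\<in>univ M. \<forall>(\<phi>, e)\<in>p0. sat M (case_nat x e) \<phi>)) \<longrightarrow>
        (\<exists>x\<in>univ M. \<forall>(\<phi>, e)\<in>p. sat M (case_nat x e) \<phi>))"

definition elementary_map ::
  "('f, 'r) lang \<Rightarrow> ('f, 'r, 'u) fo_struct \<Rightarrow> 'u set \<Rightarrow> ('u \<Rightarrow> 'u) \<Rightarrow> bool" where
  "elementary_map L M A h \<longleftrightarrow> h ` A \<subseteq> univ M \<and>
     (\<forall>\<phi> e. wf_fm L \<phi> \<and> range e \<subseteq> A \<longrightarrow> (sat M (h \<circ> e) \<phi> \<longleftrightarrow> sat M e \<phi>))"

definition struct_aut ::
  "('f, 'r) lang \<Rightarrow> ('f, 'r, 'u) fo_struct \<Rightarrow> ('u \<Rightarrow> 'u) \<Rightarrow> bool" where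
  "struct_aut L M h \<longleftrightarrow> bij_betw h (univ M) (univ M) \<and>
     (\<forall>f\<in>funs L. \<forall>xs. length xs = farity L f \<and> set xs \<subseteq> univ M \<longrightarrow>
        h (fint M f xs) = fint M f (map h xs)) \<and>
     (\<forall>r\<in>rels L. \<forall>xs. length xs = rarity L r \<and> set xs \<subseteq> univ M \<longrightarrow>
        (rint M r (map h xs) \<longleftrightarrow> rint M r xs))"

definition strongly_homogeneous ::
  "('f, 'r) lang \<Rightarrow> ('f, 'r, 'u) fo_struct \<Rightarrow> 'c rel \<Rightarrow> bool" where
  "strongly_homogeneous L M \<kappa> \<longleftrightarrow>
     (\<forall>A h. A \<subseteq> univ M \<and> |A| <o \<kappa> \<and> elementary_map L M A h \<longrightarrow>
        (\<exists>g. struct_aut L M g \<and> (\<forall>x\<in>A. g x = h x)))"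

text \<open>The complete theory of which \<open>M\<close> is a monster model is the theory of \<open>M\<close>.\<close>

definition monster_model ::
  "('f, 'r) lang \<Rightarrow> ('f, 'r, 'u) fo_struct \<Rightarrow> 'c rel \<Rightarrow> bool" where
  "monster_model L M \<kappa> \<longleftrightarrow> is_struct L M \<and> Card_order \<kappa> \<and> natLeq <o \<kappa> \<and>
     |Sum_Type.Plus (funs L) (rels L)| <o \<kappa> \<and> saturated L M \<kappa> \<and> strongly_homogeneous L M \<kappa>"


section \<open>Morley rank\<close>

text \<open>
  \<open>morley_ge Def n X\<close>: the Morley rank of \<open>X\<close> is at least \<open>n\<close>, where \<open>Def\<close> is the predicate
  "definable subset" of some sort of an \<open>\<aleph>\<^sub>0\<close>-saturated structure (without saturation this
  recursion would have to be carried out in an elementary extension).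
\<close>

primrec morley_ge :: "('s set \<Rightarrow> bool) \<Rightarrow> nat \<Rightarrow> 's set \<Rightarrow> bool" where
  "morley_ge Def 0 X \<longleftrightarrow> X \<noteq> {}"
| "morley_ge Def (Suc n) X \<longleftrightarrow>
     (\<exists>Y :: nat \<Rightarrow> 's set. disjoint_family Y \<and>
        (\<forall>i. Def (Y i) \<and> Y i \<subseteq> X \<and> morley_ge Def n (Y i)))"

definition morley_rank_le :: "('s set \<Rightarrow> bool) \<Rightarrow> 's set \<Rightarrow> nat \<Rightarrow> bool" where
  "morley_rank_le Def X n \<longleftrightarrow> \<not> morley_ge Def (Suc n) X"

definition morley_rank_eq :: "('s set \<Rightarrow> bool) \<Rightarrow> 's set \<Rightarrow> nat \<Rightarrow> bool" where
  "morley_rank_eq Def X n \<longleftrightarrow> morley_ge Def n X \<and> morley_rank_le Def X n"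


section \<open>Valued fields\<close>

text \<open>
  \<open>v x\<close> is only meaningful for \<open>x \<noteq> 0\<close>; the convention \<open>v 0 = \<infinity>\<close> is written out wherever
  it matters. The type \<open>'g\<close> is the value group, hence surjectivity.
\<close>

definition valuation :: "('m::field \<Rightarrow> 'g::linordered_ab_group_add) \<Rightarrow> bool" where
  "valuation v \<longleftrightarrow>
     (\<forall>x y. x \<noteq> 0 \<longrightarrow> y \<noteq> 0 \<longrightarrow> v (x * y) = v x + v y) \<and>
     (\<forall>x y. x \<noteq> 0 \<longrightarrow> y \<noteq> 0 \<longrightarrow> x + y \<noteq> 0 \<longrightarrow> min (v x) (v y) \<le> v (x + y)) \<and>
     v ` (UNIV - {0}) = UNIV"

definition val_ring :: "('m::field \<Rightarrow> 'g::linordered_ab_group_add) \<Rightarrow> 'm ring" where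
  "val_ring v = \<lparr>carrier = {x. x = 0 \<or> 0 \<le> v x}, mult = (*), one = 1, zero = 0, add = (+)\<rparr>"

definition max_ideal :: "('m::field \<Rightarrow> 'g::linordered_ab_group_add) \<Rightarrow> 'm set" where
  "max_ideal v = {x. x = 0 \<or> 0 < v x}"

definition res_field :: "('m::field \<Rightarrow> 'g::linordered_ab_group_add) \<Rightarrow> 'm set ring" where
  "res_field v = val_ring v Quot max_ideal v"

definition res :: "('m::field \<Rightarrow> 'g::linordered_ab_group_add) \<Rightarrow> 'm \<Rightarrow> 'm set" where
  "res v x = max_ideal v +>\<^bsub>val_ring v\<^esub> x"

abbreviation kx :: "('m::field \<Rightarrow> 'g::linordered_ab_group_add) \<Rightarrow> 'm set monoid" where
  "kx v \<equiv> mult_of (res_field v)"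

definition unit_group :: "'m::field monoid" where
  "unit_group = \<lparr>carrier = UNIV - {0}, mult = (*), one = 1\<rparr>"

definition one_units :: "('m::field \<Rightarrow> 'g::linordered_ab_group_add) \<Rightarrow> 'm set" where
  "one_units v = (+) 1 ` max_ideal v"

definition RV :: "('m::field \<Rightarrow> 'g::linordered_ab_group_add) \<Rightarrow> 'm set monoid" where
  "RV v = unit_group Mod one_units v"

definition rv :: "('m::field \<Rightarrow> 'g::linordered_ab_group_add) \<Rightarrow> 'm \<Rightarrow> 'm set" where
  "rv v x = one_units v #>\<^bsub>unit_group\<^esub> x"

definition rv_val :: "('m::field \<Rightarrow> 'g::linordered_ab_group_add) \<Rightarrow> 'm set \<Rightarrow> 'g" where
  "rv_val v A = the_elem (v ` A)"

definition RV_fiber :: "('m::field \<Rightarrow> 'g::linordered_ab_group_add) \<Rightarrow> 'g \<Rightarrow> 'm set set" where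
  "RV_fiber v a = {A \<in> carrier (RV v). rv_val v A = a}"

text \<open>
  For \<open>v x = 0\<close> the cosets \<open>x (1 + \<mm>)\<close> and \<open>x + \<mm>\<close> are the same set, so the identification
  of the kernel of \<open>RV \<rightarrow> \<Gamma>\<close> with \<open>k\<^sup>\<times>\<close> is an equality here.
\<close>

lemma valuation_add_gt:
  assumes "valuation v" "x = 0 \<or> c < v x" "y = 0 \<or> c < v y"
  shows "x + y = 0 \<or> c < v (x + y)"
proof (cases "x = 0 \<or> y = 0 \<or> x + y = 0")
  case False
  hence "c < min (v x) (v y)" "min (v x) (v y) \<le> v (x + y)"
    using assms unfolding valuation_def by auto
  thus ?thesis using less_le_trans by blast
qed (use assms in auto)

lemma valuation_one: "valuation v \<Longrightarrow> v 1 = 0"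
  unfolding valuation_def by (metis add_cancel_left_left mult_1 one_neq_zero)

lemma valuation_mult: "valuation v \<Longrightarrow> x \<noteq> 0 \<Longrightarrow> y \<noteq> 0 \<Longrightarrow> v (x * y) = v x + v y"
  unfolding valuation_def by blast

lemma valuation_divide:
  assumes "valuation v" "x \<noteq> 0" "y \<noteq> 0"
  shows "v (x / y) = v x - v y"
  using valuation_mult[OF assms(1), of "x / y" y] assms by (simp add: algebra_simps)

lemma valuation_minus: "valuation v \<Longrightarrow> v (- x) = v x"
proof (cases "x = 0")
  case False
  assume v: "valuation v"
  have "v (-1) + v (-1) = 0"
    using valuation_mult[OF v, of "-1" "-1"] valuation_one[OF v] by simp
  hence "v (-1) = 0" by (simp add: double_zero)
  thus ?thesis using valuation_mult[OF v, of "-1" x] False by simp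
qed simp

lemma valuation_near:
  assumes v: "valuation v" and "x \<noteq> 0" "y = 0 \<or> v x < v y"
  shows "x + y \<noteq> 0 \<and> v (x + y) = v x"
proof (cases "y = 0")
  case False
  hence y: "v x < v y" using assms by simp
  have ne: "x + y \<noteq> 0"
    using y valuation_minus[OF v, of y] by (metis add_eq_0_iff2 less_irrefl)
  have "v x \<le> v (x + y)"
    using v \<open>x \<noteq> 0\<close> False ne y unfolding valuation_def by (metis less_imp_le min.absorb1)
  moreover have "\<not> v x < v (x + y)"
    using valuation_add_gt[OF v, of "x + y" "v x" "- y"] y valuation_minus[OF v, of y] \<open>x \<noteq> 0\<close> by auto
  ultimately show ?thesis using ne by simp
qed (use assms in simp)

lemma rv_eq: "rv v x = {u * x | u. u - 1 \<in> max_ideal v}"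
proof -
  have "rv v x = {(1 + m) * x | m. m \<in> max_ideal v}"
    unfolding rv_def r_coset_def one_units_def unit_group_def by auto
  also have "\<dots> = {u * x | u. u - 1 \<in> max_ideal v}"
  proof -
    have "\<And>u. u - 1 \<in> max_ideal v \<Longrightarrow> u * x = (1 + (u - 1)) * x" by simp
    moreover have "\<And>m. m \<in> max_ideal v \<Longrightarrow> (1 + m) - 1 \<in> max_ideal v" by simp
    ultimately show ?thesis by blast
  qed
  finally show ?thesis .
qed

lemma res_eq: "res v x = {u + x | u. u \<in> max_ideal v}"
  by (auto simp: res_def a_r_coset_def r_coset_def val_ring_def)

lemma rv_eq_plus:
  assumes v: "valuation v" and x: "x \<noteq> 0"
  shows "rv v x = {y + x | y. y = 0 \<or> v x < v y}"
proof (intro equalityI subsetI)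
  fix z assume "z \<in> rv v x"
  then obtain u where u: "z = u * x" "u - 1 \<in> max_ideal v" unfolding rv_eq by blast
  have "z = (u - 1) * x + x" using u by (simp add: algebra_simps)
  moreover have "(u - 1) * x = 0 \<or> v x < v ((u - 1) * x)"
    using u x valuation_mult[OF v, of "u - 1" x] by (cases "u = 1") (auto simp: max_ideal_def)
  ultimately show "z \<in> {y + x | y. y = 0 \<or> v x < v y}" by blast
next
  fix z assume "z \<in> {y + x | y. y = 0 \<or> v x < v y}"
  then obtain y where y: "z = y + x" "y = 0 \<or> v x < v y" by blast
  have "z = (1 + y / x) * x" using x y by (simp add: field_simps)
  moreover have "(1 + y / x) - 1 \<in> max_ideal v"
    using y x valuation_divide[OF v, of y x] by (cases "y = 0") (auto simp: max_ideal_def)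
  ultimately show "z \<in> rv v x" unfolding rv_eq by blast
qed

lemma rv_eq_res:
  assumes "valuation v" "x \<noteq> 0" "v x = 0"
  shows "rv v x = res v x"
  using rv_eq_plus[OF assms(1,2)] assms(3) by (simp add: res_eq max_ideal_def)

lemma rv_val_rv:
  assumes v: "valuation v" and x: "x \<noteq> 0"
  shows "rv_val v (rv v x) = v x"
proof -
  have "v ` rv v x = {v x}"
  proof
    show "v ` rv v x \<subseteq> {v x}"
      unfolding rv_eq_plus[OF v x] using valuation_near[OF v x] by (auto simp: add.commute)
    have "x \<in> rv v x" unfolding rv_eq_plus[OF v x] by force
    thus "{v x} \<subseteq> v ` rv v x" by blast
  qed
  thus ?thesis by (simp add: rv_val_def)
qed

lemma carrier_RV: "carrier (RV v) = rv v ` (UNIV - {0})"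
  by (auto simp: RV_def FactGroup_def RCOSETS_def rv_def unit_group_def)

lemma carrier_res_field: "carrier (res_field v) = res v ` {x. x = 0 \<or> 0 \<le> v x}"
  by (auto simp: res_field_def FactRing_def A_RCOSETS_def RCOSETS_def res_def a_r_coset_def
      val_ring_def)

lemma RV_fiber_0_eq_kx:
  assumes v: "valuation v"
  shows "RV_fiber v 0 = carrier (kx v)"
proof -
  have z: "\<zero>\<^bsub>res_field v\<^esub> = max_ideal v" by (simp add: res_field_def FactRing_def)
  have *: "res v x = max_ideal v \<longleftrightarrow> x \<in> max_ideal v" for x
  proof
    assume "res v x = max_ideal v"
    moreover have "x \<in> res v x" unfolding res_eq by (force simp: max_ideal_def)
    ultimately show "x \<in> max_ideal v" by simp
  next
    assume x: "x \<in> max_ideal v"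
    show "res v x = max_ideal v"
    proof
      show "res v x \<subseteq> max_ideal v"
        using valuation_add_gt[OF v, of _ 0 x] x by (auto simp: res_eq max_ideal_def)
      show "max_ideal v \<subseteq> res v x"
      proof
        fix y assume y: "y \<in> max_ideal v"
        have "y - x \<in> max_ideal v"
          using valuation_add_gt[OF v, of y 0 "- x"] x y valuation_minus[OF v, of x]
          by (auto simp: max_ideal_def)
        thus "y \<in> res v x" unfolding res_eq by force
      qed
    qed
  qed
  have "carrier (kx v) = res v ` {x. x \<noteq> 0 \<and> v x = 0}"
  proof -
    have "carrier (kx v) = res v ` {x. x = 0 \<or> 0 \<le> v x} - {max_ideal v}"
      by (simp add: carrier_res_field z)
    also have "\<dots> = res v ` ({x. x = 0 \<or> 0 \<le> v x} - max_ideal v)"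
      using * by blast
    also have "{x. x = 0 \<or> 0 \<le> v x} - max_ideal v = {x. x \<noteq> 0 \<and> v x = 0}"
      by (auto simp: max_ideal_def)
    finally show ?thesis .
  qed
  also have "\<dots> = rv v ` {x. x \<noteq> 0 \<and> v x = 0}"
    using rv_eq_res[OF v] by (intro image_cong) auto
  also have "\<dots> = RV_fiber v 0"
    unfolding RV_fiber_def carrier_RV using rv_val_rv[OF v] by (auto simp: image_iff)
  finally show ?thesis by simp
qed

lemma RV_mult:
  assumes v: "valuation v" and x: "x \<noteq> 0" and y: "y \<noteq> 0"
  shows "rv v x \<otimes>\<^bsub>RV v\<^esub> rv v y = rv v (x * y)"
proof -
  have "rv v x \<otimes>\<^bsub>RV v\<^esub> rv v y = {a * b | a b. a \<in> rv v x \<and> b \<in> rv v y}"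
    by (auto simp: RV_def FactGroup_def set_mult_def unit_group_def)
  also have "\<dots> = rv v (x * y)"
  proof (intro equalityI subsetI)
    fix z assume "z \<in> {a * b | a b. a \<in> rv v x \<and> b \<in> rv v y}"
    then obtain c d where z: "z = (c * x) * (d * y)"
      and c: "c - 1 \<in> max_ideal v" and d: "d - 1 \<in> max_ideal v"
      unfolding rv_eq by blast
    have d': "d \<noteq> 0 \<and> v d = 0"
      using valuation_near[OF v, of 1 "d - 1"] d valuation_one[OF v] by (auto simp: max_ideal_def)
    have "(c - 1) * d = 0 \<or> 0 < v ((c - 1) * d)"
      using c d' valuation_mult[OF v, of "c - 1" d] by (cases "c = 1") (auto simp: max_ideal_def)
    hence "(c - 1) * d + (d - 1) \<in> max_ideal v"
      using valuation_add_gt[OF v, of "(c - 1) * d" 0 "d - 1"] d by (auto simp: max_ideal_def)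
    hence "c * d - 1 \<in> max_ideal v" by (simp add: algebra_simps)
    moreover have "z = (c * d) * (x * y)" using z by simp
    ultimately show "z \<in> rv v (x * y)" unfolding rv_eq by blast
  next
    fix z assume "z \<in> rv v (x * y)"
    then obtain c where "z = c * (x * y)" and c: "c - 1 \<in> max_ideal v"
      unfolding rv_eq by blast
    hence "z = (c * x) * (1 * y)" by simp
    moreover have "1 * y \<in> rv v y" unfolding rv_eq by (force simp: max_ideal_def)
    moreover have "c * x \<in> rv v x" using c unfolding rv_eq by blast
    ultimately show "z \<in> {a * b | a b. a \<in> rv v x \<and> b \<in> rv v y}" by blast
  qed
  finally show ?thesis .
qed

lemma res_mult:
  assumes v: "valuation v" and x: "x = 0 \<or> 0 \<le> v x" and y: "y = 0 \<or> 0 \<le> v y"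
  shows "res v x \<otimes>\<^bsub>res_field v\<^esub> res v y = res v (x * y)"
proof -
  have sub: "a * b \<in> max_ideal v" if "a \<in> max_ideal v" "b = 0 \<or> 0 \<le> v b" for a b
    using that valuation_mult[OF v, of a b]
    by (cases "a = 0"; cases "b = 0") (auto simp: max_ideal_def intro: add_pos_nonneg)
  have add: "a + b \<in> max_ideal v" if "a \<in> max_ideal v" "b \<in> max_ideal v" for a b
    using that valuation_add_gt[OF v, of a 0 b] by (auto simp: max_ideal_def)
  have neg: "- a \<in> max_ideal v" if "a \<in> max_ideal v" for a
    using that valuation_minus[OF v, of a] by (auto simp: max_ideal_def)
  have shift: "res v (m + a) = res v a" if m: "m \<in> max_ideal v" for m a
  proof (intro equalityI subsetI)
    fix z assume "z \<in> res v (m + a)"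
    then obtain u where "u \<in> max_ideal v" "z = (u + m) + a" by (auto simp: res_eq add.assoc)
    thus "z \<in> res v a" using add[OF _ m] by (auto simp: res_eq)
  next
    fix z assume "z \<in> res v a"
    then obtain u where "u \<in> max_ideal v" "z = (u + - m) + (m + a)" by (auto simp: res_eq)
    thus "z \<in> res v (m + a)" using add[OF _ neg[OF m]] unfolding res_eq by blast
  qed
  have key: "res v (a * b) = res v (x * y)" if ab: "a \<in> res v x" "b \<in> res v y" for a b
  proof -
    obtain p q where p: "a = p + x" "p \<in> max_ideal v" and q: "b = q + y" "q \<in> max_ideal v"
      using ab unfolding res_eq by blast
    have "q = 0 \<or> 0 \<le> v q" using q by (auto simp: max_ideal_def)
    hence "p * q + (p * y + q * x) \<in> max_ideal v"
      using sub p q x y by (intro add) auto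
    moreover have "a * b = (p * q + (p * y + q * x)) + x * y"
      using p q by (simp add: algebra_simps)
    ultimately show ?thesis using shift by simp
  qed
  have "res v x \<otimes>\<^bsub>res_field v\<^esub> res v y = (\<Union>a\<in>res v x. \<Union>b\<in>res v y. res v (a * b))"
    by (simp add: res_field_def FactRing_def rcoset_mult_def res_def val_ring_def)
  also have "\<dots> = (\<Union>a\<in>res v x. \<Union>b\<in>res v y. res v (x * y))" using key by simp
  also have "\<dots> = res v (x * y)"
  proof -
    have "x \<in> res v x" "y \<in> res v y" unfolding res_eq by (force simp: max_ideal_def)+
    thus ?thesis by blast
  qed
  finally show ?thesis .
qed

lemma kx_mult_eq_RV_mult:
  assumes v: "valuation v" and "A \<in> carrier (kx v)" "B \<in> carrier (kx v)"
  shows "A \<otimes>\<^bsub>kx v\<^esub> B = A \<otimes>\<^bsub>RV v\<^esub> B"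
proof -
  have "A \<in> RV_fiber v 0" "B \<in> RV_fiber v 0"
    using assms RV_fiber_0_eq_kx[OF v] by auto
  then obtain x y where x: "x \<noteq> 0" "A = rv v x" "v x = 0" and y: "y \<noteq> 0" "B = rv v y" "v y = 0"
  proof -
    assume *: "\<And>x y. \<lbrakk>x \<noteq> 0; A = rv v x; v x = 0; y \<noteq> 0; B = rv v y; v y = 0\<rbrakk> \<Longrightarrow> thesis"
    obtain x y where "x \<noteq> 0" "A = rv v x" "y \<noteq> 0" "B = rv v y"
      using \<open>A \<in> RV_fiber v 0\<close> \<open>B \<in> RV_fiber v 0\<close> unfolding RV_fiber_def carrier_RV by blast
    moreover from this have "v x = 0" "v y = 0"
      using \<open>A \<in> RV_fiber v 0\<close> \<open>B \<in> RV_fiber v 0\<close> rv_val_rv[OF v]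
      unfolding RV_fiber_def by auto
    ultimately show thesis using * by blast
  qed
  have "v (x * y) = 0" using valuation_mult[OF v, of x y] x y by simp
  thus ?thesis
    using x y RV_mult[OF v, of x y] res_mult[OF v, of x y] rv_eq_res[OF v] by simp
qed

text \<open>
  The image in \<open>(k\<^sup>\<times>)\<^sup>2\<close> of \<open>X \<inter> (RV\<^sub>a \<times> RV\<^sub>b)\<close> under the translation by the inverse of
  \<open>(\<alpha>, \<beta>) \<in> RV\<^sub>a \<times> RV\<^sub>b\<close>.
\<close>

definition kx_image :: "('m::field \<Rightarrow> 'g::linordered_ab_group_add) \<Rightarrow> 'm set \<Rightarrow> 'm set \<Rightarrow>
    ('m set \<times> 'm set) set \<Rightarrow> ('m set \<times> 'm set) set" where
  "kx_image v \<alpha> \<beta> X = {(x, y). x \<in> carrier (kx v) \<and> y \<in> carrier (kx v) \<and>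
     (x \<otimes>\<^bsub>RV v\<^esub> \<alpha>, y \<otimes>\<^bsub>RV v\<^esub> \<beta>) \<in> X}"

definition val_image :: "('m::field \<Rightarrow> 'g::linordered_ab_group_add) \<Rightarrow>
    ('m set \<times> 'm set) set \<Rightarrow> ('g \<times> 'g) set" where
  "val_image v D = map_prod (rv_val v) (rv_val v) ` D"

definition fiber :: "('m::field \<Rightarrow> 'g::linordered_ab_group_add) \<Rightarrow>
    ('m set \<times> 'm set) set \<Rightarrow> 'g \<Rightarrow> 'g \<Rightarrow> ('m set \<times> 'm set) set" where
  "fiber v D a b = D \<inter> (RV_fiber v a \<times> RV_fiber v b)"


section \<open>C-minimal expansions of ACVF\<close>

text \<open>
  One-sorted language of valued fields: the ring language together with a binary relation
  symbol for \<open>v x \<le> v y\<close>. Algebraic closedness is the class \<^class>\<open>alg_closed_field\<close>.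
\<close>

definition expands_ACVF :: "('f, 'r) lang \<Rightarrow> ('f, 'r, 'm::alg_closed_field) fo_struct \<Rightarrow>
    ('m \<Rightarrow> 'g::linordered_ab_group_add) \<Rightarrow> bool" where
  "expands_ACVF L M v \<longleftrightarrow>
     univ M = UNIV \<and> valuation v \<and> (\<exists>x. x \<noteq> 0 \<and> v x \<noteq> 0) \<and>
     (\<exists>f\<in>funs L. farity L f = 0 \<and> fint M f [] = 0) \<and>
     (\<exists>f\<in>funs L. farity L f = 0 \<and> fint M f [] = 1) \<and>
     (\<exists>f\<in>funs L. farity L f = 1 \<and> (\<forall>x. fint M f [x] = - x)) \<and>
     (\<exists>f\<in>funs L. farity L f = 2 \<and> (\<forall>x y. fint M f [x, y] = x + y)) \<and>
     (\<exists>f\<in>funs L. farity L f = 2 \<and> (\<forall>x y. fint M f [x, y] = x * y)) \<and>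
     (\<exists>r\<in>rels L. rarity L r = 2 \<and>
        (\<forall>x y. rint M r [x, y] \<longleftrightarrow> y = 0 \<or> (x \<noteq> 0 \<and> v x \<le> v y)))"

definition balls :: "('m::field \<Rightarrow> 'g::linordered_ab_group_add) \<Rightarrow> 'm set set" where
  "balls v = {{x. x = a \<or> c \<le> v (x - a)} | a c. True} \<union> {{x. x = a \<or> c < v (x - a)} | a c. True}"

inductive_set bool_combs :: "'a set set \<Rightarrow> 'a set set" for G where
  gen: "X \<in> G \<Longrightarrow> X \<in> bool_combs G"
| compl: "X \<in> bool_combs G \<Longrightarrow> - X \<in> bool_combs G"
| union: "X \<in> bool_combs G \<Longrightarrow> Y \<in> bool_combs G \<Longrightarrow> X \<union> Y \<in> bool_combs G"

definition C_minimal :: "('f, 'r) lang \<Rightarrow> ('f, 'r, 'm::field) fo_struct \<Rightarrow>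
    ('m \<Rightarrow> 'g::linordered_ab_group_add) \<Rightarrow> bool" where
  "C_minimal L M v \<longleftrightarrow>
     (\<forall>X. definable L M 1 {[x] | x. x \<in> X} \<longrightarrow> X \<in> bool_combs (balls v \<union> range (\<lambda>a. {a})))"

abbreviation definable_\<Gamma>2 :: "('f, 'r) lang \<Rightarrow> ('f, 'r, 'm::field) fo_struct \<Rightarrow>
    ('m \<Rightarrow> 'g::linordered_ab_group_add) \<Rightarrow> ('g \<times> 'g) set \<Rightarrow> bool" where
  "definable_\<Gamma>2 L M v \<equiv> definable_quot2 L M (UNIV - {0}) v"

abbreviation definable_RV2 :: "('f, 'r) lang \<Rightarrow> ('f, 'r, 'm::field) fo_struct \<Rightarrow>
    ('m \<Rightarrow> 'g::linordered_ab_group_add) \<Rightarrow> ('m set \<times> 'm set) set \<Rightarrow> bool" where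
  "definable_RV2 L M v \<equiv> definable_quot2 L M (UNIV - {0}) (rv v)"

abbreviation definable_k2 :: "('f, 'r) lang \<Rightarrow> ('f, 'r, 'm::field) fo_struct \<Rightarrow>
    ('m \<Rightarrow> 'g::linordered_ab_group_add) \<Rightarrow> ('m set \<times> 'm set) set \<Rightarrow> bool" where
  "definable_k2 L M v \<equiv> definable_quot2 L M (carrier (val_ring v)) (res v)"

definition small_over_\<Gamma>2 :: "('f, 'r) lang \<Rightarrow> ('f, 'r, 'm::field) fo_struct \<Rightarrow>
    ('m \<Rightarrow> 'g::linordered_ab_group_add) \<Rightarrow> ('m set \<times> 'm set) set \<Rightarrow> bool" where
  "small_over_\<Gamma>2 L M v D \<longleftrightarrow>
     (\<forall>a b. \<forall>\<alpha>\<in>RV_fiber v a. \<forall>\<beta>\<in>RV_fiber v b.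
        morley_rank_le (definable_k2 L M v) (kx_image v \<alpha> \<beta> (fiber v D a b)) 1)"


section \<open>Line segments\<close>

definition open_interval :: "'g::linordered_ab_group_add set \<Rightarrow> bool" where
  "open_interval I \<longleftrightarrow>
     I = UNIV \<or> (\<exists>a. I = {a<..}) \<or> (\<exists>b. I = {..<b}) \<or> (\<exists>a b. a < b \<and> I = {a<..<b})"

definition linear_on :: "'g::linordered_ab_group_add set \<Rightarrow> ('g \<Rightarrow> 'g) \<Rightarrow> bool" where
  "linear_on I f \<longleftrightarrow>
     (\<forall>a e1 e2. {a, a + e1, a + e2, a + e1 + e2} \<subseteq> I \<longrightarrow>
        f a + f (a + e1 + e2) = f (a + e1) + f (a + e2))"

definition vertical_segment :: "('g::linordered_ab_group_add \<times> 'g) set \<Rightarrow> bool" where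
  "vertical_segment s \<longleftrightarrow> (\<exists>a I. open_interval I \<and> s = {a} \<times> I)"

definition line_segment :: "('f, 'r) lang \<Rightarrow> ('f, 'r, 'm::field) fo_struct \<Rightarrow>
    ('m \<Rightarrow> 'g::linordered_ab_group_add) \<Rightarrow> ('g \<times> 'g) set \<Rightarrow> bool" where
  "line_segment L M v s \<longleftrightarrow> vertical_segment s \<or>
     (\<exists>I f. open_interval I \<and> linear_on I f \<and> s = {(x, f x) | x. x \<in> I} \<and> definable_\<Gamma>2 L M v s)"

definition zmul :: "int \<Rightarrow> 'g::ab_group_add \<Rightarrow> 'g" where
  "zmul n x = (if 0 \<le> n then ((+) x ^^ nat n) 0 else - ((+) x ^^ nat (- n)) 0)"

text \<open>
  Well-defined as the value group of an algebraically closed valued field is divisible and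
  torsion-free.
\<close>

definition qmul :: "rat \<Rightarrow> 'g::ab_group_add \<Rightarrow> 'g" where
  "qmul q x = (THE y. zmul (snd (quotient_of q)) y = zmul (fst (quotient_of q)) x)"

definition rational_slope :: "('g::linordered_ab_group_add \<times> 'g) set \<Rightarrow> bool" where
  "rational_slope s \<longleftrightarrow> vertical_segment s \<or>
     (\<exists>I q c. open_interval I \<and> s = {(x, qmul q x + c) | x. x \<in> I})"


section \<open>Exotic automorphisms\<close>

datatype ring_sym = Zero_sym | One_sym | Uminus_sym | Plus_sym | Times_sym

definition ring_lang :: "(ring_sym, unit) lang" where
  "ring_lang = \<lparr>funs = UNIV, rels = {},
     farity = (\<lambda>f. case f of Zero_sym \<Rightarrow> 0 | One_sym \<Rightarrow> 0 | Uminus_sym \<Rightarrow> 1 | Plus_sym \<Rightarrow> 2 | Times_sym \<Rightarrow> 2),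
     rarity = (\<lambda>_. 0)\<rparr>"

definition ring_struct :: "('a, 'b) ring_scheme \<Rightarrow> (ring_sym, unit, 'a) fo_struct" where
  "ring_struct R = \<lparr>univ = carrier R,
     fint = (\<lambda>f xs. case f of
         Zero_sym \<Rightarrow> \<zero>\<^bsub>R\<^esub>
       | One_sym \<Rightarrow> \<one>\<^bsub>R\<^esub>
       | Uminus_sym \<Rightarrow> \<ominus>\<^bsub>R\<^esub> (xs ! 0)
       | Plus_sym \<Rightarrow> xs ! 0 \<oplus>\<^bsub>R\<^esub> xs ! 1
       | Times_sym \<Rightarrow> xs ! 0 \<otimes>\<^bsub>R\<^esub> xs ! 1),
     rint = (\<lambda>_ _. False)\<rparr>"

definition no_exotic_automorphisms :: "('f, 'r) lang \<Rightarrow> ('f, 'r, 'm::field) fo_struct \<Rightarrow>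
    ('m \<Rightarrow> 'g::linordered_ab_group_add) \<Rightarrow> bool" where
  "no_exotic_automorphisms L M v \<longleftrightarrow>
     (\<forall>\<sigma> \<in> iso (kx v) (kx v).
        definable_k2 L M v {(x, \<sigma> x) | x. x \<in> carrier (kx v)} \<longrightarrow>
        definable ring_lang (ring_struct (res_field v)) 2 {[x, \<sigma> x] | x. x \<in> carrier (kx v)})"


section \<open>Finite unions of translates\<close>

definition one_dim_definable_subgroup :: "('f, 'r) lang \<Rightarrow> ('f, 'r, 'm::field) fo_struct \<Rightarrow>
    ('m \<Rightarrow> 'g::linordered_ab_group_add) \<Rightarrow> ('m set \<times> 'm set) set \<Rightarrow> bool" where
  "one_dim_definable_subgroup L M v H \<longleftrightarrow> subgroup H (kx v \<times>\<times> kx v) \<and>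
     definable_k2 L M v H \<and> morley_rank_eq (definable_k2 L M v) H 1"

definition finite_union_of_translates :: "('m::field \<Rightarrow> 'g::linordered_ab_group_add) \<Rightarrow>
    ('m set \<times> 'm set) set \<Rightarrow> ('m set \<times> 'm set) set \<Rightarrow> bool" where
  "finite_union_of_translates v H X \<longleftrightarrow>
     (\<exists>F. finite F \<and> F \<subseteq> carrier (RV v \<times>\<times> RV v) \<and> X = (\<Union>g\<in>F. H #>\<^bsub>RV v \<times>\<times> RV v\<^esub> g))"

end

theory Submission
  imports Defs "HOL-Library.Countable_Set_Type"
begin

text \<open>
  Let \<open>T\<close> be the preimage of \<open>D\<close> in the square of the field, so that all definability
  takes place in the home sort. By C-minimality the definable subsets of \<open>\<Gamma>\<close> are finite unions of
  points and intervals, those of \<open>k\<close> are finite or cofinite, and, by saturation, a definable family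
  of finite subsets of \<open>\<Gamma>\<close> indexed by a set \<open>RV\<^sub>a\<close> has finite union (orthogonality).

  Orthogonality and smallness leave only finitely many vertical lines meeting the image of \<open>D\<close> in
  infinitely many points; off these lines the image is a finite union of graphs of definable
  functions \<open>f\<close>. Over such a graph let \<open>C\<close> be the corresponding part of \<open>T\<close> and \<open>H a\<close> the
  stabilizer of its fibre over \<open>a\<close> in \<open>(k\<^sup>\<times>)\<^sup>2\<close>. For all but finitely many \<open>a\<close> that fibre is
  finite-to-one over \<open>RV\<^sub>a\<close>; by orthogonality its intersection with a translate of itself is then
  equally large over all points of \<open>RV\<^sub>a\<close>, which makes \<open>H a\<close> large and the fibre a finite union
  of cosets of \<open>H a\<close>. Again by orthogonality \<open>H a\<close> is locally constant in \<open>a\<close>.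

  Where \<open>H\<close> is constant, translating one fibre to another shows that \<open>f (a + d) - f a\<close> is the
  valuation of an element determined by \<open>a\<close> up to finitely many classes in \<open>RV\<close>, so it takes only
  finitely many values for each \<open>d\<close>; hence \<open>f\<close> is piecewise linear. Without exotic automorphisms
  the graph of the correspondence \<open>H\<close> is constructible over \<open>k\<close>, and independence of characters
  yields a monomial relation on \<open>H\<close>. The corresponding integer combination of \<open>a\<close> and \<open>f a\<close> then
  takes only finitely many values, so the slopes are rational.
\<close>

text \<open>The obstacle is that each exceptional set is at first finite only for a fixed leading
  term or a fixed pair \<open>(w, z)\<close> of units, while the group argument needs one
  exceptional set for all of them. Orthogonality is the device that exchanges these quantifiers, so
  it recurs wherever a parameter runs through a fibre of RV. A stabilizer defined by a formula might
  well be trivial. It is large because the fibres of \<open>C\<close> over the points of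
  \<open>RV\<^sub>a\<close>, each divided by one of its elements, are subsets of a single finite
  set: infinitely many of them agree, and two that agree yield an element of the stabilizer.
  Equality of the counts is what upgrades agreement over one point to agreement over all. Neither
  continuity nor monotonicity of \<open>f\<close> is established beforehand. Linearity comes from
  counting the jumps of \<open>a \<mapsto> f (a + d) - f a\<close>, whose number is bounded
  uniformly in \<open>d\<close> by saturation. Morley rank enters only at the two ends: smallness is
  turned into a finiteness statement about columns, and dimension one is read off from a finite
  kernel.\<close>

hide_const (open) up_ring.coeff up_ring.monom module.smult

section \<open>Definable predicates\<close>

fun rename_tm :: "(nat \<Rightarrow> nat) \<Rightarrow> 'f tm \<Rightarrow> 'f tm" where
  "rename_tm f (Var i) = Var (f i)"
| "rename_tm f (Fn g ts) = Fn g (map (rename_tm f) ts)"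

fun rename_fm :: "(nat \<Rightarrow> nat) \<Rightarrow> ('f, 'r) fm \<Rightarrow> ('f, 'r) fm" where
  "rename_fm f (Eq s t) = Eq (rename_tm f s) (rename_tm f t)"
| "rename_fm f (Rel r ts) = Rel r (map (rename_tm f) ts)"
| "rename_fm f (Neg \<phi>) = Neg (rename_fm f \<phi>)"
| "rename_fm f (Conj \<phi> \<psi>) = Conj (rename_fm f \<phi>) (rename_fm f \<psi>)"
| "rename_fm f (Ex \<phi>) = Ex (rename_fm (case_nat 0 (Suc \<circ> f)) \<phi>)"

lemma wf_rename_tm [simp]: "wf_tm L (rename_tm f t) \<longleftrightarrow> wf_tm L t"
  by (induction t) auto

lemma wf_rename_fm [simp]: "wf_fm L (rename_fm f \<phi>) \<longleftrightarrow> wf_fm L \<phi>"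
  by (induction \<phi> arbitrary: f) auto

lemma tm_val_rename [simp]: "tm_val M e (rename_tm f t) = tm_val M (\<lambda>i. e (f i)) t"
proof (induction t)
  case (Fn g ts)
  hence "map (tm_val M e) (map (rename_tm f) ts) = map (tm_val M (\<lambda>i. e (f i))) ts" by simp
  thus ?case by (simp only: rename_tm.simps tm_val.simps)
qed simp

lemma sat_rename [simp]: "sat M e (rename_fm f \<phi>) \<longleftrightarrow> sat M (\<lambda>i. e (f i)) \<phi>"
proof (induction \<phi> arbitrary: e f)
  case (Rel r ts)
  have "map (tm_val M e) (map (rename_tm f) ts) = map (tm_val M (\<lambda>i. e (f i))) ts" by simp
  thus ?case by (simp only: rename_fm.simps sat.simps)
next
  case (Ex \<phi>)
  have "(\<lambda>i. case_nat x e (case_nat 0 (Suc \<circ> f) i)) = case_nat x (\<lambda>i. e (f i))" for x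
    by (auto simp: fun_eq_iff split: nat.split)
  thus ?case using Ex by (simp only: rename_fm.simps sat.simps)
qed auto

named_theorems def_intros

locale C_min_ACVF =
  fixes L :: "('f, 'r) lang"
    and M :: "('f, 'r, 'm::alg_closed_field) fo_struct"
    and v :: "'m \<Rightarrow> 'g::linordered_ab_group_add"
    and \<kappa> :: "'c rel"
  assumes expands: "expands_ACVF L M v"
    and C_minimal: "C_minimal L M v"
    and monster: "monster_model L M \<kappa>"
begin

lemma univ: "univ M = UNIV"
  using expands by (simp add: expands_ACVF_def)

lemma val: "valuation v"
  using expands by (simp add: expands_ACVF_def)

text \<open>
  Definable predicates on environments; \<open>s\<close> tells for each variable of the formula whether it
  is a coordinate of the environment or a parameter.
\<close>

definition defpred :: "((nat \<Rightarrow> 'm) \<Rightarrow> bool) \<Rightarrow> bool" where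
  "defpred P \<longleftrightarrow> (\<exists>\<phi> s. wf_fm L \<phi> \<and> (\<forall>e. P e \<longleftrightarrow> sat M (\<lambda>i. case_sum e id (s i)) \<phi>))"

text \<open>A function is given by its graph, with the value in variable 0 and the arguments shifted
  by one. This is the shape that \<open>defpred_ex\<close> consumes when the value is quantified
  away.\<close>

definition defterm :: "((nat \<Rightarrow> 'm) \<Rightarrow> 'm) \<Rightarrow> bool" where
  "defterm f \<longleftrightarrow> defpred (\<lambda>e. e 0 = f (\<lambda>i. e (Suc i)))"

text \<open>Value group elements are represented by arbitrary field elements with that value, so
  that no second sort is needed.\<close>

definition defval :: "((nat \<Rightarrow> 'm) \<Rightarrow> 'g) \<Rightarrow> bool" where
  "defval f \<longleftrightarrow> defpred (\<lambda>e. v (e 0) = f (\<lambda>i. e (Suc i)))"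

section \<open>Closure of definable predicates under logical operations\<close>

lemma defpred_not [def_intros]:
  assumes "defpred P" shows "defpred (\<lambda>e. \<not> P e)"
proof -
  from assms obtain \<phi> s where "wf_fm L \<phi>" "\<forall>e. P e \<longleftrightarrow> sat M (\<lambda>i. case_sum e id (s i)) \<phi>"
    unfolding defpred_def by blast
  thus ?thesis unfolding defpred_def by (intro exI[of _ "Neg \<phi>"] exI[of _ s]) simp
qed

lemma defpred_conj [def_intros]:
  assumes "defpred P" "defpred Q" shows "defpred (\<lambda>e. P e \<and> Q e)"
proof -
  from assms obtain \<phi> s \<psi> r where
    1: "wf_fm L \<phi>" "\<And>e. P e \<longleftrightarrow> sat M (\<lambda>i. case_sum e id (s i)) \<phi>" and
    2: "wf_fm L \<psi>" "\<And>e. Q e \<longleftrightarrow> sat M (\<lambda>i. case_sum e id (r i)) \<psi>"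
    unfolding defpred_def by blast
  \<comment> \<open>The two formulas come with unrelated assignments of coordinates and parameters.
    The first one is moved to the even variables and the second one to the odd variables.\<close>
  let ?s = "\<lambda>i. if even i then s (i div 2) else r (i div 2)"
  have "P e \<and> Q e \<longleftrightarrow> sat M (\<lambda>i. case_sum e id (?s i))
      (Conj (rename_fm (\<lambda>i. 2 * i) \<phi>) (rename_fm (\<lambda>i. Suc (2 * i)) \<psi>))" for e
    by (simp add: 1 2)
  thus ?thesis using 1(1) 2(1) unfolding defpred_def
    by (intro exI[of _ "Conj (rename_fm (\<lambda>i. 2 * i) \<phi>) (rename_fm (\<lambda>i. Suc (2 * i)) \<psi>)"] exI[of _ ?s]) auto
qed

lemma defpred_ex [def_intros]:
  assumes "defpred (\<lambda>e. Q (\<lambda>i. e (Suc i)) (e 0))"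
  shows "defpred (\<lambda>e. \<exists>x. Q e x)"
proof -
  from assms obtain \<phi> s where
    1: "wf_fm L \<phi>" "\<And>e. Q (\<lambda>i. e (Suc i)) (e 0) \<longleftrightarrow> sat M (\<lambda>i. case_sum e id (s i)) \<phi>"
    unfolding defpred_def by blast
  \<comment> \<open>Several variables of the formula may carry coordinate 0. All of them are
    identified with the bound variable; the others move up by one.\<close>
  let ?f = "\<lambda>i. if s i = Inl 0 then 0 else Suc i"
  let ?s = "\<lambda>i. case s i of Inl j \<Rightarrow> Inl (j - 1) | Inr c \<Rightarrow> Inr c"
  have 2: "(\<lambda>i. case_nat x (\<lambda>i. case_sum e id (?s i)) (?f i)) = (\<lambda>i. case_sum (case_nat x e) id (s i))" for x and e :: "nat \<Rightarrow> 'm"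
    by (auto simp: fun_eq_iff split: sum.split nat.split)
  have "(\<exists>x. Q e x) \<longleftrightarrow> sat M (\<lambda>i. case_sum e id (?s i)) (Ex (rename_fm ?f \<phi>))" for e
    using 1(2)[of "case_nat x e" for x] by (simp add: univ 2)
  thus ?thesis using 1(1) unfolding defpred_def
    by (intro exI[of _ "Ex (rename_fm ?f \<phi>)"] exI[of _ ?s]) auto
qed

lemma defpred_rename:
  assumes "defpred P" shows "defpred (\<lambda>e. P (\<lambda>i. e (f i)))"
proof -
  from assms obtain \<phi> s where
    1: "wf_fm L \<phi>" "\<And>e. P e \<longleftrightarrow> sat M (\<lambda>i. case_sum e id (s i)) \<phi>"
    unfolding defpred_def by blast
  have "(\<lambda>i. case_sum (\<lambda>i. e (f i)) id (s i)) = (\<lambda>i. case_sum e id (map_sum f id (s i)))" for e :: "nat \<Rightarrow> 'm"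
    by (rule ext) (auto split: sum.split)
  thus ?thesis using 1 unfolding defpred_def
    by (intro exI[of _ \<phi>] exI[of _ "\<lambda>i. map_sum f id (s i)"]) simp
qed

lemma defpred_True: "defpred (\<lambda>e. True)"
proof -
  obtain f where "f \<in> funs L" "farity L f = 0" using expands unfolding expands_ACVF_def by blast
  thus ?thesis unfolding defpred_def
    by (intro exI[of _ "Eq (Fn f []) (Fn f [])"] exI[of _ "\<lambda>_. Inl 0"]) auto
qed

lemma defpred_const [def_intros]: "defpred (\<lambda>e. b)"
  using defpred_True defpred_not[OF defpred_True] by (cases "b = True") simp_all

lemma defpred_disj [def_intros]: "defpred P \<Longrightarrow> defpred Q \<Longrightarrow> defpred (\<lambda>e. P e \<or> Q e)"
  using defpred_not[OF defpred_conj[OF defpred_not[of P] defpred_not[of Q]]] by simp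

lemma defpred_imp [def_intros]: "defpred P \<Longrightarrow> defpred Q \<Longrightarrow> defpred (\<lambda>e. P e \<longrightarrow> Q e)"
  unfolding imp_conv_disj by (intro defpred_disj defpred_not)

lemma defpred_iff [def_intros]: "defpred P \<Longrightarrow> defpred Q \<Longrightarrow> defpred (\<lambda>e. P e \<longleftrightarrow> Q e)"
  unfolding iff_conv_conj_imp by (intro defpred_conj defpred_imp)

lemma defpred_all [def_intros]:
  "defpred (\<lambda>e. Q (\<lambda>i. e (Suc i)) (e 0)) \<Longrightarrow> defpred (\<lambda>e. \<forall>x. Q e x)"
  using defpred_not[OF defpred_ex[of "\<lambda>e x. \<not> Q e x"]] defpred_not[of "\<lambda>e. Q (\<lambda>i. e (Suc i)) (e 0)"]
  by simp

lemma v_surj: "\<exists>x. x \<noteq> 0 \<and> v x = \<gamma>"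
  using val unfolding valuation_def by (metis DiffE UNIV_I image_iff insertI1)

lemma ex_v: "(\<exists>\<gamma>. P \<gamma>) \<longleftrightarrow> (\<exists>x. P (v x))"
  by (metis v_surj)

lemma defpred_exv [def_intros]:
  "defpred (\<lambda>e. Q (\<lambda>i. e (Suc i)) (v (e 0))) \<Longrightarrow> defpred (\<lambda>e. \<exists>\<gamma>. Q e \<gamma>)"
  unfolding ex_v by (rule defpred_ex)

lemma defpred_allv [def_intros]:
  "defpred (\<lambda>e. Q (\<lambda>i. e (Suc i)) (v (e 0))) \<Longrightarrow> defpred (\<lambda>e. \<forall>\<gamma>. Q e \<gamma>)"
  using defpred_not[OF defpred_exv[of "\<lambda>e x. \<not> Q e x"]] defpred_not[of "\<lambda>e. Q (\<lambda>i. e (Suc i)) (v (e 0))"]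
  by simp

text \<open>Definable functions are inserted by quantifying over their value instead of substituting
  terms into formulas; this covers functions that are no terms of the language.\<close>

lemma defpred_subst:
  assumes "defpred (\<lambda>e. Q (\<lambda>i. e (Suc i)) (e 0))" "defterm f"
  shows "defpred (\<lambda>e. Q e (f e))"
proof -
  have "defpred (\<lambda>e. \<exists>x. x = f e \<and> Q e x)"
    using assms unfolding defterm_def by (intro defpred_ex defpred_conj)
  thus ?thesis by simp
qed

lemma defpred_substv:
  assumes "defpred (\<lambda>e. Q (\<lambda>i. e (Suc i)) (v (e 0)))" "defval f"
  shows "defpred (\<lambda>e. Q e (f e))"
proof -
  have "defpred (\<lambda>e. \<exists>x. v x = f e \<and> Q e (v x))"
    using assms unfolding defval_def by (intro defpred_ex defpred_conj)
  moreover have "(\<exists>x. v x = f e \<and> Q e (v x)) \<longleftrightarrow> Q e (f e)" for e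
    by (metis v_surj)
  ultimately show ?thesis by simp
qed

lemma defterm_rename: "defterm f \<Longrightarrow> defterm (\<lambda>e. f (\<lambda>i. e (g i)))"
  unfolding defterm_def
  using defpred_rename[of "\<lambda>e. e 0 = f (\<lambda>i. e (Suc i))" "case_nat 0 (Suc \<circ> g)"] by simp

lemma defval_rename: "defval f \<Longrightarrow> defval (\<lambda>e. f (\<lambda>i. e (g i)))"
  unfolding defval_def
  using defpred_rename[of "\<lambda>e. v (e 0) = f (\<lambda>i. e (Suc i))" "case_nat 0 (Suc \<circ> g)"] by simp

lemma defpred_var_eq: "defpred (\<lambda>e. e i = e j)"
  unfolding defpred_def by (intro exI[of _ "Eq (Var i) (Var j)"] exI[of _ Inl]) simp

lemma defterm_var [def_intros]: "defterm (\<lambda>e. e i)"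
  unfolding defterm_def by (rule defpred_var_eq)

lemma defterm_const [def_intros]: "defterm (\<lambda>e. c)"
  unfolding defterm_def defpred_def
  by (intro exI[of _ "Eq (Var 0) (Var 1)"] exI[of _ "case_nat (Inl 0) (\<lambda>_. Inr c)"]) simp

lemma defpred_app1: "defpred (\<lambda>e. R (e 0)) \<Longrightarrow> defterm f \<Longrightarrow> defpred (\<lambda>e. R (f e))"
  by (rule defpred_subst)

lemma defterm_eq: "defterm f \<Longrightarrow> defpred (\<lambda>e. e j = f (\<lambda>i. e (g i)))"
  unfolding defterm_def
  using defpred_rename[of "\<lambda>e. e 0 = f (\<lambda>i. e (Suc i))" "case_nat j g"] by simp

lemma defval_eq: "defval f \<Longrightarrow> defpred (\<lambda>e. v (e j) = f (\<lambda>i. e (g i)))"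
  unfolding defval_def
  using defpred_rename[of "\<lambda>e. v (e 0) = f (\<lambda>i. e (Suc i))" "case_nat j g"] by simp

lemma defpred_app2:
  assumes R: "defpred (\<lambda>e. R (e 0) (e 1))" and fg: "defterm f" "defterm g"
  shows "defpred (\<lambda>e. R (f e) (g e))"
proof -
  \<comment> \<open>Below both quantifiers the outer variable \<open>x\<close> has index 1 and the
    inner variable \<open>y\<close> has index 0, so the arguments of \<open>R\<close> have to be
    swapped first.\<close>
  have "defpred (\<lambda>e. R (e 1) (e 0))"
    using defpred_rename[OF R, of "\<lambda>i. 1 - i"] by simp
  hence "defpred (\<lambda>e. \<exists>x y. x = f e \<and> y = g e \<and> R x y)"
    by (intro defpred_ex defpred_conj defterm_eq[OF fg(1)] defterm_eq[OF fg(2)]) simp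
  thus ?thesis by simp
qed

lemma defpred_app3:
  assumes R: "defpred (\<lambda>e. R (e 0) (e 1) (e 2))" and fgh: "defterm f" "defterm g" "defterm h"
  shows "defpred (\<lambda>e. R (f e) (g e) (h e))"
proof -
  have "defpred (\<lambda>e. R (e (Suc (Suc 0))) (e (Suc 0)) (e 0))"
    using defpred_rename[OF R, of "\<lambda>i. 2 - i"] by (simp add: numeral_2_eq_2)
  hence "defpred (\<lambda>e. \<exists>x y z. x = f e \<and> y = g e \<and> z = h e \<and> R x y z)"
    by (intro defpred_ex defpred_conj defterm_eq[OF fgh(1)] defterm_eq[OF fgh(2)] defterm_eq[OF fgh(3)])
  thus ?thesis by simp
qed

lemma defpred_eq [def_intros]: "defterm f \<Longrightarrow> defterm g \<Longrightarrow> defpred (\<lambda>e. f e = g e)"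
  using defpred_app2[of "(=)"] defpred_var_eq by blast

lemma defterm_app:
  assumes F: "defpred (\<lambda>e. e 0 = F (e 1) (e 2))" and fg: "defterm f" "defterm g"
  shows "defterm (\<lambda>e. F (f e) (g e))"
  unfolding defterm_def
  by (rule defpred_app3[of "\<lambda>a b c. a = F b c", OF F defterm_var
      defterm_rename[OF fg(1), of Suc] defterm_rename[OF fg(2), of Suc]])

section \<open>Definability of the field operations, the valuation and the order\<close>

lemma defterm_plus [def_intros]:
  assumes "defterm f" "defterm g" shows "defterm (\<lambda>e. f e + g e)"
proof (rule defterm_app[where F = "(+)", OF _ assms])
  obtain p where "p \<in> funs L" "farity L p = 2" "\<forall>x y. fint M p [x, y] = x + y"
    using expands unfolding expands_ACVF_def by blast
  thus "defpred (\<lambda>e. e 0 = e 1 + e 2)" unfolding defpred_def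
    by (intro exI[of _ "Eq (Var 0) (Fn p [Var 1, Var 2])"] exI[of _ Inl]) auto
qed

lemma defterm_times [def_intros]:
  assumes "defterm f" "defterm g" shows "defterm (\<lambda>e. f e * g e)"
proof (rule defterm_app[where F = "(*)", OF _ assms])
  obtain p where "p \<in> funs L" "farity L p = 2" "\<forall>x y. fint M p [x, y] = x * y"
    using expands unfolding expands_ACVF_def by blast
  thus "defpred (\<lambda>e. e 0 = e 1 * e 2)" unfolding defpred_def
    by (intro exI[of _ "Eq (Var 0) (Fn p [Var 1, Var 2])"] exI[of _ Inl]) auto
qed

lemma defterm_minus [def_intros]:
  assumes "defterm f" "defterm g" shows "defterm (\<lambda>e. f e - g e)"
proof (rule defterm_app[where F = "(-)", OF _ assms])
  have "defpred (\<lambda>e. e 0 + e 2 = e 1)" by (intro def_intros)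
  thus "defpred (\<lambda>e. e 0 = e 1 - e 2)" by (simp add: eq_diff_eq)
qed

lemma defterm_divide [def_intros]:
  assumes "defterm f" "defterm g" shows "defterm (\<lambda>e. f e / g e)"
proof (rule defterm_app[where F = "(/)", OF _ assms])
  \<comment> \<open>The first disjunct reflects the convention \<open>x / 0 = 0\<close>.\<close>
  have "defpred (\<lambda>e. (e 2 = 0 \<and> e 0 = 0) \<or> (e 2 \<noteq> 0 \<and> e 0 * e 2 = e 1))" by (intro def_intros)
  moreover have "((e 2 = 0 \<and> e 0 = 0) \<or> (e 2 \<noteq> 0 \<and> e 0 * e 2 = e 1)) \<longleftrightarrow> e 0 = e 1 / e 2"
    for e :: "nat \<Rightarrow> 'm" by (cases "e 2 = 0") (auto simp: field_simps)
  ultimately show "defpred (\<lambda>e. e 0 = e 1 / e 2)" by simp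
qed

lemma defterm_power [def_intros]: "defterm f \<Longrightarrow> defterm (\<lambda>e. f e ^ n)"
  by (induction n) (auto intro: def_intros)

lemma defpred_v_le0: "defpred (\<lambda>e. v (e 0) \<le> v (e 1))"
proof -
  obtain p where p: "p \<in> rels L" "rarity L p = 2"
    "\<forall>x y. rint M p [x, y] \<longleftrightarrow> y = 0 \<or> (x \<noteq> 0 \<and> v x \<le> v y)"
    using expands unfolding expands_ACVF_def by blast
  define R where "R x y \<longleftrightarrow> y = 0 \<or> (x \<noteq> 0 \<and> v x \<le> v y)" for x y
  have "defpred (\<lambda>e. R (e 0) (e 1))" unfolding defpred_def R_def
    using p by (intro exI[of _ "Rel p [Var 0, Var 1]"] exI[of _ Inl]) auto
  note [def_intros] = defpred_app2[OF this]
  \<comment> \<open>The relation symbol treats 0 as having infinite valuation, whereas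
    \<open>v 0\<close> is some actual element of the value group. A nonzero \<open>c\<close> with
    this value replaces 0 on both sides, so that \<open>R\<close> compares values proper.\<close>
  obtain c where c: "c \<noteq> 0" "v c = v 0" using v_surj by blast
  have "defpred (\<lambda>e. \<exists>x y. (e 0 = 0 \<and> x = c \<or> e 0 \<noteq> 0 \<and> x = e 0) \<and>
     (e 1 = 0 \<and> y = c \<or> e 1 \<noteq> 0 \<and> y = e 1) \<and> R x y)"
    by (intro def_intros)
  moreover have "(\<exists>x y. (e 0 = 0 \<and> x = c \<or> e 0 \<noteq> 0 \<and> x = e 0) \<and>
     (e 1 = 0 \<and> y = c \<or> e 1 \<noteq> 0 \<and> y = e 1) \<and> R x y) \<longleftrightarrow> v (e 0) \<le> v (e 1)" for e :: "nat \<Rightarrow> 'm"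
    using c by (cases "e 0 = 0"; cases "e 1 = 0") (auto simp: R_def)
  ultimately show ?thesis by simp
qed

lemma defval_v [def_intros]:
  assumes f: "defterm f" shows "defval (\<lambda>e. v (f e))"
proof -
  have "defpred (\<lambda>e. v (e 0) \<le> v (e 1) \<and> v (e 1) \<le> v (e 0))"
    by (intro defpred_conj defpred_app2[OF defpred_v_le0] def_intros)
  hence "defpred (\<lambda>e. v (e 0) = v (e 1))" by (simp add: eq_iff conj_commute)
  thus ?thesis unfolding defval_def
    by (rule defpred_app2[OF _ defterm_var defterm_rename[OF f, of Suc]])
qed

lemma defval_const [def_intros]: "defval (\<lambda>e. \<gamma>)"
  using defval_v[OF defterm_const] v_surj by metis

lemma defpred_mv:
  assumes R: "defpred (\<lambda>e. R (e 0) (v (e 1)))" and fg: "defterm f" "defval g"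
  shows "defpred (\<lambda>e. R (f e) (g e))"
proof -
  have "defpred (\<lambda>e. R (e 1) (v (e 0)))"
    using defpred_rename[OF R, of "\<lambda>i. 1 - i"] by simp
  hence "defpred (\<lambda>e. \<exists>x y. x = f e \<and> v y = g e \<and> R x (v y))"
    by (intro defpred_ex defpred_conj defterm_eq[OF fg(1)] defval_eq[OF fg(2)]) simp
  moreover have "(\<exists>x y. x = f e \<and> v y = g e \<and> R x (v y)) \<longleftrightarrow> R (f e) (g e)" for e
    by (metis v_surj)
  ultimately show ?thesis by simp
qed

lemma defpred_mmv:
  assumes R: "defpred (\<lambda>e. R (e 0) (e 1) (v (e 2)))" and fg: "defterm f" "defterm g" "defval h"
  shows "defpred (\<lambda>e. R (f e) (g e) (h e))"
proof -
  have "defpred (\<lambda>e. R (e (Suc (Suc 0))) (e (Suc 0)) (v (e 0)))"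
    using defpred_rename[OF R, of "\<lambda>i. 2 - i"] by (simp add: numeral_2_eq_2)
  hence "defpred (\<lambda>e. \<exists>x y z. x = f e \<and> y = g e \<and> v z = h e \<and> R x y (v z))"
    by (intro defpred_ex defpred_conj defterm_eq[OF fg(1)] defterm_eq[OF fg(2)] defval_eq[OF fg(3)])
  moreover have "(\<exists>x y z. x = f e \<and> y = g e \<and> v z = h e \<and> R x y (v z)) \<longleftrightarrow> R (f e) (g e) (h e)" for e
    by (metis v_surj)
  ultimately show ?thesis by simp
qed

lemma defpred_v1: "defpred (\<lambda>e. R (v (e 0))) \<Longrightarrow> defval f \<Longrightarrow> defpred (\<lambda>e. R (f e))"
  by (rule defpred_substv)

lemma defpred_vv:
  assumes R: "defpred (\<lambda>e. R (v (e 0)) (v (e 1)))" and fg: "defval f" "defval g"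
  shows "defpred (\<lambda>e. R (f e) (g e))"
proof -
  have "defpred (\<lambda>e. R (v (e 1)) (v (e 0)))"
    using defpred_rename[OF R, of "\<lambda>i. 1 - i"] by simp
  hence "defpred (\<lambda>e. \<exists>x y. v x = f e \<and> v y = g e \<and> R (v x) (v y))"
    by (intro defpred_ex defpred_conj defval_eq[OF fg(1)] defval_eq[OF fg(2)]) simp
  moreover have "(\<exists>x y. v x = f e \<and> v y = g e \<and> R (v x) (v y)) \<longleftrightarrow> R (f e) (g e)" for e
    by (metis v_surj)
  ultimately show ?thesis by simp
qed

lemma defpred_le [def_intros]: "defval f \<Longrightarrow> defval g \<Longrightarrow> defpred (\<lambda>e. f e \<le> g e)"
  using defpred_vv[OF defpred_v_le0] by blast

lemma defpred_less [def_intros]: "defval f \<Longrightarrow> defval g \<Longrightarrow> defpred (\<lambda>e. f e < g e)"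
  using defpred_not[OF defpred_le[of g f]] by (simp add: not_le)

lemma defpred_eqv [def_intros]: "defval f \<Longrightarrow> defval g \<Longrightarrow> defpred (\<lambda>e. f e = g e)"
  using defpred_conj[OF defpred_le[of f g] defpred_le[of g f]] by (simp add: eq_iff)

lemma defpred_vvv:
  assumes R: "defpred (\<lambda>e. R (v (e 0)) (v (e 1)) (v (e 2)))"
    and fgh: "defval f" "defval g" "defval h"
  shows "defpred (\<lambda>e. R (f e) (g e) (h e))"
proof -
  have "defpred (\<lambda>e. R (v (e (Suc (Suc 0)))) (v (e (Suc 0))) (v (e 0)))"
    using defpred_rename[OF R, of "\<lambda>i. 2 - i"] by (simp add: numeral_2_eq_2)
  hence "defpred (\<lambda>e. \<exists>x y z. v x = f e \<and> v y = g e \<and> v z = h e \<and> R (v x) (v y) (v z))"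
    by (intro defpred_ex defpred_conj defval_eq[OF fgh(1)] defval_eq[OF fgh(2)] defval_eq[OF fgh(3)])
  moreover have "(\<exists>x y z. v x = f e \<and> v y = g e \<and> v z = h e \<and> R (v x) (v y) (v z)) \<longleftrightarrow> R (f e) (g e) (h e)" for e
    by (metis v_surj)
  ultimately show ?thesis by simp
qed

lemma defval_app:
  assumes F: "defpred (\<lambda>e. v (e 0) = F (v (e 1)))" and f: "defval f"
  shows "defval (\<lambda>e. F (f e))"
  unfolding defval_def
  by (rule defpred_vv[of "\<lambda>a b. a = F b", OF F defval_v[OF defterm_var] defval_rename[OF f, of Suc]])

lemma defval_app2:
  assumes F: "defpred (\<lambda>e. v (e 0) = F (v (e 1)) (v (e 2)))" and fg: "defval f" "defval g"
  shows "defval (\<lambda>e. F (f e) (g e))"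
  unfolding defval_def
  by (rule defpred_vvv[of "\<lambda>a b c. a = F b c", OF F defval_v[OF defterm_var]
      defval_rename[OF fg(1), of Suc] defval_rename[OF fg(2), of Suc]])

lemma v_mult: "x \<noteq> 0 \<Longrightarrow> y \<noteq> 0 \<Longrightarrow> v (x * y) = v x + v y"
  using valuation_mult[OF val] .

lemma v_divide: "x \<noteq> 0 \<Longrightarrow> y \<noteq> 0 \<Longrightarrow> v (x / y) = v x - v y"
  using valuation_divide[OF val] .

lemma v_minus: "v (- x) = v x"
  using valuation_minus[OF val] .

lemma v_one [simp]: "v 1 = 0"
  using valuation_one[OF val] .

lemma v_power: "x \<noteq> 0 \<Longrightarrow> v (x ^ n) = ((+) (v x) ^^ n) 0"
  by (induction n) (auto simp: v_mult)

lemma defval_plus [def_intros]: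
  assumes "defval f" "defval g" shows "defval (\<lambda>e. f e + g e)"
proof (rule defval_app2[where F = "(+)", OF _ assms])
  have "defpred (\<lambda>e. \<exists>x y. x \<noteq> 0 \<and> y \<noteq> 0 \<and> v x = v (e 1) \<and> v y = v (e 2) \<and> v (e 0) = v (x * y))"
    by (intro def_intros)
  moreover have "(\<exists>x y. x \<noteq> 0 \<and> y \<noteq> 0 \<and> v x = v (e 1) \<and> v y = v (e 2) \<and> v (e 0) = v (x * y))
    \<longleftrightarrow> v (e 0) = v (e 1) + v (e 2)" for e :: "nat \<Rightarrow> 'm"
    by (metis v_surj v_mult)
  ultimately show "defpred (\<lambda>e. v (e 0) = v (e 1) + v (e 2))" by simp
qed

lemma defval_minus [def_intros]:
  assumes "defval f" "defval g" shows "defval (\<lambda>e. f e - g e)"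
proof (rule defval_app2[where F = "(-)", OF _ assms])
  have "defpred (\<lambda>e. v (e 0) + v (e 2) = v (e 1))" by (intro def_intros)
  thus "defpred (\<lambda>e. v (e 0) = v (e 1) - v (e 2))" by (simp add: eq_diff_eq)
qed

section \<open>Leading terms\<close>

lemma rv_zero: "rv v 0 = {0}"
  unfolding rv_eq by (auto simp: max_ideal_def intro: exI[of _ 1])

lemma rv_self: "x \<in> rv v x"
  unfolding rv_eq by (force simp: max_ideal_def)

text \<open>An equality of cosets becomes a first-order condition on the valuation. All later uses
  of \<open>rv\<close> in definable predicates rest on this.\<close>

lemma rv_eq_iff: "rv v x = rv v y \<longleftrightarrow> x = y \<or> (x \<noteq> 0 \<and> y \<noteq> 0 \<and> v y < v (x - y))"
proof (cases "x = 0 \<or> y = 0")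
  case True
  thus ?thesis using rv_self rv_zero by (metis singleton_iff)
next
  case False
  hence ne: "x \<noteq> 0" "y \<noteq> 0" by auto
  show ?thesis
  proof (cases "x = y")
    case False
    have 1: "rv v x = rv v y" if h: "v y < v (x - y)"
    proof -
      define u where "u = x / y"
      have x: "x = u * y" using ne by (simp add: u_def)
      have "u - 1 = (x - y) / y" using ne by (simp add: u_def field_simps)
      hence u: "u - 1 \<in> max_ideal v" using h ne False v_divide[of "x - y" y] by (simp add: max_ideal_def)
      have u0: "u \<noteq> 0" using ne by (simp add: u_def)
      have "v u = 0" using valuation_near[OF val, of 1 "u - 1"] u by (auto simp: max_ideal_def)
      have "rv v u = res v u" "rv v 1 = res v 1" using rv_eq_res[OF val] u0 \<open>v u = 0\<close> by auto
      have "1 / u - 1 = - ((u - 1) / u)" using u0 by (simp add: field_simps)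
      hence iu: "1 / u - 1 \<in> max_ideal v"
        using u u0 \<open>v u = 0\<close> v_divide[of "u - 1" u] by (cases "u = 1") (auto simp: max_ideal_def v_minus)
      have mm: "a * b - 1 \<in> max_ideal v" if a: "a - 1 \<in> max_ideal v" and b: "b - 1 \<in> max_ideal v" for a b
      proof -
        have b': "b \<noteq> 0" "v b = 0"
          using valuation_near[OF val, of 1 "b - 1"] b by (auto simp: max_ideal_def)
        have "(a - 1) * b = 0 \<or> 0 < v ((a - 1) * b)"
          using a b' v_mult[of "a - 1" b] by (cases "a = 1") (auto simp: max_ideal_def)
        hence "(a - 1) * b + (b - 1) \<in> max_ideal v"
          using valuation_add_gt[OF val, of "(a - 1) * b" 0 "b - 1"] b by (auto simp: max_ideal_def)
        thus ?thesis by (simp add: algebra_simps)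
      qed
      show ?thesis
      proof (intro equalityI subsetI)
        fix z assume "z \<in> rv v x"
        then obtain w where "z = w * x" "w - 1 \<in> max_ideal v" unfolding rv_eq by blast
        thus "z \<in> rv v y" unfolding rv_eq using mm[of w u] u by (auto simp: x mult.assoc)
      next
        fix z assume "z \<in> rv v y"
        then obtain w where w: "z = w * y" "w - 1 \<in> max_ideal v" unfolding rv_eq by blast
        have "z = (w * (1 / u)) * x" using w u0 by (simp add: x)
        thus "z \<in> rv v x" unfolding rv_eq using mm[of w "1 / u"] w iu by blast
      qed
    qed
    have 2: "v y < v (x - y)" if "rv v x = rv v y"
    proof -
      have "x \<in> rv v y" using rv_self[of x] that by simp
      thus ?thesis unfolding rv_eq_plus[OF val ne(2)] using False by auto
    qed
    show ?thesis
    proof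
      assume "rv v x = rv v y"
      thus "x = y \<or> (x \<noteq> 0 \<and> y \<noteq> 0 \<and> v y < v (x - y))" using 2 ne by blast
    next
      assume "x = y \<or> (x \<noteq> 0 \<and> y \<noteq> 0 \<and> v y < v (x - y))"
      thus "rv v x = rv v y" using 1 False by blast
    qed
  next
    case True
    thus ?thesis by blast
  qed
qed

lemma defpred_rv [def_intros]:
  assumes "defterm f" "defterm g" shows "defpred (\<lambda>e. rv v (f e) = rv v (g e))"
  apply (subst rv_eq_iff)
  apply (rule defpred_disj)
  apply (rule defpred_eq)
   apply (rule assms)+
  apply (rule defpred_conj)
  apply (rule defpred_not)
  apply (rule defpred_eq)
   apply (rule assms)
   apply (rule defterm_const)
  apply (rule defpred_conj)
  apply (rule defpred_not)
  apply (rule defpred_eq)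
   apply (rule assms)
   apply (rule defterm_const)
  apply (rule defpred_less)
  apply (rule defval_v)
   apply (rule assms)
  apply (rule defval_v)
  apply (rule defterm_minus)
   apply (rule assms)+
   done

section \<open>From definable predicates to definable sets, and saturation\<close>

lemma defpred_iff_formula:
  assumes "defpred P"
  shows "\<exists>\<phi> \<rho>. wf_fm L \<phi> \<and> (\<forall>e. P (\<lambda>i. if i < n then e i else 0) \<longleftrightarrow> sat M (\<lambda>i. if i < n then e i else \<rho> (i - n)) \<phi>)"
proof -
  from assms obtain \<phi> s where
    1: "wf_fm L \<phi>" "\<And>e. P e \<longleftrightarrow> sat M (\<lambda>i. case_sum e id (s i)) \<phi>"
    unfolding defpred_def by blast
  \<comment> \<open>The first \<open>n\<close> variables must be the coordinates. Any other variable
    \<open>i\<close> goes to \<open>n + i\<close>, where \<open>\<rho> i\<close> holds its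
    parameter, or 0 for a coordinate beyond the first \<open>n\<close>.\<close>
  define f where "f i = (case s i of Inl j \<Rightarrow> if j < n then j else n + i | Inr c \<Rightarrow> n + i)" for i
  define \<rho> where "\<rho> i = (case s i of Inl j \<Rightarrow> 0 | Inr c \<Rightarrow> c)" for i
  have "(\<lambda>i. if f i < n then e (f i) else \<rho> (f i - n)) = (\<lambda>i. case_sum (\<lambda>i. if i < n then e i else 0) id (s i))" for e
    by (auto simp: fun_eq_iff f_def \<rho>_def split: sum.split)
  thus ?thesis using 1 by (intro exI[of _ "rename_fm f \<phi>"] exI[of _ \<rho>]) simp
qed

lemma definable_Collect:
  assumes "defpred P"
  shows "definable L M n {xs. length xs = n \<and> P (\<lambda>i. if i < n then xs ! i else 0)}"
proof -
  obtain \<phi> \<rho> where 1: "wf_fm L \<phi>"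
    "\<And>e. P (\<lambda>i. if i < n then e i else 0) \<longleftrightarrow> sat M (\<lambda>i. if i < n then e i else \<rho> (i - n)) \<phi>"
    using defpred_iff_formula[OF assms, of n] by (elim exE conjE) auto
  thus ?thesis unfolding definable_def univ
    by (intro exI[of _ \<phi>] exI[of _ \<rho>]) auto
qed

lemma defpred_of_definable:
  assumes "definable L M n X"
  shows "defpred (\<lambda>e. map e [0..<n] \<in> X)"
proof -
  from assms obtain \<phi> \<rho> where 1: "wf_fm L \<phi>" "X = {xs. length xs = n \<and> set xs \<subseteq> univ M \<and>
              sat M (\<lambda>i. if i < n then xs ! i else \<rho> (i - n)) \<phi>}"
    unfolding definable_def by blast
  have "(\<lambda>i. if i < n then map e [0..<n] ! i else \<rho> (i - n)) =
    (\<lambda>i. case_sum e id (if i < n then Inl i else Inr (\<rho> (i - n))))" for e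
    by (auto simp: fun_eq_iff)
  thus ?thesis unfolding defpred_def
    by (intro exI[of _ \<phi>] exI[of _ "\<lambda>i. if i < n then Inl i else Inr (\<rho> (i - n))"])
     (simp add: 1 univ)
qed

lemma definable_pairs:
  assumes "defpred (\<lambda>e. R (e 0) (e 1))"
  shows "definable L M 2 {[x, y] | x y. R x y}"
proof -
  have "{xs. length xs = 2 \<and> R (if 0 < (2::nat) then xs ! 0 else 0) (if 1 < (2::nat) then xs ! 1 else 0)} = {[x, y] | x y. R x y}"
    by (auto simp: numeral_2_eq_2 length_Suc_conv)
  thus ?thesis using definable_Collect[OF assms, of 2] by simp
qed

lemma defpred_of_definable_pairs:
  assumes "definable L M 2 {[x, y] | x y. R x y}"
  shows "defpred (\<lambda>e. R (e 0) (e 1))"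
  using defpred_of_definable[OF assms] by (simp add: numeral_2_eq_2)

lemma definable_single:
  assumes "defpred (\<lambda>e. R (e 0))"
  shows "definable L M 1 {[x] | x. x \<in> Collect R}"
proof -
  have "{xs. length xs = 1 \<and> R (if 0 < (1::nat) then xs ! 0 else 0)} = {[x] | x. x \<in> Collect R}"
    by (auto simp: length_Suc_conv)
  thus ?thesis using definable_Collect[OF assms, of 1] by simp
qed

text \<open>Countably many formulas involve only countably many parameters, and \<kappa> is
  uncountable.\<close>

lemma countable_saturation:
  assumes P: "\<And>n. defpred (\<lambda>e. P n (e 0))" and fip: "\<And>n::nat. \<exists>x. \<forall>i\<le>n. P i x"
  shows "\<exists>x. \<forall>n. P n x"
proof -
  have "\<exists>\<phi> \<rho>. wf_fm L \<phi> \<and> (\<forall>x. P n x \<longleftrightarrow> sat M (case_nat x \<rho>) \<phi>)" for n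
  proof -
    obtain \<phi> \<rho> where 1: "wf_fm L \<phi>"
      "\<And>e. P n (if 0 < (1::nat) then e 0 else 0) \<longleftrightarrow> sat M (\<lambda>i. if i < 1 then e i else \<rho> (i - 1)) \<phi>"
      using defpred_iff_formula[OF P[of n], of 1] by (elim exE conjE) auto
    have "(\<lambda>i. if i < (1::nat) then x else \<rho> (i - 1)) = case_nat x \<rho>" for x
      by (auto simp: fun_eq_iff split: nat.split)
    hence "P n x \<longleftrightarrow> sat M (case_nat x \<rho>) \<phi>" for x using 1(2)[of "\<lambda>_. x"] by simp
    thus ?thesis using 1(1) by blast
  qed
  then obtain \<phi> \<rho> where 1: "\<And>n. wf_fm L (\<phi> n)" "\<And>n x. P n x \<longleftrightarrow> sat M (case_nat x (\<rho> n)) (\<phi> n)"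
    by metis
  define A where "A = (\<Union>n. range (\<rho> n))"
  have "countable A" unfolding A_def by auto
  hence "|A| \<le>o natLeq" using countable_card_le_natLeq by blast
  hence A: "|A| <o \<kappa>"
    using monster ordLeq_ordLess_trans unfolding monster_model_def by blast
  define p where "p = range (\<lambda>n. (\<phi> n, \<rho> n))"
  have sat: "saturated L M \<kappa>" using monster unfolding monster_model_def by blast
  have 2: "\<exists>x\<in>univ M. \<forall>(\<phi>, e)\<in>p0. sat M (case_nat x e) \<phi>" if p0: "p0 \<subseteq> p" "finite p0" for p0
  proof -
    obtain N where N: "finite N" "p0 = (\<lambda>n. (\<phi> n, \<rho> n)) ` N"
      using finite_subset_image[OF p0(2) p0(1)[unfolded p_def]] by (elim exE conjE) auto
    obtain m where m: "\<forall>n\<in>N. n \<le> m" using N(1) finite_nat_set_iff_bounded_le by auto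
    obtain x where "\<forall>i\<le>m. P i x" using fip by blast
    hence "\<forall>n\<in>N. sat M (case_nat x (\<rho> n)) (\<phi> n)" using m 1(2) by blast
    thus ?thesis unfolding N(2) univ by auto
  qed
  have 3: "p \<subseteq> {(\<phi>, e). wf_fm L \<phi> \<and> range e \<subseteq> A}"
    unfolding p_def A_def using 1(1) by auto
  have "A \<subseteq> univ M \<and> |A| <o \<kappa> \<and> p \<subseteq> {(\<phi>, e). wf_fm L \<phi> \<and> range e \<subseteq> A} \<and>
      (\<forall>p0. p0 \<subseteq> p \<and> finite p0 \<longrightarrow> (\<exists>x\<in>univ M. \<forall>(\<phi>, e)\<in>p0. sat M (case_nat x e) \<phi>))"
    using 2 3 A univ by simp
  hence "\<exists>x\<in>univ M. \<forall>(\<phi>, e)\<in>p. sat M (case_nat x e) \<phi>"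
    by (rule sat[unfolded saturated_def, THEN spec, THEN spec, THEN mp])
  then obtain x where "\<forall>(\<phi>, e)\<in>p. sat M (case_nat x e) \<phi>" by blast
  hence "P n x" for n unfolding p_def using 1(2) by simp
  thus ?thesis by blast
qed

end

section \<open>Definable sets of values\<close>

text \<open>This encodes a finite union of points and intervals by a finite set \<open>F\<close>
  that contains every place where membership may change. The intervals need not be listed.\<close>

definition tame :: "('g::linorder \<Rightarrow> bool) \<Rightarrow> bool" where
  "tame X \<longleftrightarrow> (\<exists>F. finite F \<and> (\<forall>x y. x \<le> y \<longrightarrow> {x..y} \<inter> F = {} \<longrightarrow> (X x \<longleftrightarrow> X y)))"

lemma tameE:
  assumes "tame X"
  obtains F where "finite F" "\<And>x y. x \<le> y \<Longrightarrow> {x..y} \<inter> F = {} \<Longrightarrow> X x \<longleftrightarrow> X y"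
  using assms unfolding tame_def by blast

text \<open>The function \<open>f\<close> takes at least \<open>n\<close> values on
  \<open>X\<close>. The recursion unfolds, for each fixed \<open>n\<close>, to a first-order
  formula, which a statement about \<open>card\<close> would not do.\<close>

primrec atl :: "('a \<Rightarrow> 'b) \<Rightarrow> nat \<Rightarrow> ('a \<Rightarrow> bool) \<Rightarrow> bool" where
  "atl f 0 X \<longleftrightarrow> True"
| "atl f (Suc n) X \<longleftrightarrow> (\<exists>y. X y \<and> atl f n (\<lambda>z. X z \<and> f z \<noteq> f y))"

lemma atl_iff: "atl f n X \<longleftrightarrow> (\<exists>S. finite S \<and> card S = n \<and> S \<subseteq> f ` Collect X)"
proof (induction n arbitrary: X)
  case 0
  show ?case by (auto intro: exI[of _ "{}"])
next
  case (Suc n)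
  show ?case
  proof
    assume "atl f (Suc n) X"
    then obtain y S where y: "X y" "finite S" "card S = n" "S \<subseteq> f ` {z. X z \<and> f z \<noteq> f y}"
      using Suc.IH by auto
    hence "f y \<notin> S" by auto
    thus "\<exists>S. finite S \<and> card S = Suc n \<and> S \<subseteq> f ` Collect X"
      using y by (intro exI[of _ "insert (f y) S"]) auto
  next
    assume "\<exists>S. finite S \<and> card S = Suc n \<and> S \<subseteq> f ` Collect X"
    then obtain S where S: "finite S" "card S = Suc n" "S \<subseteq> f ` Collect X" by blast
    then obtain s where s: "s \<in> S" by fastforce
    then obtain y where y: "X y" "s = f y" using S by auto
    have "finite (S - {s})" "card (S - {s}) = n" "S - {s} \<subseteq> f ` {z. X z \<and> f z \<noteq> f y}"
      using S s y by auto
    hence "atl f n (\<lambda>z. X z \<and> f z \<noteq> f y)" using Suc.IH by blast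
    thus "atl f (Suc n) X" using y by auto
  qed
qed

lemma atl_finite: "finite (f ` Collect X) \<Longrightarrow> atl f n X \<longleftrightarrow> n \<le> card (f ` Collect X)"
  unfolding atl_iff by (metis card_mono obtain_subset_with_card_n)

lemma ball_cases:
  assumes "X \<in> balls v \<union> range (\<lambda>a. {a})"
  shows "(\<exists>a c. X = {x. x = a \<or> c \<le> v (x - a)}) \<or> (\<exists>a c. X = {x. x = a \<or> c < v (x - a)}) \<or> (\<exists>a. X = {a})"
proof -
  have "(\<exists>a c. X = {x. x = a \<or> c \<le> v (x - a)} \<and> True) \<or> (\<exists>a c. X = {x. x = a \<or> c < v (x - a)} \<and> True) \<or> (\<exists>a. X = {a} \<and> a \<in> UNIV)"
    using assms unfolding balls_def by (simp only: Un_iff mem_Collect_eq image_iff bex_simps Bex_def disj_assoc conj_commute)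
  thus ?thesis by (simp only: simp_thms UNIV_I)
qed

lemma not_cong_iff: "((\<not> P) = (\<not> Q)) = (P = Q)"
  by blast

context C_min_ACVF
begin

section \<open>Consequences of C-minimality\<close>

lemma v_diff:
  assumes "x \<noteq> 0" "a \<noteq> 0" "v x \<noteq> v a"
  shows "x \<noteq> a" "v (x - a) = min (v x) (v a)"
proof -
  show "x \<noteq> a" using assms by auto
  show "v (x - a) = min (v x) (v a)"
  proof (cases "v x < v a")
    case True
    thus ?thesis using valuation_near[OF val, of x "- a"] assms by (simp add: v_minus)
  next
    case False
    hence "v a < v x" using assms by simp
    thus ?thesis using valuation_near[OF val, of "- a" x] assms by (simp add: v_minus)
  qed
qed

lemma v_diff_ge:
  assumes "x \<noteq> 0" "a \<noteq> 0" "x \<noteq> a" "v x = v a"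
  shows "v x \<le> v (x - a)"
proof -
  have "min (v x) (v (- a)) \<le> v (x + - a)"
    using val assms unfolding valuation_def by (metis add_eq_0_iff2 neg_equal_0_iff_equal add.inverse_inverse)
  thus ?thesis using assms by (simp add: v_minus)
qed

lemma definable_bool_combs:
  assumes "defpred (\<lambda>e. S (e 0))"
  shows "Collect S \<in> bool_combs (balls v \<union> range (\<lambda>a. {a}))"
  using C_minimal definable_single[OF assms] unfolding C_minimal_def by blast

text \<open>For a ball with centre \<open>a\<close> and radius \<open>c\<close>, membership of
  \<open>x\<close> depends only on the position of \<open>v x\<close> with respect to
  \<open>v a\<close> and \<open>c\<close>, because \<open>v (x - a)\<close> is the minimum of
  \<open>v x\<close> and \<open>v a\<close> as soon as these differ. Each ball thus contributes two
  exceptional values.\<close>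

lemma definable_val_constant:
  assumes "defpred (\<lambda>e. S (e 0))"
  shows "\<exists>F. finite F \<and> (\<forall>x y. x \<noteq> 0 \<longrightarrow> y \<noteq> 0 \<longrightarrow> v x \<le> v y \<longrightarrow> {v x..v y} \<inter> F = {} \<longrightarrow> (S x \<longleftrightarrow> S y))"
proof -
  have "\<exists>F. finite F \<and> (\<forall>x y. x \<noteq> 0 \<longrightarrow> y \<noteq> 0 \<longrightarrow> v x \<le> v y \<longrightarrow> {v x..v y} \<inter> F = {} \<longrightarrow> (x \<in> X \<longleftrightarrow> y \<in> X))"
    if "X \<in> bool_combs (balls v \<union> range (\<lambda>a. {a}))" for X
    using that
  proof induction
    case (gen X)
    have ball: "(x = a \<or> Q (v (x - a))) \<longleftrightarrow> (y = a \<or> Q (v (y - a)))"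
      if "Q = (\<lambda>z. c \<le> z) \<or> Q = (\<lambda>z. c < z)" "x \<noteq> 0" "y \<noteq> 0" "v x \<le> v y" "{v x..v y} \<inter> {v a, c} = {}"
      for Q a c x y
    proof -
      have Q: "Q (v x) \<longleftrightarrow> Q (v y)" using that by auto
      show ?thesis
      proof (cases "a = 0")
        case False
        have ne: "v x \<noteq> v a" "v y \<noteq> v a" using that by auto
        have "v x < v a \<longleftrightarrow> v y < v a" using that by auto
        hence "min (v x) (v a) = v x \<and> min (v y) (v a) = v y \<or> min (v x) (v a) = v a \<and> min (v y) (v a) = v a"
          by (auto simp: min_def)
        thus ?thesis using v_diff[of x a] v_diff[of y a] that False ne Q by auto
      qed (use that Q in auto)
    qed
    from ball_cases[OF gen] show ?case
    proof (elim disjE exE)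
      fix a c assume 1: "X = {x. x = a \<or> c \<le> v (x - a)}"
      show ?case
      proof (intro exI[of _ "{v a, c}"] conjI allI impI)
        fix x y assume as: "x \<noteq> 0" "y \<noteq> 0" "v x \<le> v y" "{v x..v y} \<inter> {v a, c} = {}"
        show "x \<in> X \<longleftrightarrow> y \<in> X" unfolding 1 mem_Collect_eq
          by (rule ball[of "\<lambda>z. c \<le> z" c, OF _ as]) simp
      qed simp
    next
      fix a c assume 2: "X = {x. x = a \<or> c < v (x - a)}"
      show ?case
      proof (intro exI[of _ "{v a, c}"] conjI allI impI)
        fix x y assume as: "x \<noteq> 0" "y \<noteq> 0" "v x \<le> v y" "{v x..v y} \<inter> {v a, c} = {}"
        show "x \<in> X \<longleftrightarrow> y \<in> X" unfolding 2 mem_Collect_eq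
          by (rule ball[of "\<lambda>z. c < z" c, OF _ as]) simp
      qed simp
    next
      fix a assume 3: "X = {a}"
      show ?case unfolding 3 by (intro exI[of _ "{v a}"]) auto
    qed
  next
    case (compl X)
    then obtain F where "finite F" "\<forall>x y. x \<noteq> 0 \<longrightarrow> y \<noteq> 0 \<longrightarrow> v x \<le> v y \<longrightarrow> {v x..v y} \<inter> F = {} \<longrightarrow> (x \<in> X \<longleftrightarrow> y \<in> X)"
      by (elim exE conjE)
    thus ?case unfolding Compl_iff not_cong_iff by (intro exI[of _ F] conjI)
  next
    case (union X Y)
    then obtain F G where F: "finite F" "\<forall>x y. x \<noteq> 0 \<longrightarrow> y \<noteq> 0 \<longrightarrow> v x \<le> v y \<longrightarrow> {v x..v y} \<inter> F = {} \<longrightarrow> (x \<in> X \<longleftrightarrow> y \<in> X)"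
      and G: "finite G" "\<forall>x y. x \<noteq> 0 \<longrightarrow> y \<noteq> 0 \<longrightarrow> v x \<le> v y \<longrightarrow> {v x..v y} \<inter> G = {} \<longrightarrow> (x \<in> Y \<longleftrightarrow> y \<in> Y)"
      by (elim exE conjE)
    show ?case
    proof (intro exI[of _ "F \<union> G"] conjI allI impI)
      fix x y assume a: "x \<noteq> 0" "y \<noteq> 0" "v x \<le> v y" "{v x..v y} \<inter> (F \<union> G) = {}"
      hence "{v x..v y} \<inter> F = {}" "{v x..v y} \<inter> G = {}" by auto
      hence "x \<in> X \<longleftrightarrow> y \<in> X" "x \<in> Y \<longleftrightarrow> y \<in> Y" using F(2) G(2) a by blast+
      thus "x \<in> X \<union> Y \<longleftrightarrow> y \<in> X \<union> Y" by blast
    qed (use F G in simp)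
  qed
  from this[OF definable_bool_combs[OF assms]] show ?thesis by simp
qed

text \<open>Inside a fibre of the valuation, \<open>v (x - a)\<close> is the same for all
  \<open>x\<close> whose leading term differs from that of \<open>a\<close>. Each ball or point thus
  contributes one exceptional class.\<close>

lemma definable_rv_constant:
  assumes "defpred (\<lambda>e. S (e 0))"
  shows "\<exists>F. finite F \<and> (\<forall>x y. x \<noteq> 0 \<longrightarrow> y \<noteq> 0 \<longrightarrow> v x = v y \<longrightarrow> rv v x \<notin> F \<longrightarrow> rv v y \<notin> F \<longrightarrow> (S x \<longleftrightarrow> S y))"
proof -
  have "\<exists>F. finite F \<and> (\<forall>x y. x \<noteq> 0 \<longrightarrow> y \<noteq> 0 \<longrightarrow> v x = v y \<longrightarrow> rv v x \<notin> F \<longrightarrow> rv v y \<notin> F \<longrightarrow> (x \<in> X \<longleftrightarrow> y \<in> X))"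
    if "X \<in> bool_combs (balls v \<union> range (\<lambda>a. {a}))" for X
    using that
  proof induction
    case (gen X)
    have ball: "x \<noteq> a \<and> y \<noteq> a \<and> v (x - a) = v (y - a)"
      if "x \<noteq> 0" "y \<noteq> 0" "v x = v y" "rv v x \<noteq> rv v a" "rv v y \<noteq> rv v a"
      for a x y
    proof -
      have ne: "x \<noteq> a" "y \<noteq> a" using that by auto
      have "v (x - a) = v (y - a)"
      proof (cases "a = 0")
        case a: False
        show ?thesis
        proof (cases "v x = v a")
          case False
          thus ?thesis using v_diff[of x a] v_diff[of y a] that a by simp
        next
          case True
          have "v (z - a) = v a" if "z \<noteq> 0" "v z = v a" "rv v z \<noteq> rv v a" for z
          proof -
            have "z \<noteq> a" using that by auto
            thus ?thesis using v_diff_ge[of z a] that a rv_eq_iff[of z a] by force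
          qed
          thus ?thesis using True that by simp
        qed
      qed (use that in simp)
      thus ?thesis using ne by simp
    qed
    from ball_cases[OF gen] show ?case
    proof (elim disjE exE)
      fix a c assume 1: "X = {x. x = a \<or> c \<le> v (x - a)}"
      show ?case unfolding 1
      proof (intro exI[of _ "{rv v a}"] conjI allI impI)
        fix x y assume "x \<noteq> 0" "y \<noteq> 0" "v x = v y" "rv v x \<notin> {rv v a}" "rv v y \<notin> {rv v a}"
        hence "x \<noteq> a \<and> y \<noteq> a \<and> v (x - a) = v (y - a)" by (intro ball) simp_all
        thus "x \<in> {x. x = a \<or> c \<le> v (x - a)} \<longleftrightarrow> y \<in> {x. x = a \<or> c \<le> v (x - a)}" by simp
      qed simp
    next
      fix a c assume 2: "X = {x. x = a \<or> c < v (x - a)}"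
      show ?case unfolding 2
      proof (intro exI[of _ "{rv v a}"] conjI allI impI)
        fix x y assume "x \<noteq> 0" "y \<noteq> 0" "v x = v y" "rv v x \<notin> {rv v a}" "rv v y \<notin> {rv v a}"
        hence "x \<noteq> a \<and> y \<noteq> a \<and> v (x - a) = v (y - a)" by (intro ball) simp_all
        thus "x \<in> {x. x = a \<or> c < v (x - a)} \<longleftrightarrow> y \<in> {x. x = a \<or> c < v (x - a)}" by simp
      qed simp
    next
      fix a assume 3: "X = {a}"
      show ?case unfolding 3 by (intro exI[of _ "{rv v a}"]) auto
    qed
  next
    case (compl X)
    then obtain F where "finite F" "\<forall>x y. x \<noteq> 0 \<longrightarrow> y \<noteq> 0 \<longrightarrow> v x = v y \<longrightarrow> rv v x \<notin> F \<longrightarrow> rv v y \<notin> F \<longrightarrow> (x \<in> X \<longleftrightarrow> y \<in> X)"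
      by (elim exE conjE)
    thus ?case unfolding Compl_iff not_cong_iff by (intro exI[of _ F] conjI)
  next
    case (union X Y)
    then obtain F G where F: "finite F" "\<forall>x y. x \<noteq> 0 \<longrightarrow> y \<noteq> 0 \<longrightarrow> v x = v y \<longrightarrow> rv v x \<notin> F \<longrightarrow> rv v y \<notin> F \<longrightarrow> (x \<in> X \<longleftrightarrow> y \<in> X)"
      and G: "finite G" "\<forall>x y. x \<noteq> 0 \<longrightarrow> y \<noteq> 0 \<longrightarrow> v x = v y \<longrightarrow> rv v x \<notin> G \<longrightarrow> rv v y \<notin> G \<longrightarrow> (x \<in> Y \<longleftrightarrow> y \<in> Y)"
      by (elim exE conjE)
    show ?case
    proof (intro exI[of _ "F \<union> G"] conjI allI impI)
      fix x y assume a: "x \<noteq> 0" "y \<noteq> 0" "v x = v y" "rv v x \<notin> F \<union> G" "rv v y \<notin> F \<union> G"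
      hence "x \<in> X \<longleftrightarrow> y \<in> X" "x \<in> Y \<longleftrightarrow> y \<in> Y" using F(2) G(2) by blast+
      thus "x \<in> X \<union> Y \<longleftrightarrow> y \<in> X \<union> Y" by blast
    qed (use F G in simp)
  qed
  from this[OF definable_bool_combs[OF assms]] show ?thesis by simp
qed

lemma definable_tame:
  assumes "defpred (\<lambda>e. X (v (e 0)))"
  shows "tame X"
proof -
  obtain F where F: "finite F" "\<forall>x y. x \<noteq> 0 \<longrightarrow> y \<noteq> 0 \<longrightarrow> v x \<le> v y \<longrightarrow> {v x..v y} \<inter> F = {} \<longrightarrow> (X (v x) \<longleftrightarrow> X (v y))"
    using definable_val_constant[of "\<lambda>x. X (v x)", OF assms] by (elim exE conjE)
  show ?thesis unfolding tame_def
  proof (intro exI[of _ F] conjI allI impI F(1))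
    fix x y assume "x \<le> y" "{x..y} \<inter> F = {}"
    moreover obtain x' y' where "x' \<noteq> 0" "v x' = x" "y' \<noteq> 0" "v y' = y" using v_surj by metis
    ultimately show "X x \<longleftrightarrow> X y" using F(2) by blast
  qed
qed

text \<open>For \<open>v x = v y\<close> the interval in \<open>definable_val_constant\<close> is a
  single point, so a fibre that \<open>S\<close> splits lies over an exceptional value.\<close>

lemma definable_val_fibers:
  assumes "defpred (\<lambda>e. S (e 0))"
  shows "finite {\<gamma>. \<exists>x y. x \<noteq> 0 \<and> y \<noteq> 0 \<and> v x = \<gamma> \<and> v y = \<gamma> \<and> S x \<and> \<not> S y}"
proof -
  obtain F where F: "finite F" "\<forall>x y. x \<noteq> 0 \<longrightarrow> y \<noteq> 0 \<longrightarrow> v x \<le> v y \<longrightarrow> {v x..v y} \<inter> F = {} \<longrightarrow> (S x \<longleftrightarrow> S y)"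
    using definable_val_constant[OF assms] by (elim exE conjE)
  have "{\<gamma>. \<exists>x y. x \<noteq> 0 \<and> y \<noteq> 0 \<and> v x = \<gamma> \<and> v y = \<gamma> \<and> S x \<and> \<not> S y} \<subseteq> F"
  proof
    fix \<gamma> assume "\<gamma> \<in> {\<gamma>. \<exists>x y. x \<noteq> 0 \<and> y \<noteq> 0 \<and> v x = \<gamma> \<and> v y = \<gamma> \<and> S x \<and> \<not> S y}"
    then obtain x y where "x \<noteq> 0" "y \<noteq> 0" "v x = \<gamma>" "v y = \<gamma>" "S x" "\<not> S y" by blast
    thus "\<gamma> \<in> F" using F(2)[rule_format, of x y] by auto
  qed
  thus ?thesis using F(1) finite_subset by blast
qed

lemma v_prod: "finite A \<Longrightarrow> (\<And>a. a \<in> A \<Longrightarrow> f a \<noteq> 0) \<Longrightarrow> v (\<Prod>a\<in>A. f a) = (\<Sum>a\<in>A. v (f a))"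
  by (induction A rule: finite_induct) (auto simp: v_mult)

text \<open>Euclid's argument: let \<open>b\<close> be a root of 1 plus the product of all
  \<open>X - a\<close>, where \<open>a\<close> runs through 0 and representatives of finitely many
  classes of units. Then the product of all \<open>b - a\<close> is -1, which forces
  \<open>b\<close> to be integral and every \<open>b - a\<close> to be a unit; so \<open>b\<close>
  is a unit in a new class.\<close>

lemma infinite_units: "infinite (rv v ` {x. x \<noteq> 0 \<and> v x = 0})"
proof
  assume fin: "finite (rv v ` {x. x \<noteq> 0 \<and> v x = 0})"
  obtain A where A: "A \<subseteq> {x. x \<noteq> 0 \<and> v x = 0}" "finite A"
      "rv v ` {x. x \<noteq> 0 \<and> v x = 0} = rv v ` A"
    using finite_subset_image[OF fin order_refl] by meson
  define B where "B = insert 0 A"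
  have B: "finite B" "\<And>a. a \<in> B \<Longrightarrow> a = 0 \<or> v a = 0" using A by (auto simp: B_def)
  define p where "p = (\<Prod>a\<in>B. [:- a, 1:]) + [:1:]"
  have "degree (\<Prod>a\<in>B. [:- a, 1:]) = card B"
    by (subst degree_prod_eq_sum_degree) auto
  moreover have "card B > 0" using B by (auto simp: B_def card_gt_0_iff)
  ultimately have "degree p > 0" unfolding p_def by (subst degree_add_eq_left) auto
  then obtain b where "poly p b = 0" using alg_closed_imp_poly_has_root by blast
  hence prod: "(\<Prod>a\<in>B. b - a) = - 1"
    by (simp add: p_def poly_prod eq_neg_iff_add_eq_0)
  hence ne: "b - a \<noteq> 0" if "a \<in> B" for a using that B(1) by (metis prod_zero neg_equal_0_iff_equal zero_neq_one)
  have b0: "b \<noteq> 0" using ne[of 0] by (simp add: B_def)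
  have sum: "(\<Sum>a\<in>B. v (b - a)) = 0"
    using v_prod[OF B(1), of "\<lambda>a. b - a"] ne prod by (simp add: v_minus)
  have vb: "0 \<le> v b"
  proof (rule ccontr)
    assume "\<not> 0 \<le> v b"
    hence "v (b - a) < 0" if "a \<in> B" for a
      using B(2)[OF that] v_diff[of b a] b0 by (cases "a = 0") auto
    hence "(\<Sum>a\<in>B. v (b - a)) < (\<Sum>a\<in>B. 0)" using B by (intro sum_strict_mono) (auto simp: B_def)
    thus False using sum by simp
  qed
  have nn: "0 \<le> v (b - a)" if "a \<in> B" for a
  proof (cases "a = 0")
    case False
    hence a: "v a = 0" using B(2)[OF that] by simp
    show ?thesis
      using v_diff[of b a] v_diff_ge[of b a] b0 False a vb ne[OF that] by (cases "v b = v a") auto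
  qed (use vb in simp)
  have z: "v (b - a) = 0" if "a \<in> B" for a
    using sum_nonneg_eq_0_iff[OF B(1), of "\<lambda>a. v (b - a)"] nn sum that by simp
  have "v b = 0" using z[of 0] by (simp add: B_def)
  hence "rv v b \<in> rv v ` A" using b0 A(3) by blast
  then obtain a where "a \<in> A" "rv v b = rv v a" by blast
  moreover from this have "v a = 0" using A(1) by auto
  ultimately show False using z[of a] ne[of a] unfolding rv_eq_iff by (auto simp: B_def)
qed

section \<open>Arithmetic of leading terms\<close>

lemma rv_mult_left:
  assumes "c \<noteq> 0" shows "rv v (c * x) = rv v (c * y) \<longleftrightarrow> rv v x = rv v y"
proof (cases "x = y \<or> x = 0 \<or> y = 0")
  case True
  thus ?thesis using assms unfolding rv_eq_iff by auto
next
  case False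
  have "v (c * x - c * y) = v c + v (x - y)"
    using v_mult[of c "x - y"] assms False by (simp add: right_diff_distrib)
  thus ?thesis using assms False v_mult[of c y] unfolding rv_eq_iff by simp
qed

lemma rv_eq_0: "rv v x = rv v y \<Longrightarrow> x = 0 \<longleftrightarrow> y = 0"
  unfolding rv_eq_iff by (elim disjE) simp_all

lemma rv_mult_cong:
  assumes "rv v x = rv v x'" "rv v y = rv v y'"
  shows "rv v (x * y) = rv v (x' * y')"
proof (cases "x = 0 \<or> y' = 0")
  case True
  thus ?thesis using rv_eq_0[OF assms(1)] rv_eq_0[OF assms(2)] by auto
next
  case False
  have "rv v (x * y) = rv v (x * y')" using rv_mult_left[of x y y'] False assms by simp
  also have "\<dots> = rv v (x' * y')"
    using rv_mult_left[of y' x x'] False assms by (simp add: mult.commute)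
  finally show ?thesis .
qed

text \<open>Multiplication by an element of value \<gamma> carries the classes of units injectively
  into this fibre.\<close>

lemma infinite_rv: "infinite (rv v ` {x. x \<noteq> 0 \<and> v x = \<gamma>})"
proof
  assume fin: "finite (rv v ` {x. x \<noteq> 0 \<and> v x = \<gamma>})"
  obtain c where c: "c \<noteq> 0" "v c = \<gamma>" using v_surj by blast
  define h where "h A = rv v ((SOME x. rv v x = A) / c)" for A
  have "rv v ` {x. x \<noteq> 0 \<and> v x = 0} \<subseteq> h ` rv v ` {x. x \<noteq> 0 \<and> v x = \<gamma>}"
  proof
    fix A assume "A \<in> rv v ` {x. x \<noteq> 0 \<and> v x = 0}"
    then obtain x where x: "x \<noteq> 0" "v x = 0" "A = rv v x" by blast
    define y where "y = (SOME y. rv v y = rv v (c * x))"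
    have y: "rv v y = rv v (c * x)" unfolding y_def by (rule someI[of _ "c * x"]) simp
    hence "rv v (c * (y / c)) = rv v (c * x)" using c by simp
    hence e: "A = h (rv v (c * x))"
      unfolding h_def y_def[symmetric] x(3) using rv_mult_left[OF c(1)] by metis
    have "c * x \<in> {x. x \<noteq> 0 \<and> v x = \<gamma>}" using c x by (simp add: v_mult)
    hence "rv v (c * x) \<in> rv v ` {x. x \<noteq> 0 \<and> v x = \<gamma>}" by (rule imageI)
    with e show "A \<in> h ` rv v ` {x. x \<noteq> 0 \<and> v x = \<gamma>}" by (rule image_eqI)
  qed
  from infinite_units finite_subset[OF this finite_imageI[OF fin]] show False by (rule notE)
qed

lemma rv_eq_v: "rv v x = rv v y \<Longrightarrow> v x = v y"
proof -
  assume "rv v x = rv v y"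
  show ?thesis
  proof (cases "x = 0")
    case True
    thus ?thesis using rv_eq_0[OF \<open>rv v x = rv v y\<close>] by simp
  next
    case False
    thus ?thesis
      using rv_val_rv[OF val, of x] rv_val_rv[OF val, of y] rv_eq_0[OF \<open>rv v x = rv v y\<close>]
        \<open>rv v x = rv v y\<close> by simp
  qed
qed

section \<open>The order of the value group\<close>

lemma half_exists: "\<exists>\<delta>::'g. \<delta> + \<delta> = \<gamma>"
proof -
  obtain x where x: "x \<noteq> 0" "v x = \<gamma>" using v_surj by blast
  obtain y where "y ^ 2 = x" using nth_root_exists[of 2 x] by auto
  hence "x = y * y" by (simp add: power2_eq_square)
  thus ?thesis using x v_mult[of y y] by auto
qed

lemma Gamma_dense: "a < b \<Longrightarrow> \<exists>c::'g. a < c \<and> c < b"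
proof -
  assume ab: "a < b"
  obtain d where d: "d + d = b - a" using half_exists by blast
  have "0 < d" using ab d by (metis diff_gt_0_iff_gt less_add_same_cancel2 linorder_neqE_linordered_idom add_neg_neg add_0 not_less_iff_gr_or_eq)
  moreover have b: "b = a + d + d" using d by (simp add: algebra_simps)
  ultimately have "a < a + d" "a + d < b" unfolding b by (simp_all only: less_add_same_cancel1)
  thus ?thesis by blast
qed

lemma Gamma_pos: "\<exists>c::'g. 0 < c"
proof -
  obtain x where "x \<noteq> 0" "v x \<noteq> 0" using expands unfolding expands_ACVF_def by blast
  thus ?thesis by (metis neg_0_less_iff_less linorder_neqE)
qed

lemma Gamma_gt: "\<exists>c::'g. a < c"
  using Gamma_pos by (metis less_add_same_cancel1)

lemma Gamma_lt: "\<exists>c::'g. c < a"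
  using Gamma_pos by (metis diff_less_eq less_add_same_cancel1)

lemma gap_right: "finite F \<Longrightarrow> \<exists>q::'g>x. {x<..<q} \<inter> F = {}"
proof (induction F rule: finite_induct)
  case empty
  thus ?case using Gamma_gt by auto
next
  case (insert f F)
  then obtain q where "q > x" "{x<..<q} \<inter> F = {}" by blast
  thus ?case by (cases "x < f") (auto intro!: exI[of _ "if x < f then min q f else q"])
qed

lemma gap_left: "finite F \<Longrightarrow> \<exists>q::'g<x. {q<..<x} \<inter> F = {}"
proof (induction F rule: finite_induct)
  case empty
  thus ?case using Gamma_lt by auto
next
  case (insert f F)
  then obtain q where "q < x" "{q<..<x} \<inter> F = {}" by blast
  thus ?case by (cases "f < x") (auto intro!: exI[of _ "if f < x then max q f else q"])
qed

lemma gap: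
  assumes "finite F" "x \<notin> F"
  shows "\<exists>p q::'g. p < x \<and> x < q \<and> {p<..<q} \<inter> F = {}"
proof -
  obtain p q where "p < x" "{p<..<x} \<inter> F = {}" "x < q" "{x<..<q} \<inter> F = {}"
    using gap_left[OF assms(1)] gap_right[OF assms(1)] by metis
  moreover have "{p<..<q} \<subseteq> {p<..<x} \<union> {x} \<union> {x<..<q}" by auto
  ultimately show ?thesis using assms(2) by blast
qed

lemma infinite_interval: "a < b \<Longrightarrow> infinite {a<..<b::'g}"
proof
  assume ab: "a < b" and fin: "finite {a<..<b}"
  obtain q where "q > a" "{a<..<q} \<inter> {a<..<b} = {}" using gap_right[OF fin] by blast
  moreover obtain c where "a < c" "c < min q b" using Gamma_dense[of a "min q b"] ab \<open>q > a\<close> by auto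
  ultimately show False by auto
qed

text \<open>An infinite \<open>X\<close> has a point outside the exceptional set and is constant on
  a gap around it. Conversely, intervals are infinite as the order is dense.\<close>

lemma tame_infinite_iff:
  fixes X :: "'g \<Rightarrow> bool"
  assumes "tame X"
  shows "infinite (Collect X) \<longleftrightarrow> (\<exists>p q. p < q \<and> (\<forall>x. p < x \<and> x < q \<longrightarrow> X x))"
proof
  assume inf: "infinite (Collect X)"
  from assms obtain F where F: "finite F" "\<And>x y. x \<le> y \<Longrightarrow> {x..y} \<inter> F = {} \<Longrightarrow> X x \<longleftrightarrow> X y"
    by (rule tameE) blast
  obtain x where x: "X x" "x \<notin> F" using inf F(1) by (metis finite_subset mem_Collect_eq subsetI)
  obtain p q where pq: "p < x" "x < q" "{p<..<q} \<inter> F = {}" using gap[OF F(1) x(2)] by blast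
  have "X y" if "p < y \<and> y < q" for y
  proof (cases "x \<le> y")
    case True
    have "{x..y} \<subseteq> {p<..<q}" using pq that by auto
    thus ?thesis using F(2)[OF True] pq(3) x by blast
  next
    case False
    have "{y..x} \<subseteq> {p<..<q}" using pq that by auto
    hence "{y..x} \<inter> F = {}" using pq(3) by blast
    thus ?thesis using F(2)[of y x] x False by simp
  qed
  thus "\<exists>p q. p < q \<and> (\<forall>x. p < x \<and> x < q \<longrightarrow> X x)" using pq by (meson less_trans)
next
  assume "\<exists>p q. p < q \<and> (\<forall>x. p < x \<and> x < q \<longrightarrow> X x)"
  then obtain p q where pq: "p < q" "\<forall>x. p < x \<and> x < q \<longrightarrow> X x" by blast
  hence "{p<..<q} \<subseteq> Collect X" by auto
  thus "infinite (Collect X)" using infinite_interval[OF pq(1)] infinite_super by blast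
qed

text \<open>Definable connectedness of convex sets. The induction is on the number of exceptional
  points between \<open>x\<close> and \<open>y\<close>: at such a point \<open>f\<close>, local
  constancy passes from \<open>f\<close> to a nearby \<open>c\<close>, and the interval left over no
  longer contains \<open>f\<close>.\<close>

lemma tame_connected:
  fixes X :: "'g \<Rightarrow> bool"
  assumes "tame X" and conv: "\<And>x y z. x \<in> I \<Longrightarrow> y \<in> I \<Longrightarrow> x \<le> z \<Longrightarrow> z \<le> y \<Longrightarrow> z \<in> I"
    and loc: "\<And>x. x \<in> I \<Longrightarrow> \<exists>p q. p < x \<and> x < q \<and> (\<forall>y\<in>I. p < y \<and> y < q \<longrightarrow> (X y \<longleftrightarrow> X x))"
    and "x \<in> I" "y \<in> I"
  shows "X x \<longleftrightarrow> X y"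
proof -
  from assms(1) obtain F where F: "finite F" "\<And>x y. x \<le> y \<Longrightarrow> {x..y} \<inter> F = {} \<Longrightarrow> X x \<longleftrightarrow> X y"
    by (rule tameE) blast
  have *: "X x \<longleftrightarrow> X y" if "x \<le> y" "x \<in> I" "y \<in> I" for x y
    using that
  proof (induction "card ({x..y} \<inter> F)" arbitrary: x y rule: less_induct)
    case less
    show ?case
    proof (cases "{x..y} \<inter> F = {}")
      case True
      thus ?thesis using F(2) less.prems by blast
    next
      case False
      then obtain f where f: "x \<le> f" "f \<le> y" "f \<in> F" by auto
      have "f \<in> I" using conv less.prems f by blast
      then obtain p q where pq: "p < f" "f < q" "\<And>y. y \<in> I \<Longrightarrow> p < y \<Longrightarrow> y < q \<Longrightarrow> X y \<longleftrightarrow> X f"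
        using loc by blast
      have less_card: "card ({a..b} \<inter> F) < card ({x..y} \<inter> F)" if "x \<le> a" "b \<le> y" "f \<notin> {a..b}" for a b
        using that f F(1) by (intro psubset_card_mono) auto
      have "X x \<longleftrightarrow> X f"
      proof (cases "x = f")
        case False
        hence "max p x < f" using f pq by simp
        then obtain c where c: "max p x < c" "c < f" using Gamma_dense by blast
        hence "c \<in> I" using conv[of x y c] less.prems f by auto
        moreover have "X x \<longleftrightarrow> X c"
          using c f less.prems \<open>c \<in> I\<close> by (intro less.hyps less_card) auto
        ultimately show ?thesis using pq(3)[of c] pq(2) c by auto
      qed simp
      moreover have "X f \<longleftrightarrow> X y"
      proof (cases "f = y")
        case False
        hence "f < min q y" using f pq by simp
        then obtain c where c: "f < c" "c < min q y" using Gamma_dense by blast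
        hence "c \<in> I" using conv[of x y c] less.prems f by auto
        moreover have "X c \<longleftrightarrow> X y"
          using c f less.prems \<open>c \<in> I\<close> by (intro less.hyps less_card) auto
        ultimately show ?thesis using pq(3)[of c] pq(1) c by auto
      qed simp
      ultimately show ?thesis by simp
    qed
  qed
  show ?thesis
  proof (cases "x \<le> y")
    case True
    thus ?thesis using * assms(4,5) by blast
  next
    case False
    hence "y \<le> x" by simp
    thus ?thesis using *[of y x] assms(4,5) by blast
  qed
qed

section \<open>Uniform bounds and definable functions on the value group\<close>

lemma defpred_atl:
  assumes f: "defpred (\<lambda>e. f (e 0) = f (e 1))"
    and Q: "defpred (\<lambda>e. Q (\<lambda>i. e (Suc i)) (e 0))"
  shows "defpred (\<lambda>e. atl f n (Q e))"
  using Q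
proof (induction n arbitrary: Q)
  case 0
  thus ?case by (simp add: defpred_const)
next
  case (Suc n)
  have "defpred (\<lambda>e. Q (\<lambda>i. e (Suc (Suc i))) (e 0))"
    using defpred_rename[OF Suc.prems, of "case_nat 0 (\<lambda>i. Suc (Suc i))"] by simp
  hence "defpred (\<lambda>e. Q (\<lambda>i. e (Suc (Suc i))) (e 0) \<and> f (e 0) \<noteq> f (e (Suc 0)))"
    using f by (intro defpred_conj defpred_not) simp_all
  hence "defpred (\<lambda>e. atl f n (\<lambda>z. Q (\<lambda>i. e (Suc i)) z \<and> f z \<noteq> f (e 0)))"
    by (rule Suc.IH)
  hence "defpred (\<lambda>e. \<exists>y. Q e y \<and> atl f n (\<lambda>z. Q e z \<and> f z \<noteq> f y))"
    by (intro defpred_ex defpred_conj Suc.prems)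
  thus ?case by simp
qed

text \<open>If there were no bound, saturation would provide a single \<open>x\<close> with at least
  \<open>n\<close> values for every \<open>n\<close>.\<close>

lemma uniform_finite:
  assumes f: "defpred (\<lambda>e. f (e 0) = f (e 1))" and C: "defpred (\<lambda>e. C (e 0) (e 1))"
    and fin: "\<And>x. finite (f ` Collect (C x))"
  shows "\<exists>N. \<forall>x. card (f ` Collect (C x)) \<le> N"
proof (rule ccontr)
  assume "\<not> ?thesis"
  hence ex: "\<exists>x. n \<le> card (f ` Collect (C x))" for n by (metis linear)
  have "\<exists>x. \<forall>n. atl f n (C x)"
  proof (rule countable_saturation)
    fix n
    have "defpred (\<lambda>e. C (e (Suc 0)) (e 0))" using defpred_rename[OF C, of "\<lambda>i. 1 - i"] by simp
    thus "defpred (\<lambda>e. atl f n (C (e 0)))" by (intro defpred_atl[OF f])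
    show "\<exists>x. \<forall>i\<le>n. atl f i (C x)"
      using ex[of n] by (metis atl_finite[OF fin] order_trans)
  qed
  then obtain x where "\<And>n. atl f n (C x)" by blast
  hence "atl f (Suc (card (f ` Collect (C x)))) (C x)" by blast
  thus False unfolding atl_finite[OF fin] by simp
qed

lemma v_image_Collect: "v ` {y. P (v y)} = Collect P"
proof (intro equalityI subsetI)
  fix x assume x: "x \<in> Collect P"
  obtain y where "v y = x" using v_surj by blast
  thus "x \<in> v ` {y. P (v y)}" using x by (intro image_eqI[of _ v y]) auto
qed auto

lemma uniform_finite_Gamma:
  assumes R: "defpred (\<lambda>e. R (v (e 0)) (v (e 1)))" and fin: "\<And>x. finite (Collect (R x))"
  shows "\<exists>N. \<forall>x. card (Collect (R x)) \<le> N"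
proof -
  have "\<exists>N. \<forall>x. card (v ` Collect (\<lambda>y. R (v x) (v y))) \<le> N"
  proof (rule uniform_finite[of v "\<lambda>x y. R (v x) (v y)"])
    show "defpred (\<lambda>e. v (e 0) = v (e 1))" by (intro def_intros)
  qed (use R fin v_image_Collect in simp_all)
  then obtain N where "\<And>x. card (Collect (R (v x))) \<le> N" using v_image_Collect by auto
  thus ?thesis using v_surj by metis
qed

text \<open>The least element of a finite fibre is definable from the order. It gives one branch,
  and removing it lowers the bound by one.\<close>

lemma definable_branches:
  assumes "defpred (\<lambda>e. R (v (e 0)) (v (e 1)))" "\<And>x. finite (Collect (R x))"
    "\<And>x. card (Collect (R x)) \<le> N"
  shows "\<exists>fs Xs. (\<forall>i<N. defpred (\<lambda>e. v (e 0) = fs i (v (e 1))) \<and> defpred (\<lambda>e. Xs i (v (e 0)))) \<and>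
    (\<forall>x y. R x y \<longleftrightarrow> (\<exists>i<N. Xs i x \<and> y = fs i x))"
  using assms
proof (induction N arbitrary: R)
  case 0
  hence "\<not> R x y" for x y by (metis bot_nat_0.extremum_uniqueI card_0_eq empty_iff mem_Collect_eq)
  thus ?case by simp
next
  case (Suc N)
  note R = defpred_vv[OF Suc.prems(1)]
  define X where "X x \<longleftrightarrow> (\<exists>y. R x y)" for x
  \<comment> \<open>The value 0 off the domain \<open>X\<close> is only a default that keeps the
    function total.\<close>
  define f where "f x = (if X x then Min (Collect (R x)) else 0)" for x
  have fX: "R x (f x)" if "X x" for x
    using Min_in[OF Suc.prems(2)[of x]] that by (auto simp: f_def X_def)
  have fle: "f x \<le> y" if "R x y" for x y
    using Min_le[OF Suc.prems(2)[of x], of y] that by (auto simp: f_def X_def)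
  have f_iff: "y = f x \<longleftrightarrow> (X x \<and> R x y \<and> (\<forall>z. R x z \<longrightarrow> y \<le> z)) \<or> (\<not> X x \<and> y = 0)" for x y
  proof (cases "X x")
    case True
    thus ?thesis using fX[OF True] fle[of x] by (auto intro: antisym)
  qed (simp add: f_def)
  have Xd: "defpred (\<lambda>e. X (v (e 0)))" unfolding X_def by (intro R def_intros)
  have fd: "defpred (\<lambda>e. v (e 0) = f (v (e 1)))"
    unfolding f_iff by (intro R defpred_v1[OF Xd] def_intros)
  define R' where "R' x y \<longleftrightarrow> R x y \<and> y \<noteq> f x" for x y
  have R'd: "defpred (\<lambda>e. R' (v (e 0)) (v (e 1)))"
    unfolding R'_def by (intro R defpred_vv[of "\<lambda>a b. a = f b", OF fd] def_intros)
  have R'f: "finite (Collect (R' x))" for x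
    using Suc.prems(2)[of x] by (rule finite_subset[rotated]) (auto simp: R'_def)
  have "card (Collect (R' x)) \<le> N" for x
  proof (cases "X x")
    case True
    have "Collect (R' x) = Collect (R x) - {f x}" by (auto simp: R'_def)
    thus ?thesis using fX[OF True] Suc.prems(2,3)[of x] by simp
  next
    case False
    hence "Collect (R' x) = {}" by (auto simp: R'_def X_def)
    thus ?thesis by (simp only: card.empty le0)
  qed
  from Suc.IH[OF R'd R'f this] obtain fs Xs where
    IH: "\<forall>i<N. defpred (\<lambda>e. v (e 0) = fs i (v (e 1))) \<and> defpred (\<lambda>e. Xs i (v (e 0)))"
      "\<And>x y. R' x y \<longleftrightarrow> (\<exists>i<N. Xs i x \<and> y = fs i x)" by auto
  define fs' where "fs' i = (if i = N then f else fs i)" for i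
  define Xs' where "Xs' i = (if i = N then X else Xs i)" for i
  have "R x y \<longleftrightarrow> (X x \<and> y = f x) \<or> R' x y" for x y
    using fX by (auto simp: R'_def X_def)
  hence "R x y \<longleftrightarrow> (\<exists>i<Suc N. Xs' i x \<and> y = fs' i x)" for x y
  proof -
    have "(\<exists>i<Suc N. Q i) \<longleftrightarrow> Q N \<or> (\<exists>i<N. Q i)" for Q by (auto simp: less_Suc_eq)
    moreover have "(\<exists>i<N. Xs' i x \<and> y = fs' i x) \<longleftrightarrow> (\<exists>i<N. Xs i x \<and> y = fs i x)"
      by (auto simp: fs'_def Xs'_def)
    ultimately show ?thesis using \<open>\<And>x y. R x y \<longleftrightarrow> (X x \<and> y = f x) \<or> R' x y\<close> IH(2) by (simp add: fs'_def Xs'_def)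
  qed
  moreover have "defpred (\<lambda>e. v (e 0) = fs' i (v (e 1))) \<and> defpred (\<lambda>e. Xs' i (v (e 0)))" if "i < Suc N" for i
    using IH(1) fd Xd that by (cases "i = N") (simp_all add: fs'_def Xs'_def)
  ultimately show ?case by blast
qed

text \<open>
  The locus where \<open>g\<close> is locally constant has finitely many components, and every infinite fibre
  contains a germ of one of them.
\<close>

lemma finite_infinite_fibers:
  assumes g: "defpred (\<lambda>e. v (e 0) = g (v (e 1)))" and X: "defpred (\<lambda>e. X (v (e 0)))"
  shows "finite {x. infinite {y. X y \<and> g y = x}}"
proof -
  note gd = defpred_vv[of "\<lambda>a b. a = g b", OF g] and Xd = defpred_v1[OF X]
  define C where "C y \<longleftrightarrow> (\<exists>p q x. p < y \<and> y < q \<and> (\<forall>z. p < z \<and> z < q \<longrightarrow> X z \<and> x = g z))" for y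
  have "tame C" unfolding C_def by (intro definable_tame gd Xd def_intros)
  then obtain F where F: "finite F" "\<And>x y. x \<le> y \<Longrightarrow> {x..y} \<inter> F = {} \<Longrightarrow> C x \<longleftrightarrow> C y"
    by (rule tameE) blast
  have const: "g y = g y'" if "C y" "y \<le> y'" "{y..y'} \<inter> F = {}" for y y'
  proof -
    have 1: "tame (\<lambda>z. g y = g z)" by (intro definable_tame gd def_intros)
    have 2: "\<exists>p q. p < z \<and> z < q \<and> (\<forall>w\<in>{y..y'}. p < w \<and> w < q \<longrightarrow> (g y = g w \<longleftrightarrow> g y = g z))"
      if "z \<in> {y..y'}" for z
    proof -
      have "{y..z} \<subseteq> {y..y'}" using that by auto
      hence "{y..z} \<inter> F = {}" using \<open>{y..y'} \<inter> F = {}\<close> by blast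
      hence "C z" using F(2)[of y z] \<open>C y\<close> that by simp
      then obtain p q x where pq: "p < z" "z < q" and x: "\<And>w. p < w \<and> w < q \<Longrightarrow> X w \<and> x = g w"
        unfolding C_def by blast
      have "(g y = g w) \<longleftrightarrow> (g y = g z)" if "p < w \<and> w < q" for w
      proof -
        have "g w = g z" using x[OF that] x[of z] pq by simp
        thus ?thesis by (rule arg_cong)
      qed
      thus ?thesis using pq by blast
    qed
    have "(g y = g y) \<longleftrightarrow> (g y = g y')"
      by (rule tame_connected[OF 1 _ 2]) (use that in auto)
    thus ?thesis by simp
  qed
  have "\<exists>y. y \<notin> F \<and> C y \<and> g y = x" if "infinite {y. X y \<and> g y = x}" for x
  proof -
    have t: "tame (\<lambda>y. X y \<and> x = g y)" by (intro definable_tame gd Xd def_intros)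
    have "infinite (Collect (\<lambda>y. X y \<and> x = g y))"
      using that unfolding eq_commute[of x] .
    from tame_infinite_iff[OF t, THEN iffD1, OF this]
    obtain p q where pq: "p < q" "\<And>y. p < y \<and> y < q \<Longrightarrow> X y \<and> x = g y" by blast
    obtain y where "y \<in> {p<..<q}" "y \<notin> F" using infinite_interval[OF pq(1)] F(1)
      by (meson finite_subset subsetI)
    moreover from this have "C y" unfolding C_def using pq(2)
      by - (rule exI[of _ p], rule exI[of _ q], rule exI[of _ x], simp)
    ultimately show ?thesis using pq(2)[of y] by (intro exI[of _ y]) simp
  qed
  then obtain h where h: "\<And>x. infinite {y. X y \<and> g y = x} \<Longrightarrow> h x \<notin> F \<and> C (h x) \<and> g (h x) = x" by metis
  have eq: "x = x'" if "infinite {y. X y \<and> g y = x}" "infinite {y. X y \<and> g y = x'}"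
    "{f\<in>F. f < h x} = {f\<in>F. f < h x'}" "h x \<le> h x'" for x x'
  proof -
    have "f \<notin> F" if "h x \<le> f" "f \<le> h x'" for f
    proof
      assume "f \<in> F"
      hence "f < h x'" using that h[of x'] \<open>infinite {y. X y \<and> g y = x'}\<close> by (metis le_neq_trans)
      hence "f \<in> {f\<in>F. f < h x}" using \<open>f \<in> F\<close> \<open>{f\<in>F. f < h x} = {f\<in>F. f < h x'}\<close> by simp
      thus False using that by auto
    qed
    hence "{h x..h x'} \<inter> F = {}" by auto
    hence "g (h x) = g (h x')" using const h that by blast
    thus ?thesis using h that by metis
  qed
  \<comment> \<open>The set of exceptional points below \<open>h x\<close> identifies the component
    that contains \<open>h x\<close>, so there are at most as many infinite fibres as subsets of
    \<open>F\<close>.\<close>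
  have "inj_on (\<lambda>x. {f\<in>F. f < h x}) {x. infinite {y. X y \<and> g y = x}}"
  proof (rule inj_onI)
    fix x x' assume a: "x \<in> {x. infinite {y. X y \<and> g y = x}}" "x' \<in> {x. infinite {y. X y \<and> g y = x}}"
      "{f\<in>F. f < h x} = {f\<in>F. f < h x'}"
    show "x = x'"
    proof (cases "h x \<le> h x'")
      case True
      thus ?thesis using eq[of x x'] a by simp
    next
      case False
      hence "x' = x" using eq[of x' x] a by simp
      thus ?thesis ..
    qed
  qed
  moreover have "finite ((\<lambda>x. {f\<in>F. f < h x}) ` {x. infinite {y. X y \<and> g y = x}})"
    by (rule finite_subset[of _ "Pow F"]) (use F(1) in auto)
  ultimately show ?thesis using finite_imageD by blast
qed

section \<open>Orthogonality of leading terms and values\<close>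

lemma increasing_sequence:
  assumes "p < (q::'g)" shows "\<exists>c::nat \<Rightarrow> 'g. \<forall>n. (p < c n \<and> c n < q) \<and> c n < c (Suc n)"
proof -
  have "\<exists>x. p < x \<and> x < q" using Gamma_dense assms by blast
  moreover have "\<exists>y. (p < y \<and> y < q) \<and> x < y" if "p < x \<and> x < q" for x and n :: nat
  proof -
    obtain y where "x < y" "y < q" using Gamma_dense \<open>p < x \<and> x < q\<close> by blast
    thus ?thesis using that by (intro exI[of _ y]) auto
  qed
  ultimately show ?thesis
    by (rule dependent_nat_choice[of "\<lambda>_ x. p < x \<and> x < q" "\<lambda>_ x y. x < y"])
qed

text \<open>If the union were infinite, it would contain an interval and hence countably many
  disjoint intervals. Finitely many classes cannot cover one of these, so infinitely many classes
  meet it, and then all but finitely many by C-minimality. Saturation now yields one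
  \<open>w\<close> meeting all the intervals, contrary to the finiteness of
  \<open>B w\<close>.\<close>

lemma orthogonal:
  assumes B: "defpred (\<lambda>e. B (e 0) (v (e 1)))"
    and inv: "\<And>w w'. rv v w = rv v w' \<Longrightarrow> B w = B w'"
    and fin: "\<And>w. w \<noteq> 0 \<Longrightarrow> v w = \<gamma>0 \<Longrightarrow> finite (Collect (B w))"
  shows "finite {\<gamma>. \<exists>w. w \<noteq> 0 \<and> v w = \<gamma>0 \<and> B w \<gamma>}"
proof (rule ccontr)
  note Bd = defpred_mv[OF B]
  define A where "A \<gamma> \<longleftrightarrow> (\<exists>w. w \<noteq> 0 \<and> v w = \<gamma>0 \<and> B w \<gamma>)" for \<gamma>
  have "tame A" unfolding A_def by (intro definable_tame Bd def_intros)
  moreover assume "infinite {\<gamma>. \<exists>w. w \<noteq> 0 \<and> v w = \<gamma>0 \<and> B w \<gamma>}"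
  ultimately obtain p q where pq: "p < q" "\<And>x. p < x \<and> x < q \<Longrightarrow> A x"
    using tame_infinite_iff[of A] unfolding A_def by metis
  obtain c where c: "\<And>n. p < c n" "\<And>n. c n < q" "\<And>n::nat. c n < c (Suc n)"
    using increasing_sequence[OF pq(1)] by metis
  define P where "P n w \<longleftrightarrow> w \<noteq> 0 \<and> v w = \<gamma>0 \<and> (\<exists>\<gamma>. c n < \<gamma> \<and> \<gamma> < c (Suc n) \<and> B w \<gamma>)" for n w
  have Pd: "defpred (\<lambda>e. P n (e 0))" for n unfolding P_def by (intro Bd def_intros)
  have Pinf: "infinite (rv v ` Collect (P n))" for n
  proof
    assume "finite (rv v ` Collect (P n))"
    then obtain W where W: "W \<subseteq> Collect (P n)" "finite W" "rv v ` Collect (P n) = rv v ` W"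
      using finite_subset_image[OF _ order_refl] by meson
    have "{c n<..<c (Suc n)} \<subseteq> (\<Union>w\<in>W. Collect (B w))"
    proof
      fix \<gamma> assume g: "\<gamma> \<in> {c n<..<c (Suc n)}"
      hence "A \<gamma>" using pq(2) c by (meson greaterThanLessThan_iff less_trans)
      then obtain w where "w \<noteq> 0" "v w = \<gamma>0" "B w \<gamma>" unfolding A_def by blast
      moreover from this have "P n w" unfolding P_def using g by auto
      then obtain w' where w': "w' \<in> W" "rv v w = rv v w'" using W(3) by blast
      ultimately have "B w' \<gamma>" using inv[OF w'(2)] by simp
      with w'(1) show "\<gamma> \<in> (\<Union>w\<in>W. Collect (B w))" by blast
    qed
    moreover have "finite (\<Union>w\<in>W. Collect (B w))" using W fin unfolding P_def by blast
    ultimately show False using infinite_interval[OF c(3)] finite_subset by blast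
  qed
  have "\<exists>F. finite F \<and> (\<forall>w. w \<noteq> 0 \<longrightarrow> v w = \<gamma>0 \<longrightarrow> rv v w \<notin> F \<longrightarrow> P n w)" for n
  proof -
    obtain F where F: "finite F" "\<forall>x y. x \<noteq> 0 \<longrightarrow> y \<noteq> 0 \<longrightarrow> v x = v y \<longrightarrow> rv v x \<notin> F \<longrightarrow> rv v y \<notin> F \<longrightarrow> (P n x \<longleftrightarrow> P n y)"
      using definable_rv_constant[OF Pd[of n]] by (elim exE conjE)
    obtain x where x: "P n x" "rv v x \<notin> F"
      using Pinf[of n] F(1) by (metis (no_types, lifting) finite_subset image_subsetI mem_Collect_eq)
    have "P n w" if "w \<noteq> 0" "v w = \<gamma>0" "rv v w \<notin> F" for w
      using F(2)[rule_format, of x w] x that by (auto simp: P_def)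
    thus ?thesis using F(1) by blast
  qed
  then obtain F where F: "\<And>n. finite (F n)" "\<And>n w. w \<noteq> 0 \<Longrightarrow> v w = \<gamma>0 \<Longrightarrow> rv v w \<notin> F n \<Longrightarrow> P n w" by metis
  have "\<exists>w. \<forall>n. P n w"
  proof (rule countable_saturation[OF Pd])
    fix n
    have "finite (\<Union>i\<le>n. F i)" using F(1) by blast
    hence "\<not> rv v ` {x. x \<noteq> 0 \<and> v x = \<gamma>0} \<subseteq> (\<Union>i\<le>n. F i)"
      using infinite_rv[of \<gamma>0] finite_subset by metis
    then obtain w where "w \<noteq> 0" "v w = \<gamma>0" "rv v w \<notin> (\<Union>i\<le>n. F i)"
      by (auto simp: image_subset_iff)
    thus "\<exists>w. \<forall>i\<le>n. P i w" using F(2) by blast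
  qed
  then obtain w where w: "\<And>n. P n w" by blast
  hence "\<forall>n. \<exists>\<gamma>. c n < \<gamma> \<and> \<gamma> < c (Suc n) \<and> B w \<gamma>" unfolding P_def by blast
  then obtain h where h: "\<And>n. c n < h n" "\<And>n. h n < c (Suc n)" "\<And>n. B w (h n)" by metis
  have "strict_mono h" using h by (intro strict_mono_Suc_iff[THEN iffD2]) (meson less_trans)
  hence "infinite (range h)" using strict_mono_imp_inj_on range_inj_infinite by blast
  moreover have "range h \<subseteq> Collect (B w)" using h by blast
  ultimately show False using fin[of w] w unfolding P_def using finite_subset by blast
qed

text \<open>Orthogonality is applied to \<open>z\<close> with \<open>w\<close> fixed; this supplies
  the finiteness needed to apply it to \<open>w\<close>.\<close>

lemma orthogonal2:
  assumes B: "defpred (\<lambda>e. B (e 0) (e 1) (v (e 2)))"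
    and inv: "\<And>w w' z z'. rv v w = rv v w' \<Longrightarrow> rv v z = rv v z' \<Longrightarrow> B w z = B w' z'"
    and fin: "\<And>w z. w \<noteq> 0 \<Longrightarrow> v w = a \<Longrightarrow> z \<noteq> 0 \<Longrightarrow> v z = b \<Longrightarrow> finite (Collect (B w z))"
  shows "finite {\<gamma>. \<exists>w z. w \<noteq> 0 \<and> v w = a \<and> z \<noteq> 0 \<and> v z = b \<and> B w z \<gamma>}"
proof -
  note Bd = defpred_mmv[OF B]
  have "finite {\<gamma>. \<exists>w. w \<noteq> 0 \<and> v w = a \<and> (\<exists>z. z \<noteq> 0 \<and> v z = b \<and> B w z \<gamma>)}"
  proof (rule orthogonal)
    show "defpred (\<lambda>e. \<exists>z. z \<noteq> 0 \<and> v z = b \<and> B (e 0) z (v (e 1)))" by (intro Bd def_intros)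
    show "(\<lambda>\<gamma>. \<exists>z. z \<noteq> 0 \<and> v z = b \<and> B w z \<gamma>) = (\<lambda>\<gamma>. \<exists>z. z \<noteq> 0 \<and> v z = b \<and> B w' z \<gamma>)"
      if "rv v w = rv v w'" for w w'
      using inv[OF that refl] by simp
    show "finite (Collect (\<lambda>\<gamma>. \<exists>z. z \<noteq> 0 \<and> v z = b \<and> B w z \<gamma>))" if "w \<noteq> 0" "v w = a" for w
    proof (rule orthogonal)
      show "defpred (\<lambda>e. B w (e 0) (v (e 1)))" by (intro Bd def_intros)
      show "B w z = B w z'" if "rv v z = rv v z'" for z z' using inv[OF refl that] .
      show "finite (Collect (B w z))" if "z \<noteq> 0" "v z = b" for z using fin[OF \<open>w \<noteq> 0\<close> \<open>v w = a\<close> that] .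
    qed
  qed
  thus ?thesis by (simp add: conj_assoc)
qed

end

section \<open>Small relations between leading terms\<close>

context C_min_ACVF
begin

section \<open>Strong minimality of the fibres of RV over the value group\<close>

lemma rv_mult_right: "c \<noteq> 0 \<Longrightarrow> rv v (x * c) = rv v (y * c) \<longleftrightarrow> rv v x = rv v y"
  unfolding mult.commute[of _ c] by (rule rv_mult_left)

lemma rv_divide_eq: "c \<noteq> 0 \<Longrightarrow> rv v (x / c) = rv v y \<longleftrightarrow> rv v x = rv v (y * c)"
  using rv_mult_right[of c "x / c" y] by simp

lemma rv_divide_cong: "rv v x = rv v x' \<Longrightarrow> rv v y = rv v y' \<Longrightarrow> rv v (x / y) = rv v (x' / y')"
proof (cases "y = 0")
  case True
  moreover assume "rv v y = rv v y'"
  ultimately show ?thesis using rv_eq_0[of y y'] by simp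
next
  case False
  assume x: "rv v x = rv v x'" and y: "rv v y = rv v y'"
  have "y' \<noteq> 0" using False rv_eq_0[OF y] by blast
  have "rv v (x' / y' * y) = rv v (x' / y' * y')" using y by (intro rv_mult_cong) auto
  also have "\<dots> = rv v x" using x \<open>y' \<noteq> 0\<close> by simp
  finally show ?thesis using rv_divide_eq[OF False, of x "x' / y'"] by simp
qed

text \<open>Strong minimality of a fibre: an infinite \<open>S\<close> contains a class outside the
  finitely many exceptional ones, hence all such classes.\<close>

lemma cofinite_rv:
  assumes S: "defpred (\<lambda>e. S (e 0))" and S0: "\<And>x. S x \<Longrightarrow> x \<noteq> 0 \<and> v x = b"
    and inf: "infinite (rv v ` Collect S)"
  shows "\<exists>F. finite F \<and> (\<forall>x. x \<noteq> 0 \<longrightarrow> v x = b \<longrightarrow> rv v x \<notin> F \<longrightarrow> S x)"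
proof -
  obtain F where F: "finite F" "\<forall>x y. x \<noteq> 0 \<longrightarrow> y \<noteq> 0 \<longrightarrow> v x = v y \<longrightarrow> rv v x \<notin> F \<longrightarrow> rv v y \<notin> F \<longrightarrow> (S x \<longleftrightarrow> S y)"
    using definable_rv_constant[OF S] by (elim exE conjE)
  have "\<not> rv v ` Collect S \<subseteq> F" using inf F(1) finite_subset by metis
  then obtain x where x: "S x" "rv v x \<notin> F" by auto
  have "S w" if "w \<noteq> 0" "v w = b" "rv v w \<notin> F" for w
    using F(2)[rule_format, of x w] x that S0[OF x(1)] by simp
  thus ?thesis using F(1) by blast
qed

lemma avoid_rv:
  assumes "finite F" shows "\<exists>x. x \<noteq> 0 \<and> v x = b \<and> rv v x \<notin> F"
proof -
  have "\<not> rv v ` {x. x \<noteq> 0 \<and> v x = b} \<subseteq> F" using infinite_rv[of b] assms finite_subset by metis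
  thus ?thesis by auto
qed

text \<open>The classes to be added are the translates of the exceptional ones by
  \<open>1 / w\<close>. With this, a generic \<open>x\<close> can be chosen such that
  \<open>w * x\<close> is generic too.\<close>

lemma rv_translate_exceptions:
  assumes "finite F" "w \<noteq> 0"
  shows "\<exists>F'. finite F' \<and> (\<forall>x. rv v x \<notin> F' \<longrightarrow> rv v x \<notin> F \<and> rv v (w * x) \<notin> F)"
proof -
  define r where "r A = (SOME x. rv v x = A)" for A
  have r: "rv v (r (rv v x)) = rv v x" for x unfolding r_def by (rule someI[of _ x]) simp
  define F' where "F' = F \<union> (\<lambda>A. rv v (r A / w)) ` F"
  have "rv v (w * x) \<notin> F" if x: "rv v x \<notin> F'" for x
  proof
    assume "rv v (w * x) \<in> F"
    hence "rv v (r (rv v (w * x)) / w) \<in> F'" by (simp add: F'_def)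
    moreover have "rv v (r (rv v (w * x)) / w) = rv v (w * x / w)" by (intro rv_divide_cong r refl)
    ultimately show False using x assms(2) by simp
  qed
  thus ?thesis using assms by (intro exI[of _ F']) (auto simp: F'_def)
qed

lemma avoid_rv_translate:
  assumes "finite F" "w \<noteq> 0"
  shows "\<exists>x. x \<noteq> 0 \<and> v x = b \<and> rv v x \<notin> F \<and> rv v (w * x) \<notin> F"
proof -
  obtain F' where "finite F'" "\<And>x. rv v x \<notin> F' \<Longrightarrow> rv v x \<notin> F \<and> rv v (w * x) \<notin> F"
    using rv_translate_exceptions[OF assms] by blast
  thus ?thesis using avoid_rv[of F' b] by blast
qed

text \<open>This expresses infinity of a subset of a fibre by a first-order formula.\<close>

lemma infinite_rv_iff:
  assumes S: "defpred (\<lambda>e. S (e 0))" and S0: "\<And>x. S x \<Longrightarrow> x \<noteq> 0 \<and> v x = b"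
  shows "infinite (rv v ` Collect S) \<longleftrightarrow> (\<forall>w. w \<noteq> 0 \<and> v w = 0 \<longrightarrow> (\<exists>x. S x \<and> S (w * x)))"
proof
  assume "infinite (rv v ` Collect S)"
  from cofinite_rv[OF S S0 this] obtain F where
    F: "finite F" "\<And>x. x \<noteq> 0 \<Longrightarrow> v x = b \<Longrightarrow> rv v x \<notin> F \<Longrightarrow> S x" by blast
  show "\<forall>w. w \<noteq> 0 \<and> v w = 0 \<longrightarrow> (\<exists>x. S x \<and> S (w * x))"
  proof (intro allI impI, elim conjE)
    fix w assume w: "w \<noteq> 0" "v w = 0"
    obtain x where "x \<noteq> 0" "v x = b" "rv v x \<notin> F" "rv v (w * x) \<notin> F"
      using avoid_rv_translate[OF F(1) w(1)] by blast
    thus "\<exists>x. S x \<and> S (w * x)" using F(2)[of x] F(2)[of "w * x"] w by (auto simp: v_mult)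
  qed
next
  assume R: "\<forall>w. w \<noteq> 0 \<and> v w = 0 \<longrightarrow> (\<exists>x. S x \<and> S (w * x))"
  show "infinite (rv v ` Collect S)"
  proof
    assume "finite (rv v ` Collect S)"
    then obtain A where A: "A \<subseteq> Collect S" "finite A" "rv v ` Collect S = rv v ` A"
      using finite_subset_image[OF _ order_refl] by meson
    \<comment> \<open>By \<open>R\<close> every unit is a quotient of two elements of
      \<open>S\<close>, so finitely many classes in \<open>S\<close> would leave only finitely many
      classes of units.\<close>
    have "rv v ` {w. w \<noteq> 0 \<and> v w = 0} \<subseteq> (\<lambda>(x, y). rv v (y / x)) ` (A \<times> A)"
    proof
      fix B assume "B \<in> rv v ` {w. w \<noteq> 0 \<and> v w = 0}"
      then obtain w where w: "B = rv v w" "w \<noteq> 0" "v w = 0" by auto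
      obtain x where x: "S x" "S (w * x)" using R w by blast
      obtain a where a: "a \<in> A" "rv v x = rv v a" using x(1) A(3) by blast
      obtain a' where a': "a' \<in> A" "rv v (w * x) = rv v a'" using x(2) A(3) by blast
      have "rv v (a' / a) = rv v (w * x / x)" using a(2) a'(2) by (intro rv_divide_cong) simp_all
      hence "B = rv v (a' / a)" using w S0[OF x(1)] by simp
      thus "B \<in> (\<lambda>(x, y). rv v (y / x)) ` (A \<times> A)" using a(1) a'(1) by auto
    qed
    thus False using infinite_units A(2) by (meson finite_SigmaI finite_imageI finite_subset)
  qed
qed

end

text \<open>The assumption \<open>T_small\<close> is the form in which the bound on the Morley rank
  is used from here on: over each pair of values, only finitely many columns are infinite.\<close>

locale small_relation = C_min_ACVF L M v \<kappa>
  for L :: "('f, 'r) lang" and M :: "('f, 'r, 'm::alg_closed_field) fo_struct"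
    and v :: "'m \<Rightarrow> 'g::linordered_ab_group_add" and \<kappa> :: "'c rel" +
  fixes T :: "'m \<Rightarrow> 'm \<Rightarrow> bool"
  assumes T_def: "defpred (\<lambda>e. T (e 0) (e 1))"
    and T_nonzero: "T x y \<Longrightarrow> x \<noteq> 0 \<and> y \<noteq> 0"
    and T_inv: "rv v x = rv v x' \<Longrightarrow> rv v y = rv v y' \<Longrightarrow> T x y = T x' y'"
    and T_small: "finite (rv v ` {x. x \<noteq> 0 \<and> v x = a \<and> infinite (rv v ` {y. v y = b \<and> T x y})})"
begin

lemmas Td = defpred_app2[OF T_def]

definition TG :: "'g \<Rightarrow> 'g \<Rightarrow> bool" where
  "TG a b \<longleftrightarrow> (\<exists>x y. T x y \<and> v x = a \<and> v y = b)"

definition full :: "'m \<Rightarrow> 'g \<Rightarrow> bool" where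
  "full x b \<longleftrightarrow> (\<forall>y. y \<noteq> 0 \<and> v y = b \<longrightarrow> T x y)"

lemma TG_def': "defpred (\<lambda>e. TG (v (e 0)) (v (e 1)))"
  unfolding TG_def by (intro Td def_intros)

lemma full_def': "defpred (\<lambda>e. full (e 0) (v (e 1)))"
  unfolding full_def by (intro Td def_intros)

lemma full_inv: "rv v x = rv v x' \<Longrightarrow> full x = full x'"
  unfolding full_def using T_inv by blast

text \<open>For one \<open>x\<close>, the definable set of all \<open>y\<close> with
  \<open>T x y\<close> splits only finitely many fibres of the valuation. Orthogonality makes the
  exceptional values the same for all \<open>x\<close> of value \<open>a\<close>.\<close>

lemma full_or_empty:
  "finite {b. \<exists>x y. x \<noteq> 0 \<and> v x = a \<and> v y = b \<and> T x y \<and> \<not> full x b}"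
proof -
  have "finite {b. \<exists>x. x \<noteq> 0 \<and> v x = a \<and> ((\<exists>y. v y = b \<and> T x y) \<and> \<not> full x b)}"
  proof (rule orthogonal)
    show "defpred (\<lambda>e. (\<exists>y. v y = v (e 1) \<and> T (e 0) y) \<and> \<not> full (e 0) (v (e 1)))"
      by (intro Td defpred_mv[OF full_def'] def_intros)
    fix x x' assume "rv v x = rv v x'"
    show "(\<lambda>b. (\<exists>y. v y = b \<and> T x y) \<and> \<not> full x b) = (\<lambda>b. (\<exists>y. v y = b \<and> T x' y) \<and> \<not> full x' b)"
      unfolding full_inv[OF \<open>rv v x = rv v x'\<close>] T_inv[OF \<open>rv v x = rv v x'\<close> refl] by (rule refl)
  next
    fix x assume "x \<noteq> 0" "v x = a"
    have "defpred (\<lambda>e. T x (e 0))" by (intro Td def_intros)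
    from definable_val_fibers[OF this]
    show "finite (Collect (\<lambda>b. (\<exists>y. v y = b \<and> T x y) \<and> \<not> full x b))"
      by (rule finite_subset[rotated]) (use T_nonzero in \<open>auto simp: full_def\<close>)
  qed
  thus ?thesis by (rule finite_subset[rotated]) blast
qed

text \<open>The same argument with the coordinates exchanged shows that, for all but finitely many
  \<open>a\<close>, each row over \<open>b\<close> contains all or none of the points over
  \<open>a\<close>. One full column over such an \<open>a\<close> would make all columns full,
  contrary to \<open>T_small\<close>.\<close>

lemma full_horizontal_finite: "finite {a. \<exists>x. x \<noteq> 0 \<and> v x = a \<and> full x b}"
proof -
  define E where "E y a \<longleftrightarrow> (\<forall>x. x \<noteq> 0 \<and> v x = a \<longrightarrow> T x y)" for y a
  have Ed: "defpred (\<lambda>e. E (e 0) (v (e 1)))" unfolding E_def by (intro Td def_intros)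
  have fin: "finite {a. \<exists>y. y \<noteq> 0 \<and> v y = b \<and> ((\<exists>x. v x = a \<and> T x y) \<and> \<not> E y a)}"
  proof (rule orthogonal)
    show "defpred (\<lambda>e. (\<exists>x. v x = v (e 1) \<and> T x (e 0)) \<and> \<not> E (e 0) (v (e 1)))"
      by (intro Td defpred_mv[OF Ed] def_intros)
    fix y y' assume "rv v y = rv v y'"
    show "(\<lambda>a. (\<exists>x. v x = a \<and> T x y) \<and> \<not> E y a) = (\<lambda>a. (\<exists>x. v x = a \<and> T x y') \<and> \<not> E y' a)"
      unfolding E_def T_inv[OF refl \<open>rv v y = rv v y'\<close>] by (rule refl)
  next
    fix y assume "y \<noteq> 0" "v y = b"
    have "defpred (\<lambda>e. T (e 0) y)" by (intro Td def_intros)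
    from definable_val_fibers[OF this]
    show "finite (Collect (\<lambda>a. (\<exists>x. v x = a \<and> T x y) \<and> \<not> E y a))"
      by (rule finite_subset[rotated]) (use T_nonzero in \<open>auto simp: E_def\<close>)
  qed
  have "a \<in> {a. \<exists>y. y \<noteq> 0 \<and> v y = b \<and> ((\<exists>x. v x = a \<and> T x y) \<and> \<not> E y a)}"
    if x: "x \<noteq> 0" "v x = a" "full x b" for x a
  proof (rule ccontr)
    assume n: "\<not> ?thesis"
    have "T x' y" if "x' \<noteq> 0" "v x' = a" "y \<noteq> 0" "v y = b" for x' y
    proof -
      have "T x y" using x(3) that by (simp add: full_def)
      hence "E y a" using n that x by blast
      thus ?thesis using that by (simp add: E_def)
    qed
    hence eq: "{y. v y = b \<and> T x' y} = {y. y \<noteq> 0 \<and> v y = b}" if "x' \<noteq> 0" "v x' = a" for x'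
      using that T_nonzero by blast
    have "{x. x \<noteq> 0 \<and> v x = a \<and> infinite (rv v ` {y. v y = b \<and> T x y})} = {x. x \<noteq> 0 \<and> v x = a}"
      using eq infinite_rv[of b] by auto
    thus False using T_small[of a b] infinite_rv[of a] by simp
  qed
  hence "{a. \<exists>x. x \<noteq> 0 \<and> v x = a \<and> full x b} \<subseteq>
    {a. \<exists>y. y \<noteq> 0 \<and> v y = b \<and> ((\<exists>x. v x = a \<and> T x y) \<and> \<not> E y a)}" by blast
  thus ?thesis using fin finite_subset by blast
qed

text \<open>If infinitely many \<open>b\<close> lie over \<open>a\<close>, then infinitely many of
  them come from full columns. By \<open>full_horizontal_finite\<close> the full columns define
  finitely many \<open>a\<close> for each \<open>b\<close>, that is, finitely many functions from
  \<open>b\<close> to \<open>a\<close>, and each of these has only finitely many infinite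
  fibres.\<close>

lemma finite_vertical: "finite {a. infinite {b. TG a b}}"
proof -
  define R where "R b a \<longleftrightarrow> (\<exists>x. x \<noteq> 0 \<and> v x = a \<and> full x b)" for b a
  have Rd: "defpred (\<lambda>e. R (v (e 0)) (v (e 1)))"
    unfolding R_def by (intro defpred_mv[OF full_def'] def_intros)
  have "R b = (\<lambda>a. \<exists>x. x \<noteq> 0 \<and> v x = a \<and> full x b)" for b unfolding R_def ..
  hence Rf: "finite (Collect (R b))" for b using full_horizontal_finite by simp
  obtain N where "\<And>b. card (Collect (R b)) \<le> N" using uniform_finite_Gamma[OF Rd Rf] by blast
  from definable_branches[OF Rd Rf this] obtain fs Xs where
    fs: "\<And>i. i < N \<Longrightarrow> defpred (\<lambda>e. v (e 0) = fs i (v (e 1)))"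
      "\<And>i. i < N \<Longrightarrow> defpred (\<lambda>e. Xs i (v (e 0)))"
      "\<And>b a. R b a \<longleftrightarrow> (\<exists>i<N. Xs i b \<and> a = fs i b)" by blast
  have fin: "finite (\<Union>i\<in>{..<N}. {a. infinite {b. Xs i b \<and> fs i b = a}})"
    by (intro finite_UN_I finite_infinite_fibers fs) auto
  have "{a. infinite {b. TG a b}} \<subseteq> (\<Union>i\<in>{..<N}. {a. infinite {b. Xs i b \<and> fs i b = a}})"
  proof
    fix a assume "a \<in> {a. infinite {b. TG a b}}"
    hence inf: "infinite {b. TG a b}" by simp
    have "{b. TG a b} \<subseteq> {b. R b a} \<union> {b. \<exists>x y. x \<noteq> 0 \<and> v x = a \<and> v y = b \<and> T x y \<and> \<not> full x b}"
      unfolding TG_def R_def using T_nonzero by blast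
    hence "infinite {b. R b a}" using full_or_empty[of a] inf by (meson finite_UnI finite_subset)
    moreover have "{b. R b a} = (\<Union>i\<in>{..<N}. {b. Xs i b \<and> fs i b = a})" using fs(3) by auto
    ultimately show "a \<in> (\<Union>i\<in>{..<N}. {a. infinite {b. Xs i b \<and> fs i b = a}})" by auto
  qed
  thus ?thesis using fin finite_subset by blast
qed

end

section \<open>A branch of the image and its good values\<close>

locale curve = small_relation L M v \<kappa> T
  for L :: "('f, 'r) lang" and M :: "('f, 'r, 'm::alg_closed_field) fo_struct"
    and v :: "'m \<Rightarrow> 'g::linordered_ab_group_add" and \<kappa> :: "'c rel" and T +
  fixes f :: "'g \<Rightarrow> 'g" and X :: "'g \<Rightarrow> bool"
  assumes f_def: "defpred (\<lambda>e. v (e 0) = f (v (e 1)))"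
    and X_def: "defpred (\<lambda>e. X (v (e 0)))"
    and X_TG: "X a \<Longrightarrow> TG a (f a)"
begin

lemmas fd = defval_app[OF f_def]
lemmas Xd = defpred_v1[OF X_def]

definition C :: "'m \<Rightarrow> 'm \<Rightarrow> bool" where
  "C x y \<longleftrightarrow> T x y \<and> X (v x) \<and> v y = f (v x)"

lemma C_def': "defpred (\<lambda>e. C (e 0) (e 1))"
  unfolding C_def by (intro Td Xd fd def_intros)

lemmas Cd = defpred_app2[OF C_def']

lemma C_nonzero: "C x y \<Longrightarrow> x \<noteq> 0 \<and> y \<noteq> 0"
  unfolding C_def using T_nonzero by blast

lemma C_inv: "rv v x = rv v x' \<Longrightarrow> rv v y = rv v y' \<Longrightarrow> C x y = C x' y'"
  unfolding C_def using T_inv[of x x' y y'] rv_eq_v[of x x'] rv_eq_v[of y y'] by simp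

definition Inf :: "'m \<Rightarrow> bool" where
  "Inf x \<longleftrightarrow> infinite (rv v ` Collect (C x))"

lemma Inf_def': "defpred (\<lambda>e. Inf (e 0))"
proof -
  have "Inf x \<longleftrightarrow> (\<forall>w. w \<noteq> 0 \<and> v w = 0 \<longrightarrow> (\<exists>y. C x y \<and> C x (w * y)))" for x
    unfolding Inf_def
  proof (rule infinite_rv_iff)
    show "defpred (\<lambda>e. C x (e 0))" by (intro Cd def_intros)
    show "y \<noteq> 0 \<and> v y = f (v x)" if "C x y" for y using that C_nonzero[OF that] by (simp add: C_def)
  qed
  thus ?thesis by (simp only:) (intro Cd def_intros)
qed

text \<open>By \<open>T_small\<close> some column over \<open>a\<close> is finite. An infinite one
  over the same \<open>a\<close> shows that the definable set \<open>Inf\<close> splits the fibre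
  over \<open>a\<close>.\<close>

lemma finite_Inf: "finite {a. \<exists>x. x \<noteq> 0 \<and> v x = a \<and> Inf x}"
proof -
  have "{a. \<exists>x. x \<noteq> 0 \<and> v x = a \<and> Inf x} \<subseteq>
    {a. \<exists>x y. x \<noteq> 0 \<and> y \<noteq> 0 \<and> v x = a \<and> v y = a \<and> Inf x \<and> \<not> Inf y}"
  proof
    fix a assume "a \<in> {a. \<exists>x. x \<noteq> 0 \<and> v x = a \<and> Inf x}"
    then obtain x where x: "x \<noteq> 0" "v x = a" "Inf x" by blast
    obtain y where y: "y \<noteq> 0" "v y = a"
      "rv v y \<notin> rv v ` {x. x \<noteq> 0 \<and> v x = a \<and> infinite (rv v ` {y. v y = f a \<and> T x y})}"
      using avoid_rv[OF T_small] by blast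
    hence "finite (rv v ` {z. v z = f a \<and> T y z})" by blast
    moreover have "Collect (C y) \<subseteq> {z. v z = f a \<and> T y z}" using y(2) by (auto simp: C_def)
    ultimately have "\<not> Inf y" unfolding Inf_def by (meson finite_subset image_mono)
    thus "a \<in> {a. \<exists>x y. x \<noteq> 0 \<and> y \<noteq> 0 \<and> v x = a \<and> v y = a \<and> Inf x \<and> \<not> Inf y}" using x y by blast
  qed
  thus ?thesis using definable_val_fibers[OF Inf_def'] finite_subset by blast
qed

text \<open>By \<open>X_TG\<close> some column over \<open>a\<close> is nonempty, so an empty one
  means that the domain of \<open>C\<close> splits the fibre over \<open>a\<close>.\<close>

lemma finite_empty: "finite {a. X a \<and> (\<exists>x. x \<noteq> 0 \<and> v x = a \<and> (\<forall>y. \<not> C x y))}"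
proof -
  have "defpred (\<lambda>e. \<exists>y. C (e 0) y)" by (intro Cd def_intros)
  from definable_val_fibers[OF this] show ?thesis
  proof (rule finite_subset[rotated], intro subsetI)
    fix a assume "a \<in> {a. X a \<and> (\<exists>x. x \<noteq> 0 \<and> v x = a \<and> (\<forall>y. \<not> C x y))}"
    then obtain x where x: "X a" "x \<noteq> 0" "v x = a" "\<forall>y. \<not> C x y" by blast
    obtain x' y' where xy: "T x' y'" "v x' = a" "v y' = f a" using X_TG[OF x(1)] unfolding TG_def by blast
    hence "C x' y'" "x' \<noteq> 0" using x T_nonzero unfolding C_def by blast+
    thus "a \<in> {a. \<exists>x y. x \<noteq> 0 \<and> y \<noteq> 0 \<and> v x = a \<and> v y = a \<and> (\<exists>y. C x y) \<and> \<not> (\<exists>z. C y z)}"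
      using x xy by blast
  qed
qed

text \<open>The fibre over \<open>x\<close> of \<open>C\<close> intersected with the translate of
  \<open>C\<close> by the inverse of \<open>(w, z)\<close>.\<close>

definition common :: "'m \<Rightarrow> 'm \<Rightarrow> 'm \<Rightarrow> 'm \<Rightarrow> bool" where
  "common w z x y \<longleftrightarrow> C x y \<and> C (w * x) (z * y)"

text \<open>The cardinalities belong to finite sets because \<open>Inf\<close> fails over a good
  value; for infinite sets \<open>card\<close> would be 0 and carry no information.\<close>

definition good :: "'g \<Rightarrow> bool" where
  "good a \<longleftrightarrow> X a \<and> (\<forall>x. x \<noteq> 0 \<and> v x = a \<longrightarrow> \<not> Inf x \<and> (\<exists>y. C x y)) \<and>
     (\<forall>w z x x'. w \<noteq> 0 \<and> v w = 0 \<and> z \<noteq> 0 \<and> v z = 0 \<and> x \<noteq> 0 \<and> v x = a \<and> x' \<noteq> 0 \<and> v x' = a \<longrightarrow>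
        card (rv v ` Collect (common w z x)) = card (rv v ` Collect (common w z x')))"

lemma common_inv:
  assumes "rv v w = rv v w'" "rv v z = rv v z'"
  shows "common w z = common w' z'"
proof (intro ext)
  fix x y
  show "common w z x y = common w' z' x y" unfolding common_def
    using C_inv[OF rv_mult_cong[OF assms(1) refl, of x] rv_mult_cong[OF assms(2) refl, of y]] by simp
qed

text \<open>A uniform bound \<open>N\<close> on the counts reduces their equality to finitely many
  definable conditions of the form "at least j points". For fixed \<open>(w, z)\<close> each of
  these depends on \<open>x\<close> only over finitely many \<open>a\<close>, and orthogonality
  removes the dependence on \<open>(w, z)\<close>.\<close>

lemma finite_bad: "finite {a. X a \<and> \<not> good a}"
proof -
  define B where "B = {a. \<exists>x. x \<noteq> 0 \<and> v x = a \<and> Inf x} \<union> {a. X a \<and> (\<exists>x. x \<noteq> 0 \<and> v x = a \<and> (\<forall>y. \<not> C x y))}"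
  have "finite B" unfolding B_def using finite_Inf finite_empty by blast
  \<comment> \<open>Emptying the infinite columns makes every column finite, as the uniform bound
    requires.\<close>
  define C' where "C' x y \<longleftrightarrow> C x y \<and> \<not> Inf x" for x y
  have C'd: "defpred (\<lambda>e. C' (e 0) (e 1))" unfolding C'_def
    by (intro Cd defpred_app1[OF Inf_def'] def_intros)
  have "\<exists>N. \<forall>x. card (rv v ` Collect (C' x)) \<le> N"
  proof (rule uniform_finite[OF _ C'd])
    show "defpred (\<lambda>e. rv v (e 0) = rv v (e 1))" by (intro def_intros)
    show "finite (rv v ` Collect (C' x))" for x
    proof (cases "Inf x")
      case True
      hence "Collect (C' x) = {}" by (simp add: C'_def)
      thus ?thesis by (simp only: image_empty finite.emptyI)
    next
      case False
      have "rv v ` Collect (C' x) \<subseteq> rv v ` Collect (C x)" by (auto simp: C'_def)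
      thus ?thesis using False finite_subset unfolding Inf_def by blast
    qed
  qed
  then obtain N where N: "\<And>x. card (rv v ` Collect (C' x)) \<le> N" by blast
  define P where "P j w z x \<longleftrightarrow> atl (rv v) j (common w z x)" for j w z x
  have Pd: "defpred (\<lambda>e. P j (e 0) (e 1) (e 2))" for j
  proof -
    have "defpred (\<lambda>e. C (e 3) (e 0) \<and> C (e 1 * e 3) (e 2 * e 0))" by (intro Cd def_intros)
    hence "defpred (\<lambda>e. common (e (Suc 0)) (e (Suc 1)) (e (Suc 2)) (e 0))"
      by (simp add: common_def eval_nat_numeral)
    moreover have "defpred (\<lambda>e. rv v (e 0) = rv v (e 1))" by (intro def_intros)
    ultimately show ?thesis unfolding P_def
      using defpred_atl[of "rv v" "\<lambda>e. common (e 0) (e 1) (e 2)"] by blast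
  qed
  define Q where "Q j w z a \<longleftrightarrow> (\<exists>x x'. x \<noteq> 0 \<and> x' \<noteq> 0 \<and> v x = a \<and> v x' = a \<and> P j w z x \<and> \<not> P j w z x')" for j w z a
  have Qf: "finite {a. \<exists>w z. w \<noteq> 0 \<and> v w = 0 \<and> z \<noteq> 0 \<and> v z = 0 \<and> Q j w z a}" for j
  proof (rule orthogonal2)
    show "defpred (\<lambda>e. Q j (e 0) (e 1) (v (e 2)))" unfolding Q_def
      by (intro defpred_app3[OF Pd] def_intros)
    show "Q j w z = Q j w' z'" if "rv v w = rv v w'" "rv v z = rv v z'" for w w' z z'
      unfolding Q_def P_def common_inv[OF that] ..
    show "finite (Collect (Q j w z))" for w z
    proof -
      have "defpred (\<lambda>e. P j w z (e 0))" by (intro defpred_app3[OF Pd] def_intros)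
      from definable_val_fibers[OF this] show ?thesis unfolding Q_def .
    qed
  qed
  define B' where "B' = (\<Union>j\<le>Suc N. {a. \<exists>w z. w \<noteq> 0 \<and> v w = 0 \<and> z \<noteq> 0 \<and> v z = 0 \<and> Q j w z a})"
  have "finite B'" unfolding B'_def using Qf by blast
  have "good a" if Xa: "X a" and nB: "a \<notin> B \<union> B'" for a
    unfolding good_def
  proof (intro conjI allI impI; (elim conjE)?)
    show "X a" by fact
    show "\<not> Inf x" "\<exists>y. C x y" if "x \<noteq> 0" "v x = a" for x using nB Xa that unfolding B_def by blast+
    fix w z x x' assume w: "w \<noteq> 0" "v w = 0" "z \<noteq> 0" "v z = 0" and x: "x \<noteq> 0" "v x = a" and x': "x' \<noteq> 0" "v x' = a"
    have fin: "finite (rv v ` Collect (common w z y)) \<and> card (rv v ` Collect (common w z y)) \<le> N"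
      if "y \<noteq> 0" "v y = a" for y
    proof -
      have "\<not> Inf y" using nB that unfolding B_def by blast
      hence sub: "rv v ` Collect (common w z y) \<subseteq> rv v ` Collect (C' y)"
        by (auto simp: common_def C'_def)
      have "rv v ` Collect (C' y) \<subseteq> rv v ` Collect (C y)" by (auto simp: C'_def)
      hence "finite (rv v ` Collect (C' y))"
        using \<open>\<not> Inf y\<close> finite_subset unfolding Inf_def by blast
      thus ?thesis using sub N[of y] by (meson card_mono finite_subset order_trans)
    qed
    have le: "card (rv v ` Collect (common w z y)) \<le> card (rv v ` Collect (common w z y'))"
      if y: "y \<noteq> 0" "v y = a" "y' \<noteq> 0" "v y' = a" for y y'
    proof -
      let ?j = "card (rv v ` Collect (common w z y))"
      have "?j \<le> Suc N" using fin[of y] y by simp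
      hence "\<not> Q ?j w z a" using nB w unfolding B'_def by blast
      moreover have "P ?j w z y" unfolding P_def using atl_finite[of "rv v" "common w z y"] fin[of y] y by blast
      ultimately have "P ?j w z y'" using y unfolding Q_def by blast
      thus ?thesis unfolding P_def using atl_finite[of "rv v" "common w z y'"] fin[of y'] y by blast
    qed
    show "card (rv v ` Collect (common w z x)) = card (rv v ` Collect (common w z x'))"
      using le[OF x x'] le[OF x' x] by simp
  qed
  hence "{a. X a \<and> \<not> good a} \<subseteq> B \<union> B'" by blast
  thus ?thesis using \<open>finite B\<close> \<open>finite B'\<close> by (meson finite_UnI finite_subset)
qed

end

section \<open>The group of a definable curve\<close>

context C_min_ACVF
begin

lemma rv_power_cong: "rv v x = rv v y \<Longrightarrow> rv v (x ^ n) = rv v (y ^ n)"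
proof (induction n)
  case (Suc n)
  thus ?case unfolding power_Suc by (intro rv_mult_cong)
qed simp

lemma finite_rv_image:
  assumes fin: "finite (rv v ` Collect S)" and h: "\<And>x y. rv v x = rv v y \<Longrightarrow> rv v (h x) = rv v (h y)"
  shows "finite (rv v ` {z. \<exists>x. S x \<and> rv v z = rv v (h x)})"
proof -
  obtain A where A: "A \<subseteq> Collect S" "finite A" "rv v ` Collect S = rv v ` A"
    using finite_subset_image[OF fin order_refl] by meson
  have "rv v ` {z. \<exists>x. S x \<and> rv v z = rv v (h x)} \<subseteq> (\<lambda>a. rv v (h a)) ` A"
  proof
    fix B assume "B \<in> rv v ` {z. \<exists>x. S x \<and> rv v z = rv v (h x)}"
    then obtain z x where z: "B = rv v z" "S x" "rv v z = rv v (h x)" by auto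
    obtain a where "a \<in> A" "rv v x = rv v a" using z(2) A(3) by blast
    thus "B \<in> (\<lambda>a. rv v (h a)) ` A" using z h[of x a] by auto
  qed
  thus ?thesis using A(2) finite_subset by blast
qed

lemma finite_rv_quotients:
  assumes fin: "finite (rv v ` Collect S)" and fin': "finite (rv v ` Collect S')"
  shows "finite (rv v ` {z. \<exists>x y. S x \<and> S' y \<and> rv v z = rv v (y / x)})"
proof -
  obtain A where A: "A \<subseteq> Collect S" "finite A" "rv v ` Collect S = rv v ` A"
    using finite_subset_image[OF fin order_refl] by meson
  have "rv v ` {z. \<exists>x y. S x \<and> S' y \<and> rv v z = rv v (y / x)} \<subseteq>
    (\<Union>a\<in>A. rv v ` {z. \<exists>y. S' y \<and> rv v z = rv v (y / a)})"
  proof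
    fix B assume "B \<in> rv v ` {z. \<exists>x y. S x \<and> S' y \<and> rv v z = rv v (y / x)}"
    then obtain z x y where z: "B = rv v z" "S x" "S' y" "rv v z = rv v (y / x)" by auto
    obtain a where "a \<in> A" "rv v x = rv v a" using z(2) A(3) by blast
    moreover from this have "rv v z = rv v (y / a)" using z(4) rv_divide_cong[OF refl, of x a y] by simp
    ultimately show "B \<in> (\<Union>a\<in>A. rv v ` {z. \<exists>y. S' y \<and> rv v z = rv v (y / a)})" using z by blast
  qed
  moreover have "finite (\<Union>a\<in>A. rv v ` {z. \<exists>y. S' y \<and> rv v z = rv v (y / a)})"
    using A(2) by (intro finite_UN_I finite_rv_image[OF fin'] rv_divide_cong refl)
  ultimately show ?thesis by (rule finite_subset)
qed

text \<open>
  Otherwise \<open>G\<close> would cover a whole fibre of the valuation over some \<open>\<gamma>\<close> that is a value of \<open>\<delta>\<close> at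
  only finitely many points.
\<close>

lemma finite_values_of_section:
  assumes d: "defpred (\<lambda>e. v (e 0) = \<delta> (v (e 1)))" and J: "defpred (\<lambda>e. J (v (e 0)))"
    and G: "defpred (\<lambda>e. G (e 0) (v (e 1)))"
    and ex: "\<And>a. J a \<Longrightarrow> \<exists>z. z \<noteq> 0 \<and> v z = \<delta> a \<and> G z a"
    and fin: "\<And>a. J a \<Longrightarrow> finite (rv v ` {z. z \<noteq> 0 \<and> v z = \<delta> a \<and> G z a})"
  shows "finite (\<delta> ` Collect J)"
proof -
  note dd = defval_app[OF d] and Jd = defpred_v1[OF J] and Gd = defpred_mv[OF G]
  define S where "S z \<longleftrightarrow> z \<noteq> 0 \<and> (\<exists>a. J a \<and> v z = \<delta> a \<and> G z a)" for z
  have Sd: "defpred (\<lambda>e. S (e 0))" unfolding S_def by (intro dd Jd Gd def_intros)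
  define B where "B = {\<gamma>. infinite {a. J a \<and> \<delta> a = \<gamma>}} \<union>
    {\<gamma>. \<exists>x y. x \<noteq> 0 \<and> y \<noteq> 0 \<and> v x = \<gamma> \<and> v y = \<gamma> \<and> S x \<and> \<not> S y}"
  have "finite B"
    unfolding B_def using finite_infinite_fibers[OF d J] definable_val_fibers[OF Sd] by simp
  moreover have "\<delta> ` Collect J \<subseteq> B"
  proof (rule ccontr)
    assume "\<not> \<delta> ` Collect J \<subseteq> B"
    then obtain a where a: "J a" "\<delta> a \<notin> B" by blast
    have fa: "finite {b. J b \<and> \<delta> b = \<delta> a}" using a(2) unfolding B_def by blast
    obtain z where "z \<noteq> 0" "v z = \<delta> a" "G z a" using ex[OF a(1)] by blast
    hence "S z" "z \<noteq> 0" "v z = \<delta> a" using a unfolding S_def by blast+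
    hence all: "S y" if "y \<noteq> 0" "v y = \<delta> a" for y using a(2) that unfolding B_def by blast
    have "rv v ` {y. y \<noteq> 0 \<and> v y = \<delta> a} \<subseteq> (\<Union>b\<in>{b. J b \<and> \<delta> b = \<delta> a}. rv v ` {z. z \<noteq> 0 \<and> v z = \<delta> b \<and> G z b})"
      using all unfolding S_def by fastforce
    moreover have "finite (\<Union>b\<in>{b. J b \<and> \<delta> b = \<delta> a}. rv v ` {z. z \<noteq> 0 \<and> v z = \<delta> b \<and> G z b})"
      using fa fin by (intro finite_UN_I) blast+
    ultimately have "finite (rv v ` {y. y \<noteq> 0 \<and> v y = \<delta> a})" by (rule finite_subset)
    thus False using infinite_rv[of "\<delta> a"] by (rule notE[rotated])
  qed
  ultimately show ?thesis by (rule finite_subset[rotated])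
qed

end

context curve
begin

section \<open>The stabilizer of a fibre of the curve\<close>

definition H :: "'g \<Rightarrow> 'm \<Rightarrow> 'm \<Rightarrow> bool" where
  "H a w z \<longleftrightarrow> w \<noteq> 0 \<and> v w = 0 \<and> z \<noteq> 0 \<and> v z = 0 \<and>
     (\<forall>x y. x \<noteq> 0 \<and> v x = a \<longrightarrow> (C x y \<longleftrightarrow> C (w * x) (z * y)))"

lemma H_unit: "H a w z \<Longrightarrow> w \<noteq> 0 \<and> v w = 0 \<and> z \<noteq> 0 \<and> v z = 0"
  unfolding H_def by blast

lemma H_apply: "H a w z \<Longrightarrow> v x = a \<Longrightarrow> C x y \<Longrightarrow> C (w * x) (z * y)"
  unfolding H_def using C_nonzero by blast

lemma H_inv: "rv v w = rv v w' \<Longrightarrow> rv v z = rv v z' \<Longrightarrow> H a w z \<Longrightarrow> H a w' z'"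
proof -
  assume w: "rv v w = rv v w'" and z: "rv v z = rv v z'" and H: "H a w z"
  have "C (w * x) (z * y) = C (w' * x) (z' * y)" for x y
    using w z by (intro C_inv rv_mult_cong refl)
  hence "\<forall>x y. x \<noteq> 0 \<and> v x = a \<longrightarrow> (C x y \<longleftrightarrow> C (w' * x) (z' * y))"
    using H unfolding H_def by blast
  moreover have "w' \<noteq> 0 \<and> v w' = 0 \<and> z' \<noteq> 0 \<and> v z' = 0"
    using H rv_eq_0[OF w] rv_eq_0[OF z] unfolding rv_eq_v[OF w, symmetric] rv_eq_v[OF z, symmetric] H_def
    by blast
  ultimately show ?thesis unfolding H_def by blast
qed

lemma H_one: "H a 1 1"
  unfolding H_def by simp

lemma H_mult:
  assumes "H a w z" "H a w' z'" shows "H a (w * w') (z * z')"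
proof -
  have "C x y \<longleftrightarrow> C (w * w' * x) (z * z' * y)" if x: "x \<noteq> 0" "v x = a" for x y
  proof -
    have "w' * x \<noteq> 0" "v (w' * x) = a" using x H_unit[OF assms(2)] by (simp_all add: v_mult)
    hence "C (w' * x) (z' * y) \<longleftrightarrow> C (w * (w' * x)) (z * (z' * y))" using assms(1) unfolding H_def by blast
    moreover have "C x y \<longleftrightarrow> C (w' * x) (z' * y)" using assms(2) x unfolding H_def by blast
    ultimately show ?thesis by (simp only: mult.assoc)
  qed
  moreover have "w * w' \<noteq> 0 \<and> v (w * w') = 0 \<and> z * z' \<noteq> 0 \<and> v (z * z') = 0"
    using H_unit[OF assms(1)] H_unit[OF assms(2)] by (simp add: v_mult)
  ultimately show ?thesis unfolding H_def by blast
qed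

lemma H_inverse:
  assumes "H a w z" shows "H a (1 / w) (1 / z)"
proof -
  note u = H_unit[OF assms]
  have "C x y \<longleftrightarrow> C (1 / w * x) (1 / z * y)" if x: "x \<noteq> 0" "v x = a" for x y
  proof -
    have "x / w \<noteq> 0" "v (x / w) = a" using x u by (simp_all add: v_divide)
    hence "C (x / w) (y / z) \<longleftrightarrow> C (w * (x / w)) (z * (y / z))" using assms unfolding H_def by blast
    thus ?thesis using u by simp
  qed
  moreover have "1 / w \<noteq> 0 \<and> v (1 / w) = 0 \<and> 1 / z \<noteq> 0 \<and> v (1 / z) = 0"
    using u by (simp add: v_divide)
  ultimately show ?thesis unfolding H_def by blast
qed

lemma C_val: "C x y \<Longrightarrow> v y = f (v x)"
  unfolding C_def by blast

lemma good_finite: "good a \<Longrightarrow> x \<noteq> 0 \<Longrightarrow> v x = a \<Longrightarrow> finite (rv v ` Collect (C x))"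
  unfolding good_def Inf_def by blast

lemma good_ex: "good a \<Longrightarrow> x \<noteq> 0 \<Longrightarrow> v x = a \<Longrightarrow> \<exists>y. C x y"
  unfolding good_def by blast

lemma good_card:
  assumes "good a" "w \<noteq> 0" "v w = 0" "z \<noteq> 0" "v z = 0" "x \<noteq> 0" "v x = a" "x' \<noteq> 0" "v x' = a"
  shows "card (rv v ` Collect (common w z x)) = card (rv v ` Collect (common w z x'))"
  using assms unfolding good_def by blast

text \<open>The column of \<open>C\<close> over \<open>x\<close>, divided by one of its points
  \<open>y\<close>. Equality of two such sets means that \<open>y' / y\<close> carries the column
  over \<open>x\<close> onto the column over \<open>x'\<close>.\<close>

definition ratios :: "'m \<Rightarrow> 'm \<Rightarrow> 'm set set" where
  "ratios x y = rv v ` {z. z \<noteq> 0 \<and> v z = 0 \<and> C x (z * y)}"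

text \<open>
  The number of points of \<open>C \<inter> (w, z)\<inverse> C\<close> over \<open>x\<close> does not depend on \<open>x\<close>, so that \<open>(w, z)\<close>
  stabilizes \<open>C\<close> as soon as it maps one fibre of \<open>C\<close> onto another one.
\<close>

lemma stabilizer_of_equal_ratios_aux:
  assumes g: "good a" and xy: "C x y" "v x = a" and xy': "C x' y'" "v x' = a"
    and eq: "ratios x y = ratios x' y'" and u: "C u t" "v u = a"
  shows "C (x' / x * u) (y' / y * t)"
proof -
  define w z where "w = x' / x" and "z = y' / y"
  note ne = C_nonzero[OF xy(1)] C_nonzero[OF xy'(1)] C_nonzero[OF u(1)]
  have w: "w \<noteq> 0" "v w = 0" using ne xy xy' by (simp_all add: w_def v_divide)
  have z: "z \<noteq> 0" "v z = 0"
    using ne C_val[OF xy(1)] C_val[OF xy'(1)] xy(2) xy'(2) by (simp_all add: z_def v_divide)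
  have "common w z x s" if s: "C x s" for s
  proof -
    have s0: "s / y \<noteq> 0" "v (s / y) = 0"
      using ne C_nonzero[OF s] C_val[OF s] C_val[OF xy(1)] by (simp_all add: v_divide)
    have "C x (s / y * y)" using s ne by simp
    hence "rv v (s / y) \<in> rv v ` {z. z \<noteq> 0 \<and> v z = 0 \<and> C x (z * y)}" using s0 by blast
    hence "rv v (s / y) \<in> ratios x' y'" using eq by (simp only: ratios_def)
    hence "rv v (s / y) \<in> rv v ` {z. z \<noteq> 0 \<and> v z = 0 \<and> C x' (z * y')}" by (simp only: ratios_def)
    then obtain r where r: "rv v (s / y) = rv v r" "C x' (r * y')" by (elim imageE CollectE conjE)
    have "C x' (s / y * y')"
      using C_inv[OF refl rv_mult_cong[OF r(1) refl], of x' y'] r(2) by simp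
    moreover have "s / y * y' = z * s" by (simp add: z_def)
    moreover have "w * x = x'" using ne by (simp add: w_def)
    ultimately show ?thesis using s by (simp add: common_def)
  qed
  hence "Collect (common w z x) = Collect (C x)" by (auto simp: common_def)
  hence "card (rv v ` Collect (common w z u)) = card (rv v ` Collect (C x))"
    using good_card[OF g w z, of u x] ne u xy by simp
  also have "\<dots> = card (rv v ` Collect (C u))"
  proof -
    \<comment> \<open>For \<open>w = z = 1\<close> the counting condition says that the columns of
      \<open>C\<close> themselves have constant size. The common part over \<open>x\<close> is the
      whole column, so it is the whole column over \<open>u\<close> as well.\<close>
    have "common 1 1 = C" by (intro ext) (simp add: common_def)
    thus ?thesis using good_card[OF g, of 1 1 x u] ne u xy by simp
  qed
  finally have "card (rv v ` Collect (common w z u)) = card (rv v ` Collect (C u))" .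
  moreover have "rv v ` Collect (common w z u) \<subseteq> rv v ` Collect (C u)" by (auto simp: common_def)
  ultimately have "rv v ` Collect (common w z u) = rv v ` Collect (C u)"
    using good_finite[OF g, of u] ne u by (intro card_subset_eq) auto
  moreover have "rv v t \<in> rv v ` Collect (C u)" using u(1) by blast
  ultimately have "rv v t \<in> rv v ` Collect (common w z u)" by (simp only:)
  then obtain t' where t': "rv v t = rv v t'" "common w z u t'" by (elim imageE CollectE)
  have "C (w * u) (z * t)"
    using C_inv[OF refl rv_mult_cong[OF refl t'(1)], of "w * u" z] t'(2) by (simp add: common_def)
  thus ?thesis by (simp add: w_def z_def)
qed

lemma stabilizer_of_equal_ratios:
  assumes g: "good a" and xy: "C x y" "v x = a" and xy': "C x' y'" "v x' = a"
    and eq: "ratios x y = ratios x' y'"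
  shows "H a (x' / x) (y' / y)"
proof -
  note ne = C_nonzero[OF xy(1)] C_nonzero[OF xy'(1)]
  have u: "v (x' / x) = 0" "v (y' / y) = 0"
    using ne xy(2) xy'(2) C_val[OF xy(1)] C_val[OF xy'(1)] by (simp_all add: v_divide)
  \<comment> \<open>The converse implication is the auxiliary lemma for the inverse pair.\<close>
  have "C s t" if s: "s \<noteq> 0" "v s = a" and C: "C (x' / x * s) (y' / y * t)" for s t
  proof -
    have "v (x' / x * s) = v (x' / x) + v s" using ne s by (intro v_mult) simp_all
    hence "v (x' / x * s) = a" using s u by simp
    hence "C (x / x' * (x' / x * s)) (y / y' * (y' / y * t))"
      by (rule stabilizer_of_equal_ratios_aux[OF g xy' xy eq[symmetric] C])
    thus ?thesis using ne by simp
  qed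
  moreover have "C (x' / x * s) (y' / y * t)" if "v s = a" "C s t" for s t
    using stabilizer_of_equal_ratios_aux[OF g xy xy' eq that(2,1)] .
  ultimately show ?thesis unfolding H_def using ne u by auto
qed

text \<open>A ratio \<open>z\<close> occurring over \<open>x\<close> means that \<open>C\<close> and
  its translate by the inverse of \<open>(1, z)\<close> meet over \<open>x\<close>. By equality of
  counts they meet over the reference point \<open>u\<close> too, so all sets of ratios lie in one
  finite set.\<close>

lemma ratios_bound:
  assumes g: "good a" and xy: "C x y" "v x = a" and u: "u \<noteq> 0" "v u = a"
  shows "ratios x y \<subseteq> rv v ` {z. \<exists>s t. C u s \<and> C u t \<and> rv v z = rv v (t / s)}"
proof
  fix Z assume "Z \<in> ratios x y"
  then obtain z where z: "Z = rv v z" "z \<noteq> 0" "v z = 0" "C x (z * y)" unfolding ratios_def by auto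
  have x0: "x \<noteq> 0" using C_nonzero[OF xy(1)] by simp
  have "common 1 z x y" using xy z by (simp add: common_def)
  moreover have "finite (rv v ` Collect (common 1 z x))"
    using good_finite[OF g x0 xy(2)] by (rule finite_subset[rotated]) (auto simp: common_def)
  ultimately have "card (rv v ` Collect (common 1 z x)) > 0" by (auto simp: card_gt_0_iff)
  hence "card (rv v ` Collect (common 1 z u)) > 0" using good_card[OF g, of 1 z u x] z x0 xy u by simp
  hence "rv v ` Collect (common 1 z u) \<noteq> {}" by (metis card.empty less_irrefl)
  then obtain s where s: "C u s" "C u (z * s)" by (auto simp: common_def)
  hence "rv v z = rv v (z * s / s)" using C_nonzero[OF s(1)] by simp
  thus "Z \<in> rv v ` {z. \<exists>s t. C u s \<and> C u t \<and> rv v z = rv v (t / s)}" using s z(1) by blast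
qed

text \<open>Since all sets of ratios are subsets of one finite set, infinitely many classes
  \<open>x\<close> share the same one. The quotients of these classes belong to the projection of
  the stabilizer.\<close>

lemma H_infinite:
  assumes g: "good a" shows "infinite (rv v ` {w. \<exists>z. H a w z})"
proof
  assume finH: "finite (rv v ` {w. \<exists>z. H a w z})"
  obtain u where u: "u \<noteq> 0" "v u = a" using v_surj by blast
  define W where "W = rv v ` {z. \<exists>s t. C u s \<and> C u t \<and> rv v z = rv v (t / s)}"
  have "finite W" unfolding W_def using good_finite[OF g u] by (intro finite_rv_quotients)
  define K where "K = rv v ` {x. x \<noteq> 0 \<and> v x = a}"
  have "\<exists>x y. rv v x = A \<and> x \<noteq> 0 \<and> v x = a \<and> C x y" if "A \<in> K" for A
    using that good_ex[OF g] unfolding K_def by blast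
  then obtain r s where r: "\<And>A. A \<in> K \<Longrightarrow> rv v (r A) = A \<and> r A \<noteq> 0 \<and> v (r A) = a \<and> C (r A) (s A)" by metis
  have "(\<lambda>A. ratios (r A) (s A)) ` K \<subseteq> Pow W"
    using ratios_bound[OF g _ _ u] r unfolding W_def by blast
  hence "finite ((\<lambda>A. ratios (r A) (s A)) ` K)" using \<open>finite W\<close> finite_subset by blast
  moreover have "infinite K" unfolding K_def by (rule infinite_rv)
  ultimately obtain A0 where A0: "A0 \<in> K" "infinite {A\<in>K. ratios (r A) (s A) = ratios (r A0) (s A0)}"
    using pigeonhole_infinite by blast
  have "(\<lambda>A. rv v (r A / r A0)) ` {A\<in>K. ratios (r A) (s A) = ratios (r A0) (s A0)} \<subseteq> rv v ` {w. \<exists>z. H a w z}"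
  proof (rule image_subsetI)
    fix A assume "A \<in> {A\<in>K. ratios (r A) (s A) = ratios (r A0) (s A0)}"
    hence A: "A \<in> K" "ratios (r A0) (s A0) = ratios (r A) (s A)" by auto
    have "H a (r A / r A0) (s A / s A0)"
      using r[OF A0(1)] r[OF A(1)] by (intro stabilizer_of_equal_ratios[OF g _ _ _ _ A(2)]) auto
    thus "rv v (r A / r A0) \<in> rv v ` {w. \<exists>z. H a w z}" by blast
  qed
  moreover have "inj_on (\<lambda>A. rv v (r A / r A0)) {A\<in>K. ratios (r A) (s A) = ratios (r A0) (s A0)}"
  proof (rule inj_onI)
    fix A B assume AB: "A \<in> {A\<in>K. ratios (r A) (s A) = ratios (r A0) (s A0)}"
      "B \<in> {A\<in>K. ratios (r A) (s A) = ratios (r A0) (s A0)}" "rv v (r A / r A0) = rv v (r B / r A0)"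
    hence "rv v (r A) = rv v (r B)" using r[OF A0(1)] rv_divide_eq[of "r A0" "r A" "r B / r A0"] by simp
    thus "A = B" using r[of A] r[of B] AB by simp
  qed
  ultimately show False using A0(2) finH by (meson finite_imageD finite_subset)
qed

text \<open>The projection of the stabilizer is an infinite definable group of units, hence
  cofinite, and every unit \<open>w\<close> is the quotient of the two generic elements
  \<open>w * x\<close> and \<open>x\<close>.\<close>

lemma H_surj:
  assumes g: "good a" and w: "w \<noteq> 0" "v w = 0"
  shows "\<exists>z. H a w z"
proof -
  define S where "S w \<longleftrightarrow> (\<exists>z. H a w z)" for w
  obtain u where u: "v u = a" using v_surj by blast
  have "defpred (\<lambda>e. \<exists>z. H (v u) (e 0) z)" unfolding H_def by (intro Cd def_intros)
  hence Sd: "defpred (\<lambda>e. S (e 0))" unfolding S_def u .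
  have "infinite (rv v ` Collect S)" using H_infinite[OF g] unfolding S_def .
  from cofinite_rv[OF Sd _ this, of 0] obtain F where
    F: "finite F" "\<And>x. x \<noteq> 0 \<Longrightarrow> v x = 0 \<Longrightarrow> rv v x \<notin> F \<Longrightarrow> S x"
    using H_unit unfolding S_def by blast
  obtain x where x: "x \<noteq> 0" "v x = 0" "rv v x \<notin> F" "rv v (w * x) \<notin> F"
    using avoid_rv_translate[OF F(1) w(1)] by blast
  have "S x" using F(2) x by blast
  moreover have "S (w * x)" using F(2)[of "w * x"] x w by (simp add: v_mult)
  ultimately obtain z z' where "H a x z" "H a (w * x) z'" unfolding S_def by blast
  hence "H a (w * x * (1 / x)) (z' * (1 / z))" by (intro H_mult H_inverse)
  thus ?thesis using x by auto
qed

text \<open>Any point of the curve over \<open>a\<close> can be moved into the column over a fixed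
  \<open>u\<close>. In this way statements about all points over \<open>a\<close> are reduced to one
  finite column.\<close>

lemma H_translate:
  assumes g: "good a" and x: "C x y" "v x = a" and u: "u \<noteq> 0" "v u = a"
  shows "\<exists>w z. H a w z \<and> w * x = u \<and> C u (z * y)"
proof -
  have x0: "x \<noteq> 0" using C_nonzero[OF x(1)] by simp
  obtain z where z: "H a (u / x) z" using H_surj[OF g, of "u / x"] x0 u x(2) by (auto simp: v_divide)
  have e: "u / x * x = u" using x0 by simp
  have "C u (z * y)" using H_apply[OF z x(2) x(1)] unfolding e .
  thus ?thesis using z e by blast
qed

text \<open>An element of the kernel is a quotient of two points in the same finite column.\<close>

lemma H_finite_kernel:
  assumes g: "good a" shows "finite (rv v ` {z. H a 1 z})"
proof -
  obtain u where u: "u \<noteq> 0" "v u = a" using v_surj by blast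
  obtain y where y: "C u y" using good_ex[OF g u] by blast
  have "rv v ` {z. H a 1 z} \<subseteq> rv v ` {z. \<exists>s t. C u s \<and> C u t \<and> rv v z = rv v (t / s)}"
  proof (rule image_mono, intro subsetI CollectI)
    fix z assume "z \<in> {z. H a 1 z}"
    hence "C (1 * u) (z * y)" using H_apply[OF _ u(2) y] by blast
    moreover have "rv v z = rv v (z * y / y)" using C_nonzero[OF y] by simp
    ultimately show "\<exists>s t. C u s \<and> C u t \<and> rv v z = rv v (t / s)"
      using y by (intro exI[where x = y and P = "\<lambda>s. \<exists>t. C u s \<and> C u t \<and> rv v z = rv v (t / s)"] exI[of _ "z * y"] conjI) (simp_all only: mult_1)
  qed
  thus ?thesis using finite_rv_quotients[OF good_finite[OF g u] good_finite[OF g u]] finite_subset by blast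
qed

text \<open>For a fixed pair \<open>(w, z)\<close> the set of all \<open>a\<close> with
  \<open>H a w z\<close> has only finitely many boundary points, described by \<open>B\<close>.
  Orthogonality collects the boundary points of all pairs in one finite set, and definable
  connectedness gives constancy between them.\<close>

lemma H_locally_constant:
  "\<exists>F. finite F \<and> (\<forall>a b. a \<le> b \<longrightarrow> {a..b} \<inter> F = {} \<longrightarrow> H a = H b)"
proof -
  define B where "B w z a \<longleftrightarrow> (\<forall>p q. p < a \<and> a < q \<longrightarrow> (\<exists>b. p < b \<and> b < q \<and> \<not> (H b w z \<longleftrightarrow> H a w z)))" for w z a
  have "defpred (\<lambda>e. H (v (e 2)) (e 0) (e 1))" unfolding H_def by (intro Cd def_intros)
  note Hd = defpred_mmv[of "\<lambda>w z a. H a w z", OF this]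
  have tame: "tame (\<lambda>a. H a w z)" for w z by (intro definable_tame Hd def_intros)
  have "finite {a. \<exists>w z. w \<noteq> 0 \<and> v w = 0 \<and> z \<noteq> 0 \<and> v z = 0 \<and> B w z a}"
  proof (rule orthogonal2)
    show "defpred (\<lambda>e. B (e 0) (e 1) (v (e 2)))" unfolding B_def by (intro Hd def_intros)
    show "B w z = B w' z'" if "rv v w = rv v w'" "rv v z = rv v z'" for w w' z z'
    proof -
      have "H a w z = H a w' z'" for a using H_inv[OF that] H_inv[OF that[symmetric]] by blast
      thus ?thesis unfolding B_def by simp
    qed
    show "finite (Collect (B w z))" for w z
    proof -
      from tame[of w z] obtain F where
        F: "finite F" "\<And>x y. x \<le> y \<Longrightarrow> {x..y} \<inter> F = {} \<Longrightarrow> H x w z \<longleftrightarrow> H y w z"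
        by (rule tameE) blast
      have "\<not> B w z a" if a: "a \<notin> F" for a
      proof -
        obtain p q where pq: "p < a" "a < q" "{p<..<q} \<inter> F = {}" using gap[OF F(1) a] by blast
        have "H b w z \<longleftrightarrow> H a w z" if b: "p < b" "b < q" for b
        proof (cases "a \<le> b")
          case True
          have "{a..b} \<subseteq> {p<..<q}" using pq b by auto
          thus ?thesis using F(2)[OF True] pq(3) by blast
        next
          case False
          have "{b..a} \<subseteq> {p<..<q}" using pq b by auto
          hence "{b..a} \<inter> F = {}" using pq(3) by blast
          thus ?thesis using F(2)[of b a] False by simp
        qed
        thus ?thesis using pq unfolding B_def by blast
      qed
      hence "Collect (B w z) \<subseteq> F" by blast
      thus ?thesis using F(1) finite_subset by blast
    qed
  qed
  moreover have "H a w z \<longleftrightarrow> H b w z"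
    if ab: "a \<le> b" "{a..b} \<inter> {a. \<exists>w z. w \<noteq> 0 \<and> v w = 0 \<and> z \<noteq> 0 \<and> v z = 0 \<and> B w z a} = {}" for a b w z
  proof (cases "w \<noteq> 0 \<and> v w = 0 \<and> z \<noteq> 0 \<and> v z = 0")
    case True
    have "\<not> B w z c" if "c \<in> {a..b}" for c using that True ab(2) by blast
    hence loc: "\<exists>p q. p < c \<and> c < q \<and> (\<forall>y\<in>{a..b}. p < y \<and> y < q \<longrightarrow> (H y w z \<longleftrightarrow> H c w z))"
      if "c \<in> {a..b}" for c using that unfolding B_def by blast
    show ?thesis
      by (rule tame_connected[OF tame _ loc]) (use ab(1) in auto)
  next
    case False
    thus ?thesis unfolding H_def by blast
  qed
  ultimately show ?thesis
    by (intro exI[of _ "{a. \<exists>w z. w \<noteq> 0 \<and> v w = 0 \<and> z \<noteq> 0 \<and> v z = 0 \<and> B w z a}"]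
        conjI allI impI ext)
qed

text \<open>The ratio of second coordinates of points over \<open>a\<close> and over
  \<open>a + d\<close>, whose first coordinates differ by a fixed factor \<open>u\<close> of value
  \<open>d\<close>, has valuation \<open>f (a + d) - f a\<close>. Moving the points to a fixed
  \<open>x\<close> with the common stabilizer leaves only finitely many classes for this ratio, so
  \<open>finite_values_of_section\<close> applies.\<close>

lemma finite_differences:
  assumes J: "defpred (\<lambda>e. J (v (e 0)))" and Jg: "\<And>a. J a \<Longrightarrow> good a"
    and JH: "\<And>a b. J a \<Longrightarrow> J b \<Longrightarrow> H a = H b"
  shows "finite ((\<lambda>a. f (a + d) - f a) ` {a. J a \<and> J (a + d)})"
proof -
  obtain u where u: "u \<noteq> 0" "v u = d" using v_surj by blast
  note Jd = defpred_v1[OF J]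
  define G where "G z a \<longleftrightarrow> (\<exists>x y x' y'. C x y \<and> C x' y' \<and> v x = a \<and> v x' = a + d \<and>
    rv v x' = rv v (u * x) \<and> rv v z = rv v (y' / y))" for z a
  show ?thesis
  proof (rule finite_values_of_section)
    show "defpred (\<lambda>e. v (e 0) = f (v (e 1) + d) - f (v (e 1)))" by (intro fd def_intros)
    show "defpred (\<lambda>e. J (v (e 0)) \<and> J (v (e 0) + d))" by (intro Jd def_intros)
    show "defpred (\<lambda>e. G (e 0) (v (e 1)))" unfolding G_def by (intro Cd def_intros)
  next
    fix a assume a: "J a \<and> J (a + d)"
    obtain x where x: "x \<noteq> 0" "v x = a" using v_surj by blast
    obtain y where y: "C x y" using good_ex[OF Jg x] a by blast
    have ux: "u * x \<noteq> 0" "v (u * x) = a + d" using x u by (simp_all add: v_mult add.commute)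
    obtain y' where y': "C (u * x) y'" using good_ex[OF Jg ux] a by blast
    have "G (y' / y) a" unfolding G_def using x y ux y' by blast
    moreover have "y' / y \<noteq> 0" "v (y' / y) = f (a + d) - f a"
      using C_nonzero[OF y] C_nonzero[OF y'] C_val[OF y] C_val[OF y'] x ux by (simp_all add: v_divide)
    ultimately show "\<exists>z. z \<noteq> 0 \<and> v z = f (a + d) - f a \<and> G z a" by blast
    have "rv v ` {z. z \<noteq> 0 \<and> v z = f (a + d) - f a \<and> G z a} \<subseteq>
      rv v ` {z. \<exists>s t. C x s \<and> C (u * x) t \<and> rv v z = rv v (t / s)}"
    proof (rule image_mono, intro subsetI CollectI)
      fix z assume "z \<in> {z. z \<noteq> 0 \<and> v z = f (a + d) - f a \<and> G z a}"
      then obtain r s r' s' where G: "C r s" "C r' s'" "v r = a" "v r' = a + d"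
        "rv v r' = rv v (u * r)" "rv v z = rv v (s' / s)" unfolding G_def by auto
      obtain w t where wt: "H a w t" "w * r = x" "C x (t * s)"
        using H_translate[OF Jg G(1,3) x] a by blast
      \<comment> \<open>Since the stabilizers over \<open>a\<close> and \<open>a + d\<close>
        coincide, one pair moves both points at once and their ratio is unchanged.\<close>
      have "H (a + d) w t" using wt(1) JH a by metis
      hence "C (w * r') (t * s')" using H_apply G(2,4) by blast
      moreover have "rv v (w * r') = rv v (w * (u * r))" using G(5) by (intro rv_mult_cong) auto
      moreover have "w * (u * r) = u * x" using wt(2) by (simp add: mult_ac)
      ultimately have "C (u * x) (t * s')" using C_inv[of "w * r'" "u * x" "t * s'"] by simp
      moreover have "rv v z = rv v (t * s' / (t * s))" using G(6) H_unit[OF wt(1)] by simp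
      ultimately show "\<exists>s t. C x s \<and> C (u * x) t \<and> rv v z = rv v (t / s)" using wt(3) by blast
    qed
    moreover have "finite (rv v ` {z. \<exists>s t. C x s \<and> C (u * x) t \<and> rv v z = rv v (t / s)})"
      using good_finite[OF Jg x] good_finite[OF Jg ux] a by (intro finite_rv_quotients) blast+
    ultimately show "finite (rv v ` {z. z \<noteq> 0 \<and> v z = f (a + d) - f a \<and> G z a})"
      by (rule finite_subset)
  qed
qed

text \<open>The relation on the stabilizer makes the monomial quotient \<open>m\<close> invariant
  under it, so \<open>m\<close> takes finitely many classes on the fibre over \<open>a\<close>. Two
  pairs of natural exponents stand for one pair of integers, and \<open>((+) a ^^ i) 0\<close> is
  the \<open>i\<close>-fold multiple of \<open>a\<close>.\<close>

lemma finite_monomial_values: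
  assumes J: "defpred (\<lambda>e. J (v (e 0)))" and Jg: "\<And>a. J a \<Longrightarrow> good a"
    and rel: "\<And>a w z. J a \<Longrightarrow> H a w z \<Longrightarrow> rv v (w ^ i * z ^ j) = rv v (w ^ i' * z ^ j')"
  shows "finite ((\<lambda>a. ((+) a ^^ i) 0 + ((+) (f a) ^^ j) 0 - (((+) a ^^ i') 0 + ((+) (f a) ^^ j') 0)) ` Collect J)"
proof -
  define m where "m x y = (x ^ i * y ^ j) / (x ^ i' * y ^ j')" for x y :: 'm
  have v_m: "v (m x y) = ((+) (v x) ^^ i) 0 + ((+) (v y) ^^ j) 0 - (((+) (v x) ^^ i') 0 + ((+) (v y) ^^ j') 0)"
    "m x y \<noteq> 0" if "x \<noteq> 0" "y \<noteq> 0" for x y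
    using that by (simp_all add: m_def v_divide v_mult v_power)
  define G where "G z a \<longleftrightarrow> (\<exists>x y. C x y \<and> v x = a \<and> rv v z = rv v (m x y))" for z a
  show ?thesis
  proof (rule finite_values_of_section)
    have nd: "defval (\<lambda>e. ((+) (g e) ^^ k) 0)" if "defval g" for g and k :: nat
      by (induction k) (auto intro!: def_intros that)
    show "defpred (\<lambda>e. v (e 0) = ((+) (v (e 1)) ^^ i) 0 + ((+) (f (v (e 1))) ^^ j) 0 -
        (((+) (v (e 1)) ^^ i') 0 + ((+) (f (v (e 1))) ^^ j') 0))"
      by (intro nd fd def_intros)
    show "defpred (\<lambda>e. G (e 0) (v (e 1)))" unfolding G_def m_def by (intro Cd def_intros)
    show "defpred (\<lambda>e. J (v (e 0)))" by (rule J)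
  next
    fix a assume a: "J a"
    let ?d = "((+) a ^^ i) 0 + ((+) (f a) ^^ j) 0 - (((+) a ^^ i') 0 + ((+) (f a) ^^ j') 0)"
    obtain x where x: "x \<noteq> 0" "v x = a" using v_surj by blast
    obtain y where y: "C x y" using good_ex[OF Jg x] a by blast
    have "G (m x y) a" unfolding G_def using x y by blast
    thus "\<exists>z. z \<noteq> 0 \<and> v z = ?d \<and> G z a"
      using v_m[of x y] C_nonzero[OF y] C_val[OF y] x by auto
    have "rv v ` {z. z \<noteq> 0 \<and> v z = ?d \<and> G z a} \<subseteq> rv v ` {z. \<exists>s. C x s \<and> rv v z = rv v (m x s)}"
    proof (rule image_mono, intro subsetI CollectI)
      fix z assume "z \<in> {z. z \<noteq> 0 \<and> v z = ?d \<and> G z a}"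
      then obtain r s where G: "C r s" "v r = a" "rv v z = rv v (m r s)" unfolding G_def by auto
      obtain w t where wt: "H a w t" "w * r = x" "C x (t * s)"
        using H_translate[OF Jg G(1,2) x] a by blast
      note ne = H_unit[OF wt(1)] C_nonzero[OF G(1)]
      have "rv v (m w t) = rv v 1"
        using rel[OF a wt(1)] ne rv_divide_eq[of "w ^ i' * t ^ j'" "w ^ i * t ^ j" 1] by (simp add: m_def)
      hence "rv v (m w t * m r s) = rv v (1 * m r s)" by (intro rv_mult_cong) auto
      moreover have "m w t * m r s = m x (t * s)"
        unfolding m_def wt(2)[symmetric] using ne by (simp add: field_simps power_mult_distrib)
      ultimately have "rv v z = rv v (m x (t * s))" using G(3) by simp
      thus "\<exists>s. C x s \<and> rv v z = rv v (m x s)" using wt(3) by blast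
    qed
    moreover have "finite (rv v ` {z. \<exists>s. C x s \<and> rv v z = rv v (m x s)})"
      unfolding m_def
      by (intro finite_rv_image good_finite[OF Jg x] a rv_divide_cong rv_mult_cong rv_power_cong refl)
    ultimately show "finite (rv v ` {z. z \<noteq> 0 \<and> v z = ?d \<and> G z a})" by (rule finite_subset)
  qed
qed

end

section \<open>Piecewise linearity\<close>

lemma open_interval_convex:
  "open_interval I \<Longrightarrow> x \<in> I \<Longrightarrow> y \<in> I \<Longrightarrow> x \<le> z \<Longrightarrow> z \<le> y \<Longrightarrow> z \<in> I"
  unfolding open_interval_def by (elim disjE exE conjE) auto

lemma open_interval_inter:
  assumes "open_interval I" "K = {..<f} \<or> K = {f<..}" "I \<inter> K \<noteq> {}"
  shows "open_interval (I \<inter> K)"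
proof -
  have "UNIV \<inter> {..<f} = {..<f}" "{..<b} \<inter> {..<f} = {..<min b f}"
      "{a<..} \<inter> {..<f} = {a<..<f}" "{a<..<b} \<inter> {..<f} = {a<..<min b f}"
      "UNIV \<inter> {f<..} = {f<..}" "{..<b} \<inter> {f<..} = {f<..<b}"
      "{a<..} \<inter> {f<..} = {max a f<..}" "{a<..<b} \<inter> {f<..} = {max a f<..<b}" for a b :: 'a by auto
  hence "\<exists>a b. I \<inter> K = {a<..<b} \<or> I \<inter> K = {..<b} \<or> I \<inter> K = {a<..}"
    using assms(1,2) unfolding open_interval_def by (elim disjE exE conjE) (simp_all only:, blast+)
  then obtain a b where "I \<inter> K = {a<..<b} \<or> I \<inter> K = {..<b} \<or> I \<inter> K = {a<..}" by blast
  moreover have "a < b" if "I \<inter> K = {a<..<b}"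
  proof -
    have "\<exists>x. x \<in> {a<..<b}" using assms(3) unfolding that by blast
    thus ?thesis by auto
  qed
  ultimately show ?thesis unfolding open_interval_def by blast
qed

lemma open_interval_split:
  assumes I: "open_interval I"
  shows "\<exists>\<J>. finite \<J> \<and> (\<forall>J\<in>\<J>. open_interval J) \<and> \<Union>\<J> = I - {f}"
proof (intro exI[of _ "{J. (J = I \<inter> {..<f} \<or> J = I \<inter> {f<..}) \<and> J \<noteq> {}}"] conjI ballI)
  show "finite {J. (J = I \<inter> {..<f} \<or> J = I \<inter> {f<..}) \<and> J \<noteq> {}}" by simp
  show "open_interval J" if "J \<in> {J. (J = I \<inter> {..<f} \<or> J = I \<inter> {f<..}) \<and> J \<noteq> {}}" for J
    using that open_interval_inter[OF I, of "{..<f}" f] open_interval_inter[OF I, of "{f<..}" f]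
    by (elim CollectE conjE disjE) simp_all
  have "I - {f} = I \<inter> {..<f} \<union> I \<inter> {f<..}" by auto
  thus "\<Union>{J. (J = I \<inter> {..<f} \<or> J = I \<inter> {f<..}) \<and> J \<noteq> {}} = I - {f}" by (simp only:) blast
qed

lemma finite_complement_intervals:
  fixes F :: "'g::linordered_ab_group_add set"
  assumes "finite F"
  shows "\<exists>\<J>. finite \<J> \<and> (\<forall>J\<in>\<J>. open_interval J) \<and> \<Union>\<J> = - F"
  using assms
proof (induction F rule: finite_induct)
  case empty
  show ?case by (intro exI[of _ "{UNIV}"]) (simp add: open_interval_def)
next
  case (insert f F)
  then obtain \<J> where J: "finite \<J>" "\<And>J. J \<in> \<J> \<Longrightarrow> open_interval J" "\<Union>\<J> = - F" by auto
  have "\<exists>h. \<forall>J\<in>\<J>. finite (h J) \<and> (\<forall>K\<in>h J. open_interval K) \<and> \<Union>(h J) = J - {f}"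
  proof (rule bchoice, rule ballI)
    fix J assume "J \<in> \<J>"
    from open_interval_split[OF J(2)[OF this], of f]
    show "\<exists>H. finite H \<and> (\<forall>K\<in>H. open_interval K) \<and> \<Union>H = J - {f}" .
  qed
  then obtain h where "\<forall>J\<in>\<J>. finite (h J) \<and> (\<forall>K\<in>h J. open_interval K) \<and> \<Union>(h J) = J - {f}"
    by (rule exE)
  note h = bspec[OF this]
  have "\<Union>(\<Union>(h ` \<J>)) = - insert f F"
  proof -
    have "\<Union>(\<Union>(h ` \<J>)) = (\<Union>J\<in>\<J>. \<Union>(h J))" by blast
    also have "\<dots> = (\<Union>J\<in>\<J>. J - {f})" using h by simp
    also have "\<dots> = \<Union>\<J> - {f}" by blast
    finally show ?thesis using J(3) by auto
  qed
  thus ?case using J(1) h by (intro exI[of _ "\<Union>(h ` \<J>)"]) blast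
qed

context C_min_ACVF
begin

section \<open>Local behaviour of tame sets and finite-valued functions\<close>

lemma open_interval_nbhd:
  assumes "open_interval I" "a \<in> I"
  shows "\<exists>p q. p < a \<and> a < (q::'g) \<and> {p<..<q} \<subseteq> I"
proof -
  obtain l u where "l < a" "a < u" using Gamma_gt Gamma_lt by metis
  from assms(1) consider "I = UNIV" | c where "I = {c<..}" | c where "I = {..<c}" | c d where "I = {c<..<d}"
    unfolding open_interval_def by blast
  thus ?thesis
  proof cases
    case 1
    thus ?thesis using \<open>l < a\<close> \<open>a < u\<close> by blast
  next
    case (2 c)
    hence "c < a" "{c<..<u} \<subseteq> I" using assms(2) by auto
    thus ?thesis using \<open>a < u\<close> by blast
  next
    case (3 c)
    hence "a < c" "{l<..<c} \<subseteq> I" using assms(2) by auto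
    thus ?thesis using \<open>l < a\<close> by blast
  next
    case (4 c d)
    thus ?thesis using assms(2) by auto
  qed
qed

lemma tame_nbhd:
  fixes X :: "'g \<Rightarrow> bool"
  assumes "tame X"
  shows "\<exists>F. finite F \<and> (\<forall>a. a \<notin> F \<longrightarrow> (\<exists>p q. p < a \<and> a < q \<and> (\<forall>b. p < b \<and> b < q \<longrightarrow> (X b \<longleftrightarrow> X a))))"
proof -
  from assms obtain F where F: "finite F" "\<And>x y. x \<le> y \<Longrightarrow> {x..y} \<inter> F = {} \<Longrightarrow> X x \<longleftrightarrow> X y"
    by (rule tameE) blast
  have "\<exists>p q. p < a \<and> a < q \<and> (\<forall>b. p < b \<and> b < q \<longrightarrow> (X b \<longleftrightarrow> X a))" if a: "a \<notin> F" for a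
  proof -
    obtain p q where pq: "p < a" "a < q" "{p<..<q} \<inter> F = {}" using gap[OF F(1) a] by blast
    have "X b \<longleftrightarrow> X a" if b: "p < b \<and> b < q" for b
    proof (cases "a \<le> b")
      case True
      have "{a..b} \<subseteq> {p<..<q}" using pq b by auto
      thus ?thesis using F(2)[OF True] pq(3) by blast
    next
      case False
      have "{b..a} \<subseteq> {p<..<q}" using pq b by auto
      hence "{b..a} \<inter> F = {}" using pq(3) by blast
      thus ?thesis using F(2)[of b a] False by simp
    qed
    thus ?thesis using pq(1,2) by blast
  qed
  thus ?thesis using F(1) by blast
qed

text \<open>To the right of 0 and below the next exceptional point \<open>X\<close> is constant, and
  \<open>ex\<close> says that it is not constantly false.\<close>

lemma tame_germ:
  fixes X :: "'g \<Rightarrow> bool"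
  assumes "tame X" and ex: "\<And>\<delta>. 0 < \<delta> \<Longrightarrow> \<exists>d. 0 < d \<and> d < \<delta> \<and> X d"
  shows "\<exists>\<delta>. 0 < \<delta> \<and> (\<forall>d. 0 < d \<and> d < \<delta> \<longrightarrow> X d)"
proof -
  from assms(1) obtain F where F: "finite F" "\<And>x y. x \<le> y \<Longrightarrow> {x..y} \<inter> F = {} \<Longrightarrow> X x \<longleftrightarrow> X y"
    by (rule tameE) blast
  obtain q where q: "q > 0" "{0<..<q} \<inter> F = {}" using gap_right[OF F(1)] by blast
  obtain d where d: "0 < d" "d < q" "X d" using ex[OF q(1)] by blast
  have "X e" if e: "0 < e \<and> e < q" for e
  proof (cases "d \<le> e")
    case True
    have "{d..e} \<subseteq> {0<..<q}" using d e by auto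
    thus ?thesis using F(2)[OF True] q(2) d(3) by blast
  next
    case False
    have "{e..d} \<subseteq> {0<..<q}" using d e by auto
    hence "{e..d} \<inter> F = {}" using q(2) by blast
    thus ?thesis using F(2)[of e d] False d(3) by simp
  qed
  thus ?thesis using q(1) by blast
qed

lemma finite_image_constant:
  assumes g: "defpred (\<lambda>e. v (e 0) = g (v (e 1)))" and J: "defpred (\<lambda>e. J (v (e 0)))"
    and fin: "finite (g ` Collect J)"
  shows "\<exists>F. finite F \<and> (\<forall>I a b. open_interval I \<longrightarrow> I \<subseteq> Collect J \<longrightarrow> I \<inter> F = {} \<longrightarrow> a \<in> I \<longrightarrow> b \<in> I \<longrightarrow> g a = g b)"
proof -
  note gd = defpred_vv[of "\<lambda>a b. a = g b", OF g]
  have "\<exists>F. finite F \<and> (\<forall>x y. x \<le> y \<longrightarrow> {x..y} \<inter> F = {} \<longrightarrow> (c = g x \<longleftrightarrow> c = g y))" for c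
  proof -
    have "tame (\<lambda>x. c = g x)" by (intro definable_tame gd def_intros)
    thus ?thesis unfolding tame_def .
  qed
  then obtain F where F: "\<And>c. finite (F c)" "\<And>c x y. x \<le> y \<Longrightarrow> {x..y} \<inter> F c = {} \<Longrightarrow> c = g x \<Longrightarrow> c = g y"
    by metis
  have *: "g a = g b" if I: "open_interval I" "I \<subseteq> Collect J" "I \<inter> \<Union>(F ` g ` Collect J) = {}" "a \<in> I" "b \<in> I" "a \<le> b"
    for I a b
  proof -
    have "{a..b} \<subseteq> I" using open_interval_convex[OF I(1,4,5)] by auto
    moreover have "F (g a) \<subseteq> \<Union>(F ` g ` Collect J)" using I by blast
    ultimately have "{a..b} \<inter> F (g a) = {}" using I(3) by blast
    thus ?thesis using F(2)[OF I(6) _ refl] by blast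
  qed
  have "g a = g b" if I: "open_interval I" "I \<subseteq> Collect J" "I \<inter> \<Union>(F ` g ` Collect J) = {}" "a \<in> I" "b \<in> I" for I a b
  proof (cases "a \<le> b")
    case True
    thus ?thesis using *[OF I] by simp
  next
    case False
    thus ?thesis using *[OF I(1-3,5,4)] by simp
  qed
  moreover have "finite (\<Union>(F ` g ` Collect J))" using fin F(1) by blast
  ultimately show ?thesis by (intro exI[of _ "\<Union>(F ` g ` Collect J)"] conjI allI impI)
qed

text \<open>For each \<open>d\<close> the increment \<open>g d\<close> has finitely many jumps, and
  their number is bounded by some \<open>N\<close> uniformly in \<open>d\<close>. Hence only
  finitely many points are limits of jumps for arbitrarily small \<open>d\<close>. Away from them,
  \<open>g d\<close> is locally constant for all small \<open>d\<close> at once, and two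
  applications of definable connectedness spread this over the whole interval.\<close>

lemma piecewise_linear:
  assumes f: "defpred (\<lambda>e. v (e 0) = f (v (e 1)))" and J: "defpred (\<lambda>e. J (v (e 0)))"
    and fin: "\<And>d. finite ((\<lambda>a. f (a + d) - f a) ` {a. J a \<and> J (a + d)})"
  shows "\<exists>F. finite F \<and> (\<forall>I. open_interval I \<longrightarrow> I \<subseteq> Collect J \<longrightarrow> I \<inter> F = {} \<longrightarrow> linear_on I f)"
proof -
  note fd = defval_app[OF f] and Jd = defpred_v1[OF J]
  define g where "g d a = f (a + d) - f a" for d a
  define jump where "jump d a \<longleftrightarrow> J a \<and> J (a + d) \<and>
    \<not> (\<exists>p q. p < a \<and> a < q \<and> (\<forall>b. p < b \<and> b < q \<longrightarrow> g d b = g d a))" for d a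
  have jd': "defpred (\<lambda>e. jump (v (e 0)) (v (e 1)))"
    unfolding jump_def g_def by (intro fd Jd def_intros)
  note jd = defpred_vv[OF jd']
  have jf: "finite (Collect (jump d))" for d
  proof -
    have "\<exists>F. finite F \<and> (\<forall>a. a \<notin> F \<longrightarrow> (\<exists>p q. p < a \<and> a < q \<and> (\<forall>b. p < b \<and> b < q \<longrightarrow> (g d b = c \<longleftrightarrow> g d a = c))))" for c
      unfolding g_def by (intro tame_nbhd definable_tame fd def_intros)
    then obtain F where F: "\<And>c. finite (F c)"
      "\<And>c a. a \<notin> F c \<Longrightarrow> \<exists>p q. p < a \<and> a < q \<and> (\<forall>b. p < b \<and> b < q \<longrightarrow> (g d b = c \<longleftrightarrow> g d a = c))"
      by metis
    have "Collect (jump d) \<subseteq> (\<Union>c\<in>g d ` {a. J a \<and> J (a + d)}. F c)"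
    proof (rule subsetI, rule ccontr)
      fix a assume a: "a \<in> Collect (jump d)" "a \<notin> (\<Union>c\<in>g d ` {a. J a \<and> J (a + d)}. F c)"
      hence "a \<notin> F (g d a)" unfolding jump_def by blast
      from F(2)[OF this] have "\<exists>p q. p < a \<and> a < q \<and> (\<forall>b. p < b \<and> b < q \<longrightarrow> g d b = g d a)" by blast
      thus False using a(1) unfolding jump_def by blast
    qed
    moreover have "finite (\<Union>c\<in>g d ` {a. J a \<and> J (a + d)}. F c)"
      using fin[of d] F(1) unfolding g_def by blast
    ultimately show ?thesis by (rule finite_subset)
  qed
  obtain N where N: "\<And>d. card (Collect (jump d)) \<le> N" using uniform_finite_Gamma[OF jd' jf] by blast
  define bad where "bad a \<longleftrightarrow> (\<forall>p q \<delta>. p < a \<and> a < q \<and> 0 < \<delta> \<longrightarrow>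
    (\<exists>d b. 0 < d \<and> d < \<delta> \<and> p < b \<and> b < q \<and> jump d b))" for a
  have "finite (Collect bad)"
  proof (rule ccontr)
    assume inf: "infinite (Collect bad)"
    have "tame bad" unfolding bad_def by (intro definable_tame jd def_intros)
    from tame_infinite_iff[OF this] inf obtain p q where pq: "p < q" "\<And>x. p < x \<and> x < q \<Longrightarrow> bad x" by blast
    obtain c where c: "\<And>n. p < c n" "\<And>n. c n < q" "\<And>n::nat. c n < c (Suc n)"
      using increasing_sequence[OF pq(1)] by metis
    have mono: "strict_mono c" using c(3) by (simp add: strict_mono_Suc_iff)
    \<comment> \<open>Badness gives jumps in the n-th interval for some arbitrarily small
      \<open>d\<close>; tameness gives them for all sufficiently small \<open>d\<close>. One
      \<open>d\<close> then has a jump in each of \<open>N + 1\<close> disjoint intervals.\<close>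
    have "\<exists>\<delta>. 0 < \<delta> \<and> (\<forall>d. 0 < d \<and> d < \<delta> \<longrightarrow> (\<exists>b. c n < b \<and> b < c (Suc n) \<and> jump d b))" for n
    proof (rule tame_germ)
      show "tame (\<lambda>d. \<exists>b. c n < b \<and> b < c (Suc n) \<and> jump d b)" by (intro definable_tame jd def_intros)
      fix \<delta> :: 'g assume d: "0 < \<delta>"
      obtain a where a: "c n < a" "a < c (Suc n)" using Gamma_dense[OF c(3)] by blast
      hence "bad a" using pq(2) c(1)[of n] c(2)[of "Suc n"] by (meson less_trans)
      thus "\<exists>d. 0 < d \<and> d < \<delta> \<and> (\<exists>b. c n < b \<and> b < c (Suc n) \<and> jump d b)"
        using a d unfolding bad_def by blast
    qed
    then obtain \<delta> where \<delta>: "\<And>n. 0 < \<delta> n"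
      "\<And>n d. 0 < d \<Longrightarrow> d < \<delta> n \<Longrightarrow> \<exists>b. c n < b \<and> b < c (Suc n) \<and> jump d b" by metis
    have "0 < Min (\<delta> ` {..N})" using \<delta>(1) by (subst Min_gr_iff) auto
    then obtain d where d: "0 < d" "d < Min (\<delta> ` {..N})" using Gamma_dense by blast
    hence "\<forall>n\<in>{..N}. \<exists>b. c n < b \<and> b < c (Suc n) \<and> jump d b" by (intro ballI \<delta>(2)) auto
    then obtain b where b: "\<And>n. n \<le> N \<Longrightarrow> c n < b n \<and> b n < c (Suc n) \<and> jump d (b n)" by (metis atMost_iff)
    have lt: "b i < b j" if "i < j" "j \<le> N" for i j
    proof -
      have "b i < c (Suc i)" using b[of i] that by simp
      also have "c (Suc i) \<le> c j" using mono that by (simp add: strict_mono_less_eq)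
      also have "c j < b j" using b[of j] that by simp
      finally show ?thesis .
    qed
    have "inj_on b {..N}"
      by (rule inj_onI) (metis atMost_iff less_irrefl linorder_neqE_nat lt)
    hence "card (b ` {..N}) = Suc N" by (simp add: card_image)
    moreover have "b ` {..N} \<subseteq> Collect (jump d)" using b by auto
    ultimately have "Suc N \<le> card (Collect (jump d))" using card_mono[OF jf] by metis
    thus False using N[of d] by simp
  qed
  moreover have "linear_on I f" if I: "open_interval I" "I \<subseteq> Collect J" "I \<inter> Collect bad = {}" for I
  proof -
    note conv = open_interval_convex[OF I(1)]
    have loc: "\<exists>p q \<delta>. p < a \<and> a < q \<and> 0 < \<delta> \<and> {p<..<q} \<subseteq> I \<and>
      (\<forall>d b b'. 0 < d \<and> d < \<delta> \<and> p < b \<and> b < q \<and> p < b' \<and> b' < q \<longrightarrow> g d b = g d b')" if a: "a \<in> I" for a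
    proof -
      have "\<not> bad a" using I(3) a by blast
      then obtain p q \<delta> where pq: "p < a" "a < q" "0 < \<delta>"
        "\<And>d b. 0 < d \<Longrightarrow> d < \<delta> \<Longrightarrow> p < b \<Longrightarrow> b < q \<Longrightarrow> \<not> jump d b" unfolding bad_def by blast
      obtain p' q' where pq': "p' < a" "a < q'" "{p'<..<q'} \<subseteq> I" using open_interval_nbhd[OF I(1) a] by blast
      obtain r where r: "a < r" "r < min q q'" using Gamma_dense[of a "min q q'"] pq pq' by auto
      define P where "P = max p p'"
      \<comment> \<open>The bound \<open>q' - r\<close> keeps \<open>x + d\<close> inside the
        interval for every \<open>x\<close> below \<open>r\<close>, so that only a genuine jump
        could break local constancy.\<close>
      define \<epsilon> where "\<epsilon> = min \<delta> (q' - r)"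
      have "0 < \<epsilon>" using pq r by (simp add: \<epsilon>_def)
      have "P < a" "P \<ge> p" "P \<ge> p'" using pq pq' by (auto simp: P_def)
      have sub: "{P<..<r} \<subseteq> I" using pq' r \<open>P \<ge> p'\<close> by (auto intro!: subsetD[OF pq'(3)])
      have "g d b = g d b'" if d: "0 < d" "d < \<epsilon>" and b: "P < b" "b < r" "P < b'" "b' < r" for d b b'
      proof -
        have "b + d < q'" if "b < r" for b
        proof -
          have "b + d < r + (q' - r)" using that d(2) by (intro add_strict_mono) (simp_all add: \<epsilon>_def)
          thus ?thesis by simp
        qed
        hence JJ: "J x \<and> J (x + d)" if "P < x" "x < r" for x
        proof -
          have "x \<in> I" using sub that by auto
          moreover have "x + d \<in> {p'<..<q'}" using \<open>\<And>b. b < r \<Longrightarrow> b + d < q'\<close>[OF that(2)] that d \<open>P \<ge> p'\<close>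
            by (auto intro: less_trans[OF _ less_add_same_cancel1[THEN iffD2]])
          ultimately show ?thesis using pq'(3) I(2) by auto
        qed
        have nb: "\<exists>p q. p < x \<and> x < q \<and> (\<forall>y\<in>{P<..<r}. p < y \<and> y < q \<longrightarrow> (g d b = g d y \<longleftrightarrow> g d b = g d x))"
          if x: "x \<in> {P<..<r}" for x
        proof -
          have "p < x" "x < q" using x r \<open>P \<ge> p\<close> by auto
          hence "\<not> jump d x" using pq(4)[of d x] d x r by (auto simp: \<epsilon>_def)
          then obtain s t where st: "s < x" "x < t" "\<And>y. s < y \<and> y < t \<Longrightarrow> g d y = g d x"
            unfolding jump_def using JJ x by auto
          have "\<forall>y\<in>{P<..<r}. s < y \<and> y < t \<longrightarrow> (g d b = g d y \<longleftrightarrow> g d b = g d x)"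
            using st(3) by (intro ballI impI arg_cong[where f = "\<lambda>z. g d b = z"]) blast
          thus ?thesis using st(1,2) by blast
        qed
        have "tame (\<lambda>y. g d b = g d y)" unfolding g_def by (intro definable_tame fd def_intros)
        hence "(g d b = g d b) \<longleftrightarrow> (g d b = g d b')"
          by (rule tame_connected[OF _ _ nb]) (use b in auto)
        thus ?thesis by simp
      qed
      thus ?thesis using \<open>P < a\<close> r(1) \<open>0 < \<epsilon>\<close> sub
        by - (rule exI[of _ P], rule exI[of _ r], rule exI[of _ \<epsilon>], blast)
    qed
    \<comment> \<open>The increments of \<open>f\<close> have the same germ at \<open>a\<close> and
      at \<open>b\<close>, which stands in for having the same slope.\<close>
    define E where "E a b \<longleftrightarrow> (\<exists>\<delta>. 0 < \<delta> \<and> (\<forall>d. 0 < d \<and> d < \<delta> \<longrightarrow> g d a = g d b))" for a b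
    have E_trans: "E a c" if E1: "E a b" and E2: "E b c" for a b c
    proof -
      obtain \<delta> where \<delta>: "0 < \<delta>" "\<And>d. 0 < d \<and> d < \<delta> \<Longrightarrow> g d a = g d b"
        using E1 unfolding E_def by blast
      obtain \<epsilon> where \<epsilon>: "0 < \<epsilon>" "\<And>d. 0 < d \<and> d < \<epsilon> \<Longrightarrow> g d b = g d c"
        using E2 unfolding E_def by blast
      show ?thesis unfolding E_def
      proof (intro exI[of _ "min \<delta> \<epsilon>"] conjI allI impI)
        fix d assume d: "0 < d \<and> d < min \<delta> \<epsilon>"
        have "g d a = g d b" using d by (intro \<delta>(2)) simp
        also have "\<dots> = g d c" using d by (intro \<epsilon>(2)) simp
        finally show "g d a = g d c" .
      qed (use \<delta>(1) \<epsilon>(1) in simp)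
    qed
    have E_sym: "E b a" if "E a b" for a b using that unfolding E_def by metis
    have E_all: "E a b" if ab: "a \<in> I" "b \<in> I" for a b
    proof -
      have 1: "tame (E a)" unfolding E_def g_def by (intro definable_tame fd def_intros)
      have 2: "\<exists>p q. p < x \<and> x < q \<and> (\<forall>y\<in>I. p < y \<and> y < q \<longrightarrow> (E a y \<longleftrightarrow> E a x))" if x: "x \<in> I" for x
      proof -
        obtain p q \<delta> where pq: "p < x" "x < q" "0 < \<delta>"
          "\<And>d b b'. 0 < d \<and> d < \<delta> \<and> p < b \<and> b < q \<and> p < b' \<and> b' < q \<Longrightarrow> g d b = g d b'"
          using loc[OF x] by blast
        have "E x y" if "p < y" "y < q" for y
          unfolding E_def
        proof (intro exI[of _ \<delta>] conjI allI impI)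
          fix d assume "0 < d \<and> d < \<delta>"
          thus "g d x = g d y" using pq(1,2) that by (intro pq(4) conjI) simp_all
        qed fact
        hence "\<forall>y\<in>I. p < y \<and> y < q \<longrightarrow> (E a y \<longleftrightarrow> E a x)" using E_trans E_sym by blast
        thus ?thesis using pq(1,2) by blast
      qed
      have "E a a \<longleftrightarrow> E a b"
        by (rule tame_connected[OF 1 _ 2 ab]) (rule conv)
      moreover have "E a a" using Gamma_pos unfolding E_def by blast
      ultimately show ?thesis by simp
    qed
    have key: "g d a = g d b" if d: "0 < d" and ab: "a \<in> I" "a + d \<in> I" "b \<in> I" "b + d \<in> I" for d a b
    proof -
      define K where "K = {x. x \<in> I \<and> x + d \<in> I}"
      have 1: "tame (\<lambda>y. g d a = g d y)" unfolding g_def by (intro definable_tame fd def_intros)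
      have 2: "z \<in> K" if "x \<in> K" "y \<in> K" "x \<le> z" "z \<le> y" for x y z
        using conv[of x y z] conv[of "x + d" "y + d" "z + d"] that by (auto simp: K_def)
      have 3: "\<exists>p q. p < x \<and> x < q \<and> (\<forall>y\<in>K. p < y \<and> y < q \<longrightarrow> (g d a = g d y \<longleftrightarrow> g d a = g d x))"
        if x: "x \<in> K" for x
      proof -
        have xI: "x \<in> I" "x + d \<in> I" using x by (auto simp: K_def)
        obtain p q \<delta> where pq: "p < x" "x < q" "0 < \<delta>"
          "\<And>e b b'. 0 < e \<and> e < \<delta> \<and> p < b \<and> b < q \<and> p < b' \<and> b' < q \<Longrightarrow> g e b = g e b'"
          using loc[OF xI(1)] by blast
        obtain p' q' \<delta>' where pq': "p' < x + d" "x + d < q'" "0 < \<delta>'"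
          "\<And>e b b'. 0 < e \<and> e < \<delta>' \<and> p' < b \<and> b < q' \<and> p' < b' \<and> b' < q' \<Longrightarrow> g e b = g e b'"
          using loc[OF xI(2)] by blast
        obtain \<epsilon> where \<epsilon>: "0 < \<epsilon>" "\<And>e. 0 < e \<and> e < \<epsilon> \<Longrightarrow> g e x = g e (x + d)"
          using E_all[OF xI] unfolding E_def by blast
        define \<eta> where "\<eta> = min (min (min \<delta> \<delta>') \<epsilon>) (min (x - p) (x + d - p'))"
        have "0 < \<eta>" using pq pq' \<epsilon> by (simp add: \<eta>_def)
        \<comment> \<open>In general \<open>g d (x + e) - g d x = g e (x + d) - g e x\<close>, and
          the right-hand side vanishes for small \<open>e\<close> because the germs at
          \<open>x\<close> and \<open>x + d\<close> agree. To the left of \<open>x\<close> the same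
          identity is used after shifting by \<open>e\<close>.\<close>
        have up: "g d (x + e) = g d x" if e: "0 < e" "e < \<eta>" for e
        proof -
          have "g e x = g e (x + d)" using \<epsilon>(2) e by (simp add: \<eta>_def)
          thus ?thesis by (simp add: g_def algebra_simps)
        qed
        have down: "g d (x - e) = g d x" if e: "0 < e" "e < \<eta>" for e
        proof -
          have lt: "p < x - e" "p' < x + d - e" "x - e < q" "x + d - e < q'"
          proof -
            have "e < x - p" "e < x + d - p'" using e by (simp_all add: \<eta>_def)
            thus "p < x - e" "p' < x + d - e" by (simp_all add: algebra_simps)
            have "x - e < x" "x + d - e < x + d" using e by simp_all
            thus "x - e < q" "x + d - e < q'" using pq(2) pq'(2) by (meson less_trans)+
          qed
          have "g e (x - e) = g e x" using pq(4)[of e "x - e" x] lt pq(1,2) e by (simp add: \<eta>_def)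
          moreover have "g e (x + d - e) = g e (x + d)"
            using pq'(4)[of e "x + d - e" "x + d"] lt pq'(1,2) e by (simp add: \<eta>_def)
          moreover have "g e x = g e (x + d)" using \<epsilon>(2) e by (simp add: \<eta>_def)
          ultimately have "g e (x - e) = g e (x + d - e)" by simp
          thus ?thesis by (simp add: g_def algebra_simps)
        qed
        have "g d y = g d x" if y: "x - \<eta> < y" "y < x + \<eta>" for y
        proof (cases y x rule: linorder_cases)
          case less
          thus ?thesis using down[of "x - y"] y by (simp add: algebra_simps)
        next
          case greater
          thus ?thesis using up[of "y - x"] y by (simp add: algebra_simps)
        qed simp
        hence "\<forall>y\<in>K. x - \<eta> < y \<and> y < x + \<eta> \<longrightarrow> (g d a = g d y \<longleftrightarrow> g d a = g d x)"
          by (intro ballI impI arg_cong[where f = "\<lambda>z. g d a = z"]) blast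
        moreover have "x - \<eta> < x" "x < x + \<eta>" using \<open>0 < \<eta>\<close> by simp_all
        ultimately show ?thesis by blast
      qed
      have "a \<in> K" "b \<in> K" using ab by (simp_all add: K_def)
      from tame_connected[OF 1 2 3 this] show ?thesis by simp
    qed
    show ?thesis unfolding linear_on_def
    proof (intro allI impI)
      fix a e1 e2 assume sub: "{a, a + e1, a + e2, a + e1 + e2} \<subseteq> I"
      show "f a + f (a + e1 + e2) = f (a + e1) + f (a + e2)"
      proof (cases e1 "0 :: 'g" rule: linorder_cases)
        case less
        have "g (- e1) (a + e1) = g (- e1) (a + e1 + e2)"
          using less sub by (intro key) (simp_all add: algebra_simps)
        thus ?thesis by (simp add: g_def algebra_simps)
      next
        case greater
        have "g e1 a = g e1 (a + e2)"
          using greater sub by (intro key) (simp_all add: algebra_simps)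
        thus ?thesis by (simp add: g_def algebra_simps)
      qed simp
    qed
  qed
  ultimately show ?thesis by (intro exI[of _ "Collect bad"]) blast
qed

section \<open>Integer and rational multiples in the value group\<close>

lemma zmul_of_nat: "zmul (int n) x = ((+) x ^^ n) (0::'g)"
  by (simp add: zmul_def)

lemma zmul_minus: "zmul (- n) x = - zmul n (x::'g)"
  by (simp add: zmul_def)

lemma zmul_add_one: "zmul (n + 1) x = zmul n x + (x::'g)"
proof (cases "0 \<le> n")
  case True
  hence "nat (n + 1) = Suc (nat n)" by simp
  thus ?thesis using True by (simp add: zmul_def add.commute)
next
  case False
  hence "nat (- n) = Suc (nat (- (n + 1)))" by simp
  thus ?thesis using False by (cases "n = -1") (simp_all add: zmul_def)
qed

lemma zmul_add: "zmul (m + n) x = zmul m x + zmul n (x::'g)"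
proof (induction n rule: int_induct[where k = 0])
  case base
  show ?case by (simp add: zmul_def)
next
  case (step1 i)
  thus ?case using zmul_add_one[of "m + i" x] zmul_add_one[of i x] by (simp add: algebra_simps)
next
  case (step2 i)
  thus ?case using zmul_add_one[of "m + (i - 1)" x] zmul_add_one[of "i - 1" x] by (simp add: algebra_simps)
qed

lemma zmul_mult: "zmul (m * n) x = zmul m (zmul n (x::'g))"
proof (induction m rule: int_induct[where k = 0])
  case base
  show ?case by (simp add: zmul_def)
next
  case (step1 i)
  thus ?case using zmul_add_one[of i] by (simp add: distrib_right zmul_add)
next
  case (step2 i)
  thus ?case using zmul_add_one[of "i - 1" "zmul n x"] zmul_add[of "(i - 1) * n" n x]
    by (simp add: algebra_simps)
qed

lemma zmul_add_right: "zmul n (x + y) = zmul n x + zmul n (y::'g)"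
proof (induction n rule: int_induct[where k = 0])
  case base
  show ?case by (simp add: zmul_def)
next
  case (step1 i)
  thus ?case
    using zmul_add_one[of i "x + y"] zmul_add_one[of i x] zmul_add_one[of i y] by (simp add: algebra_simps)
next
  case (step2 i)
  thus ?case
    using zmul_add_one[of "i - 1" "x + y"] zmul_add_one[of "i - 1" x] zmul_add_one[of "i - 1" y]
    by (simp add: algebra_simps)
qed

lemma zmul_pos: "0 < n \<Longrightarrow> 0 < x \<Longrightarrow> 0 < zmul n (x::'g)"
proof (induction n rule: int_gr_induct[where k = 0])
  case base
  thus ?case using zmul_add_one[of 0 x] by (simp add: zmul_def)
next
  case (step i)
  thus ?case by (simp add: zmul_add_one add_pos_pos)
qed

lemma zmul_zero_right: "zmul n (0::'g) = 0"
  using zmul_add_right[of n 0 0] by simp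

lemma zmul_neg_right: "zmul n (- x) = - zmul n (x::'g)"
  using zmul_add_right[of n x "- x"] zmul_zero_right[of n] by (simp add: eq_neg_iff_add_eq_0 add.commute)

lemma zmul_eq_0:
  assumes "zmul n (x::'g) = 0" "n \<noteq> 0" shows "x = 0"
proof -
  have *: "x = 0" if "zmul n x = 0" "0 < n" for n and x :: 'g
  proof (rule ccontr)
    assume "x \<noteq> 0"
    then consider "0 < x" | "0 < - x" unfolding neq_iff by auto
    thus False
      using zmul_pos[OF that(2), of x] zmul_pos[OF that(2), of "- x"] that(1) zmul_neg_right[of n x] by cases auto
  qed
  show ?thesis
  proof (cases "0 < n")
    case False
    thus ?thesis using *[of "- n" x] assms zmul_minus[of n x] by simp
  qed (use * assms in blast)
qed

lemma zmul_inj: "zmul n x = zmul n (y::'g) \<Longrightarrow> n \<noteq> 0 \<Longrightarrow> x = y"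
  using zmul_eq_0[of n "x - y"] zmul_add_right[of n x "- y"] zmul_neg_right[of n y] by simp

lemma zmul_divisible:
  assumes "n \<noteq> 0" shows "\<exists>y. zmul n y = (x::'g)"
proof -
  have *: "\<exists>y. zmul n y = x" if "0 < n" for n and x :: 'g
  proof -
    obtain z where z: "z \<noteq> 0" "v z = x" using v_surj by blast
    obtain y where y: "y ^ nat n = z" using nth_root_exists[of "nat n" z] \<open>0 < n\<close> by auto
    have "y \<noteq> 0" using y z \<open>0 < n\<close> by auto
    have "zmul (int (nat n)) (v y) = v (y ^ nat n)" unfolding zmul_of_nat using v_power[OF \<open>y \<noteq> 0\<close>] by simp
    thus ?thesis using y z \<open>0 < n\<close> by auto
  qed
  show ?thesis
  proof (cases "0 < n")
    case False
    hence "0 < - n" using assms by simp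
    from *[OF this, of "- x"] show ?thesis by (auto simp: zmul_minus)
  qed (rule *)
qed

lemma qmul_eq: "zmul (snd (quotient_of q)) (qmul q x) = zmul (fst (quotient_of q)) (x::'g)"
proof -
  have pos: "snd (quotient_of q) \<noteq> 0" by (metis quotient_of_denom_pos' less_irrefl)
  have "\<exists>!y. zmul (snd (quotient_of q)) y = zmul (fst (quotient_of q)) x"
    using zmul_divisible[OF pos] zmul_inj[OF _ pos] by metis
  thus ?thesis unfolding qmul_def by (rule theI')
qed

text \<open>Since \<open>qmul\<close> is defined through the reduced fraction, the given
  coefficients \<open>A\<close> and \<open>B\<close> have to be compared with it; cancellation is
  possible because the value group is torsion-free.\<close>

lemma rational_slope_of_linear_relation:
  assumes I: "open_interval I" and B: "B \<noteq> 0"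
    and rel: "\<And>x. x \<in> I \<Longrightarrow> zmul B (f x) = zmul A x + (c::'g)"
  shows "rational_slope {(x, f x) | x. x \<in> I}"
proof -
  define q where "q = Fract A B"
  obtain p r where pr: "quotient_of q = (p, r)" by (cases "quotient_of q")
  have r: "r > 0" using quotient_of_denom_pos[OF pr] .
  have "Fract A B = Fract p r" using quotient_of_div[OF pr] by (simp add: q_def Fract_of_int_quotient)
  hence pB: "A * r = p * B" using B r by (simp add: eq_rat)
  obtain c' where c': "zmul B c' = c" using zmul_divisible[OF B] by blast
  have "f x = qmul q x + c'" if "x \<in> I" for x
  proof -
    have y: "zmul r (qmul q x) = zmul p x" using qmul_eq[of q x] pr by simp
    have "zmul r (zmul B (qmul q x)) = zmul B (zmul r (qmul q x))"
      by (simp only: zmul_mult[symmetric] mult.commute)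
    also have "\<dots> = zmul (A * r) x" unfolding y pB by (simp only: zmul_mult[symmetric] mult.commute)
    also have "\<dots> = zmul r (zmul A x)" by (simp only: zmul_mult[symmetric] mult.commute)
    finally have e: "zmul r (zmul B (qmul q x)) = zmul r (zmul A x)" .
    have "zmul B (qmul q x) = zmul A x" using zmul_inj[OF e] r by simp
    hence "zmul B (f x) = zmul B (qmul q x + c')" using rel[OF that] c' by (simp add: zmul_add_right)
    thus ?thesis using B by (rule zmul_inj)
  qed
  hence "(\<lambda>x. (x, f x)) ` I = (\<lambda>x. (x, qmul q x + c')) ` I" by (intro image_cong) simp_all
  hence "{(x, f x) | x. x \<in> I} = {(x, qmul q x + c') | x. x \<in> I}" by (simp only: Setcompr_eq_image)
  thus ?thesis using I unfolding rational_slope_def by blast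
qed

end

section \<open>Quantifier elimination for the residue field\<close>

lemma set_eq_insert_remove1: "x \<in> set xs \<Longrightarrow> set xs = insert x (set (remove1 x xs))"
  by (induction xs) auto

context C_min_ACVF
begin

text \<open>Residues are handled through integral representatives, with infinitesimal difference in
  place of equality. Polynomial algebra over the residue field then takes place in \<open>'m\<close>
  itself.\<close>

definition integral :: "'m \<Rightarrow> bool" where
  "integral x \<longleftrightarrow> x = 0 \<or> 0 \<le> v x"

definition infsml :: "'m \<Rightarrow> bool" where
  "infsml x \<longleftrightarrow> x = 0 \<or> 0 < v x"

section \<open>Integral and infinitesimal elements\<close>

lemma infsml_integral: "infsml x \<Longrightarrow> integral x"
  unfolding infsml_def integral_def by auto

lemma infsml_0 [simp]: "infsml 0" and integral_0 [simp]: "integral 0"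
  and not_infsml_1 [simp]: "\<not> infsml 1" and integral_1 [simp]: "integral 1"
  by (simp_all add: infsml_def integral_def)

lemma infsml_add: "infsml x \<Longrightarrow> infsml y \<Longrightarrow> infsml (x + y)"
  using valuation_add_gt[OF val, of x 0 y] unfolding infsml_def by blast

lemma infsml_minus [simp]: "infsml (- x) = infsml x"
  unfolding infsml_def by (simp add: v_minus)

lemma infsml_diff: "infsml x \<Longrightarrow> infsml y \<Longrightarrow> infsml (x - y)"
  using infsml_add[of x "- y"] by simp

lemma integral_minus [simp]: "integral (- x) = integral x"
  unfolding integral_def by (simp add: v_minus)

lemma integral_add:
  assumes "integral x" "integral y" shows "integral (x + y)"
proof (cases "x = 0 \<or> y = 0 \<or> x + y = 0")
  case False
  hence "min (v x) (v y) \<le> v (x + y)" using val unfolding valuation_def by blast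
  moreover have "0 \<le> min (v x) (v y)" using assms False unfolding integral_def by simp
  ultimately show ?thesis unfolding integral_def by (meson order_trans)
qed (use assms in \<open>auto simp: integral_def\<close>)

lemma integral_diff: "integral x \<Longrightarrow> integral y \<Longrightarrow> integral (x - y)"
  using integral_add[of x "- y"] by simp

lemma integral_mult: "integral x \<Longrightarrow> integral y \<Longrightarrow> integral (x * y)"
  unfolding integral_def by (cases "x = 0"; cases "y = 0") (auto simp: v_mult)

lemma infsml_mult: "infsml x \<Longrightarrow> integral y \<Longrightarrow> infsml (x * y)"
  unfolding integral_def infsml_def by (cases "x = 0"; cases "y = 0") (auto simp: v_mult add_pos_nonneg)

lemma infsml_mult': "integral x \<Longrightarrow> infsml y \<Longrightarrow> infsml (x * y)"
  using infsml_mult[of y x] by (simp add: mult.commute)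

lemma integral_power: "integral x \<Longrightarrow> integral (x ^ n)"
  by (induction n) (auto intro: integral_mult)

lemma infsml_prime: "integral x \<Longrightarrow> integral y \<Longrightarrow> infsml (x * y) \<longleftrightarrow> infsml x \<or> infsml y"
proof
  assume *: "integral x" "integral y" "infsml (x * y)"
  show "infsml x \<or> infsml y"
  proof (rule ccontr)
    assume "\<not> ?thesis"
    hence "x \<noteq> 0" "y \<noteq> 0" "v x = 0" "v y = 0" using * unfolding integral_def infsml_def by auto
    thus False using *(3) unfolding infsml_def by (simp add: v_mult)
  qed
qed (auto intro: infsml_mult infsml_mult')

lemma infsml_power: "integral x \<Longrightarrow> infsml (x ^ n) \<longleftrightarrow> infsml x \<and> n > 0"
  by (induction n) (auto simp: infsml_prime integral_power)

lemma integral_sum: "(\<And>i. i \<in> A \<Longrightarrow> integral (f i)) \<Longrightarrow> integral (sum f A)"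
  by (induction A rule: infinite_finite_induct) (auto intro: integral_add)

lemma infsml_sum: "(\<And>i. i \<in> A \<Longrightarrow> infsml (f i)) \<Longrightarrow> infsml (sum f A)"
  by (induction A rule: infinite_finite_induct) (auto intro: infsml_add)

lemma infsml_cong: "infsml (x - y) \<Longrightarrow> infsml x \<longleftrightarrow> infsml y"
  using infsml_add[of "x - y" y] infsml_diff[of x "x - y"] by auto

definition unit_elt :: "'m \<Rightarrow> bool" where
  "unit_elt x \<longleftrightarrow> x \<noteq> 0 \<and> v x = 0"

lemma unit_elt_iff: "unit_elt x \<longleftrightarrow> integral x \<and> \<not> infsml x"
  unfolding unit_elt_def integral_def infsml_def by auto

lemma unit_elt_mult: "unit_elt x \<Longrightarrow> unit_elt y \<Longrightarrow> unit_elt (x * y)"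
  unfolding unit_elt_def by (simp add: v_mult)

lemma unit_elt_power: "unit_elt x \<Longrightarrow> unit_elt (x ^ n)"
  by (induction n) (auto simp: unit_elt_mult unit_elt_def[of 1])

lemma rv_unit_eq: "unit_elt x \<Longrightarrow> unit_elt y \<Longrightarrow> rv v x = rv v y \<longleftrightarrow> infsml (x - y)"
  unfolding rv_eq_iff unit_elt_def infsml_def by auto

section \<open>Polynomials over the valuation ring and their reductions\<close>

definition integral_poly :: "'m poly \<Rightarrow> bool" where
  "integral_poly p \<longleftrightarrow> (\<forall>i. integral (coeff p i))"

definition infsml_poly :: "'m poly \<Rightarrow> bool" where
  "infsml_poly p \<longleftrightarrow> (\<forall>i. infsml (coeff p i))"

lemma integral_poly_mult: "integral_poly p \<Longrightarrow> integral_poly q \<Longrightarrow> integral_poly (p * q)"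
  unfolding integral_poly_def coeff_mult by (intro allI integral_sum integral_mult) auto

lemma infsml_poly_mult: "infsml_poly p \<Longrightarrow> integral_poly q \<Longrightarrow> infsml_poly (p * q)"
  unfolding integral_poly_def infsml_poly_def coeff_mult by (intro allI infsml_sum infsml_mult) auto

lemma infsml_poly_mult': "integral_poly p \<Longrightarrow> infsml_poly q \<Longrightarrow> infsml_poly (p * q)"
  using infsml_poly_mult[of q p] by (simp add: mult.commute)

lemma integral_poly_add: "integral_poly p \<Longrightarrow> integral_poly q \<Longrightarrow> integral_poly (p + q)"
  unfolding integral_poly_def by (simp add: integral_add)

lemma integral_poly_diff: "integral_poly p \<Longrightarrow> integral_poly q \<Longrightarrow> integral_poly (p - q)"
  unfolding integral_poly_def by (simp add: integral_diff)

lemma infsml_poly_add: "infsml_poly p \<Longrightarrow> infsml_poly q \<Longrightarrow> infsml_poly (p + q)"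
  unfolding infsml_poly_def by (simp add: infsml_add)

lemma integral_poly_smult: "integral c \<Longrightarrow> integral_poly p \<Longrightarrow> integral_poly (smult c p)"
  unfolding integral_poly_def by (simp add: integral_mult)

lemma infsml_poly_smult: "integral c \<Longrightarrow> infsml_poly p \<Longrightarrow> infsml_poly (smult c p)"
  unfolding infsml_poly_def by (simp add: infsml_mult')

lemma integral_poly_pCons [simp]: "integral_poly (pCons a p) \<longleftrightarrow> integral a \<and> integral_poly p"
  unfolding integral_poly_def by (metis coeff_pCons_0 coeff_pCons_Suc not0_implies_Suc)

lemma infsml_poly_pCons [simp]: "infsml_poly (pCons a p) \<longleftrightarrow> infsml a \<and> infsml_poly p"
  unfolding infsml_poly_def by (metis coeff_pCons_0 coeff_pCons_Suc not0_implies_Suc)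

lemma integral_poly_0 [simp]: "integral_poly 0" and infsml_poly_0 [simp]: "infsml_poly 0"
  by (simp_all add: integral_poly_def infsml_poly_def)

lemma integral_poly_monom: "integral c \<Longrightarrow> integral_poly (monom c n)"
  unfolding integral_poly_def by simp

lemma poly_integral: "integral_poly p \<Longrightarrow> integral x \<Longrightarrow> integral (poly p x)"
  unfolding integral_poly_def poly_altdef by (intro integral_sum integral_mult integral_power) auto

lemma poly_infsml: "infsml_poly p \<Longrightarrow> integral x \<Longrightarrow> infsml (poly p x)"
  unfolding infsml_poly_def poly_altdef by (intro infsml_sum infsml_mult integral_power) auto

lemma integral_linear_division:
  assumes "integral_poly q" "integral a"
  shows "\<exists>u. integral_poly u \<and> q = [:- a, 1:] * u + [:poly q a:] \<and> degree u \<le> degree q - 1"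
  using assms(1)
proof (induction q)
  case 0
  show ?case by (intro exI[of _ 0]) simp
next
  case (pCons c q)
  then obtain u where u: "integral_poly u" "q = [:- a, 1:] * u + [:poly q a:]" "degree u \<le> degree q - 1"
    by auto
  have "pCons c q = [:- a, 1:] * pCons (poly q a) u + [:poly (pCons c q) a:]"
    by (subst u(2)) (simp add: algebra_simps)
  moreover have "integral_poly (pCons (poly q a) u)"
    using pCons.prems u(1) assms(2) by (simp add: poly_integral)
  moreover have "degree (pCons (poly q a) u) \<le> degree (pCons c q) - 1"
  proof (cases "u = 0")
    case False
    hence "q \<noteq> 0 \<and> degree q \<ge> 1"
    proof -
      have "degree q = degree ([:- a, 1:] * u)"
        using False by (subst u(2)) (simp add: degree_add_eq_left degree_mult_eq del: mult_pCons_left)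
      thus ?thesis using False by (auto simp: degree_mult_eq simp del: mult_pCons_left)
    qed
    moreover from this have "Suc (degree u) \<le> degree q" using u(3) by linarith
    ultimately show ?thesis using False by simp
  qed simp
  ultimately show ?case by blast
qed

text \<open>The usual induction for the nonzero reduction of \<open>q\<close>: a root
  \<open>a\<close> splits off the factor \<open>X - a\<close> up to the infinitesimal constant
  \<open>poly q a\<close>, and any other root is a root of the cofactor because infinitesimals form
  a prime ideal.\<close>

lemma finite_infsml_roots:
  assumes "integral_poly q" "\<not> infsml_poly q"
  shows "finite (rv v ` {x. unit_elt x \<and> infsml (poly q x)}) \<and>
    card (rv v ` {x. unit_elt x \<and> infsml (poly q x)}) \<le> degree q"
  using assms
proof (induction "degree q" arbitrary: q rule: less_induct)
  case less
  show ?case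
  proof (cases "\<exists>a. unit_elt a \<and> infsml (poly q a)")
    case True
    then obtain a where a: "unit_elt a" "infsml (poly q a)" by blast
    hence ia: "integral a" by (simp add: unit_elt_iff)
    obtain u where u: "integral_poly u" "q = [:- a, 1:] * u + [:poly q a:]" "degree u \<le> degree q - 1"
      using integral_linear_division[OF less.prems(1) ia] by blast
    have mp: "infsml_poly [:poly q a:]" using a(2) by simp
    have nu: "\<not> infsml_poly u"
    proof
      assume "infsml_poly u"
      hence "infsml_poly ([:- a, 1:] * u)" using ia by (intro infsml_poly_mult') auto
      hence "infsml_poly ([:- a, 1:] * u + [:poly q a:])" using mp by (rule infsml_poly_add)
      thus False using less.prems(2) u(2) by simp
    qed
    have "degree q \<noteq> 0"
    proof
      assume "degree q = 0"
      then obtain c where "q = [:c:]" by (rule degree_eq_zeroE)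
      thus False using a(2) less.prems(2) by simp
    qed
    hence "degree u < degree q" using u(3) by linarith
    hence fin: "finite (rv v ` {x. unit_elt x \<and> infsml (poly u x)})"
      "card (rv v ` {x. unit_elt x \<and> infsml (poly u x)}) \<le> degree u" using less.hyps u(1) nu by blast+
    have sub: "rv v ` {x. unit_elt x \<and> infsml (poly q x)} \<subseteq> insert (rv v a) (rv v ` {x. unit_elt x \<and> infsml (poly u x)})"
    proof (rule image_subsetI)
      fix x assume "x \<in> {x. unit_elt x \<and> infsml (poly q x)}"
      hence x: "unit_elt x" "infsml (poly q x)" by auto
      hence ix: "integral x" by (simp add: unit_elt_iff)
      have "poly q x = (x - a) * poly u x + poly q a"
        by (subst u(2)) (simp add: algebra_simps)
      hence "infsml ((x - a) * poly u x)" using infsml_diff[OF x(2) a(2)] by simp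
      hence "infsml (x - a) \<or> infsml (poly u x)"
        using ix ia u(1) by (subst (asm) infsml_prime) (auto intro: integral_diff poly_integral)
      thus "rv v x \<in> insert (rv v a) (rv v ` {x. unit_elt x \<and> infsml (poly u x)})"
        using rv_unit_eq[OF x(1) a(1)] x(1) by auto
    qed
    have "card (insert (rv v a) (rv v ` {x. unit_elt x \<and> infsml (poly u x)})) \<le> Suc (degree u)"
      using card_insert_le_m1[of "Suc (degree u)" "rv v ` {x. unit_elt x \<and> infsml (poly u x)}" "rv v a"] fin(2) by simp
    thus ?thesis using sub fin(1) \<open>degree u < degree q\<close>
      by (meson Suc_leI card_mono finite.insertI finite_subset le_trans)
  next
    case False
    hence "{x. unit_elt x \<and> infsml (poly q x)} = {}" by blast
    thus ?thesis by (simp only: image_empty finite.emptyI card.empty le0 simp_thms)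
  qed
qed

lemma exists_unit_nonroot:
  assumes "integral_poly q" "\<not> infsml_poly q" "finite F"
  shows "\<exists>x. unit_elt x \<and> \<not> infsml (poly q x) \<and> rv v x \<notin> F"
proof -
  obtain x where "x \<noteq> 0" "v x = 0" "rv v x \<notin> F \<union> rv v ` {x. unit_elt x \<and> infsml (poly q x)}"
    using avoid_rv[of "F \<union> rv v ` {x. unit_elt x \<and> infsml (poly q x)}" 0] finite_infsml_roots[OF assms(1,2)] assms(3)
    by blast
  thus ?thesis unfolding unit_elt_def by blast
qed

text \<open>If \<open>a\<close> were not integral, then \<open>b = 1 / a\<close> would be
  infinitesimal, and multiplying the equation by \<open>b ^ degree p\<close> would express the
  leading coefficient by infinitesimals.\<close>

lemma root_integral:
  assumes p: "integral_poly p" and lc: "\<not> infsml (lead_coeff p)" and a: "poly p a = 0"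
  shows "integral a"
proof (rule ccontr)
  assume na: "\<not> integral a"
  define b where "b = 1 / a"
  have a0: "a \<noteq> 0" and "v a < 0" using na by (auto simp: integral_def)
  hence "v b > 0" using v_divide[of 1 a] by (simp add: b_def)
  hence b: "infsml b" unfolding infsml_def by blast
  let ?d = "degree p"
  have "0 = b ^ ?d * (\<Sum>i\<le>?d. coeff p i * a ^ i)" using a by (simp add: poly_altdef)
  also have "\<dots> = (\<Sum>i\<le>?d. coeff p i * b ^ (?d - i))"
    unfolding sum_distrib_left
  proof (intro sum.cong refl)
    fix i assume "i \<in> {..?d}"
    hence "b ^ ?d = b ^ (?d - i) * b ^ i" by (simp flip: power_add)
    thus "b ^ ?d * (coeff p i * a ^ i) = coeff p i * b ^ (?d - i)" using a0 by (simp add: b_def power_divide)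
  qed
  also have "\<dots> = lead_coeff p + (\<Sum>i<?d. coeff p i * b ^ (?d - i))"
    by (simp add: lessThan_Suc_atMost[symmetric])
  finally have "lead_coeff p = - (\<Sum>i<?d. coeff p i * b ^ (?d - i))" by (simp add: eq_neg_iff_add_eq_0)
  moreover have "infsml (\<Sum>i<?d. coeff p i * b ^ (?d - i))"
    using p b infsml_integral[OF b] by (intro infsml_sum infsml_mult') (auto simp: integral_poly_def infsml_power)
  ultimately show False using lc by simp
qed

lemma integral_poly_linear_factors:
  "(\<And>a. a \<in> set as \<Longrightarrow> integral a) \<Longrightarrow> integral_poly (\<Prod>a\<leftarrow>as. [:- a, 1:])"
proof (induction as)
  case (Cons a as)
  have "integral_poly ([:- a, 1:] * (\<Prod>a\<leftarrow>as. [:- a, 1:]))"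
    using Cons by (intro integral_poly_mult) auto
  thus ?case by (simp only: list.map prod_list.Cons)
qed (simp add: one_pCons)

text \<open>Modulo infinitesimals \<open>q\<close> is a multiple of each \<open>X - a\<close>.
  Spending one factor \<open>q\<close> on every entry of the list takes care of
  multiplicities.\<close>

lemma power_in_root_ideal:
  assumes q: "integral_poly q" and as: "\<And>a. a \<in> set as \<Longrightarrow> integral a \<and> infsml (poly q a)"
  shows "\<exists>U N. integral_poly U \<and> infsml_poly N \<and> q ^ length as = (\<Prod>a\<leftarrow>as. [:- a, 1:]) * U + N"
  using as
proof (induction as)
  case Nil
  show ?case by (rule exI[of _ 1], rule exI[of _ 0]) (simp add: one_pCons)
next
  case (Cons a as)
  obtain U N where UN: "integral_poly U" "infsml_poly N" "q ^ length as = (\<Prod>a\<leftarrow>as. [:- a, 1:]) * U + N"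
    using Cons by auto
  have a: "integral a" "infsml (poly q a)" using Cons.prems by auto
  obtain u where u: "integral_poly u" "q = [:- a, 1:] * u + [:poly q a:]"
    using integral_linear_division[OF q a(1)] by blast
  let ?P = "\<Prod>a\<leftarrow>as. [:- a, 1:]"
  have P: "integral_poly ?P" using Cons.prems by (intro integral_poly_linear_factors) simp
  have mp: "infsml_poly [:poly q a:]" using a(2) by simp
  define N' where "N' = ?P * U * [:poly q a:] + N * q"
  have "infsml_poly N'" unfolding N'_def
    by (intro infsml_poly_add infsml_poly_mult'[OF integral_poly_mult[OF P UN(1)] mp]
        infsml_poly_mult[OF UN(2) q])
  moreover have "q ^ length (a # as) = (\<Prod>a\<leftarrow>a # as. [:- a, 1:]) * (U * u) + N'"
  proof -
    have "q ^ length (a # as) = q ^ length as * q" by simp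
    also have "\<dots> = ?P * U * q + N * q" by (simp only: UN(3) distrib_right)
    also have "?P * U * q = ?P * U * ([:- a, 1:] * u + [:poly q a:])" using u(2) by simp
    also have "\<dots> = ([:- a, 1:] * ?P) * (U * u) + ?P * U * [:poly q a:]"
      by (simp only: distrib_left mult_ac)
    finally show ?thesis by (simp only: N'_def list.map prod_list.Cons add.assoc)
  qed
  moreover have "integral_poly (U * u)" using UN u by (intro integral_poly_mult)
  ultimately show ?case by blast
qed

text \<open>Uniqueness of division by a monic polynomial over the residue field. If \<open>j\<close>
  is the highest degree at which \<open>W\<close> has a coefficient that is not infinitesimal, then
  coefficient \<open>d + j\<close> of \<open>P * W\<close> equals it up to an infinitesimal.\<close>

lemma monic_mult_not_infsml:
  assumes P: "integral_poly P" "degree P = d" "coeff P d = 1" and W: "integral_poly W"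
    and PW: "\<And>n. n \<ge> d \<Longrightarrow> infsml (coeff (P * W) n)"
  shows "infsml_poly W"
proof (rule ccontr)
  assume "\<not> infsml_poly W"
  then obtain i where i: "\<not> infsml (coeff W i)" unfolding infsml_poly_def by blast
  define j where "j = Max {i. \<not> infsml (coeff W i)}"
  have fin: "finite {i. \<not> infsml (coeff W i)}"
    by (rule finite_subset[of _ "{..degree W}"]) (auto simp: intro!: leI, metis coeff_eq_0 infsml_0)
  have j: "\<not> infsml (coeff W j)" using Max_in[OF fin] i unfolding j_def by blast
  have gt: "infsml (coeff W k)" if "k > j" for k
  proof (rule ccontr)
    assume "\<not> infsml (coeff W k)"
    hence "k \<le> j" using Max_ge[OF fin] unfolding j_def by blast
    thus False using that by simp
  qed
  have "coeff (P * W) (d + j) = (\<Sum>i\<le>d + j. coeff P i * coeff W (d + j - i))" by (rule coeff_mult)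
  also have "\<dots> = coeff P d * coeff W j + (\<Sum>i\<in>{..d + j} - {d}. coeff P i * coeff W (d + j - i))"
    by (subst sum.remove[of _ d]) auto
  finally have eq: "coeff (P * W) (d + j) - (\<Sum>i\<in>{..d + j} - {d}. coeff P i * coeff W (d + j - i)) = coeff W j"
    using P(3) by simp
  have "infsml (\<Sum>i\<in>{..d + j} - {d}. coeff P i * coeff W (d + j - i))"
  proof (rule infsml_sum)
    fix i assume i: "i \<in> {..d + j} - {d}"
    show "infsml (coeff P i * coeff W (d + j - i))"
    proof (cases "i < d")
      case True
      hence "d + j - i > j" by simp
      thus ?thesis using gt P(1) by (intro infsml_mult') (auto simp: integral_poly_def)
    next
      case False
      hence "coeff P i = 0" using i P(2) by (intro coeff_eq_0) auto
      thus ?thesis by simp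
    qed
  qed
  hence "infsml (coeff W j)" using infsml_diff[OF PW[OF le_add1]] eq by metis
  thus False using j by simp
qed

text \<open>
  Over the algebraically closed residue field, \<open>p\<close> has a root that is not a root of \<open>q\<close> iff
  \<open>p\<close> does not divide \<open>q ^ degree p\<close>.
\<close>

lemma root_not_root_iff:
  assumes p: "integral_poly p" "degree p \<le> d" "\<not> infsml (coeff p d)" "d > 0"
    and q: "integral_poly q" and R: "integral_poly R" "\<And>i. i \<ge> d \<Longrightarrow> coeff R i = 0"
    and s: "integral_poly s" and eq: "smult (coeff p d ^ n) (q ^ d) = s * p + R"
  shows "(\<exists>x. integral x \<and> infsml (poly p x) \<and> \<not> infsml (poly q x)) \<longleftrightarrow> \<not> infsml_poly R"
proof
  assume "\<exists>x. integral x \<and> infsml (poly p x) \<and> \<not> infsml (poly q x)"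
  then obtain x where x: "integral x" "infsml (poly p x)" "\<not> infsml (poly q x)" by blast
  have lci: "integral (coeff p d)" using p(1) by (simp add: integral_poly_def)
  have "coeff p d ^ n * poly q x ^ d = poly s x * poly p x + poly R x"
    using arg_cong[OF eq, of "\<lambda>r. poly r x"] by simp
  moreover have "\<not> infsml (coeff p d ^ n * poly q x ^ d)"
    using x p lci q by (simp add: infsml_prime infsml_power integral_power poly_integral)
  moreover have "infsml (poly s x * poly p x)" using s x by (intro infsml_mult' poly_integral)
  ultimately show "\<not> infsml_poly R" using poly_infsml[of R x] x(1) infsml_add by metis
next
  assume nR: "\<not> infsml_poly R"
  show "\<exists>x. integral x \<and> infsml (poly p x) \<and> \<not> infsml (poly q x)"
  proof (rule ccontr)
    assume no: "\<not> ?thesis"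
    let ?c = "coeff p d"
    have c0: "?c \<noteq> 0" using p(3) by auto
    hence deg: "degree p = d" using p(2) le_degree[of p d] by simp
    have lci: "integral ?c" using p(1) by (simp add: integral_poly_def)
    have "p \<noteq> 0" using c0 by auto
    \<comment> \<open>The factorization is taken over the algebraically closed field itself; the
      roots are integral because the leading coefficient is not infinitesimal.\<close>
    then obtain A where A: "size A = degree p" "p = smult (lead_coeff p) (\<Prod>x\<in>#A. [:- x, 1:])"
      using alg_closed_imp_factorization by blast
    obtain as where as: "mset as = A" using ex_mset by blast
    define P where "P = (\<Prod>a\<leftarrow>as. [:- a, 1:])"
    have pP: "p = smult ?c P" using A(2) unfolding P_def as[symmetric] deg
      by (simp add: prod_mset_prod_list flip: mset_map)
    have len: "length as = d" using A(1) as deg by (metis size_mset)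
    have asr: "integral a \<and> infsml (poly q a)" if "a \<in> set as" for a
    proof -
      have "poly P a = 0" unfolding P_def poly_prod_list using that
        by (induction as) auto
      hence "poly p a = 0" by (subst pP) simp
      moreover from this have "integral a" using root_integral[OF p(1)] p(3) deg by simp
      ultimately show ?thesis using no by auto
    qed
    have Pi: "integral_poly P" unfolding P_def using asr by (intro integral_poly_linear_factors) blast
    have degP: "degree P = d" using deg c0 by (subst (asm) pP) simp
    have lcP: "coeff P d = 1"
    proof -
      have "coeff p d = ?c * coeff P d" by (subst pP) simp
      thus ?thesis using c0 by simp
    qed
    have "\<exists>U N. integral_poly U \<and> infsml_poly N \<and> q ^ length as = (\<Prod>a\<leftarrow>as. [:- a, 1:]) * U + N"
      by (rule power_in_root_ideal[OF q]) (rule asr)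
    then obtain U N where UN: "integral_poly U" "infsml_poly N" "q ^ d = P * U + N"
      unfolding P_def[symmetric] len by (elim exE conjE)
    \<comment> \<open>There are two divisions of \<open>smult (?c ^ n) (q ^ d)\<close> by
      \<open>P\<close>: one with infinitesimal remainder, from the common roots, and one with
      remainder \<open>R\<close>. The difference \<open>W\<close> of the quotients must be
      infinitesimal, and therefore \<open>R\<close> as well.\<close>
    define W where "W = smult (?c ^ n) U - smult ?c s"
    have Wi: "integral_poly W" unfolding W_def
      using UN s lci by (intro integral_poly_diff integral_poly_smult integral_power)
    have PW: "P * W = R - smult (?c ^ n) N"
    proof -
      have "s * p = smult ?c (P * s)" by (subst pP) (simp add: mult.commute)
      with eq have "smult (?c ^ n) (P * U + N) = smult ?c (P * s) + R" by (simp only: UN(3))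
      hence "smult (?c ^ n) (P * U) + smult (?c ^ n) N = smult ?c (P * s) + R"
        by (simp only: smult_add_right)
      hence "smult (?c ^ n) (P * U) = smult ?c (P * s) + R - smult (?c ^ n) N"
        by (simp only: eq_diff_eq)
      hence "smult (?c ^ n) (P * U) - smult ?c (P * s) = R - smult (?c ^ n) N" by simp
      moreover have "P * W = smult (?c ^ n) (P * U) - smult ?c (P * s)"
        unfolding W_def by (simp only: right_diff_distrib mult_smult_right)
      ultimately show ?thesis by (simp only:)
    qed
    have N': "infsml_poly (smult (?c ^ n) N)" using UN(2) lci by (intro infsml_poly_smult integral_power)
    have "infsml_poly W"
    proof (rule monic_mult_not_infsml[OF Pi degP lcP Wi])
      fix m assume "m \<ge> d"
      thus "infsml (coeff (P * W) m)" unfolding PW using N' R(2) by (simp add: infsml_poly_def)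
    qed
    hence "infsml_poly (P * W + smult (?c ^ n) N)" using Pi N' by (intro infsml_poly_add infsml_poly_mult')
    thus False using nR unfolding PW by simp
  qed
qed

section \<open>Polynomial functions and families of polynomials\<close>

inductive polyfun :: "((nat \<Rightarrow> 'm) \<Rightarrow> 'm) \<Rightarrow> bool" where
  var: "polyfun (\<lambda>e. e i)"
| const: "integral c \<Longrightarrow> polyfun (\<lambda>e. c)"
| add: "polyfun p \<Longrightarrow> polyfun q \<Longrightarrow> polyfun (\<lambda>e. p e + q e)"
| mult: "polyfun p \<Longrightarrow> polyfun q \<Longrightarrow> polyfun (\<lambda>e. p e * q e)"

lemma polyfun_minus: "polyfun p \<Longrightarrow> polyfun (\<lambda>e. - p e)"
  using polyfun.mult[OF polyfun.const[of "- 1"], of p] by simp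

lemma polyfun_diff: "polyfun p \<Longrightarrow> polyfun q \<Longrightarrow> polyfun (\<lambda>e. p e - q e)"
  using polyfun.add[OF _ polyfun_minus, of p q] by simp

lemma polyfun_sum: "(\<And>i. i \<in> A \<Longrightarrow> polyfun (p i)) \<Longrightarrow> polyfun (\<lambda>e. \<Sum>i\<in>A. p i e)"
  by (induction A rule: infinite_finite_induct) (auto intro: polyfun.intros)

lemma polyfun_integral: "polyfun p \<Longrightarrow> (\<And>i. integral (e i)) \<Longrightarrow> integral (p e)"
  by (induction rule: polyfun.induct) (auto intro: integral_add integral_mult)

lemma polyfun_subst: "polyfun p \<Longrightarrow> (\<And>i. polyfun (t i)) \<Longrightarrow> polyfun (\<lambda>e. p (\<lambda>i. t i e))"
  by (induction rule: polyfun.induct) (auto intro: polyfun.intros)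

lemma defterm_polyfun: "polyfun p \<Longrightarrow> defterm p"
  by (induction rule: polyfun.induct) (auto intro: def_intros)

text \<open>A polynomial in the variable to be eliminated whose coefficients are polynomial in the
  remaining ones. Only a bound on the degree is recorded, since the actual degree varies with the
  environment.\<close>

definition polyfam :: "nat \<Rightarrow> ((nat \<Rightarrow> 'm) \<Rightarrow> 'm poly) \<Rightarrow> bool" where
  "polyfam d F \<longleftrightarrow> (\<forall>i. polyfun (\<lambda>e. coeff (F e) i)) \<and> (\<forall>e. degree (F e) \<le> d)"

lemma polyfam_coeff: "polyfam d F \<Longrightarrow> polyfun (\<lambda>e. coeff (F e) i)"
  unfolding polyfam_def by blast

lemma polyfam_degree: "polyfam d F \<Longrightarrow> degree (F e) \<le> d"
  unfolding polyfam_def by blast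

lemma polyfam_mono: "polyfam d F \<Longrightarrow> d \<le> d' \<Longrightarrow> polyfam d' F"
  unfolding polyfam_def using le_trans by blast

lemma polyfam_add: "polyfam d F \<Longrightarrow> polyfam d' G \<Longrightarrow> polyfam (max d d') (\<lambda>e. F e + G e)"
  unfolding polyfam_def coeff_add
  by (intro conjI allI polyfun.add order_trans[OF degree_add_le_max max.mono]) blast+

lemma polyfam_diff: "polyfam d F \<Longrightarrow> polyfam d' G \<Longrightarrow> polyfam (max d d') (\<lambda>e. F e - G e)"
  unfolding polyfam_def coeff_diff
  by (intro conjI allI polyfun_diff order_trans[OF degree_diff_le_max max.mono]) blast+

lemma polyfam_mult: "polyfam d F \<Longrightarrow> polyfam d' G \<Longrightarrow> polyfam (d + d') (\<lambda>e. F e * G e)"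
  unfolding polyfam_def coeff_mult
  by (auto intro!: polyfun_sum polyfun.mult order_trans[OF degree_mult_le] add_mono)

lemma polyfam_monom:
  assumes "polyfun c" shows "polyfam n (\<lambda>e. monom (c e) n)"
proof -
  have "polyfun (\<lambda>e. coeff (monom (c e) n) i)" for i
    using assms polyfun.const[OF integral_0] by (cases "n = i") simp_all
  thus ?thesis unfolding polyfam_def by (simp add: degree_monom_le)
qed

lemma polyfam_const: "polyfun c \<Longrightarrow> polyfam 0 (\<lambda>e. [:c e:])"
  using polyfam_monom[of c 0] by (simp add: monom_0)

lemma polyfam_smult: "polyfun c \<Longrightarrow> polyfam d F \<Longrightarrow> polyfam d (\<lambda>e. smult (c e) (F e))"
  unfolding polyfam_def by (auto intro: polyfun.mult order_trans[OF degree_smult_le])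

lemma polyfam_power: "polyfam d F \<Longrightarrow> polyfam (n * d) (\<lambda>e. F e ^ n)"
proof (induction n)
  case 0
  show ?case using polyfam_const[OF polyfun.const[of 1]] by (simp add: one_pCons)
next
  case (Suc n)
  thus ?case using polyfam_mult[of d F "n * d" "\<lambda>e. F e ^ n"] by simp
qed

lemma polyfam_integral: "polyfam d F \<Longrightarrow> (\<And>i. integral (e i)) \<Longrightarrow> integral_poly (F e)"
  unfolding integral_poly_def using polyfam_coeff polyfun_integral by blast

lemma polyfam_reduce:
  assumes "polyfam d F" "\<And>e. coeff (F e) d = 0" "0 < d" shows "polyfam (d - 1) F"
proof -
  have "degree (F e) \<le> d - 1" for e
  proof (rule degree_le, intro allI impI)
    fix i assume "d - 1 < i"
    show "coeff (F e) i = 0"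
    proof (cases "i = d")
      case False
      hence "degree (F e) < i" using polyfam_degree[OF assms(1), of e] \<open>d - 1 < i\<close> by linarith
      thus ?thesis by (rule coeff_eq_0)
    qed (use assms(2) in simp)
  qed
  thus ?thesis using assms(1) unfolding polyfam_def by blast
qed

lemma polyfam_of_polyfun:
  "polyfun p \<Longrightarrow> \<exists>F d. polyfam d F \<and> (\<forall>x e. p (case_nat x e) = poly (F e) x)"
proof (induction rule: polyfun.induct)
  case (var i)
  show ?case
  proof (cases i)
    case 0
    have "polyfam 1 (\<lambda>e. monom 1 1)" by (intro polyfam_monom polyfun.const) simp
    thus ?thesis using 0 by (intro exI[of _ "\<lambda>e. monom 1 1"] exI[of _ "1::nat"]) (simp add: poly_monom)
  next
    case (Suc j)
    have "polyfam 0 (\<lambda>e. [:e j:])" by (intro polyfam_const polyfun.var)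
    thus ?thesis using Suc by (intro exI[of _ "\<lambda>e. [:e j:]"] exI[of _ "0::nat"]) simp
  qed
next
  case (const c)
  hence "polyfam 0 (\<lambda>e. [:c:])" by (intro polyfam_const polyfun.const)
  thus ?case by (intro exI[of _ "\<lambda>e. [:c:]"] exI[of _ "0::nat"]) simp
next
  case (add p q)
  then obtain F d G d' where "polyfam d F" "\<forall>x e. p (case_nat x e) = poly (F e) x"
    "polyfam d' G" "\<forall>x e. q (case_nat x e) = poly (G e) x" by blast
  thus ?case using polyfam_add[of d F d' G]
    by (intro exI[of _ "\<lambda>e. F e + G e"] exI[of _ "max d d'"]) simp
next
  case (mult p q)
  then obtain F d G d' where "polyfam d F" "\<forall>x e. p (case_nat x e) = poly (F e) x"
    "polyfam d' G" "\<forall>x e. q (case_nat x e) = poly (G e) x" by blast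
  thus ?case using polyfam_mult[of d F d' G]
    by (intro exI[of _ "\<lambda>e. F e * G e"] exI[of _ "d + d'"]) simp
qed

definition integral_env :: "(nat \<Rightarrow> 'm) \<Rightarrow> bool" where
  "integral_env e \<longleftrightarrow> (\<forall>i. integral (e i))"

lemma polyfun_env: "polyfun p \<Longrightarrow> integral_env e \<Longrightarrow> integral (p e)"
  unfolding integral_env_def using polyfun_integral by blast

lemma polyfam_env: "polyfam d F \<Longrightarrow> integral_env e \<Longrightarrow> integral_poly (F e)"
  unfolding integral_env_def using polyfam_integral by blast

text \<open>Constructible conditions on tuples of residues, given by representatives.\<close>

inductive constructible :: "((nat \<Rightarrow> 'm) \<Rightarrow> bool) \<Rightarrow> bool" where
  atom: "polyfun p \<Longrightarrow> constructible (\<lambda>e. infsml (p e))"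
| neg: "constructible Q \<Longrightarrow> constructible (\<lambda>e. \<not> Q e)"
| conj: "constructible Q \<Longrightarrow> constructible Q' \<Longrightarrow> constructible (\<lambda>e. Q e \<and> Q' e)"
| equiv: "constructible Q \<Longrightarrow> (\<And>e. integral_env e \<Longrightarrow> Q' e \<longleftrightarrow> Q e) \<Longrightarrow> constructible Q'"

section \<open>Elimination of an existential quantifier\<close>

lemma constructible_disj: "constructible Q \<Longrightarrow> constructible Q' \<Longrightarrow> constructible (\<lambda>e. Q e \<or> Q' e)"
  by (rule constructible.equiv[OF constructible.neg[OF constructible.conj[OF constructible.neg constructible.neg]]]) auto

lemma constructible_True: "constructible (\<lambda>e. True)"
  by (rule constructible.equiv[OF constructible.atom[OF polyfun.const[of 0]]]) auto

lemma constructible_ball: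
  "finite A \<Longrightarrow> (\<And>i. i \<in> A \<Longrightarrow> constructible (Q i)) \<Longrightarrow> constructible (\<lambda>e. \<forall>i\<in>A. Q i e)"
proof (induction A rule: finite_induct)
  case (insert a A)
  have "constructible (\<lambda>e. Q a e \<and> (\<forall>i\<in>A. Q i e))" using insert by (intro constructible.conj) auto
  thus ?case by simp
qed (simp add: constructible_True)

lemma constructible_bex:
  "finite A \<Longrightarrow> (\<And>i. i \<in> A \<Longrightarrow> constructible (Q i)) \<Longrightarrow> constructible (\<lambda>e. \<exists>i\<in>A. Q i e)"
  using constructible.neg[OF constructible_ball[of A "\<lambda>i e. \<not> Q i e"]] constructible.neg by simp

lemma constructible_infsml_poly:
  assumes "polyfam d F" shows "constructible (\<lambda>e. infsml_poly (F e))"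
proof (rule constructible.equiv)
  show "constructible (\<lambda>e. \<forall>i\<in>{..d}. infsml (coeff (F e) i))"
    by (intro constructible_ball constructible.atom polyfam_coeff[OF assms]) simp
  show "infsml_poly (F e) \<longleftrightarrow> (\<forall>i\<in>{..d}. infsml (coeff (F e) i))" for e
  proof -
    have "coeff (F e) i = 0" if "i > d" for i
      using polyfam_degree[OF assms, of e] that by (intro coeff_eq_0) simp
    thus ?thesis unfolding infsml_poly_def by (metis atMost_iff infsml_0 not_le)
  qed
qed

text \<open>Instead of dividing by the coefficient of degree \<open>d\<close>, the dividend is
  multiplied by it at each step. The remainder is therefore polynomial in the environment, also
  where this coefficient vanishes.\<close>

lemma pseudo_remainder:
  assumes p: "polyfam d p" "0 < d"
  shows "polyfam D F \<Longrightarrow> \<exists>R. polyfam (d - 1) R \<and>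
    (\<forall>e. integral_env e \<longrightarrow> (\<exists>n s. integral_poly s \<and> smult (coeff (p e) d ^ n) (F e) = s * p e + R e))"
proof (induction D arbitrary: F rule: less_induct)
  case (less D)
  show ?case
  proof (cases "D < d")
    case True
    hence "polyfam (d - 1) F" using polyfam_mono[OF less.prems] True by simp
    moreover have "\<exists>n s. integral_poly s \<and> smult (coeff (p e) d ^ n) (F e) = s * p e + F e" for e
      by (rule exI[of _ 0], rule exI[of _ 0]) simp
    ultimately show ?thesis by blast
  next
    case False
    define G where "G e = smult (coeff (p e) d) (F e) - monom (coeff (F e) D) (D - d) * p e" for e
    have "polyfam D G"
    proof -
      have "polyfam (max D (D - d + d)) G" unfolding G_def
        by (intro polyfam_diff polyfam_smult polyfam_mult polyfam_monom polyfam_coeff[OF p(1)]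
            polyfam_coeff[OF less.prems] less.prems p(1))
      thus ?thesis using False by simp
    qed
    moreover have "coeff (G e) D = 0" for e
      using False by (simp add: G_def coeff_monom_mult)
    ultimately have "polyfam (D - 1) G" using False p(2) by (intro polyfam_reduce) auto
    then obtain R where R: "polyfam (d - 1) R" "\<And>e. integral_env e \<Longrightarrow>
        \<exists>n s. integral_poly s \<and> smult (coeff (p e) d ^ n) (G e) = s * p e + R e"
      using less.IH[of "D - 1" G] False p(2) by auto
    have "\<exists>n s. integral_poly s \<and> smult (coeff (p e) d ^ n) (F e) = s * p e + R e" if e: "integral_env e" for e
    proof -
      obtain n s where s: "integral_poly s" "smult (coeff (p e) d ^ n) (G e) = s * p e + R e"
        using R(2)[OF e] by blast
      define s' where "s' = s + smult (coeff (p e) d ^ n) (monom (coeff (F e) D) (D - d))"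
      have "integral_poly s'" unfolding s'_def
        using s(1) polyfun_env[OF polyfam_coeff[OF p(1)] e] polyfun_env[OF polyfam_coeff[OF less.prems] e]
        by (intro integral_poly_add integral_poly_smult integral_power integral_poly_monom)
      moreover have "smult (coeff (p e) d ^ Suc n) (F e) = s' * p e + R e"
      proof -
        have "smult (coeff (p e) d ^ Suc n) (F e) =
            smult (coeff (p e) d ^ n) (G e) + smult (coeff (p e) d ^ n) (monom (coeff (F e) D) (D - d)) * p e"
          unfolding G_def by (simp add: smult_diff_right mult.commute)
        thus ?thesis unfolding s(2) s'_def by (simp only: distrib_right add_ac)
      qed
      ultimately show ?thesis by blast
    qed
    thus ?thesis using R(1) by blast
  qed
qed

text \<open>Euclid's algorithm. Let \<open>p\<close> have the least degree bound \<open>m\<close>.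
  Where its coefficient of degree \<open>m\<close> is infinitesimal, this term is dropped. Elsewhere
  \<open>p\<close> lowers the degree bound of another equation, or, if no other is left,
  \<open>root_not_root_iff\<close> decides the question by the pseudo-remainder of
  \<open>q ^ m\<close>.\<close>

lemma constructible_ex_conjunction:
  assumes q: "polyfam dq q"
  shows "(\<And>F d. (F, d) \<in> set ps \<Longrightarrow> polyfam d F) \<Longrightarrow>
    constructible (\<lambda>e. \<exists>x. integral x \<and> (\<forall>(F, d)\<in>set ps. infsml (poly (F e) x)) \<and> \<not> infsml (poly (q e) x))"
proof (induction "\<Sum>(F, d)\<leftarrow>ps. Suc d" arbitrary: ps rule: less_induct)
  case less
  \<comment> \<open>The successor makes the measure drop also when an equation of degree bound 0 is
    removed.\<close>
  define \<mu> where "\<mu> = (\<lambda>(F :: (nat \<Rightarrow> 'm) \<Rightarrow> 'm poly, d). Suc d)"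
  note IH = less.hyps[folded \<mu>_def]
  let ?Q = "\<lambda>ps e. \<exists>x. integral x \<and> (\<forall>(F, d)\<in>set ps. infsml (poly (F e) x)) \<and> \<not> infsml (poly (q e) x)"
  show ?case
  proof (cases "ps = []")
    case True
    show ?thesis
    proof (rule constructible.equiv)
      show "constructible (\<lambda>e. \<not> infsml_poly (q e))" by (intro constructible.neg constructible_infsml_poly[OF q])
      fix e assume e: "integral_env e"
      show "?Q ps e \<longleftrightarrow> \<not> infsml_poly (q e)"
        unfolding True using poly_infsml exists_unit_nonroot[OF polyfam_env[OF q e], of "{}"] unit_elt_iff by auto
    qed
  next
    case False
    define m where "m = Min (snd ` set ps)"
    have "m \<in> snd ` set ps" unfolding m_def using False by (intro Min_in) auto
    then obtain p where p: "(p, m) \<in> set ps" by auto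
    have min: "m \<le> d" if "(F, d) \<in> set ps" for F d
      unfolding m_def using that by (intro Min_le) (auto intro!: image_eqI[of _ snd "(F, d)"])
    define rest where "rest = remove1 (p, m) ps"
    have set_ps: "set ps = insert (p, m) (set rest)" unfolding rest_def by (rule set_eq_insert_remove1[OF p])
    have rest_sub: "set rest \<subseteq> set ps" unfolding rest_def by (rule set_remove1_subset)
    have meas: "sum_list (map \<mu> ps) = Suc m + sum_list (map \<mu> rest)"
      using sum_list_map_remove1[OF p, of \<mu>] by (simp add: rest_def \<mu>_def)
    have pf: "polyfam m p" using less.prems p by blast
    have Q_ps: "?Q ps e \<longleftrightarrow> (\<exists>x. integral x \<and> infsml (poly (p e) x) \<and>
        (\<forall>(F, d)\<in>set rest. infsml (poly (F e) x)) \<and> \<not> infsml (poly (q e) x))" for e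
      unfolding set_ps by simp
    show ?thesis
    proof (cases "m = 0")
      case True
      have c: "constructible (?Q rest)"
        using less.prems rest_sub meas by (intro IH) auto
      show ?thesis
      proof (rule constructible.equiv)
        show "constructible (\<lambda>e. infsml (coeff (p e) 0) \<and> ?Q rest e)"
          by (intro constructible.conj constructible.atom polyfam_coeff[OF pf] c)
        fix e
        have "degree (p e) = 0" using polyfam_degree[OF pf, of e] True by simp
        then obtain c where "p e = [:c:]" by (rule degree_eq_zeroE)
        hence "poly (p e) x = coeff (p e) 0" for x by simp
        thus "?Q ps e \<longleftrightarrow> infsml (coeff (p e) 0) \<and> ?Q rest e" unfolding Q_ps by auto
      qed
    next
      case m: False
      define lc where "lc e = coeff (p e) m" for e
      have lcf: "polyfun lc" unfolding lc_def by (rule polyfam_coeff[OF pf])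
      define p' where "p' e = p e - monom (lc e) m" for e
      have p'f: "polyfam (m - 1) p'"
      proof (rule polyfam_reduce)
        show "polyfam m p'" unfolding p'_def using polyfam_diff[OF pf polyfam_monom[OF lcf, of m]] by simp
      qed (use m in \<open>auto simp: p'_def lc_def\<close>)
      have c1: "constructible (?Q ((p', m - 1) # rest))"
        using less.prems rest_sub meas p'f m by (intro IH) (auto simp: \<mu>_def)
      have Q1: "?Q ps e \<longleftrightarrow> ?Q ((p', m - 1) # rest) e" if "infsml (lc e)" for e
      proof -
        have "infsml (poly (p e) x) \<longleftrightarrow> infsml (poly (p' e) x)" if "integral x" for x
        proof (rule infsml_cong)
          have "poly (p e) x - poly (p' e) x = lc e * x ^ m" by (simp add: p'_def poly_monom)
          thus "infsml (poly (p e) x - poly (p' e) x)"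
            using infsml_mult[OF \<open>infsml (lc e)\<close> integral_power[OF that]] by simp
        qed
        thus ?thesis unfolding Q_ps by auto
      qed
      have "\<exists>Q2. constructible Q2 \<and> (\<forall>e. integral_env e \<longrightarrow> \<not> infsml (lc e) \<longrightarrow> (?Q ps e \<longleftrightarrow> Q2 e))"
      proof (cases rest)
        case Nil
        obtain R where R: "polyfam (m - 1) R" "\<And>e. integral_env e \<Longrightarrow>
            \<exists>n s. integral_poly s \<and> smult (coeff (p e) m ^ n) (q e ^ m) = s * p e + R e"
          using pseudo_remainder[OF pf _ polyfam_power[OF q, of m]] m by blast
        have "?Q ps e \<longleftrightarrow> \<not> infsml_poly (R e)" if e: "integral_env e" "\<not> infsml (lc e)" for e
        proof -
          obtain n s where ns: "integral_poly s" "smult (coeff (p e) m ^ n) (q e ^ m) = s * p e + R e"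
            using R(2)[OF e(1)] by blast
          have "coeff (R e) i = 0" if "i \<ge> m" for i
            using polyfam_degree[OF R(1), of e] that m by (intro coeff_eq_0) simp
          from root_not_root_iff[OF polyfam_env[OF pf e(1)] polyfam_degree[OF pf] e(2)[unfolded lc_def] _
              polyfam_env[OF q e(1)] polyfam_env[OF R(1) e(1)] this ns] m
          show ?thesis unfolding Q_ps Nil by simp
        qed
        thus ?thesis using constructible.neg[OF constructible_infsml_poly[OF R(1)]] by blast
      next
        case (Cons a rest')
        obtain F d where a: "a = (F, d)" by (cases a)
        have Fd: "(F, d) \<in> set ps" using Cons a rest_sub by auto
        have Ff: "polyfam d F" using less.prems Fd by blast
        have md: "m \<le> d" using min[OF Fd] .
        define F' where "F' e = smult (lc e) (F e) - monom (coeff (F e) d) (d - m) * p e" for e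
        have F'f: "polyfam (d - 1) F'"
        proof (rule polyfam_reduce)
          have "polyfam (max d (d - m + m)) F'" unfolding F'_def
            by (intro polyfam_diff polyfam_smult polyfam_mult polyfam_monom polyfam_coeff[OF Ff] lcf Ff pf)
          thus "polyfam d F'" using md by simp
          show "coeff (F' e) d = 0" for e using md by (simp add: F'_def lc_def coeff_monom_mult)
        qed (use m md in simp)
        have "constructible (?Q ((p, m) # (F', d - 1) # rest'))"
        proof (rule IH)
          have "sum_list (map \<mu> ps) = Suc m + (Suc d + sum_list (map \<mu> rest'))"
            unfolding meas Cons a by (simp add: \<mu>_def)
          thus "sum_list (map \<mu> ((p, m) # (F', d - 1) # rest')) < sum_list (map \<mu> ps)"
            using m md by (simp add: \<mu>_def)
          show "polyfam d' G" if "(G, d') \<in> set ((p, m) # (F', d - 1) # rest')" for G d'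
            using that pf F'f less.prems rest_sub Cons by auto
        qed
        moreover have "?Q ps e \<longleftrightarrow> ?Q ((p, m) # (F', d - 1) # rest') e" if e: "integral_env e" "\<not> infsml (lc e)" for e
        proof -
          have "infsml (poly (F e) x) \<longleftrightarrow> infsml (poly (F' e) x)" if x: "integral x" "infsml (poly (p e) x)" for x
          proof -
            have "infsml (poly (F e) x) \<longleftrightarrow> infsml (lc e * poly (F e) x)"
              using e(2) polyfun_env[OF lcf e(1)] poly_integral[OF polyfam_env[OF Ff e(1)] x(1)]
              by (simp add: infsml_prime)
            also have "\<dots> \<longleftrightarrow> infsml (poly (F' e) x)"
            proof (rule infsml_cong)
              have "lc e * poly (F e) x - poly (F' e) x = coeff (F e) d * x ^ (d - m) * poly (p e) x"
                by (simp add: F'_def poly_monom)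
              thus "infsml (lc e * poly (F e) x - poly (F' e) x)"
                using x polyfun_env[OF polyfam_coeff[OF Ff] e(1)]
                by (simp add: infsml_mult' integral_mult integral_power)
            qed
            finally show ?thesis .
          qed
          thus ?thesis unfolding Q_ps Cons a by auto
        qed
        ultimately show ?thesis by blast
      qed
      then obtain Q2 where Q2: "constructible Q2"
        "\<And>e. integral_env e \<Longrightarrow> \<not> infsml (lc e) \<Longrightarrow> ?Q ps e \<longleftrightarrow> Q2 e" by blast
      show ?thesis
      proof (rule constructible.equiv)
        show "constructible (\<lambda>e. (infsml (lc e) \<and> ?Q ((p', m - 1) # rest) e) \<or> (\<not> infsml (lc e) \<and> Q2 e))"
          by (intro constructible_disj constructible.conj constructible.neg constructible.atom lcf c1 Q2(1))
        show "?Q ps e \<longleftrightarrow> (infsml (lc e) \<and> ?Q ((p', m - 1) # rest) e) \<or> (\<not> infsml (lc e) \<and> Q2 e)"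
          if "integral_env e" for e
          using Q1[of e] Q2(2)[OF that] by (cases "infsml (lc e)") (simp_all only: simp_thms)
      qed
    qed
  qed
qed

text \<open>One inequation per disjunct suffices: several of them are equivalent to the inequation
  for their product, as the residue field has no zero divisors.\<close>

definition dnf :: "((nat \<Rightarrow> 'm) \<Rightarrow> bool) \<Rightarrow> bool" where
  "dnf Q \<longleftrightarrow> (\<exists>L. (\<forall>(ps, q)\<in>set L. (\<forall>p\<in>set ps. polyfun p) \<and> polyfun q) \<and>
     (\<forall>e. integral_env e \<longrightarrow> (Q e \<longleftrightarrow> (\<exists>(ps, q)\<in>set L. (\<forall>p\<in>set ps. infsml (p e)) \<and> \<not> infsml (q e)))))"

lemma dnf_disj:
  assumes "dnf Q" "dnf Q'" shows "dnf (\<lambda>e. Q e \<or> Q' e)"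
proof -
  obtain L where L: "\<forall>(ps, q)\<in>set L. (\<forall>p\<in>set ps. polyfun p) \<and> polyfun q"
    "\<forall>e. integral_env e \<longrightarrow> (Q e \<longleftrightarrow> (\<exists>(ps, q)\<in>set L. (\<forall>p\<in>set ps. infsml (p e)) \<and> \<not> infsml (q e)))"
    using assms(1) unfolding dnf_def by (elim exE conjE)
  obtain L' where L': "\<forall>(ps, q)\<in>set L'. (\<forall>p\<in>set ps. polyfun p) \<and> polyfun q"
    "\<forall>e. integral_env e \<longrightarrow> (Q' e \<longleftrightarrow> (\<exists>(ps, q)\<in>set L'. (\<forall>p\<in>set ps. infsml (p e)) \<and> \<not> infsml (q e)))"
    using assms(2) unfolding dnf_def by (elim exE conjE)
  show ?thesis unfolding dnf_def
  proof (intro exI[of _ "L @ L'"] conjI allI impI)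
    show "\<forall>(ps, q)\<in>set (L @ L'). (\<forall>p\<in>set ps. polyfun p) \<and> polyfun q" using L(1) L'(1) by auto
    fix e assume "integral_env e"
    thus "(Q e \<or> Q' e) \<longleftrightarrow> (\<exists>(ps, q)\<in>set (L @ L'). (\<forall>p\<in>set ps. infsml (p e)) \<and> \<not> infsml (q e))"
      using L(2) L'(2) by (simp add: bex_Un)
  qed
qed

lemma dnf_conj:
  assumes "dnf Q" "dnf Q'" shows "dnf (\<lambda>e. Q e \<and> Q' e)"
proof -
  obtain L where L: "\<forall>(ps, q)\<in>set L. (\<forall>p\<in>set ps. polyfun p) \<and> polyfun q"
    "\<forall>e. integral_env e \<longrightarrow> (Q e \<longleftrightarrow> (\<exists>(ps, q)\<in>set L. (\<forall>p\<in>set ps. infsml (p e)) \<and> \<not> infsml (q e)))"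
    using assms(1) unfolding dnf_def by (elim exE conjE)
  obtain L' where L': "\<forall>(ps, q)\<in>set L'. (\<forall>p\<in>set ps. polyfun p) \<and> polyfun q"
    "\<forall>e. integral_env e \<longrightarrow> (Q' e \<longleftrightarrow> (\<exists>(ps, q)\<in>set L'. (\<forall>p\<in>set ps. infsml (p e)) \<and> \<not> infsml (q e)))"
    using assms(2) unfolding dnf_def by (elim exE conjE)
  define N where "N = map (\<lambda>((ps, q), (ps', q')). (ps @ ps', \<lambda>e. q e * q' e)) (List.product L L')"
  have N: "set N = (\<lambda>((ps, q), (ps', q')). (ps @ ps', \<lambda>e. q e * q' e)) ` (set L \<times> set L')"
    by (simp add: N_def)
  show ?thesis unfolding dnf_def
  proof (intro exI[of _ N] conjI allI impI)
    show "\<forall>(ps, q)\<in>set N. (\<forall>p\<in>set ps. polyfun p) \<and> polyfun q"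
      unfolding N using L(1) L'(1) by (fastforce intro: polyfun.mult)
    fix e assume e: "integral_env e"
    have pr: "infsml (q e * q' e) \<longleftrightarrow> infsml (q e) \<or> infsml (q' e)"
      if "(ps, q) \<in> set L" "(ps', q') \<in> set L'" for ps q ps' q'
      using that L(1) L'(1) polyfun_env[OF _ e] by (intro infsml_prime) fast+
    have "(\<exists>(ps, q)\<in>set N. (\<forall>p\<in>set ps. infsml (p e)) \<and> \<not> infsml (q e)) \<longleftrightarrow>
      (\<exists>(ps, q)\<in>set L. \<exists>(ps', q')\<in>set L'. (\<forall>p\<in>set (ps @ ps'). infsml (p e)) \<and> \<not> infsml (q e * q' e))"
      unfolding N by (simp add: bex_simps split_beta)
    also have "\<dots> \<longleftrightarrow> (\<exists>(ps, q)\<in>set L. \<exists>(ps', q')\<in>set L'.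
        ((\<forall>p\<in>set ps. infsml (p e)) \<and> \<not> infsml (q e)) \<and> ((\<forall>p\<in>set ps'. infsml (p e)) \<and> \<not> infsml (q' e)))"
      using pr by (intro bex_cong refl) (auto simp: split_beta intro!: bex_cong)
    also have "\<dots> \<longleftrightarrow> Q e \<and> Q' e"
      unfolding L(2)[rule_format, OF e] L'(2)[rule_format, OF e] by (auto simp: split_beta)
    finally show "Q e \<and> Q' e \<longleftrightarrow> (\<exists>(ps, q)\<in>set N. (\<forall>p\<in>set ps. infsml (p e)) \<and> \<not> infsml (q e))" by (rule sym)
  qed
qed

lemma dnf_cong:
  assumes "dnf Q" "\<And>e. integral_env e \<Longrightarrow> Q' e \<longleftrightarrow> Q e" shows "dnf Q'"
  using assms(1) unfolding dnf_def using assms(2) by (simp cong: conj_cong imp_cong)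

lemma constructible_dnf: "constructible Q \<Longrightarrow> dnf Q \<and> dnf (\<lambda>e. \<not> Q e)"
proof (induction rule: constructible.induct)
  case (atom p)
  have "dnf (\<lambda>e. infsml (p e))" unfolding dnf_def
    using atom by (intro exI[of _ "[([p], \<lambda>e. 1)]"]) (simp add: polyfun.const)
  moreover have "dnf (\<lambda>e. \<not> infsml (p e))" unfolding dnf_def
    using atom by (intro exI[of _ "[([], p)]"]) simp
  ultimately show ?case by blast
next
  case (neg Q)
  thus ?case by simp
next
  case (conj Q Q')
  thus ?case using dnf_conj[of Q Q'] dnf_disj[of "\<lambda>e. \<not> Q e" "\<lambda>e. \<not> Q' e"] by simp
next
  case (equiv Q Q')
  show ?case using equiv.IH dnf_cong[of Q Q'] dnf_cong[of "\<lambda>e. \<not> Q e" "\<lambda>e. \<not> Q' e"] equiv.hyps(2) by blast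
qed

lemma constructible_ex:
  assumes "constructible Q"
  shows "constructible (\<lambda>e. \<exists>x. integral x \<and> Q (case_nat x e))"
proof -
  obtain L where L: "\<forall>(ps, q)\<in>set L. (\<forall>p\<in>set ps. polyfun p) \<and> polyfun q"
    "\<forall>e. integral_env e \<longrightarrow> (Q e \<longleftrightarrow> (\<exists>(ps, q)\<in>set L. (\<forall>p\<in>set ps. infsml (p e)) \<and> \<not> infsml (q e)))"
    using conjunct1[OF constructible_dnf[OF assms]] unfolding dnf_def by (elim exE conjE)
  have one: "constructible (\<lambda>e. \<exists>x. integral x \<and> (\<forall>p\<in>set ps. infsml (p (case_nat x e))) \<and> \<not> infsml (q (case_nat x e)))"
    if ps: "\<forall>p\<in>set ps. polyfun p" and q: "polyfun q" for ps q
  proof -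
    have "\<forall>p\<in>set ps. \<exists>Fd. polyfam (snd Fd) (fst Fd) \<and> (\<forall>x e. p (case_nat x e) = poly (fst Fd e) x)"
      using polyfam_of_polyfun ps by fastforce
    then obtain h where h: "\<And>p. p \<in> set ps \<Longrightarrow> polyfam (snd (h p)) (fst (h p)) \<and> (\<forall>x e. p (case_nat x e) = poly (fst (h p) e) x)"
      by metis
    obtain G d where G: "polyfam d G" "\<And>x e. q (case_nat x e) = poly (G e) x"
      using polyfam_of_polyfun[OF q] by blast
    have "constructible (\<lambda>e. \<exists>x. integral x \<and> (\<forall>(F, d)\<in>set (map h ps). infsml (poly (F e) x)) \<and> \<not> infsml (poly (G e) x))"
    proof (rule constructible_ex_conjunction[OF G(1)])
      fix F d assume "(F, d) \<in> set (map h ps)"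
      then obtain p where "p \<in> set ps" "h p = (F, d)" by auto
      thus "polyfam d F" using h[of p] by simp
    qed
    moreover have "(\<forall>(F, d)\<in>set (map h ps). infsml (poly (F e) x)) \<longleftrightarrow> (\<forall>p\<in>set ps. infsml (p (case_nat x e)))" for x e
      using h by (simp add: split_beta)
    ultimately show ?thesis unfolding G(2) by simp
  qed
  show ?thesis
  proof (rule constructible.equiv)
    show "constructible (\<lambda>e. \<exists>(ps, q)\<in>set L. \<exists>x. integral x \<and> (\<forall>p\<in>set ps. infsml (p (case_nat x e))) \<and> \<not> infsml (q (case_nat x e)))"
      unfolding split_beta using L(1) by (intro constructible_bex one) auto
    fix e assume e: "integral_env e"
    have env: "integral_env (case_nat x e)" if "integral x" for x
      using e that unfolding integral_env_def by (simp split: nat.split)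
    show "(\<exists>x. integral x \<and> Q (case_nat x e)) \<longleftrightarrow> (\<exists>(ps, q)\<in>set L. \<exists>x. integral x \<and>
        (\<forall>p\<in>set ps. infsml (p (case_nat x e))) \<and> \<not> infsml (q (case_nat x e)))"
    proof -
      have "integral x \<and> Q (case_nat x e) \<longleftrightarrow> integral x \<and> (\<exists>z\<in>set L.
          (\<forall>p\<in>set (fst z). infsml (p (case_nat x e))) \<and> \<not> infsml (snd z (case_nat x e)))" for x
        using L(2)[rule_format, OF env[of x]] unfolding split_beta by blast
      thus ?thesis unfolding split_beta by blast
    qed
  qed
qed

lemma constructible_subst:
  "constructible Q \<Longrightarrow> (\<And>i. polyfun (t i)) \<Longrightarrow> constructible (\<lambda>e. Q (\<lambda>i. t i e))"
proof (induction rule: constructible.induct)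
  case (atom p)
  show ?case by (rule constructible.atom[OF polyfun_subst[OF atom.hyps atom.prems]])
next
  case (neg Q)
  show ?case by (rule constructible.neg[OF neg.IH[OF neg.prems]])
next
  case (conj Q Q')
  show ?case by (rule constructible.conj[OF conj.IH(1)[OF conj.prems] conj.IH(2)[OF conj.prems]])
next
  case (equiv Q Q')
  have "integral_env (\<lambda>i. t i e)" if "integral_env e" for e
    using polyfun_env[OF equiv.prems that] unfolding integral_env_def by blast
  thus ?case using equiv.hyps(2) by (intro constructible.equiv[OF equiv.IH[OF equiv.prems]]) blast
qed

text \<open>Artin's independence of characters, over the residue field and for relations that may
  fail on finitely many classes. If \<open>g\<close> separates the characters \<open>a\<close> and
  \<open>b\<close>, the relation translated by \<open>g\<close> minus \<open>\<chi> a g\<close>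
  times the relation no longer involves \<open>a\<close> but still involves
  \<open>b\<close>.\<close>

lemma characters_independent:
  fixes \<chi> :: "'i \<Rightarrow> 'm \<Rightarrow> 'm"
  assumes \<chi>: "\<And>i x. unit_elt x \<Longrightarrow> unit_elt (\<chi> i x)"
    and \<chi>_mult: "\<And>i x y. unit_elt x \<Longrightarrow> unit_elt y \<Longrightarrow> infsml (\<chi> i (x * y) - \<chi> i x * \<chi> i y)"
  shows "finite I \<Longrightarrow> I \<noteq> {} \<Longrightarrow> (\<And>i. i \<in> I \<Longrightarrow> unit_elt (c i)) \<Longrightarrow> finite F \<Longrightarrow>
    (\<And>x. unit_elt x \<Longrightarrow> rv v x \<notin> F \<Longrightarrow> infsml (\<Sum>i\<in>I. c i * \<chi> i x)) \<Longrightarrow>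
    \<exists>i\<in>I. \<exists>j\<in>I. i \<noteq> j \<and> (\<forall>x. unit_elt x \<longrightarrow> infsml (\<chi> i x - \<chi> j x))"
proof (induction "card I" arbitrary: I c F rule: less_induct)
  case less
  show ?case
  proof (rule ccontr)
    assume no: "\<not> ?thesis"
    obtain a where a: "a \<in> I" using less.prems(2) by blast
    show False
    proof (cases "I = {a}")
      case True
      obtain x where x: "unit_elt x" "rv v x \<notin> F"
        using avoid_rv[OF less.prems(4), of 0] unfolding unit_elt_def by blast
      hence "infsml (c a * \<chi> a x)" using less.prems(5)[OF x] True by simp
      thus False using \<chi>[OF x(1), of a] less.prems(3)[OF a] by (simp add: infsml_prime unit_elt_iff)
    next
      case False
      then obtain b where b: "b \<in> I" "b \<noteq> a" using a by blast
      then obtain g where g: "unit_elt g" "\<not> infsml (\<chi> b g - \<chi> a g)" using no a by blast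
      have \<chi>i: "integral (\<chi> i x)" if "unit_elt x" for i x using \<chi>[OF that] by (simp add: unit_elt_iff)
      have ci: "integral (c i)" if "i \<in> I" for i using less.prems(3)[OF that] by (simp add: unit_elt_iff)
      define d where "d i = c i * (\<chi> i g - \<chi> a g)" for i
      have di: "integral (d i)" if "i \<in> I" for i
        unfolding d_def using ci[OF that] \<chi>i[OF g(1)] by (intro integral_mult integral_diff)
      \<comment> \<open>Besides \<open>a\<close>, all terms whose new coefficient is infinitesimal
        are discarded, since the induction needs unit coefficients.\<close>
      define I' where "I' = {i \<in> I. \<not> infsml (d i)}"
      have "a \<notin> I'" by (simp add: I'_def d_def)
      hence "I' \<subset> I" using a unfolding I'_def by blast
      hence card: "card I' < card I" using less.prems(1) by (intro psubset_card_mono)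
      have "\<not> infsml (d b)" unfolding d_def
        using b(1) g less.prems(3)[OF b(1)] \<chi>i[OF g(1)] by (simp add: infsml_prime integral_diff unit_elt_iff)
      hence "I' \<noteq> {}" using b unfolding I'_def by blast
      have "g \<noteq> 0" using g(1) by (simp add: unit_elt_def)
      then obtain F' where F': "finite F'" "\<And>x. rv v x \<notin> F' \<Longrightarrow> rv v x \<notin> F \<and> rv v (g * x) \<notin> F"
        using rv_translate_exceptions[OF less.prems(4)] by blast
      have rel: "infsml (\<Sum>i\<in>I'. d i * \<chi> i x)" if x: "unit_elt x" "rv v x \<notin> F'" for x
      proof -
        have 1: "infsml (\<Sum>i\<in>I. c i * \<chi> i (g * x))"
          using less.prems(5)[of "g * x"] F'(2)[OF x(2)] unit_elt_mult[OF g(1) x(1)] by blast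
        have 2: "infsml (\<chi> a g * (\<Sum>i\<in>I. c i * \<chi> i x))"
          using less.prems(5)[OF x(1)] F'(2)[OF x(2)] \<chi>i[OF g(1)] by (intro infsml_mult') blast+
        have 3: "infsml (\<Sum>i\<in>I. c i * (\<chi> i (g * x) - \<chi> i g * \<chi> i x))"
          using ci \<chi>_mult[OF g(1) x(1)] by (intro infsml_sum infsml_mult') blast+
        have "(\<Sum>i\<in>I. d i * \<chi> i x) = (\<Sum>i\<in>I. c i * \<chi> i (g * x)) - (\<Sum>i\<in>I. c i * (\<chi> i (g * x) - \<chi> i g * \<chi> i x))
            - \<chi> a g * (\<Sum>i\<in>I. c i * \<chi> i x)"
          unfolding sum_distrib_left sum_subtractf[symmetric]
          by (intro sum.cong refl) (simp add: d_def algebra_simps)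
        hence "infsml (\<Sum>i\<in>I. d i * \<chi> i x)" using 1 2 3 by (simp only:) (intro infsml_diff)
        moreover have "infsml (\<Sum>i\<in>I - I'. d i * \<chi> i x)"
          using \<chi>i[OF x(1)] by (intro infsml_sum infsml_mult) (auto simp: I'_def)
        moreover have "(\<Sum>i\<in>I'. d i * \<chi> i x) = (\<Sum>i\<in>I. d i * \<chi> i x) - (\<Sum>i\<in>I - I'. d i * \<chi> i x)"
          using sum.subset_diff[of I' I "\<lambda>i. d i * \<chi> i x"] less.prems(1) \<open>I' \<subset> I\<close> by simp
        ultimately show ?thesis by (simp add: infsml_diff)
      qed
      have "\<exists>i\<in>I'. \<exists>j\<in>I'. i \<noteq> j \<and> (\<forall>x. unit_elt x \<longrightarrow> infsml (\<chi> i x - \<chi> j x))"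
      proof (rule less.hyps[OF card _ \<open>I' \<noteq> {}\<close> _ F'(1) rel])
        show "finite I'" using less.prems(1) by (simp add: I'_def)
        show "unit_elt (d i)" if "i \<in> I'" for i using that di unfolding I'_def unit_elt_iff by blast
      qed
      thus False using no \<open>I' \<subset> I\<close> by blast
    qed
  qed
qed

section \<open>Polynomials in two variables\<close>

definition integral_poly2 :: "'m poly poly \<Rightarrow> bool" where
  "integral_poly2 P \<longleftrightarrow> (\<forall>i. integral_poly (coeff P i))"

definition infsml_poly2 :: "'m poly poly \<Rightarrow> bool" where
  "infsml_poly2 P \<longleftrightarrow> (\<forall>i. infsml_poly (coeff P i))"

lemma integral_poly_sum: "(\<And>i. i \<in> A \<Longrightarrow> integral_poly (f i)) \<Longrightarrow> integral_poly (sum f A)"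
  by (induction A rule: infinite_finite_induct) (auto intro: integral_poly_add)

definition pair_env :: "'m \<Rightarrow> 'm \<Rightarrow> nat \<Rightarrow> 'm" where
  "pair_env x y i = (if i = 0 then x else if i = 1 then y else 0)"

lemma integral_pair_env: "integral x \<Longrightarrow> integral y \<Longrightarrow> integral_env (pair_env x y)"
  unfolding integral_env_def pair_env_def by simp

text \<open>The outer variable of \<open>P\<close> stands for \<open>x\<close> and the inner one for
  \<open>y\<close>; all coordinates of \<open>pair_env\<close> beyond the first two are 0.\<close>

lemma bivariate_of_polyfun:
  "polyfun p \<Longrightarrow> \<exists>P. integral_poly2 P \<and> (\<forall>x y. p (pair_env x y) = poly (poly P [:x:]) y)"
proof (induction rule: polyfun.induct)
  case (var i)
  have m: "integral_poly2 [:0, 1:]" "integral_poly2 [:[:0, 1:]:]" "integral_poly2 0"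
    by (auto simp: integral_poly2_def coeff_pCons one_pCons split: nat.split)
  define P :: "'m poly poly" where "P = (if i = 0 then [:0, 1:] else if i = 1 then [:[:0, 1:]:] else 0)"
  have "integral_poly2 P" using m by (simp add: P_def)
  moreover have "pair_env x y i = poly (poly P [:x:]) y" for x y by (simp add: pair_env_def P_def)
  ultimately show ?case by blast
next
  case (const c)
  thus ?case by (intro exI[of _ "[:[:c:]:]"]) (simp add: integral_poly2_def coeff_pCons split: nat.split)
next
  case (add p q)
  then obtain P Q where PQ: "integral_poly2 P" "\<forall>x y. p (pair_env x y) = poly (poly P [:x:]) y"
    "integral_poly2 Q" "\<forall>x y. q (pair_env x y) = poly (poly Q [:x:]) y" by blast
  have "integral_poly2 (P + Q)" using PQ(1,3) unfolding integral_poly2_def by (simp add: integral_poly_add)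
  thus ?case using PQ(2,4) by (intro exI[of _ "P + Q"]) simp
next
  case (mult p q)
  then obtain P Q where PQ: "integral_poly2 P" "\<forall>x y. p (pair_env x y) = poly (poly P [:x:]) y"
    "integral_poly2 Q" "\<forall>x y. q (pair_env x y) = poly (poly Q [:x:]) y" by blast
  have "integral_poly2 (P * Q)" using PQ(1,3) unfolding integral_poly2_def coeff_mult
    by (intro allI integral_poly_sum integral_poly_mult) blast+
  thus ?case using PQ(2,4) by (intro exI[of _ "P * Q"]) simp
qed

lemma coeff_mult_const_power: "coeff (c * [:x:] ^ i) j = coeff c j * (x::'m) ^ i"
proof (induction i)
  case (Suc i)
  have "c * [:x:] ^ Suc i = smult x (c * [:x:] ^ i)" by simp
  thus ?case using Suc by simp
qed simp

lemma coeff_poly_const: "coeff (poly P [:x:]) j = (\<Sum>i\<le>degree P. coeff (coeff P i) j * (x::'m) ^ i)"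
  unfolding poly_altdef coeff_sum coeff_mult_const_power ..

lemma poly2_expand:
  assumes "\<And>i. degree (coeff P i) \<le> N"
  shows "poly (poly P [:x:]) y = (\<Sum>(i, j)\<in>{..degree P} \<times> {..N}. coeff (coeff P i) j * (x ^ i * (y::'m) ^ j))"
proof -
  have "poly (poly P [:x:]) y = (\<Sum>i\<le>degree P. poly (coeff P i) y * x ^ i)"
    by (simp add: poly_altdef[of P] poly_sum)
  also have "\<dots> = (\<Sum>i\<le>degree P. \<Sum>j\<le>N. coeff (coeff P i) j * (x ^ i * y ^ j))"
  proof (intro sum.cong refl)
    fix i
    have "poly (coeff P i) y = (\<Sum>j\<le>N. coeff (coeff P i) j * y ^ j)"
      unfolding poly_altdef using assms[of i] by (intro sum.mono_neutral_left) (auto simp: coeff_eq_0)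
    thus "poly (coeff P i) y * x ^ i = (\<Sum>j\<le>N. coeff (coeff P i) j * (x ^ i * y ^ j))"
      by (simp add: sum_distrib_left sum_distrib_right mult_ac)
  qed
  also have "\<dots> = (\<Sum>(i, j)\<in>{..degree P} \<times> {..N}. coeff (coeff P i) j * (x ^ i * y ^ j))"
    by (rule sum.cartesian_product)
  finally show ?thesis .
qed

lemma infsml_poly2_eval:
  assumes "infsml_poly2 P" "integral x" "integral y" shows "infsml (poly (poly P [:x:]) y)"
proof (rule poly_infsml)
  show "infsml_poly (poly P [:x:])" unfolding infsml_poly_def coeff_poly_const
    using assms by (intro allI infsml_sum infsml_mult integral_power) (auto simp: infsml_poly2_def infsml_poly_def)
qed fact

text \<open>The coefficients at one suitable power of the inner variable form a polynomial in
  \<open>x\<close> with nonzero reduction, and a unit can be chosen off its finitely many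
  roots.\<close>

lemma exists_unit_nonzero_specialization:
  assumes "integral_poly2 P" "\<not> infsml_poly2 P"
  shows "\<exists>x. unit_elt x \<and> integral_poly (poly P [:x:]) \<and> \<not> infsml_poly (poly P [:x:])"
proof -
  obtain i j where ij: "\<not> infsml (coeff (coeff P i) j)"
    using assms(2) unfolding infsml_poly2_def infsml_poly_def by blast
  define Q where "Q = (\<Sum>i\<le>degree P. monom (coeff (coeff P i) j) i)"
  have cQ: "coeff Q k = coeff (coeff P k) j" for k
  proof (cases "k \<le> degree P")
    case True
    thus ?thesis by (simp add: Q_def coeff_sum)
  next
    case False
    hence "coeff P k = 0" by (intro coeff_eq_0) simp
    thus ?thesis using False by (simp add: Q_def coeff_sum)
  qed
  have "integral_poly Q" "\<not> infsml_poly Q"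
    using assms(1) ij unfolding integral_poly_def infsml_poly_def cQ integral_poly2_def by blast+
  then obtain x where x: "unit_elt x" "\<not> infsml (poly Q x)" using exists_unit_nonroot[of Q "{}"] by blast
  have "poly Q x = coeff (poly P [:x:]) j"
    unfolding coeff_poly_const by (simp add: Q_def poly_sum poly_monom)
  hence "\<not> infsml_poly (poly P [:x:])" using x(2) unfolding infsml_poly_def by metis
  moreover have "integral_poly (poly P [:x:])" unfolding integral_poly_def coeff_poly_const
    using assms(1) x(1) by (intro allI integral_sum integral_mult integral_power)
      (auto simp: integral_poly2_def integral_poly_def unit_elt_iff)
  ultimately show ?thesis using x(1) by blast
qed

text \<open>Every point of the graph satisfies an equation with nonzero reduction, since a disjunct
  without one would be an open condition and relate some \<open>u\<close> to several classes. One
  such equation holds over cofinitely many \<open>x\<close>. Its monomials in \<open>x\<close> and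
  its image are characters of \<open>x\<close>, so by independence two of them agree.\<close>

lemma pure_character:
  assumes con: "constructible (\<lambda>e. Gr (e 0) (e 1))" and Gr_def: "defpred (\<lambda>e. Gr (e 0) (e 1))"
    and unit: "\<And>x y. Gr x y \<Longrightarrow> unit_elt x \<and> unit_elt y"
    and tot: "\<And>x. unit_elt x \<Longrightarrow> \<exists>y. Gr x y"
    and func: "\<And>x y y'. Gr x y \<Longrightarrow> Gr x y' \<Longrightarrow> rv v y = rv v y'"
    and mult: "\<And>x y x' y'. Gr x y \<Longrightarrow> Gr x' y' \<Longrightarrow> Gr (x * x') (y * y')"
  shows "\<exists>i j i' j'. (i, j) \<noteq> (i', j') \<and> (\<forall>x y. Gr x y \<longrightarrow> rv v (x ^ i * y ^ j) = rv v (x ^ i' * y ^ j'))"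
proof -
  obtain L where L: "\<forall>(ps, q)\<in>set L. (\<forall>p\<in>set ps. polyfun p) \<and> polyfun q"
    "\<forall>e. integral_env e \<longrightarrow> (Gr (e 0) (e 1) \<longleftrightarrow> (\<exists>(ps, q)\<in>set L. (\<forall>p\<in>set ps. infsml (p e)) \<and> \<not> infsml (q e)))"
    using conjunct1[OF constructible_dnf[OF con]] unfolding dnf_def by (elim exE conjE)
  have GrL: "Gr x y \<longleftrightarrow> (\<exists>z\<in>set L. (\<forall>p\<in>set (fst z). infsml (p (pair_env x y))) \<and> \<not> infsml (snd z (pair_env x y)))"
    if "integral x" "integral y" for x y
    using L(2)[rule_format, OF integral_pair_env[OF that]] unfolding split_beta by (simp add: pair_env_def)
  have polyL: "polyfun p" if "z \<in> set L" "p \<in> set (fst z)" for z p using L(1) that by fastforce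
  have polyLq: "polyfun (snd z)" if "z \<in> set L" for z using L(1) that by fastforce
  define rep where "rep p = (SOME P. integral_poly2 P \<and> (\<forall>x y. p (pair_env x y) = poly (poly P [:x:]) y))" for p
  have rep: "integral_poly2 (rep p) \<and> (\<forall>x y. p (pair_env x y) = poly (poly (rep p) [:x:]) y)" if "polyfun p" for p
    unfolding rep_def by (rule someI_ex[OF bivariate_of_polyfun[OF that]])
  \<comment> \<open>The finitely many equations of the normal form whose reduction is not the zero
    polynomial.\<close>
  define PP where "PP = {p \<in> (\<Union>z\<in>set L. set (fst z)). \<not> infsml_poly2 (rep p)}"
  have "finite PP" unfolding PP_def by simp
  have key: "\<exists>p\<in>PP. \<exists>y. Gr x y \<and> infsml (p (pair_env x y))" if x: "unit_elt x" for x
  proof -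
    obtain y where y: "Gr x y" using tot[OF x] by blast
    have ixy: "integral x" "integral y" using unit[OF y] by (simp_all add: unit_elt_iff)
    obtain z where z: "z \<in> set L" "\<And>p. p \<in> set (fst z) \<Longrightarrow> infsml (p (pair_env x y))" "\<not> infsml (snd z (pair_env x y))"
      using GrL[OF ixy] y by blast
    have q: "\<not> infsml_poly2 (rep (snd z))"
      using infsml_poly2_eval[OF _ ixy] z(3) rep[OF polyLq[OF z(1)]] by metis
    have "\<exists>p\<in>set (fst z). \<not> infsml_poly2 (rep p)"
    proof (rule ccontr)
      assume no: "\<not> ?thesis"
      obtain u where u: "unit_elt u" "integral_poly (poly (rep (snd z)) [:u:])" "\<not> infsml_poly (poly (rep (snd z)) [:u:])"
        using exists_unit_nonzero_specialization[OF _ q] rep[OF polyLq[OF z(1)]] by blast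
      have iu: "integral u" using u(1) by (simp add: unit_elt_iff)
      have G: "Gr u w" if w: "unit_elt w" "\<not> infsml (poly (poly (rep (snd z)) [:u:]) w)" for w
      proof -
        have iw: "integral w" using w(1) by (simp add: unit_elt_iff)
        have "infsml (p (pair_env u w))" if "p \<in> set (fst z)" for p
          using infsml_poly2_eval[OF _ iu iw] no that rep[OF polyL[OF z(1) that]] by metis
        moreover have "\<not> infsml (snd z (pair_env u w))" using w(2) rep[OF polyLq[OF z(1)]] by metis
        ultimately show ?thesis using GrL[OF iu iw] z(1) by blast
      qed
      obtain w where w: "unit_elt w" "\<not> infsml (poly (poly (rep (snd z)) [:u:]) w)"
        using exists_unit_nonroot[OF u(2,3), of "{}"] by blast
      obtain w' where w': "unit_elt w'" "\<not> infsml (poly (poly (rep (snd z)) [:u:]) w')" "rv v w' \<notin> {rv v w}"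
        using exists_unit_nonroot[OF u(2,3), of "{rv v w}"] by blast
      show False using func[OF G[OF w'(1,2)] G[OF w]] w'(3) by simp
    qed
    then obtain p where "p \<in> set (fst z)" "\<not> infsml_poly2 (rep p)" by blast
    hence "p \<in> PP" "infsml (p (pair_env x y))" using z unfolding PP_def by blast+
    thus ?thesis using y by blast
  qed
  define S where "S p x \<longleftrightarrow> (\<exists>y. Gr x y \<and> infsml (p (pair_env x y)))" for p x
  have "\<exists>p\<in>PP. infinite (rv v ` Collect (S p))"
  proof (rule ccontr)
    assume "\<not> ?thesis"
    hence "finite (\<Union>p\<in>PP. rv v ` Collect (S p))" using \<open>finite PP\<close> by blast
    moreover have "rv v ` {x. x \<noteq> 0 \<and> v x = 0} \<subseteq> (\<Union>p\<in>PP. rv v ` Collect (S p))"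
      using key unfolding S_def unit_elt_def by blast
    ultimately show False using infinite_units finite_subset by blast
  qed
  then obtain p where p: "p \<in> PP" "infinite (rv v ` Collect (S p))" by blast
  have pp: "polyfun p" "\<not> infsml_poly2 (rep p)" using p(1) polyL unfolding PP_def by blast+
  have Sd: "defpred (\<lambda>e. S p (e 0))"
  proof -
    have "polyfun (\<lambda>e. pair_env (e (Suc 0)) (e 0) i)" for i
    proof -
      consider "i = 0" | "i = 1" | "i \<noteq> 0" "i \<noteq> 1" by blast
      thus ?thesis
        using polyfun.var[of "Suc 0"] polyfun.var[of 0] polyfun.const[OF integral_0] by cases (simp_all add: pair_env_def)
    qed
    hence "polyfun (\<lambda>e. p (\<lambda>i. pair_env (e (Suc 0)) (e 0) i))" by (rule polyfun_subst[OF pp(1)])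
    hence "defterm (\<lambda>e. p (pair_env (e (Suc 0)) (e 0)))" by (rule defterm_polyfun)
    thus ?thesis unfolding S_def infsml_def by (intro defpred_app2[OF Gr_def] def_intros)
  qed
  have S0: "x \<noteq> 0 \<and> v x = 0" if "S p x" for x using that unit unfolding S_def unit_elt_def by blast
  from cofinite_rv[OF Sd S0 p(2)] obtain F where
    F: "finite F" "\<And>x. unit_elt x \<Longrightarrow> rv v x \<notin> F \<Longrightarrow> S p x" unfolding unit_elt_def by blast
  define s where "s x = (SOME y. Gr x y)" for x
  have s: "Gr x (s x)" if "unit_elt x" for x unfolding s_def by (rule someI_ex[OF tot[OF that]])
  \<comment> \<open>The choice function \<open>s\<close> is multiplicative only up to
    infinitesimals, which is all that \<open>characters_independent\<close> asks of a
    character.\<close>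
  define \<chi> where "\<chi> ij x = x ^ fst ij * s x ^ snd ij" for ij :: "nat \<times> nat" and x
  define N where "N = Max (insert 0 ((\<lambda>i. degree (coeff (rep p) i)) ` {..degree (rep p)}))"
  have degN: "degree (coeff (rep p) i) \<le> N" for i
  proof (cases "i \<le> degree (rep p)")
    case True
    thus ?thesis unfolding N_def by (intro Max_ge) auto
  next
    case False
    thus ?thesis by (simp add: coeff_eq_0)
  qed
  define c where "c ij = coeff (coeff (rep p) (fst ij)) (snd ij)" for ij
  define A where "A = {..degree (rep p)} \<times> {..N}"
  define I where "I = {ij \<in> A. \<not> infsml (c ij)}"
  have "finite A" by (simp add: A_def)
  hence "finite I" by (simp add: I_def)
  have ci: "integral (c ij)" for ij
    using rep[OF pp(1)] unfolding c_def integral_poly2_def integral_poly_def by blast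
  obtain i j where "\<not> infsml (coeff (coeff (rep p) i) j)"
    using pp(2) unfolding infsml_poly2_def infsml_poly_def by blast
  moreover from this have "i \<le> degree (rep p)" by (metis coeff_0 coeff_eq_0 infsml_0 not_le)
  moreover have "j \<le> N" using calculation(1) degN[of i] by (metis coeff_eq_0 infsml_0 not_le order_trans)
  ultimately have "(i, j) \<in> I" by (simp add: I_def A_def c_def)
  hence "I \<noteq> {}" by blast
  have \<chi>u: "unit_elt (\<chi> ij x)" if "unit_elt x" for ij x
    unfolding \<chi>_def using that unit[OF s[OF that]] by (intro unit_elt_mult unit_elt_power) auto
  have "\<exists>i\<in>I. \<exists>j\<in>I. i \<noteq> j \<and> (\<forall>x. unit_elt x \<longrightarrow> infsml (\<chi> i x - \<chi> j x))"
  proof (rule characters_independent[OF \<chi>u _ \<open>finite I\<close> \<open>I \<noteq> {}\<close> _ F(1)])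
    fix ij x y assume x: "unit_elt x" and y: "unit_elt y"
    have "rv v (s (x * y)) = rv v (s x * s y)"
      using func[OF s[OF unit_elt_mult[OF x y]] mult[OF s[OF x] s[OF y]]] .
    hence "rv v (\<chi> ij (x * y)) = rv v ((x * y) ^ fst ij * (s x * s y) ^ snd ij)"
      unfolding \<chi>_def by (intro rv_mult_cong rv_power_cong refl)
    also have "(x * y) ^ fst ij * (s x * s y) ^ snd ij = \<chi> ij x * \<chi> ij y"
      by (simp add: \<chi>_def power_mult_distrib mult_ac)
    finally show "infsml (\<chi> ij (x * y) - \<chi> ij x * \<chi> ij y)"
      using rv_unit_eq \<chi>u[OF unit_elt_mult[OF x y]] unit_elt_mult[OF \<chi>u[OF x] \<chi>u[OF y]] by blast
  next
    show "unit_elt (c ij)" if "ij \<in> I" for ij using that ci unfolding I_def unit_elt_iff by blast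
  next
    fix x assume x: "unit_elt x" "rv v x \<notin> F"
    obtain y where y: "Gr x y" "infsml (p (pair_env x y))" using F(2)[OF x] unfolding S_def by blast
    have "(\<Sum>ij\<in>A. c ij * (x ^ fst ij * y ^ snd ij)) = p (pair_env x y)"
      using poly2_expand[OF degN, of x y] rep[OF pp(1)] by (simp add: A_def c_def split_beta)
    hence 1: "infsml (\<Sum>ij\<in>A. c ij * (x ^ fst ij * y ^ snd ij))" using y(2) by simp
    have "rv v (x ^ fst ij * y ^ snd ij) = rv v (\<chi> ij x)" for ij
      unfolding \<chi>_def using func[OF y(1) s[OF x(1)]] by (intro rv_mult_cong rv_power_cong refl)
    moreover have "unit_elt (x ^ fst ij * y ^ snd ij)" for ij :: "nat \<times> nat"
      using unit[OF y(1)] by (intro unit_elt_mult unit_elt_power) auto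
    ultimately have 2: "infsml (x ^ fst ij * y ^ snd ij - \<chi> ij x)" for ij
      using rv_unit_eq \<chi>u[OF x(1)] by blast
    have 3: "infsml (\<Sum>ij\<in>A. c ij * (x ^ fst ij * y ^ snd ij - \<chi> ij x))"
      using ci 2 by (intro infsml_sum infsml_mult')
    have 4: "infsml (\<Sum>ij\<in>A - I. c ij * \<chi> ij x)"
      using \<chi>u[OF x(1)] by (intro infsml_sum infsml_mult) (auto simp: I_def unit_elt_iff)
    have "I \<subseteq> A" by (auto simp: I_def)
    hence "(\<Sum>ij\<in>I. c ij * \<chi> ij x) = (\<Sum>ij\<in>A. c ij * \<chi> ij x) - (\<Sum>ij\<in>A - I. c ij * \<chi> ij x)"
      using sum.subset_diff[of I A "\<lambda>ij. c ij * \<chi> ij x"] \<open>finite A\<close> by simp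
    also have "(\<Sum>ij\<in>A. c ij * \<chi> ij x) = (\<Sum>ij\<in>A. c ij * (x ^ fst ij * y ^ snd ij)) -
        (\<Sum>ij\<in>A. c ij * (x ^ fst ij * y ^ snd ij - \<chi> ij x))"
      unfolding sum_subtractf[symmetric] by (intro sum.cong refl) (simp add: algebra_simps)
    finally show "infsml (\<Sum>ij\<in>I. c ij * \<chi> ij x)" using 1 3 4 by (simp only:) (intro infsml_diff)
  qed
  then obtain k l where kl: "k \<noteq> l" "\<And>x. unit_elt x \<Longrightarrow> infsml (\<chi> k x - \<chi> l x)" by blast
  have "rv v (x ^ fst k * y ^ snd k) = rv v (x ^ fst l * y ^ snd l)" if xy: "Gr x y" for x y
  proof -
    have x: "unit_elt x" using unit[OF xy] by blast
    have "rv v (x ^ fst m * y ^ snd m) = rv v (\<chi> m x)" for m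
      unfolding \<chi>_def using func[OF xy s[OF x]] by (intro rv_mult_cong rv_power_cong refl)
    moreover have "rv v (\<chi> k x) = rv v (\<chi> l x)" using rv_unit_eq[OF \<chi>u[OF x] \<chi>u[OF x]] kl(2)[OF x] by blast
    ultimately show ?thesis by simp
  qed
  moreover have "(fst k, snd k) \<noteq> (fst l, snd l)" using kl(1) by simp
  ultimately show ?thesis by blast
qed

section \<open>Formulas in the ring language over the residue field\<close>

lemma res_eq_iff: "res v x = res v y \<longleftrightarrow> infsml (x - y)"
proof
  assume "res v x = res v y"
  moreover have "x \<in> res v x" unfolding res_eq by (force simp: max_ideal_def)
  ultimately have "x \<in> res v y" by simp
  thus "infsml (x - y)" unfolding res_eq by (auto simp: max_ideal_def infsml_def)
next
  assume i: "infsml (x - y)"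
  have "res v a \<subseteq> res v b" if "infsml (a - b)" for a b
  proof
    fix z assume "z \<in> res v a"
    then obtain u where u: "u \<in> max_ideal v" "z = u + a" unfolding res_eq by blast
    have "infsml (u + (a - b))" using u(1) that by (intro infsml_add) (auto simp: infsml_def max_ideal_def)
    moreover have "z = (u + (a - b)) + b" using u(2) by simp
    ultimately show "z \<in> res v b" unfolding res_eq max_ideal_def infsml_def by blast
  qed
  moreover have "infsml (y - x)" using i infsml_minus[of "x - y"] by simp
  ultimately show "res v x = res v y" using i by blast
qed

lemma carrier_res: "carrier (res_field v) = res v ` Collect integral"
  unfolding carrier_res_field integral_def ..

lemma res_zero: "\<zero>\<^bsub>res_field v\<^esub> = res v 0"
  by (simp add: res_field_def FactRing_def res_eq)

lemma res_one: "\<one>\<^bsub>res_field v\<^esub> = res v 1"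
  by (simp add: res_field_def FactRing_def res_def val_ring_def)

lemma res_add: "res v x \<oplus>\<^bsub>res_field v\<^esub> res v y = res v (x + y)"
proof -
  have "res v x \<oplus>\<^bsub>res_field v\<^esub> res v y = {a + b | a b. a \<in> res v x \<and> b \<in> res v y}"
    by (auto simp: res_field_def FactRing_def set_add_def set_mult_def val_ring_def)
  also have "\<dots> = res v (x + y)"
  proof (intro equalityI subsetI)
    fix z assume "z \<in> {a + b | a b. a \<in> res v x \<and> b \<in> res v y}"
    then obtain a b where ab: "z = a + b" "a \<in> res v x" "b \<in> res v y" by blast
    then obtain p q where pq: "a = p + x" "b = q + y" "infsml p" "infsml q"
      unfolding res_eq max_ideal_def infsml_def by blast
    have "z = (p + q) + (x + y)" using ab pq by simp
    thus "z \<in> res v (x + y)" unfolding res_eq max_ideal_def using infsml_add[OF pq(3,4)] unfolding infsml_def by blast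
  next
    fix z assume "z \<in> res v (x + y)"
    then obtain u where u: "u \<in> max_ideal v" "z = (u + x) + (0 + y)" unfolding res_eq by (auto simp: add.assoc)
    moreover have "0 \<in> max_ideal v" by (simp add: max_ideal_def)
    ultimately show "z \<in> {a + b | a b. a \<in> res v x \<and> b \<in> res v y}" unfolding res_eq by blast
  qed
  finally show ?thesis .
qed

lemma res_minus:
  assumes "integral x" shows "\<ominus>\<^bsub>res_field v\<^esub> res v x = res v (- x)"
  unfolding a_inv_def m_inv_def
proof (rule the_equality)
  show "res v (- x) \<in> carrier (add_monoid (res_field v)) \<and>
    res v x \<otimes>\<^bsub>add_monoid (res_field v)\<^esub> res v (- x) = \<one>\<^bsub>add_monoid (res_field v)\<^esub> \<and>
    res v (- x) \<otimes>\<^bsub>add_monoid (res_field v)\<^esub> res v x = \<one>\<^bsub>add_monoid (res_field v)\<^esub>"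
    using assms by (simp add: res_add res_zero carrier_res)
next
  fix B assume B: "B \<in> carrier (add_monoid (res_field v)) \<and>
    res v x \<otimes>\<^bsub>add_monoid (res_field v)\<^esub> B = \<one>\<^bsub>add_monoid (res_field v)\<^esub> \<and>
    B \<otimes>\<^bsub>add_monoid (res_field v)\<^esub> res v x = \<one>\<^bsub>add_monoid (res_field v)\<^esub>"
  then obtain b where b: "B = res v b" by (auto simp: carrier_res)
  have "res v (x + b) = res v 0" using B by (simp add: b res_add res_zero)
  thus "B = res v (- x)" unfolding b res_eq_iff by (simp add: add.commute)
qed

lemma polyfun_of_term:
  "wf_tm ring_lang t \<Longrightarrow> \<exists>p. polyfun p \<and>
    (\<forall>e. integral_env e \<longrightarrow> tm_val (ring_struct (res_field v)) (\<lambda>i. res v (e i)) t = res v (p e))"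
proof (induction t)
  case (Var i)
  show ?case by (rule exI[of _ "\<lambda>e. e i"]) (simp add: polyfun.var)
next
  case (Fn f ts)
  have IH: "\<exists>p. polyfun p \<and> (\<forall>e. integral_env e \<longrightarrow> tm_val (ring_struct (res_field v)) (\<lambda>i. res v (e i)) t = res v (p e))"
    if "t \<in> set ts" for t using Fn.IH[OF that] Fn.prems that by simp
  have len: "length ts = farity ring_lang f" using Fn.prems by simp
  show ?case
  proof (cases f)
    case Zero_sym
    thus ?thesis by (intro exI[of _ "\<lambda>e. 0"]) (simp add: ring_struct_def res_zero polyfun.const)
  next
    case One_sym
    thus ?thesis by (intro exI[of _ "\<lambda>e. 1"]) (simp add: ring_struct_def res_one polyfun.const)
  next
    case Uminus_sym
    hence "length ts = 1" using len by (simp add: ring_lang_def)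
    then obtain a where ts: "ts = [a]" by (auto simp: length_Suc_conv)
    obtain p where p: "polyfun p" "\<And>e. integral_env e \<Longrightarrow> tm_val (ring_struct (res_field v)) (\<lambda>i. res v (e i)) a = res v (p e)"
      using IH[of a] ts by auto
    have "tm_val (ring_struct (res_field v)) (\<lambda>i. res v (e i)) (Fn f ts) = res v (- p e)" if e: "integral_env e" for e
    proof -
      have "tm_val (ring_struct (res_field v)) (\<lambda>i. res v (e i)) (Fn f ts) =
          \<ominus>\<^bsub>res_field v\<^esub> tm_val (ring_struct (res_field v)) (\<lambda>i. res v (e i)) a"
        by (simp add: ring_struct_def ts Uminus_sym)
      thus ?thesis using p(2)[OF e] res_minus[OF polyfun_env[OF p(1) e]] by simp
    qed
    thus ?thesis using polyfun_minus[OF p(1)] by blast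
  next
    case Plus_sym
    hence "length ts = 2" using len by (simp add: ring_lang_def)
    then obtain a b where ts: "ts = [a, b]" by (auto simp: numeral_2_eq_2 length_Suc_conv)
    obtain p q where p: "polyfun p" "\<And>e. integral_env e \<Longrightarrow> tm_val (ring_struct (res_field v)) (\<lambda>i. res v (e i)) a = res v (p e)"
      and q: "polyfun q" "\<And>e. integral_env e \<Longrightarrow> tm_val (ring_struct (res_field v)) (\<lambda>i. res v (e i)) b = res v (q e)"
      using IH[of a] IH[of b] ts by auto
    have "tm_val (ring_struct (res_field v)) (\<lambda>i. res v (e i)) (Fn f ts) = res v (p e + q e)" if e: "integral_env e" for e
    proof -
      have "tm_val (ring_struct (res_field v)) (\<lambda>i. res v (e i)) (Fn f ts) =
          tm_val (ring_struct (res_field v)) (\<lambda>i. res v (e i)) a \<oplus>\<^bsub>res_field v\<^esub>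
          tm_val (ring_struct (res_field v)) (\<lambda>i. res v (e i)) b"
        by (simp add: ring_struct_def ts Plus_sym)
      thus ?thesis using p(2)[OF e] q(2)[OF e] res_add by simp
    qed
    thus ?thesis using polyfun.add[OF p(1) q(1)] by blast
  next
    case Times_sym
    hence "length ts = 2" using len by (simp add: ring_lang_def)
    then obtain a b where ts: "ts = [a, b]" by (auto simp: numeral_2_eq_2 length_Suc_conv)
    obtain p q where p: "polyfun p" "\<And>e. integral_env e \<Longrightarrow> tm_val (ring_struct (res_field v)) (\<lambda>i. res v (e i)) a = res v (p e)"
      and q: "polyfun q" "\<And>e. integral_env e \<Longrightarrow> tm_val (ring_struct (res_field v)) (\<lambda>i. res v (e i)) b = res v (q e)"
      using IH[of a] IH[of b] ts by auto
    have "tm_val (ring_struct (res_field v)) (\<lambda>i. res v (e i)) (Fn f ts) = res v (p e * q e)" if e: "integral_env e" for e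
    proof -
      have "tm_val (ring_struct (res_field v)) (\<lambda>i. res v (e i)) (Fn f ts) =
          tm_val (ring_struct (res_field v)) (\<lambda>i. res v (e i)) a \<otimes>\<^bsub>res_field v\<^esub>
          tm_val (ring_struct (res_field v)) (\<lambda>i. res v (e i)) b"
        by (simp add: ring_struct_def ts Times_sym)
      thus ?thesis
        using p(2)[OF e] q(2)[OF e] res_mult[OF val, of "p e" "q e"]
          polyfun_env[OF p(1) e] polyfun_env[OF q(1) e] by (simp add: integral_def)
    qed
    thus ?thesis using polyfun.mult[OF p(1) q(1)] by blast
  qed
qed

text \<open>Quantifiers of the residue field range over residues of integral elements, so they are
  removed by \<open>constructible_ex\<close>.\<close>

lemma constructible_of_formula:
  "wf_fm ring_lang \<phi> \<Longrightarrow> constructible (\<lambda>e. sat (ring_struct (res_field v)) (\<lambda>i. res v (e i)) \<phi>)"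
proof (induction \<phi>)
  case (Eq s t)
  obtain p where p: "polyfun p" "\<And>e. integral_env e \<Longrightarrow> tm_val (ring_struct (res_field v)) (\<lambda>i. res v (e i)) s = res v (p e)"
    using polyfun_of_term[of s] Eq by auto
  obtain q where q: "polyfun q" "\<And>e. integral_env e \<Longrightarrow> tm_val (ring_struct (res_field v)) (\<lambda>i. res v (e i)) t = res v (q e)"
    using polyfun_of_term[of t] Eq by auto
  show ?case
    by (rule constructible.equiv[OF constructible.atom[OF polyfun_diff[OF p(1) q(1)]]])
      (simp add: p(2) q(2) res_eq_iff)
next
  case (Rel r ts)
  thus ?case by (simp add: ring_lang_def)
next
  case (Neg \<phi>)
  thus ?case using constructible.neg by simp
next
  case (Conj \<phi> \<psi>)
  thus ?case using constructible.conj by simp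
next
  case (Ex \<phi>)
  hence "constructible (\<lambda>e. \<exists>x. integral x \<and> sat (ring_struct (res_field v)) (\<lambda>i. res v (case_nat x e i)) \<phi>)"
    by (intro constructible_ex) simp
  moreover have "(\<lambda>i. res v (case_nat x e i)) = case_nat (res v x) (\<lambda>i. res v (e i))" for x e
    by (auto simp: fun_eq_iff split: nat.split)
  moreover have "univ (ring_struct (res_field v)) = res v ` Collect integral"
    unfolding carrier_res[symmetric] by (simp add: ring_struct_def)
  ultimately show ?case by simp
qed

lemma constructible_of_definable_pairs:
  assumes "definable ring_lang (ring_struct (res_field v)) 2 X"
  shows "constructible (\<lambda>e. [res v (e 0), res v (e 1)] \<in> X)"
proof -
  have un: "univ (ring_struct (res_field v)) = res v ` Collect integral"
    unfolding carrier_res[symmetric] by (simp add: ring_struct_def)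
  from assms obtain \<phi> \<rho> where 1: "wf_fm ring_lang \<phi>" "range \<rho> \<subseteq> res v ` Collect integral"
    "X = {xs. length xs = 2 \<and> set xs \<subseteq> res v ` Collect integral \<and>
      sat (ring_struct (res_field v)) (\<lambda>i. if i < 2 then xs ! i else \<rho> (i - 2)) \<phi>}"
    unfolding definable_def un by blast
  have "\<forall>i. \<exists>r. integral r \<and> \<rho> i = res v r" using 1(2) by blast
  then obtain r where r: "\<And>i. integral (r i)" "\<And>i. \<rho> i = res v (r i)" by metis
  define t where "t i e = (if i < 2 then e i else r (i - 2))" for i and e :: "nat \<Rightarrow> 'm"
  have "polyfun (t i)" for i
    unfolding t_def using polyfun.var[of i] polyfun.const[OF r(1)] by (cases "i < 2") simp_all
  from constructible_subst[OF constructible_of_formula[OF 1(1)] this]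
  show ?thesis
  proof (rule constructible.equiv)
    fix e :: "nat \<Rightarrow> 'm" assume e: "integral_env e"
    have "(\<lambda>i. if i < 2 then [res v (e 0), res v (e (Suc 0))] ! i else \<rho> (i - 2)) = (\<lambda>i. res v (t i e))"
      by (auto simp: fun_eq_iff t_def r(2) less_2_cases_iff)
    thus "[res v (e 0), res v (e 1)] \<in> X \<longleftrightarrow> sat (ring_struct (res_field v)) (\<lambda>i. res v (t i e)) \<phi>"
      using e unfolding 1(3) integral_env_def by auto
  qed
qed

end

section \<open>Subgroups of \<open>(k\<^sup>\<times>)\<^sup>2\<close>\<close>

lemma morley_ge_1_infinite: "morley_ge P (Suc 0) X \<Longrightarrow> infinite X"
proof
  assume "morley_ge P (Suc 0) X" and fin: "finite X"
  then obtain Y :: "nat \<Rightarrow> _" where Y: "disjoint_family Y" "\<And>i. Y i \<subseteq> X" "\<And>i. Y i \<noteq> {}" by auto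
  define f where "f i = (SOME x. x \<in> Y i)" for i
  have f: "f i \<in> Y i" for i unfolding f_def using Y(3)[of i] by (simp add: some_in_eq)
  have "inj f"
  proof (rule injI)
    fix i j assume "f i = f j"
    thus "i = j" using f[of i] f[of j] Y(1) unfolding disjoint_family_on_def by (metis UNIV_I disjoint_iff)
  qed
  moreover have "range f \<subseteq> X" using f Y(2) by blast
  ultimately show False using fin finite_subset range_inj_infinite by blast
qed

lemma infinite_morley_ge_1:
  assumes "infinite X" "\<And>p. p \<in> X \<Longrightarrow> P {p}" shows "morley_ge P (Suc 0) X"
proof -
  obtain f :: "nat \<Rightarrow> _" where f: "inj f" "range f \<subseteq> X" using infinite_countable_subset[OF assms(1)] by blast
  have "disjoint_family (\<lambda>i. {f i})"
    unfolding disjoint_family_on_def using f(1) by (auto dest: injD)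
  thus ?thesis using f(2) assms(2) by (auto intro!: exI[of _ "\<lambda>i. {f i}"])
qed

context C_min_ACVF
begin

lemma rv_res: "unit_elt x \<Longrightarrow> rv v x = res v x"
  using rv_eq_res[OF val] unfolding unit_elt_def by blast

lemma carrier_kx: "carrier (kx v) = rv v ` Collect unit_elt"
proof -
  have "carrier (kx v) = RV_fiber v 0" using RV_fiber_0_eq_kx[OF val] ..
  also have "\<dots> = rv v ` Collect unit_elt"
    unfolding RV_fiber_def carrier_RV unit_elt_def using rv_val_rv[OF val] by auto
  finally show ?thesis .
qed

lemma RV_fiber_eq: "RV_fiber v a = rv v ` {x. x \<noteq> 0 \<and> v x = a}"
  unfolding RV_fiber_def carrier_RV using rv_val_rv[OF val] by auto

lemma kx_mult_rv:
  assumes "unit_elt x" "unit_elt y" shows "rv v x \<otimes>\<^bsub>kx v\<^esub> rv v y = rv v (x * y)"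
proof -
  have "rv v x \<in> carrier (kx v)" "rv v y \<in> carrier (kx v)" unfolding carrier_kx using assms by blast+
  thus ?thesis using kx_mult_eq_RV_mult[OF val] RV_mult[OF val, of x y] assms by (simp add: unit_elt_def)
qed

lemma kx_one: "\<one>\<^bsub>kx v\<^esub> = rv v 1"
  using res_one rv_res[of 1] by (simp add: unit_elt_def)

lemma defpred_res: "defterm f \<Longrightarrow> defterm g \<Longrightarrow> defpred (\<lambda>e. res v (f e) = res v (g e))"
  unfolding res_eq_iff infsml_def by (intro def_intros)

lemma defpred_integral: "defterm f \<Longrightarrow> defpred (\<lambda>e. integral (f e))"
  unfolding integral_def by (intro def_intros)

lemma defpred_unit_elt: "defterm f \<Longrightarrow> defpred (\<lambda>e. unit_elt (f e))"
  unfolding unit_elt_def by (intro def_intros)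

lemma definable_k2_rel:
  assumes R: "defpred (\<lambda>e. R (e 0) (e 1))" and unit: "\<And>x y. R x y \<Longrightarrow> unit_elt x \<and> unit_elt y"
  shows "definable_k2 L M v {(rv v x, rv v y) | x y. R x y}"
proof -
  let ?X = "{(rv v x, rv v y) | x y. R x y}"
  have e: "(rv v x, rv v y) = (res v x, res v y)" if "R x y" for x y
    using unit[OF that] by (simp add: rv_res)
  have X: "?X = {(res v x, res v y) | x y. R x y}"
  proof (intro Collect_cong iffI; elim exE conjE)
    fix p x y assume p: "p = (rv v x, rv v y)" "R x y"
    show "\<exists>x y. p = (res v x, res v y) \<and> R x y" using p(2) unfolding p(1) e[OF p(2)] by blast
  next
    fix p x y assume p: "p = (res v x, res v y)" "R x y"
    show "\<exists>x y. p = (rv v x, rv v y) \<and> R x y" using p(2) unfolding p(1) e[OF p(2), symmetric] by blast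
  qed
  have c: "carrier (val_ring v) = Collect integral" by (auto simp: val_ring_def integral_def)
  have "?X \<subseteq> res v ` Collect integral \<times> res v ` Collect integral"
    unfolding X using unit unfolding unit_elt_iff by blast
  moreover have "definable L M 2 {[x, y] | x y. integral x \<and> integral y \<and> (\<exists>x' y'. R x' y' \<and> res v x = res v x' \<and> res v y = res v y')}"
    by (intro definable_pairs defpred_app2[OF R] defpred_res defpred_integral def_intros)
  moreover have "{[x, y] | x y. integral x \<and> integral y \<and> (\<exists>x' y'. R x' y' \<and> res v x = res v x' \<and> res v y = res v y')} =
      {[x, y] | x y. x \<in> Collect integral \<and> y \<in> Collect integral \<and> (res v x, res v y) \<in> ?X}"
    unfolding X by blast
  ultimately show ?thesis unfolding definable_quot2_def c by (simp only:)
qed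

lemma defpred_of_definable_k2:
  assumes "definable_k2 L M v X"
  shows "defpred (\<lambda>e. unit_elt (e 0) \<and> unit_elt (e 1) \<and> (rv v (e 0), rv v (e 1)) \<in> X)"
proof -
  have c: "carrier (val_ring v) = Collect integral" by (auto simp: val_ring_def integral_def)
  have "definable L M 2 {[x, y] | x y. integral x \<and> integral y \<and> (res v x, res v y) \<in> X}"
    using assms unfolding definable_quot2_def c by simp
  note X = defpred_of_definable_pairs[OF this]
  have "defpred (\<lambda>e. unit_elt (e 0) \<and> unit_elt (e 1))" by (intro defpred_unit_elt def_intros)
  note defpred_conj[OF this X]
  moreover have "((unit_elt x \<and> unit_elt y) \<and> (integral x \<and> integral y \<and> (res v x, res v y) \<in> X)) \<longleftrightarrow>
      unit_elt x \<and> unit_elt y \<and> (rv v x, rv v y) \<in> X" for x y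
    using rv_res unit_elt_iff by auto
  ultimately show ?thesis by simp
qed

lemma definable_k2_point:
  assumes "unit_elt a" "unit_elt b" shows "definable_k2 L M v {(rv v a, rv v b)}"
proof -
  have "definable_k2 L M v {(rv v x, rv v y) | x y. x = a \<and> y = b}"
  proof (rule definable_k2_rel)
    show "defpred (\<lambda>e. e 0 = a \<and> e 1 = b)" by (intro def_intros)
  qed (use assms in auto)
  thus ?thesis by simp
qed

text \<open>
  By strong minimality, the infinite definable subsets of a set with uniformly finite fibres over
  one coordinate have cofinite projections, so boundedly many of them are pairwise disjoint.
\<close>

lemma morley_rank_le_1:
  assumes X: "X \<subseteq> carrier (kx v) \<times> carrier (kx v)" and f: "f = fst \<or> f = snd"
    and fin: "\<And>A. finite {p \<in> X. f p = A}" and card: "\<And>A. card {p \<in> X. f p = A} \<le> N"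
  shows "morley_rank_le (definable_k2 L M v) X 1"
  unfolding morley_rank_le_def
proof
  assume "morley_ge (definable_k2 L M v) (Suc 1) X"
  then obtain Y :: "nat \<Rightarrow> _" where Y: "disjoint_family Y" "\<And>i. definable_k2 L M v (Y i)" "\<And>i. Y i \<subseteq> X"
    "\<And>i. morley_ge (definable_k2 L M v) (Suc 0) (Y i)" unfolding One_nat_def morley_ge.simps(2)[of _ "Suc 0"] by blast
  have YX: "Y i \<subseteq> rv v ` Collect unit_elt \<times> rv v ` Collect unit_elt" for i
    using Y(3) X unfolding carrier_kx by blast
  define S where "S i u \<longleftrightarrow> unit_elt u \<and> rv v u \<in> f ` Y i" for i u
  have Sd: "defpred (\<lambda>e. S i (e 0))" for i
  proof (cases "f = fst")
    case True
    have "S i u \<longleftrightarrow> (\<exists>w. unit_elt u \<and> unit_elt w \<and> (rv v u, rv v w) \<in> Y i)" for u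
    proof
      assume "S i u"
      then obtain p where p: "unit_elt u" "p \<in> Y i" "fst p = rv v u" unfolding S_def True by auto
      then obtain w where w: "unit_elt w" "snd p = rv v w" using YX[of i] by auto
      have "p = (rv v u, rv v w)" using p(3) w(2) by (metis prod.collapse)
      thus "\<exists>w. unit_elt u \<and> unit_elt w \<and> (rv v u, rv v w) \<in> Y i" using p(1,2) w(1) by blast
    qed (auto simp: S_def True intro!: image_eqI[of _ fst])
    moreover have "defpred (\<lambda>e. \<exists>w. unit_elt (e 0) \<and> unit_elt w \<and> (rv v (e 0), rv v w) \<in> Y i)"
      by (rule defpred_ex, rule defpred_app2[OF defpred_of_definable_k2[OF Y(2)]]) (intro def_intros)+
    ultimately show ?thesis by simp
  next
    case False
    hence f: "f = snd" using f by blast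
    have "S i u \<longleftrightarrow> (\<exists>w. unit_elt w \<and> unit_elt u \<and> (rv v w, rv v u) \<in> Y i)" for u
    proof
      assume "S i u"
      then obtain p where p: "unit_elt u" "p \<in> Y i" "snd p = rv v u" unfolding S_def f by auto
      then obtain w where w: "unit_elt w" "fst p = rv v w" using YX[of i] by auto
      have "p = (rv v w, rv v u)" using p(3) w(2) by (metis prod.collapse)
      thus "\<exists>w. unit_elt w \<and> unit_elt u \<and> (rv v w, rv v u) \<in> Y i" using p(1,2) w(1) by blast
    qed (auto simp: S_def f intro!: image_eqI[of _ snd])
    moreover have "defpred (\<lambda>e. \<exists>w. unit_elt w \<and> unit_elt (e 0) \<and> (rv v w, rv v (e 0)) \<in> Y i)"
      by (rule defpred_ex, rule defpred_app2[OF defpred_of_definable_k2[OF Y(2)]]) (intro def_intros)+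
    ultimately show ?thesis by simp
  qed
  have Sinf: "infinite (rv v ` Collect (S i))" for i
  proof
    assume "finite (rv v ` Collect (S i))"
    moreover have "f ` Y i \<subseteq> rv v ` Collect (S i)"
    proof
      fix A assume A: "A \<in> f ` Y i"
      hence "A \<in> rv v ` Collect unit_elt" using YX[of i] f by force
      thus "A \<in> rv v ` Collect (S i)" using A unfolding S_def by blast
    qed
    ultimately have "finite (f ` Y i)" by (rule finite_subset[rotated])
    hence "finite (\<Union>A\<in>f ` Y i. {p \<in> X. f p = A})" using fin by blast
    moreover have "Y i \<subseteq> (\<Union>A\<in>f ` Y i. {p \<in> X. f p = A})" using Y(3) by blast
    ultimately have "finite (Y i)" by (rule finite_subset[rotated])
    thus False using morley_ge_1_infinite[OF Y(4)] by simp
  qed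
  have "\<exists>F. finite F \<and> (\<forall>u. unit_elt u \<longrightarrow> rv v u \<notin> F \<longrightarrow> S i u)" for i
    using cofinite_rv[OF Sd _ Sinf, of i 0] unfolding S_def unit_elt_def by auto
  then obtain F where F: "\<And>i. finite (F i)" "\<And>i u. unit_elt u \<Longrightarrow> rv v u \<notin> F i \<Longrightarrow> S i u" by metis
  obtain u where u: "unit_elt u" "rv v u \<notin> (\<Union>i\<le>N. F i)"
    using avoid_rv[of "\<Union>i\<le>N. F i" 0] F(1) unfolding unit_elt_def by blast
  have "\<forall>i\<in>{..N}. \<exists>p\<in>Y i. f p = rv v u" using F(2)[OF u(1)] u(2) unfolding S_def by fastforce
  then obtain p where p: "\<And>i. i \<le> N \<Longrightarrow> p i \<in> Y i \<and> f (p i) = rv v u" by (metis atMost_iff)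
  have "inj_on p {..N}"
  proof (rule inj_onI)
    fix i j assume "i \<in> {..N}" "j \<in> {..N}" "p i = p j"
    thus "i = j" using p[of i] p[of j] Y(1) unfolding disjoint_family_on_def
      by (metis UNIV_I atMost_iff disjoint_iff)
  qed
  hence "card (p ` {..N}) = Suc N" by (simp add: card_image)
  moreover have "p ` {..N} \<subseteq> {q \<in> X. f q = rv v u}" using p Y(3) by blast
  moreover note card_mono[OF fin, of "p ` {..N}" "rv v u"]
  ultimately have "Suc N \<le> card {q \<in> X. f q = rv v u}" by simp
  thus False using card[of "rv v u"] by simp
qed

lemma inv_kx2:
  assumes "unit_elt x" "unit_elt y"
  shows "inv\<^bsub>kx v \<times>\<times> kx v\<^esub> (rv v x, rv v y) = (rv v (1 / x), rv v (1 / y))"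
  unfolding m_inv_def
proof (rule the_equality)
  have u: "unit_elt (1 / x)" "unit_elt (1 / y)" using assms unfolding unit_elt_def by (simp_all add: v_divide)
  have "x \<noteq> 0" "y \<noteq> 0" using assms unfolding unit_elt_def by simp_all
  thus "(rv v (1 / x), rv v (1 / y)) \<in> carrier (kx v \<times>\<times> kx v) \<and>
    (rv v x, rv v y) \<otimes>\<^bsub>kx v \<times>\<times> kx v\<^esub> (rv v (1 / x), rv v (1 / y)) = \<one>\<^bsub>kx v \<times>\<times> kx v\<^esub> \<and>
    (rv v (1 / x), rv v (1 / y)) \<otimes>\<^bsub>kx v \<times>\<times> kx v\<^esub> (rv v x, rv v y) = \<one>\<^bsub>kx v \<times>\<times> kx v\<^esub>"
    unfolding DirProd_def by (simp only: monoid.simps partial_object.simps split kx_mult_rv[OF assms(1) u(1)]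
      kx_mult_rv[OF assms(2) u(2)] kx_mult_rv[OF u(1) assms(1)] kx_mult_rv[OF u(2) assms(2)] kx_one carrier_kx)
     (use u in \<open>auto\<close>)
next
  fix p assume p: "p \<in> carrier (kx v \<times>\<times> kx v) \<and>
    (rv v x, rv v y) \<otimes>\<^bsub>kx v \<times>\<times> kx v\<^esub> p = \<one>\<^bsub>kx v \<times>\<times> kx v\<^esub> \<and> p \<otimes>\<^bsub>kx v \<times>\<times> kx v\<^esub> (rv v x, rv v y) = \<one>\<^bsub>kx v \<times>\<times> kx v\<^esub>"
  then obtain a b where ab: "p = (rv v a, rv v b)" "unit_elt a" "unit_elt b"
    unfolding DirProd_def carrier_kx by auto
  have "rv v x \<otimes>\<^bsub>kx v\<^esub> rv v a = rv v 1" "rv v y \<otimes>\<^bsub>kx v\<^esub> rv v b = rv v 1"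
    using p unfolding ab(1) DirProd_def kx_one[symmetric] by simp_all
  hence "rv v (x * a) = rv v 1" "rv v (y * b) = rv v 1" using kx_mult_rv assms ab by simp_all
  hence "rv v (x * a / x) = rv v (1 / x)" "rv v (y * b / y) = rv v (1 / y)"
    using rv_divide_cong[OF _ refl] by blast+
  thus "p = (rv v (1 / x), rv v (1 / y))" using assms unfolding ab(1) unit_elt_def by simp
qed

text \<open>Subgroups of \<open>(k\<^sup>\<times>)\<^sup>2\<close> presented by relations between units.\<close>

definition rel_group :: "('m \<Rightarrow> 'm \<Rightarrow> bool) \<Rightarrow> bool" where
  "rel_group R \<longleftrightarrow> (\<forall>x y. R x y \<longrightarrow> unit_elt x \<and> unit_elt y) \<and> R 1 1 \<and>
    (\<forall>x y x' y'. R x y \<longrightarrow> R x' y' \<longrightarrow> R (x * x') (y * y')) \<and> (\<forall>x y. R x y \<longrightarrow> R (1 / x) (1 / y)) \<and>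
    (\<forall>x y x' y'. rv v x = rv v x' \<longrightarrow> rv v y = rv v y' \<longrightarrow> R x y \<longrightarrow> R x' y')"

definition rv_rel :: "('m \<Rightarrow> 'm \<Rightarrow> bool) \<Rightarrow> ('m set \<times> 'm set) set" where
  "rv_rel R = {(rv v x, rv v y) | x y. R x y}"

lemma rel_groupD:
  assumes "rel_group R"
  shows "\<And>x y. R x y \<Longrightarrow> unit_elt x \<and> unit_elt y" "R 1 1"
    "\<And>x y x' y'. R x y \<Longrightarrow> R x' y' \<Longrightarrow> R (x * x') (y * y')"
    "\<And>x y. R x y \<Longrightarrow> R (1 / x) (1 / y)"
    "\<And>x y x' y'. rv v x = rv v x' \<Longrightarrow> rv v y = rv v y' \<Longrightarrow> R x y \<Longrightarrow> R x' y'"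
proof -
  note R = assms[unfolded rel_group_def]
  note R2 = conjunct2[OF R] and R3 = conjunct2[OF conjunct2[OF R]]
    and R4 = conjunct2[OF conjunct2[OF conjunct2[OF R]]]
  show "R x y \<Longrightarrow> unit_elt x \<and> unit_elt y" for x y by (rule conjunct1[OF R, rule_format])
  show "R 1 1" by (rule conjunct1[OF R2])
  show "R x y \<Longrightarrow> R x' y' \<Longrightarrow> R (x * x') (y * y')" for x y x' y' by (rule conjunct1[OF R3, rule_format])
  show "R x y \<Longrightarrow> R (1 / x) (1 / y)" for x y by (rule conjunct1[OF R4, rule_format])
  show "rv v x = rv v x' \<Longrightarrow> rv v y = rv v y' \<Longrightarrow> R x y \<Longrightarrow> R x' y'" for x y x' y'
    by (rule conjunct2[OF R4, rule_format])
qed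

lemma subgroup_rv_rel:
  assumes R: "rel_group R" shows "subgroup (rv_rel R) (kx v \<times>\<times> kx v)"
proof (rule subgroup.intro)
  show "rv_rel R \<subseteq> carrier (kx v \<times>\<times> kx v)"
    using rel_groupD(1)[OF R] unfolding rv_rel_def DirProd_def carrier_kx by auto
next
  fix p q assume "p \<in> rv_rel R" "q \<in> rv_rel R"
  then obtain x y x' y' where pq: "p = (rv v x, rv v y)" "R x y" "q = (rv v x', rv v y')" "R x' y'"
    unfolding rv_rel_def by blast
  have u: "unit_elt x" "unit_elt y" "unit_elt x'" "unit_elt y'"
    using rel_groupD(1)[OF R pq(2)] rel_groupD(1)[OF R pq(4)] by simp_all
  have "p \<otimes>\<^bsub>kx v \<times>\<times> kx v\<^esub> q = (rv v (x * x'), rv v (y * y'))"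
    using u unfolding pq DirProd_def by (simp only: monoid.simps split kx_mult_rv)
  moreover have "R (x * x') (y * y')" by (rule rel_groupD(3)[OF R pq(2,4)])
  ultimately show "p \<otimes>\<^bsub>kx v \<times>\<times> kx v\<^esub> q \<in> rv_rel R" unfolding rv_rel_def by blast
next
  have "\<one>\<^bsub>kx v \<times>\<times> kx v\<^esub> = (rv v 1, rv v 1)" unfolding DirProd_def by (simp only: monoid.simps kx_one)
  thus "\<one>\<^bsub>kx v \<times>\<times> kx v\<^esub> \<in> rv_rel R" using rel_groupD(2)[OF R] unfolding rv_rel_def by blast
next
  fix p assume "p \<in> rv_rel R"
  then obtain x y where p: "p = (rv v x, rv v y)" "R x y" unfolding rv_rel_def by blast
  have "unit_elt x" "unit_elt y" "R (1 / x) (1 / y)"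
    using rel_groupD(1,4)[OF R p(2)] by simp_all
  thus "inv\<^bsub>kx v \<times>\<times> kx v\<^esub> p \<in> rv_rel R" unfolding p(1) using inv_kx2[of x y] by (auto simp: rv_rel_def)
qed

text \<open>All fibres of the group over one coordinate are translates of the corresponding kernel.
  If this kernel is finite, their sizes are bounded by its order, as \<open>morley_rank_le_1\<close>
  demands.\<close>

lemma one_dim_rv_rel:
  assumes R: "rel_group R" and Rd: "defpred (\<lambda>e. R (e 0) (e 1))" and inf: "infinite (rv_rel R)"
    and ker: "finite (rv v ` {y. R 1 y}) \<or> finite (rv v ` {x. R x 1})"
  shows "one_dim_definable_subgroup L M v (rv_rel R)"
proof -
  have sub: "subgroup (rv_rel R) (kx v \<times>\<times> kx v)" by (rule subgroup_rv_rel[OF R])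
  have def: "definable_k2 L M v (rv_rel R)"
    unfolding rv_rel_def by (rule definable_k2_rel[OF Rd rel_groupD(1)[OF R]])
  have pt: "definable_k2 L M v {p}" if "p \<in> rv_rel R" for p
    using that rel_groupD(1)[OF R] definable_k2_point unfolding rv_rel_def by auto
  have ge: "morley_ge (definable_k2 L M v) 1 (rv_rel R)"
    using infinite_morley_ge_1[where P = "definable_k2 L M v", OF inf pt] by simp
  have c: "rv_rel R \<subseteq> carrier (kx v) \<times> carrier (kx v)"
    using rel_groupD(1)[OF R] unfolding rv_rel_def carrier_kx by auto
  have mult: "R (x / x') (y / y')" if "R x y" "R x' y'" for x y x' y'
  proof -
    have "R (x * (1 / x')) (y * (1 / y'))"
      by (rule rel_groupD(3)[OF R that(1) rel_groupD(4)[OF R that(2)]])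
    thus ?thesis by simp
  qed
  note inv = rel_groupD(5)[OF R] and un = rel_groupD(1)[OF R]
  have le: "morley_rank_le (definable_k2 L M v) (rv_rel R) 1"
    using ker
  proof
    assume fin: "finite (rv v ` {y. R 1 y})"
    have "finite {p \<in> rv_rel R. fst p = A} \<and> card {p \<in> rv_rel R. fst p = A} \<le> card (rv v ` {y. R 1 y})" for A
    proof (cases "\<exists>x y. A = rv v x \<and> R x y")
      case True
      then obtain x y where xy: "A = rv v x" "R x y" by blast
      have u: "x \<noteq> 0" "y \<noteq> 0" using un[OF xy(2)] unfolding unit_elt_def by auto
      define h where "h B = (A, rv v ((SOME t. rv v t = B) * y))" for B
      have h: "h (rv v t) = (A, rv v (t * y))" for t
        unfolding h_def by (intro arg_cong[where f = "Pair A"] rv_mult_cong refl someI[of _ t])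
      have "{p \<in> rv_rel R. fst p = A} \<subseteq> h ` rv v ` {y. R 1 y}"
      proof
        fix p assume "p \<in> {p \<in> rv_rel R. fst p = A}"
        then obtain x' y' where p: "p = (A, rv v y')" "R x' y'" "rv v x' = A" unfolding rv_rel_def by auto
        have "R (x' / x) (y' / y)" using mult[OF p(2) xy(2)] .
        moreover have "rv v (x' / x) = rv v (x / x)" using p(3) xy(1) by (intro rv_divide_cong refl) simp
        ultimately have "R 1 (y' / y)" using inv[OF _ refl, of "x' / x" 1] u by simp
        moreover have "p = h (rv v (y' / y))" unfolding h p using u by simp
        ultimately show "p \<in> h ` rv v ` {y. R 1 y}" by blast
      qed
      moreover have "finite (h ` rv v ` {y. R 1 y})" "card (h ` rv v ` {y. R 1 y}) \<le> card (rv v ` {y. R 1 y})"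
        using fin by (auto intro: card_image_le)
      ultimately show ?thesis by (meson card_mono finite_subset le_trans)
    next
      case False
      hence "{p \<in> rv_rel R. fst p = A} = {}" unfolding rv_rel_def by auto
      thus ?thesis by (simp only: finite.emptyI card.empty le0 simp_thms)
    qed
    thus ?thesis by (intro morley_rank_le_1[OF c, of fst]) blast+
  next
    assume fin: "finite (rv v ` {x. R x 1})"
    have "finite {p \<in> rv_rel R. snd p = A} \<and> card {p \<in> rv_rel R. snd p = A} \<le> card (rv v ` {x. R x 1})" for A
    proof (cases "\<exists>x y. A = rv v y \<and> R x y")
      case True
      then obtain x y where xy: "A = rv v y" "R x y" by blast
      have u: "x \<noteq> 0" "y \<noteq> 0" using un[OF xy(2)] unfolding unit_elt_def by auto
      define h where "h B = (rv v ((SOME t. rv v t = B) * x), A)" for B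
      have h: "h (rv v t) = (rv v (t * x), A)" for t
        unfolding h_def by (intro arg_cong[where f = "\<lambda>B. (B, A)"] rv_mult_cong refl someI[of _ t])
      have "{p \<in> rv_rel R. snd p = A} \<subseteq> h ` rv v ` {x. R x 1}"
      proof
        fix p assume "p \<in> {p \<in> rv_rel R. snd p = A}"
        then obtain x' y' where p: "p = (rv v x', A)" "R x' y'" "rv v y' = A" unfolding rv_rel_def by auto
        have "R (x' / x) (y' / y)" using mult[OF p(2) xy(2)] .
        moreover have "rv v (y' / y) = rv v (y / y)" using p(3) xy(1) by (intro rv_divide_cong refl) simp
        ultimately have "R (x' / x) 1" using inv[OF refl, of "y' / y" 1] u by simp
        moreover have "p = h (rv v (x' / x))" unfolding h p using u by simp
        ultimately show "p \<in> h ` rv v ` {x. R x 1}" by blast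
      qed
      moreover have "finite (h ` rv v ` {x. R x 1})" "card (h ` rv v ` {x. R x 1}) \<le> card (rv v ` {x. R x 1})"
        using fin by (auto intro: card_image_le)
      ultimately show ?thesis by (meson card_mono finite_subset le_trans)
    next
      case False
      hence "{p \<in> rv_rel R. snd p = A} = {}" unfolding rv_rel_def by auto
      thus ?thesis by (simp only: finite.emptyI card.empty le0 simp_thms)
    qed
    thus ?thesis by (intro morley_rank_le_1[OF c, of snd]) blast+
  qed
  show ?thesis
    unfolding one_dim_definable_subgroup_def morley_rank_eq_def using sub def ge le by blast
qed

lemma translate_rv_rel:
  assumes R: "rel_group R" and "a \<noteq> 0" "b \<noteq> 0"
  shows "rv_rel R #>\<^bsub>RV v \<times>\<times> RV v\<^esub> (rv v a, rv v b) = {(rv v (x * a), rv v (y * b)) | x y. R x y}"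
proof -
  have m: "(rv v x, rv v y) \<otimes>\<^bsub>RV v \<times>\<times> RV v\<^esub> (rv v a, rv v b) = (rv v (x * a), rv v (y * b))" if "R x y" for x y
  proof -
    have "x \<noteq> 0" "y \<noteq> 0" using rel_groupD(1)[OF R that] unfolding unit_elt_def by blast+
    thus ?thesis unfolding DirProd_def using RV_mult[OF val] assms(2,3) by simp
  qed
  show ?thesis unfolding r_coset_def rv_rel_def using m by force
qed

end

lemma open_interval_Int:
  fixes I K :: "'g::linordered_ab_group_add set"
  assumes I: "open_interval I" and K: "open_interval K" and ne: "I \<inter> K \<noteq> {}"
  shows "open_interval (I \<inter> K)"
proof -
  from K consider "K = UNIV" | a where "K = {a<..}" | b where "K = {..<b}" | a b where "K = {a<..<b}"
    unfolding open_interval_def by blast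
  thus ?thesis
  proof cases
    case 1
    thus ?thesis using I by simp
  next
    case (2 a)
    thus ?thesis using open_interval_inter[OF I, of "{a<..}" a] ne by simp
  next
    case (3 b)
    thus ?thesis using open_interval_inter[OF I, of "{..<b}" b] ne by simp
  next
    case (4 a b)
    have e: "I \<inter> K = I \<inter> {a<..} \<inter> {..<b}" using 4 by auto
    hence "I \<inter> {a<..} \<noteq> {}" using ne by blast
    hence "open_interval (I \<inter> {a<..})" using open_interval_inter[OF I, of "{a<..}" a] by simp
    thus ?thesis using open_interval_inter[of "I \<inter> {a<..}" "{..<b}" b] ne unfolding e by simp
  qed
qed

context C_min_ACVF
begin

lemma defpred_open_interval:
  assumes "open_interval I" shows "defpred (\<lambda>e. v (e 0) \<in> I)"
proof -
  from assms consider "I = UNIV" | a where "I = {a<..}" | b where "I = {..<b}" | a b where "I = {a<..<b}"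
    unfolding open_interval_def by blast
  thus ?thesis
  proof cases
    case 1
    thus ?thesis by (simp add: defpred_const)
  next
    case (2 a)
    have "defpred (\<lambda>e. a < v (e 0))" by (intro def_intros)
    thus ?thesis using 2 by simp
  next
    case (3 b)
    have "defpred (\<lambda>e. v (e 0) < b)" by (intro def_intros)
    thus ?thesis using 3 by simp
  next
    case (4 a b)
    have "defpred (\<lambda>e. a < v (e 0) \<and> v (e 0) < b)" by (intro def_intros)
    thus ?thesis using 4 by simp
  qed
qed

lemma definable_Gamma2_rel:
  assumes "defpred (\<lambda>e. R (v (e 0)) (v (e 1)))"
  shows "definable_\<Gamma>2 L M v {(a, b) | a b. R a b}"
proof -
  have "definable L M 2 {[x, y] | x y. x \<noteq> 0 \<and> y \<noteq> 0 \<and> R (v x) (v y)}"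
    by (intro definable_pairs defpred_vv[OF assms] def_intros)
  moreover have "v ` (UNIV - {0}) = UNIV" using val unfolding valuation_def by blast
  ultimately show ?thesis unfolding definable_quot2_def by simp
qed

section \<open>Definable groups of units\<close>

lemma rv_prod_cong: "(\<And>a. a \<in> A \<Longrightarrow> rv v (f a) = rv v (g a)) \<Longrightarrow> rv v (prod f A) = rv v (prod g A)"
proof (induction A rule: infinite_finite_induct)
  case (insert a A)
  have "rv v (f a * prod f A) = rv v (g a * prod g A)"
    by (rule rv_mult_cong) (use insert.IH insert.prems in blast)+
  thus ?case unfolding prod.insert[OF insert.hyps] .
next
  case (infinite A)
  show ?case unfolding prod.infinite[OF infinite.hyps] ..
qed simp

text \<open>By strong minimality the group is cofinite, and any \<open>w\<close> is the quotient of
  the generic elements \<open>w * x\<close> and \<open>x\<close>.\<close>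

lemma infinite_unit_group:
  assumes S: "defpred (\<lambda>e. S (e 0))" and unit: "\<And>x. S x \<Longrightarrow> unit_elt x"
    and divide: "\<And>x y. S x \<Longrightarrow> S y \<Longrightarrow> S (x / y)"
    and inf: "infinite (rv v ` Collect S)" and w: "unit_elt w"
  shows "S w"
proof -
  from cofinite_rv[OF S _ inf, of 0] unit obtain F where
    F: "finite F" "\<And>x. unit_elt x \<Longrightarrow> rv v x \<notin> F \<Longrightarrow> S x" unfolding unit_elt_def by blast
  obtain x where x: "unit_elt x" "rv v x \<notin> F" "rv v (w * x) \<notin> F"
    using avoid_rv_translate[OF F(1), of w 0] w unfolding unit_elt_def by blast
  have "S (w * x / x)" using F(2) x unit_elt_mult[OF w x(1)] by (intro divide) blast+
  thus ?thesis using x(1) by (simp add: unit_elt_def)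
qed

text \<open>Multiplication by \<open>u\<close> permutes the classes, and comparing the products
  gives \<open>u ^ n = 1\<close> in the residue field. As \<open>X ^ n - 1\<close> has at most
  \<open>n\<close> roots there, the \<open>n\<close> classes of the group are all of them.\<close>

lemma finite_unit_group:
  assumes unit: "\<And>x. S x \<Longrightarrow> unit_elt x" and one: "S 1"
    and mult: "\<And>x y. S x \<Longrightarrow> S y \<Longrightarrow> S (x * y)"
    and inv: "\<And>x y. rv v x = rv v y \<Longrightarrow> S x \<Longrightarrow> S y"
    and fin: "finite (rv v ` Collect S)" and n: "n = card (rv v ` Collect S)"
  shows "0 < n" "\<And>u. unit_elt u \<Longrightarrow> S u \<longleftrightarrow> rv v (u ^ n) = rv v 1"
proof -
  show n0: "0 < n" unfolding n using one fin by (auto simp: card_gt_0_iff)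
  obtain A where A: "A \<subseteq> Collect S" "inj_on (rv v) A" "rv v ` Collect S = rv v ` A"
    using subset_image_inj[of "rv v ` Collect S" "rv v" "Collect S"] by auto
  have finA: "finite A" using fin A(2,3) by (metis finite_imageD)
  have cardA: "card A = n" unfolding n A(3) using A(2) by (simp add: card_image)
  have lag: "rv v (u ^ n) = rv v 1" if u: "S u" for u
  proof -
    have "\<exists>b\<in>A. rv v (u * a) = rv v b" if "a \<in> A" for a
    proof -
      have "S (u * a)" using A(1) that u by (intro mult) auto
      hence "rv v (u * a) \<in> rv v ` A" unfolding A(3)[symmetric] by blast
      thus ?thesis by blast
    qed
    then obtain \<pi> where \<pi>: "\<And>a. a \<in> A \<Longrightarrow> \<pi> a \<in> A" "\<And>a. a \<in> A \<Longrightarrow> rv v (u * a) = rv v (\<pi> a)" by metis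
    have u0: "u \<noteq> 0" using unit[OF u] by (simp add: unit_elt_def)
    have inj: "inj_on \<pi> A"
    proof (rule inj_onI)
      fix a b assume ab: "a \<in> A" "b \<in> A" "\<pi> a = \<pi> b"
      hence "rv v (u * a) = rv v (u * b)" using \<pi>(2) by simp
      hence "rv v a = rv v b" using rv_mult_left[OF u0] by blast
      thus "a = b" using A(2) ab by (meson inj_onD)
    qed
    have "\<pi> ` A \<subseteq> A" using \<pi>(1) by blast
    hence im: "\<pi> ` A = A" using finA inj by (metis card_image card_subset_eq)
    have P0: "prod id A \<noteq> 0" using finA A(1) unit unfolding unit_elt_def by (auto simp: prod_zero_iff)
    have "rv v (u ^ n * prod id A) = rv v (\<Prod>a\<in>A. u * a)"
      by (simp add: prod.distrib cardA)
    also have "\<dots> = rv v (\<Prod>a\<in>A. \<pi> a)" by (rule rv_prod_cong) (rule \<pi>(2))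
    also have "(\<Prod>a\<in>A. \<pi> a) = prod id (\<pi> ` A)" using inj by (simp add: prod.reindex)
    also have "\<dots> = 1 * prod id A" by (simp only: im mult_1)
    finally show ?thesis using rv_mult_right[OF P0] by blast
  qed
  define q where "q = (monom 1 n - 1 :: 'm poly)"
  have iq: "integral_poly q" unfolding q_def by (intro integral_poly_diff integral_poly_monom) (simp_all add: one_pCons)
  have "coeff q n = 1" using n0 by (simp add: q_def)
  hence nq: "\<not> infsml_poly q" unfolding infsml_poly_def by (metis not_infsml_1)
  have deg: "degree q \<le> n" unfolding q_def by (intro degree_diff_le degree_monom_le) simp
  have root: "infsml (poly q x) \<longleftrightarrow> rv v (x ^ n) = rv v 1" if "unit_elt x" for x
    using rv_unit_eq[OF unit_elt_power[OF that], of 1 n] by (simp add: q_def poly_monom unit_elt_def[of 1])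
  have sub: "rv v ` Collect S \<subseteq> rv v ` {x. unit_elt x \<and> infsml (poly q x)}"
    using unit lag root by blast
  have "card (rv v ` {x. unit_elt x \<and> infsml (poly q x)}) \<le> n"
    using finite_infsml_roots[OF iq nq] deg by linarith
  hence eq: "rv v ` Collect S = rv v ` {x. unit_elt x \<and> infsml (poly q x)}"
    using finite_infsml_roots[OF iq nq] sub unfolding n by (intro card_seteq) auto
  show "S u \<longleftrightarrow> rv v (u ^ n) = rv v 1" if u: "unit_elt u" for u
  proof
    assume "rv v (u ^ n) = rv v 1"
    hence "u \<in> {x. unit_elt x \<and> infsml (poly q x)}" using root[OF u] u by blast
    hence "rv v u \<in> rv v ` Collect S" unfolding eq by (rule imageI)
    then obtain s where "rv v u = rv v s" "S s" by (elim imageE CollectE)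
    thus "S u" using inv[of s u] by simp
  qed (rule lag)
qed

lemma unit_elt_root: "unit_elt x \<Longrightarrow> 0 < n \<Longrightarrow> \<exists>w. unit_elt w \<and> w ^ n = x"
proof -
  assume x: "unit_elt x" and n: "0 < n"
  obtain w where w: "w ^ n = x" using nth_root_exists[of n x] n by auto
  have w0: "w \<noteq> 0" using w x n by (auto simp: unit_elt_def)
  have "zmul (int n) (v w) = 0" unfolding zmul_of_nat using v_power[OF w0, of n] w x by (simp add: unit_elt_def)
  hence "v w = 0" using zmul_eq_0[of "int n" "v w"] n by simp
  thus ?thesis using w w0 unfolding unit_elt_def by blast
qed

lemma rv_divide_eq_1: "unit_elt y \<Longrightarrow> rv v (x / y) = rv v 1 \<longleftrightarrow> rv v x = rv v y"
  using rv_divide_eq[of y x 1] by (simp add: unit_elt_def)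

text \<open>
  A definable subgroup of \<open>(k\<^sup>\<times>)\<^sup>2\<close> that projects onto both factors with finite kernels of orders
  \<open>n\<close> and \<open>m\<close> becomes the graph of an automorphism after taking \<open>n\<close>-th and \<open>m\<close>-th powers.
\<close>

lemma no_exotic_relation:
  assumes R: "rel_group R" and Rd: "defpred (\<lambda>e. R (e 0) (e 1))"
    and surj: "\<And>x. unit_elt x \<Longrightarrow> \<exists>y. R x y" and ker: "finite (rv v ` {y. R 1 y})"
    and noex: "no_exotic_automorphisms L M v"
  shows "\<exists>i j i' j'. (i, j) \<noteq> (i', j') \<and> (\<forall>x y. R x y \<longrightarrow> rv v (x ^ i * y ^ j) = rv v (x ^ i' * y ^ j'))"
proof -
  note un = rel_groupD(1)[OF R] and R1 = rel_groupD(2)[OF R] and R_mult = rel_groupD(3)[OF R]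
    and R_inv = rel_groupD(5)[OF R]
  have R_div: "R (x / x') (y / y')" if "R x y" "R x' y'" for x y x' y'
    using R_mult[OF that(1) rel_groupD(4)[OF R that(2)]] by simp
  note Rd' = defpred_app2[OF Rd]
  show ?thesis
  proof (cases "finite (rv v ` {y. \<exists>x. R x y})")
    case True
    \<comment> \<open>The second coordinates form a finite group here. If \<open>n\<close> is its
      order, \<open>y ^ n = 1\<close> is already a monomial relation.\<close>
    define S where "S y \<longleftrightarrow> (\<exists>x. R x y)" for y
    have fin: "finite (rv v ` Collect S)" using True unfolding S_def .
    define n where "n = card (rv v ` Collect S)"
    have g: "\<And>y. S y \<Longrightarrow> unit_elt y" "S 1" "\<And>y y'. S y \<Longrightarrow> S y' \<Longrightarrow> S (y * y')"
      "\<And>y y'. rv v y = rv v y' \<Longrightarrow> S y \<Longrightarrow> S y'"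
      unfolding S_def using un apply blast
      using R1 apply blast
      using R_mult apply blast
      using R_inv[OF refl] by blast
    have "0 < n" by (rule finite_unit_group(1)[OF g fin n_def])
    have *: "S u \<longleftrightarrow> rv v (u ^ n) = rv v 1" if "unit_elt u" for u
      by (rule finite_unit_group(2)[OF g fin n_def that])
    show ?thesis
    proof (intro exI conjI allI impI)
      show "(0, n) \<noteq> (0::nat, 0)" using \<open>0 < n\<close> by simp
      fix x y assume "R x y"
      thus "rv v (x ^ 0 * y ^ n) = rv v (x ^ 0 * y ^ 0)" using *[of y] un[of x y] unfolding S_def by auto
    qed
  next
    case False
    have surj2: "\<exists>x. R x y" if "unit_elt y" for y
    proof (rule infinite_unit_group[of "\<lambda>y. \<exists>x. R x y", OF _ _ _ False that])
      show "defpred (\<lambda>e. \<exists>x. R x (e 0))" by (intro Rd' def_intros)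
      show "\<exists>x. R x (y / y')" if "\<exists>x. R x y" "\<exists>x. R x y'" for y y' using that R_div by blast
    qed (use un in blast)
    \<comment> \<open>An infinite kernel would contain all units; dividing any \<open>(x, y)\<close>
      in \<open>R\<close> by \<open>(x, 1)\<close> would then put every unit into the other kernel,
      which is finite.\<close>
    have ker1: "finite (rv v ` {x. R x 1})"
    proof (rule ccontr)
      assume inf: "infinite (rv v ` {x. R x 1})"
      have all: "R x 1" if "unit_elt x" for x
      proof (rule infinite_unit_group[of "\<lambda>x. R x 1", OF _ _ _ inf that])
        show "defpred (\<lambda>e. R (e 0) 1)" by (intro Rd' def_intros)
        show "R (x / y) 1" if "R x 1" "R y 1" for x y using R_div[OF that] by simp
      qed (use un in blast)
      have "R 1 y" if y: "unit_elt y" for y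
      proof -
        obtain x where x: "R x y" using surj2[OF y] by blast
        have "R (x / x) (y / 1)" using x all un[OF x] by (intro R_div) auto
        thus ?thesis using un[OF x] by (simp add: unit_elt_def)
      qed
      hence "{x. x \<noteq> 0 \<and> v x = 0} \<subseteq> {y. R 1 y}" unfolding unit_elt_def by blast
      hence "finite (rv v ` {x. x \<noteq> 0 \<and> v x = 0})" using ker by (meson finite_subset image_mono)
      thus False using infinite_units by blast
    qed
    define n where "n = card (rv v ` {x. R x 1})"
    define m where "m = card (rv v ` {y. R 1 y})"
    have n: "0 < n" "\<And>u. unit_elt u \<Longrightarrow> R u 1 \<longleftrightarrow> rv v (u ^ n) = rv v 1"
    proof -
      have g: "\<And>x. R x 1 \<Longrightarrow> unit_elt x" "\<And>x y. R x 1 \<Longrightarrow> R y 1 \<Longrightarrow> R (x * y) 1"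
        "\<And>x y. rv v x = rv v y \<Longrightarrow> R x 1 \<Longrightarrow> R y 1"
        using un apply blast
        using R_mult[of _ 1 _ 1] apply simp
        using R_inv[OF _ refl] by blast
      show "0 < n" by (rule finite_unit_group(1)[OF g(1) R1 g(2,3) ker1 n_def])
      show "R u 1 \<longleftrightarrow> rv v (u ^ n) = rv v 1" if "unit_elt u" for u
        by (rule finite_unit_group(2)[OF g(1) R1 g(2,3) ker1 n_def that])
    qed
    have m: "0 < m" "\<And>u. unit_elt u \<Longrightarrow> R 1 u \<longleftrightarrow> rv v (u ^ m) = rv v 1"
    proof -
      have g: "\<And>x. R 1 x \<Longrightarrow> unit_elt x" "\<And>x y. R 1 x \<Longrightarrow> R 1 y \<Longrightarrow> R 1 (x * y)"
        "\<And>x y. rv v x = rv v y \<Longrightarrow> R 1 x \<Longrightarrow> R 1 y"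
        using un apply blast
        using R_mult[of 1 _ 1] apply simp
        using R_inv[OF refl] by blast
      show "0 < m" by (rule finite_unit_group(1)[OF g(1) R1 g(2,3) ker m_def])
      show "R 1 u \<longleftrightarrow> rv v (u ^ m) = rv v 1" if "unit_elt u" for u
        by (rule finite_unit_group(2)[OF g(1) R1 g(2,3) ker m_def that])
    qed
    \<comment> \<open>Given \<open>R x y\<close>, the pairs \<open>(x, 1)\<close> and
      \<open>(1, y)\<close> lie in \<open>R\<close> together. Since the kernels are exactly the
      roots of unity of orders dividing \<open>n\<close> and \<open>m\<close>, the powers determine
      each other.\<close>
    have kk: "rv v (x ^ n) = rv v 1 \<longleftrightarrow> rv v (y ^ m) = rv v 1" if xy: "R x y" for x y
    proof -
      note u = un[OF xy]
      have "R 1 y" if "R x 1" using R_div[OF xy that] u by (simp add: unit_elt_def)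
      moreover have "R x 1" if "R 1 y" using R_div[OF xy that] u by (simp add: unit_elt_def)
      ultimately show ?thesis using n(2)[of x] m(2)[of y] u by blast
    qed
    have pow: "rv v (x ^ n) = rv v (x' ^ n) \<longleftrightarrow> rv v (y ^ m) = rv v (y' ^ m)" if "R x y" "R x' y'" for x y x' y'
      using kk[OF R_div[OF that]] rv_divide_eq_1[OF unit_elt_power[of x' n], of "x ^ n"]
        rv_divide_eq_1[OF unit_elt_power[of y' m], of "y ^ m"] un[OF that(2)] by (simp add: power_divide)
    define Gr where "Gr x y \<longleftrightarrow> (\<exists>w z. R w z \<and> rv v x = rv v (w ^ n) \<and> rv v y = rv v (z ^ m))" for x y
    have Grd: "defpred (\<lambda>e. Gr (e 0) (e 1))" unfolding Gr_def by (intro Rd' def_intros)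
    have unit_cong: "unit_elt y" if "rv v x = rv v y" "unit_elt x" for x y
      using that rv_eq_0[OF that(1)] rv_eq_v[OF that(1)] unfolding unit_elt_def by simp
    have Gr_unit: "unit_elt x \<and> unit_elt y" if G: "Gr x y" for x y
    proof -
      obtain w z where wz: "R w z" "rv v x = rv v (w ^ n)" "rv v y = rv v (z ^ m)"
        using G unfolding Gr_def by blast
      have "unit_elt (w ^ n)" "unit_elt (z ^ m)" using un[OF wz(1)] unit_elt_power by blast+
      thus ?thesis using unit_cong[OF wz(2)[symmetric]] unit_cong[OF wz(3)[symmetric]] by blast
    qed
    have Gr_inv: "Gr x' y'" if "rv v x = rv v x'" "rv v y = rv v y'" "Gr x y" for x y x' y'
      using that(3) unfolding Gr_def that(1,2) .
    have Gr_tot: "\<exists>y. Gr x y" if x: "unit_elt x" for x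
    proof -
      obtain w where w: "unit_elt w" "w ^ n = x" using unit_elt_root[OF x n(1)] by blast
      obtain z where "R w z" using surj[OF w(1)] by blast
      hence "Gr x (z ^ m)" unfolding Gr_def using w(2) by blast
      thus ?thesis by blast
    qed
    have Gr_tot2: "\<exists>x. Gr x y" if y: "unit_elt y" for y
    proof -
      obtain z where z: "unit_elt z" "z ^ m = y" using unit_elt_root[OF y m(1)] by blast
      obtain w where "R w z" using surj2[OF z(1)] by blast
      hence "Gr (w ^ n) y" unfolding Gr_def using z(2) by blast
      thus ?thesis by blast
    qed
    have Gr_iff: "rv v x = rv v x' \<longleftrightarrow> rv v y = rv v y'" if xy: "Gr x y" and xy': "Gr x' y'" for x y x' y'
    proof -
      obtain w z where wz: "R w z" "rv v x = rv v (w ^ n)" "rv v y = rv v (z ^ m)"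
        using xy unfolding Gr_def by blast
      obtain w' z' where wz': "R w' z'" "rv v x' = rv v (w' ^ n)" "rv v y' = rv v (z' ^ m)"
        using xy' unfolding Gr_def by blast
      show ?thesis unfolding wz(2,3) wz'(2,3) by (rule pow[OF wz(1) wz'(1)])
    qed
    have Gr_mult: "Gr (x * x') (y * y')" if xy: "Gr x y" and xy': "Gr x' y'" for x y x' y'
    proof -
      obtain w z where wz: "R w z" "rv v x = rv v (w ^ n)" "rv v y = rv v (z ^ m)"
        using xy unfolding Gr_def by blast
      obtain w' z' where wz': "R w' z'" "rv v x' = rv v (w' ^ n)" "rv v y' = rv v (z' ^ m)"
        using xy' unfolding Gr_def by blast
      have "rv v (x * x') = rv v ((w * w') ^ n)" "rv v (y * y') = rv v ((z * z') ^ m)"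
        unfolding power_mult_distrib using wz wz' by (intro rv_mult_cong; simp)+
      thus ?thesis unfolding Gr_def using R_mult[OF wz(1) wz'(1)] by blast
    qed
    define \<sigma> where "\<sigma> A = (SOME B. \<exists>x y. Gr x y \<and> A = rv v x \<and> B = rv v y)" for A
    have \<sigma>: "\<sigma> (rv v x) = rv v y" if xy: "Gr x y" for x y
      unfolding \<sigma>_def
    proof (rule some_equality)
      show "\<exists>x' y'. Gr x' y' \<and> rv v x = rv v x' \<and> rv v y = rv v y'" using xy by blast
      fix B assume "\<exists>x' y'. Gr x' y' \<and> rv v x = rv v x' \<and> B = rv v y'"
      then obtain x' y' where "Gr x' y'" "rv v x = rv v x'" "B = rv v y'" by blast
      thus "B = rv v y" using Gr_iff[OF xy] by simp
    qed
    have iso: "\<sigma> \<in> iso (kx v) (kx v)"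
    proof (rule isoI)
      show "\<sigma> \<in> hom (kx v) (kx v)"
      proof (rule homI)
        fix A assume "A \<in> carrier (kx v)"
        then obtain x where x: "A = rv v x" "unit_elt x" unfolding carrier_kx by blast
        obtain y where y: "Gr x y" using Gr_tot[OF x(2)] by blast
        show "\<sigma> A \<in> carrier (kx v)" unfolding x(1) \<sigma>[OF y] carrier_kx using Gr_unit[OF y] by blast
        fix B assume "B \<in> carrier (kx v)"
        then obtain x' where x': "B = rv v x'" "unit_elt x'" unfolding carrier_kx by blast
        obtain y' where y': "Gr x' y'" using Gr_tot[OF x'(2)] by blast
        show "\<sigma> (A \<otimes>\<^bsub>kx v\<^esub> B) = \<sigma> A \<otimes>\<^bsub>kx v\<^esub> \<sigma> B"
          unfolding x(1) x'(1) kx_mult_rv[OF x(2) x'(2)] \<sigma>[OF y] \<sigma>[OF y'] \<sigma>[OF Gr_mult[OF y y']]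
          using kx_mult_rv[of y y'] Gr_unit[OF y] Gr_unit[OF y'] by simp
      qed
      show "bij_betw \<sigma> (carrier (kx v)) (carrier (kx v))"
      proof (rule bij_betw_imageI)
        show "inj_on \<sigma> (carrier (kx v))"
        proof (rule inj_onI)
          fix A B assume "A \<in> carrier (kx v)" "B \<in> carrier (kx v)" and eq: "\<sigma> A = \<sigma> B"
          then obtain x x' where x: "A = rv v x" "unit_elt x" "B = rv v x'" "unit_elt x'"
            unfolding carrier_kx by blast
          obtain y y' where y: "Gr x y" "Gr x' y'" using Gr_tot x by metis
          have "rv v y = rv v y'" using eq unfolding x(1,3) \<sigma>[OF y(1)] \<sigma>[OF y(2)] .
          thus "A = B" unfolding x(1,3) using Gr_iff[OF y] by blast
        qed
        show "\<sigma> ` carrier (kx v) = carrier (kx v)"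
        proof (intro equalityI subsetI)
          fix B assume "B \<in> \<sigma> ` carrier (kx v)"
          then obtain x where x: "B = \<sigma> (rv v x)" "unit_elt x" unfolding carrier_kx by blast
          obtain y where y: "Gr x y" using Gr_tot[OF x(2)] by blast
          show "B \<in> carrier (kx v)" unfolding x(1) \<sigma>[OF y] carrier_kx using Gr_unit[OF y] by blast
        next
          fix B assume "B \<in> carrier (kx v)"
          then obtain y where y: "B = rv v y" "unit_elt y" unfolding carrier_kx by blast
          obtain x where x: "Gr x y" using Gr_tot2[OF y(2)] by blast
          have "rv v x \<in> carrier (kx v)" unfolding carrier_kx using Gr_unit[OF x] by blast
          thus "B \<in> \<sigma> ` carrier (kx v)" unfolding y(1) \<sigma>[OF x, symmetric] by (rule imageI)
        qed
      qed
    qed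
    have graph: "{(A, \<sigma> A) | A. A \<in> carrier (kx v)} = {(rv v x, rv v y) | x y. Gr x y}"
    proof (intro equalityI subsetI)
      fix p assume "p \<in> {(A, \<sigma> A) | A. A \<in> carrier (kx v)}"
      then obtain x where x: "p = (rv v x, \<sigma> (rv v x))" "unit_elt x" unfolding carrier_kx by blast
      obtain y where y: "Gr x y" using Gr_tot[OF x(2)] by blast
      show "p \<in> {(rv v x, rv v y) | x y. Gr x y}" unfolding x(1) \<sigma>[OF y] using y by blast
    next
      fix p assume "p \<in> {(rv v x, rv v y) | x y. Gr x y}"
      then obtain x y where p: "p = (rv v x, rv v y)" "Gr x y" by blast
      show "p \<in> {(A, \<sigma> A) | A. A \<in> carrier (kx v)}"
        unfolding p(1) \<sigma>[OF p(2), symmetric] carrier_kx using Gr_unit[OF p(2)] by blast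
    qed
    have "definable_k2 L M v {(A, \<sigma> A) | A. A \<in> carrier (kx v)}"
      unfolding graph by (rule definable_k2_rel[OF Grd Gr_unit])
    hence "definable ring_lang (ring_struct (res_field v)) 2 {[A, \<sigma> A] | A. A \<in> carrier (kx v)}"
      using noex iso unfolding no_exotic_automorphisms_def by blast
    note con = constructible_of_definable_pairs[OF this]
    have "constructible (\<lambda>e. Gr (e 0) (e 1))"
    proof (rule constructible.equiv[OF con])
      fix e :: "nat \<Rightarrow> 'm" assume e: "integral_env e"
      have ie: "integral (e i)" for i using e unfolding integral_env_def by blast
      have unit_res: "unit_elt x \<and> rv v x = rv v x'" if "integral x" "unit_elt x'" "res v x = rv v x'" for x x'
      proof -
        have "infsml (x - x')" using that(2,3) rv_res res_eq_iff by metis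
        hence "unit_elt x" using infsml_cong that(1,2) unfolding unit_elt_iff by blast
        thus ?thesis using rv_unit_eq that(2) \<open>infsml (x - x')\<close> by blast
      qed
      show "Gr (e 0) (e 1) \<longleftrightarrow> [res v (e 0), res v (e 1)] \<in> {[A, \<sigma> A] | A. A \<in> carrier (kx v)}"
      proof
        assume G: "Gr (e 0) (e 1)"
        have "[res v (e 0), res v (e 1)] = [rv v (e 0), \<sigma> (rv v (e 0))]"
          using Gr_unit[OF G] \<sigma>[OF G] rv_res by simp
        moreover have "rv v (e 0) \<in> carrier (kx v)" unfolding carrier_kx using Gr_unit[OF G] by blast
        ultimately show "[res v (e 0), res v (e 1)] \<in> {[A, \<sigma> A] | A. A \<in> carrier (kx v)}" by blast
      next
        assume "[res v (e 0), res v (e 1)] \<in> {[A, \<sigma> A] | A. A \<in> carrier (kx v)}"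
        then obtain A where A: "A \<in> carrier (kx v)" "[res v (e 0), res v (e 1)] = [A, \<sigma> A]" by blast
        then obtain x where x: "unit_elt x" "A = rv v x" unfolding carrier_kx by blast
        hence x: "unit_elt x" "res v (e 0) = rv v x" "res v (e 1) = \<sigma> (rv v x)" using A(2) by simp_all
        obtain y where y: "Gr x y" using Gr_tot[OF x(1)] by blast
        have "rv v (e 0) = rv v x" using unit_res[OF ie x(1,2)] by blast
        moreover have "res v (e 1) = rv v y" using x(3) \<sigma>[OF y] by simp
        hence "rv v (e 1) = rv v y" using unit_res[OF ie] Gr_unit[OF y] by blast
        ultimately show "Gr (e 0) (e 1)" by (intro Gr_inv[OF _ _ y]) simp_all
      qed
    qed
    from pure_character[OF this Grd Gr_unit Gr_tot _ Gr_mult] obtain i j i' j' where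
      ij: "(i, j) \<noteq> (i', j')" "\<And>x y. Gr x y \<Longrightarrow> rv v (x ^ i * y ^ j) = rv v (x ^ i' * y ^ j')"
      using Gr_iff by blast
    show ?thesis
    proof (intro exI conjI allI impI)
      show "(n * i, m * j) \<noteq> (n * i', m * j')" using ij(1) n(1) m(1) by auto
      fix x y assume "R x y"
      hence "Gr (x ^ n) (y ^ m)" unfolding Gr_def by blast
      thus "rv v (x ^ (n * i) * y ^ (m * j)) = rv v (x ^ (n * i') * y ^ (m * j'))"
        unfolding power_mult by (rule ij(2))
    qed
  qed
qed

end

context curve
begin

section \<open>Segments of a single branch\<close>

lemma rel_group_H: "rel_group (H a)"
  unfolding rel_group_def
proof (intro conjI allI impI)
  show "unit_elt x" "unit_elt y" if "H a x y" for x y using H_unit[OF that] unfolding unit_elt_def by blast+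
  show "H a 1 1" by (rule H_one)
  show "H a (x * x') (y * y')" if "H a x y" "H a x' y'" for x y x' y' by (rule H_mult[OF that])
  show "H a (1 / x) (1 / y)" if "H a x y" for x y by (rule H_inverse[OF that])
  show "H a x' y'" if "rv v x = rv v x'" "rv v y = rv v y'" "H a x y" for x y x' y' by (rule H_inv[OF that])
qed

lemma H_def_fixed: "defpred (\<lambda>e. H a (e 0) (e 1))"
  unfolding H_def by (intro Cd def_intros)

lemma one_dim_H:
  assumes "good a" shows "one_dim_definable_subgroup L M v (rv_rel (H a))"
proof (rule one_dim_rv_rel[OF rel_group_H H_def_fixed])
  have "rv v ` {w. \<exists>z. H a w z} \<subseteq> fst ` rv_rel (H a)" unfolding rv_rel_def by force
  thus "infinite (rv_rel (H a))" using H_infinite[OF assms] by (meson finite_imageI finite_subset)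
  show "finite (rv v ` {y. H a 1 y}) \<or> finite (rv v ` {x. H a x 1})" using H_finite_kernel[OF assms] by blast
qed

text \<open>The second coordinate must occur in the relation for it to be solvable for
  \<open>f a\<close>. With \<open>j = j'\<close> it would reduce to \<open>w ^ i = w ^ i'\<close>
  for all units \<open>w\<close>, because the stabilizer projects onto them, and a nonzero
  polynomial does not vanish on all units.\<close>

lemma no_exotic_H:
  assumes g: "good a" and noex: "no_exotic_automorphisms L M v"
  shows "\<exists>i j i' j'. j \<noteq> j' \<and> (\<forall>x y. H a x y \<longrightarrow> rv v (x ^ i * y ^ j) = rv v (x ^ i' * y ^ j'))"
proof -
  have "\<exists>y. H a x y" if "unit_elt x" for x using H_surj[OF g] that unfolding unit_elt_def by blast
  from no_exotic_relation[OF rel_group_H H_def_fixed this H_finite_kernel[OF g] noex]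
  obtain i j i' j' where ij: "(i, j) \<noteq> (i', j')"
    "\<And>x y. H a x y \<Longrightarrow> rv v (x ^ i * y ^ j) = rv v (x ^ i' * y ^ j')" by blast
  have "j \<noteq> j'"
  proof
    assume j: "j = j'"
    hence i: "i \<noteq> i'" using ij(1) by simp
    define q where "q = (monom 1 i - monom 1 i' :: 'm poly)"
    have iq: "integral_poly q" unfolding q_def by (intro integral_poly_diff integral_poly_monom) simp_all
    have "coeff q i = 1" using i by (simp add: q_def)
    hence nq: "\<not> infsml_poly q" unfolding infsml_poly_def by (metis not_infsml_1)
    obtain w where w: "unit_elt w" "\<not> infsml (poly q w)" using exists_unit_nonroot[OF iq nq, of "{}"] by blast
    obtain z where z: "H a w z" using H_surj[OF g] w(1) unfolding unit_elt_def by blast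
    have "z ^ j \<noteq> 0" using H_unit[OF z] by simp
    hence "rv v (w ^ i) = rv v (w ^ i')" using ij(2)[OF z] unfolding j by (simp add: rv_mult_right)
    hence "infsml (w ^ i - w ^ i')" using rv_unit_eq unit_elt_power[OF w(1)] by blast
    thus False using w(2) by (simp add: q_def poly_monom)
  qed
  thus ?thesis using ij(2) by blast
qed

lemma line_segment_graph:
  assumes "open_interval I" "linear_on I f" shows "line_segment L M v {(x, f x) | x. x \<in> I}"
proof -
  have "defpred (\<lambda>e. v (e 0) \<in> I \<and> v (e 1) = f (v (e 0)))"
    by (intro defpred_v1[OF defpred_open_interval[OF assms(1)]] fd def_intros)
  hence "definable_\<Gamma>2 L M v {(a, b) | a b. a \<in> I \<and> b = f a}" by (rule definable_Gamma2_rel)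
  moreover have "{(a, b) | a b. a \<in> I \<and> b = f a} = {(x, f x) | x. x \<in> I}" by blast
  ultimately show ?thesis using assms unfolding line_segment_def by auto
qed

lemma segments_on_interval:
  assumes I: "open_interval I" and Ig: "\<And>a. a \<in> I \<Longrightarrow> good a"
    and IH: "\<And>a b. a \<in> I \<Longrightarrow> b \<in> I \<Longrightarrow> H a = H b"
  shows "\<exists>F. finite F \<and> (\<forall>K. open_interval K \<longrightarrow> K \<subseteq> I - F \<longrightarrow>
    line_segment L M v {(x, f x) | x. x \<in> K} \<and>
    (no_exotic_automorphisms L M v \<longrightarrow> rational_slope {(x, f x) | x. x \<in> K}))"
proof -
  note J = defpred_open_interval[OF I]
  have "finite ((\<lambda>a. f (a + d) - f a) ` {a. a \<in> I \<and> a + d \<in> I})" for d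
    by (rule finite_differences[OF J Ig IH])
  from piecewise_linear[OF f_def J this] obtain F where
    F: "finite F" "\<And>K. open_interval K \<Longrightarrow> K \<subseteq> I \<Longrightarrow> K \<inter> F = {} \<Longrightarrow> linear_on K f" by auto
  have "\<exists>F'. finite F' \<and> (no_exotic_automorphisms L M v \<longrightarrow>
      (\<forall>K. open_interval K \<longrightarrow> K \<subseteq> I - F' \<longrightarrow> rational_slope {(x, f x) | x. x \<in> K}))"
  proof (cases "no_exotic_automorphisms L M v \<and> I \<noteq> {}")
    case True
    then obtain a where a: "a \<in> I" by blast
    obtain i j i' j' where ij: "j \<noteq> j'" "\<And>x y. H a x y \<Longrightarrow> rv v (x ^ i * y ^ j) = rv v (x ^ i' * y ^ j')"
      using no_exotic_H[OF Ig[OF a]] True by blast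
    define g where "g a = ((+) a ^^ i) 0 + ((+) (f a) ^^ j) 0 - (((+) a ^^ i') 0 + ((+) (f a) ^^ j') 0)" for a
    have "finite (g ` {a. a \<in> I})" unfolding g_def
    proof (rule finite_monomial_values[OF J Ig])
      fix b w z assume b: "b \<in> I" "H b w z"
      \<comment> \<open>The monomial relation was found over one value \<open>a\<close>; it holds
        over all of \<open>I\<close> because the stabilizer is constant there.\<close>
      have "H a w z" unfolding IH[OF a b(1)] by (rule b(2))
      thus "rv v (w ^ i * z ^ j) = rv v (w ^ i' * z ^ j')" by (rule ij(2))
    qed
    hence gfin: "finite (g ` I)" unfolding Collect_mem_eq .
    have gd: "defpred (\<lambda>e. v (e 0) = g (v (e 1)))"
    proof -
      have nd: "defval (\<lambda>e. ((+) (h e) ^^ k) 0)" if "defval h" for h and k :: nat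
        by (induction k) (auto intro!: def_intros that)
      show ?thesis unfolding g_def by (intro nd fd def_intros)
    qed
    obtain F' where F': "finite F'"
      "\<And>K a b. open_interval K \<Longrightarrow> K \<subseteq> I \<Longrightarrow> K \<inter> F' = {} \<Longrightarrow> a \<in> K \<Longrightarrow> b \<in> K \<Longrightarrow> g a = g b"
      using finite_image_constant[OF gd J, unfolded Collect_mem_eq, OF gfin] by (elim exE conjE) blast
    have "rational_slope {(x, f x) | x. x \<in> K}" if K: "open_interval K" "K \<subseteq> I - F'" for K
    proof (cases "K = {}")
      case True
      thus ?thesis using K(1) unfolding rational_slope_def by blast
    next
      case False
      then obtain b where b: "b \<in> K" by blast
      show ?thesis
      proof (rule rational_slope_of_linear_relation[OF K(1)])
        show "int j - int j' \<noteq> 0" using ij(1) by simp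
        fix x assume x: "x \<in> K"
        have "g x = g b" using F'(2)[OF K(1) _ _ x b] K(2) by blast
        hence e: "zmul (int i) x + zmul (int j) (f x) - (zmul (int i') x + zmul (int j') (f x)) = g b"
          unfolding zmul_of_nat g_def .
        have d: "zmul (int k - int l) y = zmul (int k) y - zmul (int l) y" for k l and y :: 'g
          using zmul_add[of "int k" "- int l" y] by (simp add: zmul_minus)
        show "zmul (int j - int j') (f x) = zmul (int i' - int i) x + g b"
          unfolding e[symmetric] d by (simp add: algebra_simps)
      qed
    qed
    thus ?thesis using F'(1) by blast
  next
    case False
    show ?thesis
    proof (intro exI[of _ "{}"] conjI impI allI)
      fix K assume "no_exotic_automorphisms L M v" "K \<subseteq> I - {}" "open_interval K"
      moreover from this have "K = {}" using False by blast
      ultimately show "rational_slope {(x, f x) | x. x \<in> K}" unfolding rational_slope_def by blast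
    qed simp
  qed
  then obtain F' where F': "finite F'" "no_exotic_automorphisms L M v \<Longrightarrow> open_interval K \<Longrightarrow> K \<subseteq> I - F' \<Longrightarrow>
      rational_slope {(x, f x) | x. x \<in> K}" for K by blast
  show ?thesis
  proof (intro exI[of _ "F \<union> F'"] conjI allI impI)
    fix K assume K: "open_interval K" "K \<subseteq> I - (F \<union> F')"
    have "linear_on K f" using K by (intro F(2)) auto
    thus "line_segment L M v {(x, f x) | x. x \<in> K}" by (rule line_segment_graph[OF K(1)])
    show "rational_slope {(x, f x) | x. x \<in> K}" if "no_exotic_automorphisms L M v"
      using F'(2)[OF that K(1)] K(2) by blast
  qed (use F(1) F'(1) in simp)
qed

text \<open>The line is cut where \<open>H\<close> or \<open>X\<close> may change and at the bad
  values. Each remaining interval lies inside \<open>X\<close> or outside it, and those inside are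
  cut again by \<open>segments_on_interval\<close>; the cut points in \<open>X\<close> form
  \<open>F\<close>.\<close>

lemma graph_decomposition:
  "\<exists>F \<J>. finite F \<and> finite \<J> \<and> Collect X = F \<union> \<Union>\<J> \<and>
    (\<forall>K\<in>\<J>. line_segment L M v {(x, f x) | x. x \<in> K} \<and>
      (no_exotic_automorphisms L M v \<longrightarrow> rational_slope {(x, f x) | x. x \<in> K}))"
proof -
  obtain FH where FH: "finite FH" "\<And>a b. a \<le> b \<Longrightarrow> {a..b} \<inter> FH = {} \<Longrightarrow> H a = H b"
    using H_locally_constant by blast
  have "tame X" by (rule definable_tame[OF X_def])
  then obtain FX where FX: "finite FX" "\<And>a b. a \<le> b \<Longrightarrow> {a..b} \<inter> FX = {} \<Longrightarrow> X a \<longleftrightarrow> X b"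
    by (rule tameE) blast
  define F0 where "F0 = FH \<union> FX \<union> {a. X a \<and> \<not> good a}"
  have "finite F0" unfolding F0_def using FH(1) FX(1) finite_bad by simp
  from finite_complement_intervals[OF this] obtain \<I> where
    I: "finite \<I>" "\<And>I. I \<in> \<I> \<Longrightarrow> open_interval I" "\<Union>\<I> = - F0" by blast
  define \<I>' where "\<I>' = {I \<in> \<I>. I \<subseteq> Collect X}"
  have between: "{a..b} \<inter> F0 = {}" if "I \<in> \<I>" "a \<in> I" "b \<in> I" for I a b
  proof -
    have "{a..b} \<subseteq> I" using open_interval_convex[OF I(2)[OF that(1)] that(2,3)] by auto
    moreover have "I \<inter> F0 = {}" using I(3) that(1) by blast
    ultimately show ?thesis by blast
  qed
  have XI: "I \<in> \<I>'" if "I \<in> \<I>" "a \<in> I" "X a" for I a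
  proof -
    have "X b" if "b \<in> I" for b
    proof (cases "a \<le> b")
      case True
      thus ?thesis using FX(2)[OF True] between[OF \<open>I \<in> \<I>\<close> \<open>a \<in> I\<close> \<open>b \<in> I\<close>] \<open>X a\<close> unfolding F0_def by blast
    next
      case False
      hence "b \<le> a" by simp
      thus ?thesis using FX(2)[of b a] between[OF \<open>I \<in> \<I>\<close> \<open>b \<in> I\<close> \<open>a \<in> I\<close>] \<open>X a\<close> unfolding F0_def by blast
    qed
    thus ?thesis using that(1) unfolding \<I>'_def by blast
  qed
  have "\<forall>I\<in>\<I>'. \<exists>F. finite F \<and> (\<forall>K. open_interval K \<longrightarrow> K \<subseteq> I - F \<longrightarrow>
    line_segment L M v {(x, f x) | x. x \<in> K} \<and>
    (no_exotic_automorphisms L M v \<longrightarrow> rational_slope {(x, f x) | x. x \<in> K}))"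
  proof
    fix I assume "I \<in> \<I>'"
    hence II: "I \<in> \<I>" "I \<subseteq> Collect X" unfolding \<I>'_def by auto
    show "\<exists>F. finite F \<and> (\<forall>K. open_interval K \<longrightarrow> K \<subseteq> I - F \<longrightarrow>
      line_segment L M v {(x, f x) | x. x \<in> K} \<and>
      (no_exotic_automorphisms L M v \<longrightarrow> rational_slope {(x, f x) | x. x \<in> K}))"
    proof (rule segments_on_interval[OF I(2)[OF II(1)]])
      fix a assume a: "a \<in> I"
      hence "a \<notin> F0" using I(3) II(1) by blast
      thus "good a" using a II(2) unfolding F0_def by blast
      fix b assume b: "b \<in> I"
      show "H a = H b"
      proof (cases "a \<le> b")
        case True
        thus ?thesis using FH(2)[OF True] between[OF II(1) a b] unfolding F0_def by blast
      next
        case False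
        hence ba: "b \<le> a" by simp
        hence "H b = H a" using FH(2)[OF ba] between[OF II(1) b a] unfolding F0_def by blast
        thus ?thesis ..
      qed
    qed
  qed
  from bchoice[OF this] obtain FI where FI: "\<And>I. I \<in> \<I>' \<Longrightarrow> finite (FI I)"
    "\<And>I K. I \<in> \<I>' \<Longrightarrow> open_interval K \<Longrightarrow> K \<subseteq> I - FI I \<Longrightarrow> line_segment L M v {(x, f x) | x. x \<in> K} \<and>
      (no_exotic_automorphisms L M v \<longrightarrow> rational_slope {(x, f x) | x. x \<in> K})" by blast
  have "\<forall>I\<in>\<I>'. \<exists>\<K>. finite \<K> \<and> (\<forall>K\<in>\<K>. open_interval K) \<and> \<Union>\<K> = I - FI I"
  proof
    fix I assume II: "I \<in> \<I>'"
    hence oI: "open_interval I" using I(2) unfolding \<I>'_def by blast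
    obtain \<K> where K: "finite \<K>" "\<And>K. K \<in> \<K> \<Longrightarrow> open_interval K" "\<Union>\<K> = - FI I"
      using finite_complement_intervals[OF FI(1)[OF II]] by blast
    have "\<Union>{J \<in> (\<inter>) I ` \<K>. J \<noteq> {}} = I \<inter> \<Union>\<K>" by blast
    hence "\<Union>{J \<in> (\<inter>) I ` \<K>. J \<noteq> {}} = I - FI I" unfolding K(3) by blast
    moreover have "open_interval J" if J: "J \<in> {J \<in> (\<inter>) I ` \<K>. J \<noteq> {}}" for J
    proof -
      obtain K' where "K' \<in> \<K>" "J = I \<inter> K'" "I \<inter> K' \<noteq> {}" using J by blast
      thus ?thesis using open_interval_Int[OF oI K(2)] by simp
    qed
    moreover have "finite {J \<in> (\<inter>) I ` \<K>. J \<noteq> {}}" using K(1) by simp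
    ultimately show "\<exists>\<K>. finite \<K> \<and> (\<forall>K\<in>\<K>. open_interval K) \<and> \<Union>\<K> = I - FI I"
      by (intro exI[of _ "{J \<in> (\<inter>) I ` \<K>. J \<noteq> {}}"] conjI ballI)
  qed
  from bchoice[OF this] obtain KI where
    KI: "\<forall>I\<in>\<I>'. finite (KI I) \<and> (\<forall>K\<in>KI I. open_interval K) \<and> \<Union>(KI I) = I - FI I" ..
  define \<J> where "\<J> = (\<Union>I\<in>\<I>'. KI I)"
  have fI': "finite \<I>'" using I(1) unfolding \<I>'_def by simp
  hence "finite \<J>" unfolding \<J>_def using KI by blast
  have UJ: "\<Union>\<J> = (\<Union>I\<in>\<I>'. I - FI I)"
  proof -
    have "\<Union>\<J> = (\<Union>I\<in>\<I>'. \<Union>(KI I))" unfolding \<J>_def by blast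
    also have "\<dots> = (\<Union>I\<in>\<I>'. I - FI I)" using KI by (intro SUP_cong) auto
    finally show ?thesis .
  qed
  define F where "F = Collect X \<inter> (F0 \<union> (\<Union>I\<in>\<I>'. FI I))"
  have "finite F" unfolding F_def using \<open>finite F0\<close> fI' FI(1) by blast
  moreover have "Collect X = F \<union> \<Union>\<J>"
  proof (intro equalityI subsetI)
    fix a assume a: "a \<in> Collect X"
    show "a \<in> F \<union> \<Union>\<J>"
    proof (cases "a \<in> F0")
      case False
      then obtain I where "I \<in> \<I>" "a \<in> I" using I(3) by blast
      hence "I \<in> \<I>'" "a \<in> I" using XI a by blast+
      thus ?thesis using a unfolding UJ F_def by blast
    qed (use a in \<open>simp add: F_def\<close>)
  next
    fix a assume "a \<in> F \<union> \<Union>\<J>"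
    thus "a \<in> Collect X" unfolding F_def UJ \<I>'_def by blast
  qed
  moreover have "line_segment L M v {(x, f x) | x. x \<in> K} \<and>
      (no_exotic_automorphisms L M v \<longrightarrow> rational_slope {(x, f x) | x. x \<in> K})" if KJ: "K \<in> \<J>" for K
  proof -
    obtain I where II: "I \<in> \<I>'" "K \<in> KI I" using KJ unfolding \<J>_def by blast
    have "K \<subseteq> I - FI I" "open_interval K" using KI II by blast+
    thus ?thesis using FI(2)[OF II(1)] by blast
  qed
  ultimately show ?thesis using \<open>finite \<J>\<close> by blast
qed

end

section \<open>Decomposition of small sets\<close>

context C_min_ACVF
begin

section \<open>Smallness in terms of columns, and finite unions of segments\<close>

lemma unit_elt_cong: "rv v x = rv v y \<Longrightarrow> unit_elt y \<Longrightarrow> unit_elt x"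
  using rv_eq_0[of x y] rv_eq_v[of x y] unfolding unit_elt_def by simp

lemma unit_elt_divide: "x \<noteq> 0 \<Longrightarrow> y \<noteq> 0 \<Longrightarrow> v x = v y \<Longrightarrow> unit_elt (x / y)"
  unfolding unit_elt_def by (simp add: v_divide)

lemma RV_mult_divide: "x \<noteq> 0 \<Longrightarrow> y \<noteq> 0 \<Longrightarrow> rv v (x / y) \<otimes>\<^bsub>RV v\<^esub> rv v y = rv v x"
  using RV_mult[OF val, of "x / y" y] by simp

text \<open>Infinitely many infinite columns over \<open>(a, b)\<close> would give infinitely many
  disjoint definable sets of Morley rank at least 1, hence Morley rank at least 2.\<close>

lemma small_fibers:
  assumes T: "defpred (\<lambda>e. T (e 0) (e 1))" and T_nonzero: "\<And>x y. T x y \<Longrightarrow> x \<noteq> 0 \<and> y \<noteq> 0"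
    and small: "small_over_\<Gamma>2 L M v (rv_rel T)"
  shows "finite (rv v ` {x. x \<noteq> 0 \<and> v x = a \<and> infinite (rv v ` {y. v y = b \<and> T x y})})" (is "finite (rv v ` ?B)")
proof (rule ccontr)
  assume "infinite (rv v ` ?B)"
  then obtain g :: "nat \<Rightarrow> _" where g: "inj g" "range g \<subseteq> rv v ` ?B" using infinite_countable_subset by blast
  hence "\<forall>n. \<exists>x. x \<in> ?B \<and> g n = rv v x" by blast
  from choice[OF this] obtain x where x: "\<And>n. x n \<in> ?B" "\<And>n. g n = rv v (x n)" by blast
  have x0: "x n \<noteq> 0" "v (x n) = a" for n using x(1)[of n] by auto
  obtain c where c: "c \<noteq> 0" "v c = a" using v_surj by blast
  obtain d where d: "d \<noteq> 0" "v d = b" using v_surj by blast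
  \<comment> \<open>The column over \<open>x n\<close>, moved into the square of the unit classes by
    the inverse of \<open>(c, d)\<close>.\<close>
  define R where "R n w z \<longleftrightarrow> rv v w = rv v (x n / c) \<and> unit_elt z \<and> T (x n) (z * d)" for n w z
  have R_unit: "unit_elt w \<and> unit_elt z" if "R n w z" for n w z
    using that unit_elt_cong[OF _ unit_elt_divide[OF x0(1) c(1)], of w n] x0(2)[of n] c(2)
    unfolding R_def by simp
  have def: "definable_k2 L M v (rv_rel (R n))" for n
    unfolding rv_rel_def
  proof (rule definable_k2_rel[OF _ R_unit])
    show "defpred (\<lambda>e. R n (e 0) (e 1))" unfolding R_def
      by (intro defpred_app2[OF T] defpred_unit_elt def_intros)
  qed
  have "morley_ge (definable_k2 L M v) (Suc 0) (rv_rel (R n))" for n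
  proof (rule infinite_morley_ge_1)
    have "rv v ` {y. v y = b \<and> T (x n) y} \<subseteq> (\<lambda>A. A \<otimes>\<^bsub>RV v\<^esub> rv v d) ` snd ` rv_rel (R n)"
    proof
      fix A assume "A \<in> rv v ` {y. v y = b \<and> T (x n) y}"
      then obtain y where y: "A = rv v y" "v y = b" "T (x n) y" by blast
      have y0: "y \<noteq> 0" using T_nonzero[OF y(3)] by blast
      have "R n (x n / c) (y / d)" unfolding R_def using y y0 d unit_elt_divide[of y d] by simp
      hence "rv v (y / d) \<in> snd ` rv_rel (R n)" unfolding rv_rel_def by force
      moreover have "A = rv v (y / d) \<otimes>\<^bsub>RV v\<^esub> rv v d" using RV_mult_divide[OF y0 d(1)] y(1) by simp
      ultimately show "A \<in> (\<lambda>A. A \<otimes>\<^bsub>RV v\<^esub> rv v d) ` snd ` rv_rel (R n)" by blast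
    qed
    moreover have "infinite (rv v ` {y. v y = b \<and> T (x n) y})" using x(1)[of n] by blast
    ultimately show "infinite (rv_rel (R n))" by (meson finite_imageI finite_subset)
    show "definable_k2 L M v {p}" if p: "p \<in> rv_rel (R n)" for p
    proof -
      obtain w z where wz: "p = (rv v w, rv v z)" "R n w z" using p unfolding rv_rel_def by blast
      show ?thesis unfolding wz(1) using R_unit[OF wz(2)] by (intro definable_k2_point) blast+
    qed
  qed
  moreover have "disjoint_family (\<lambda>n. rv_rel (R n))"
  proof (unfold disjoint_family_on_def, intro ballI impI)
    fix n m :: nat assume nm: "n \<noteq> m"
    have "rv v (x n / c) \<noteq> rv v (x m / c)"
    proof
      assume "rv v (x n / c) = rv v (x m / c)"
      hence "rv v (x n) = rv v (x m / c * c)" unfolding rv_divide_eq[OF c(1)] .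
      hence "g n = g m" unfolding x(2) using c(1) by simp
      thus False using g(1) nm by (simp add: inj_eq)
    qed
    moreover have "fst p = rv v (x k / c)" if p: "p \<in> rv_rel (R k)" for p k
    proof -
      obtain w z where "p = (rv v w, rv v z)" "R k w z" using p unfolding rv_rel_def by blast
      thus ?thesis unfolding R_def by simp
    qed
    ultimately show "rv_rel (R n) \<inter> rv_rel (R m) = {}" by fastforce
  qed
  moreover have "rv_rel (R n) \<subseteq> kx_image v (rv v c) (rv v d) (fiber v (rv_rel T) a b)" for n
  proof
    fix p assume "p \<in> rv_rel (R n)"
    then obtain w z where p: "p = (rv v w, rv v z)" and R: "R n w z" unfolding rv_rel_def by blast
    note u = R_unit[OF R]
    have wz: "w \<noteq> 0" "z \<noteq> 0" "v z = 0" using u unfolding unit_elt_def by blast+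
    have T: "T (x n) (z * d)" using R unfolding R_def by blast
    have "rv v w \<otimes>\<^bsub>RV v\<^esub> rv v c = rv v (x n)"
      using R RV_mult_divide[OF x0(1)[of n] c(1)] unfolding R_def by simp
    moreover have "rv v z \<otimes>\<^bsub>RV v\<^esub> rv v d = rv v (z * d)" by (rule RV_mult[OF val wz(2) d(1)])
    moreover have "(rv v (x n), rv v (z * d)) \<in> fiber v (rv_rel T) a b"
      unfolding fiber_def RV_fiber_eq rv_rel_def using T x0[of n] wz d by (auto simp: v_mult)
    ultimately show "p \<in> kx_image v (rv v c) (rv v d) (fiber v (rv_rel T) a b)"
      unfolding p kx_image_def carrier_kx using u by auto
  qed
  ultimately have "morley_ge (definable_k2 L M v) (Suc 1) (kx_image v (rv v c) (rv v d) (fiber v (rv_rel T) a b))"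
    using def unfolding One_nat_def morley_ge.simps(2)[of _ "Suc 0"] by blast
  moreover have "rv v c \<in> RV_fiber v a" "rv v d \<in> RV_fiber v b" unfolding RV_fiber_eq using c d by blast+
  ultimately show False using small unfolding small_over_\<Gamma>2_def morley_rank_le_def by blast
qed

lemma tame_intervals:
  assumes "tame X"
  shows "\<exists>F \<J>. finite F \<and> finite \<J> \<and> (\<forall>J\<in>\<J>. open_interval J) \<and> Collect X = F \<union> \<Union>\<J>"
proof -
  obtain F where F: "finite F" "\<And>a b. a \<le> b \<Longrightarrow> {a..b} \<inter> F = {} \<Longrightarrow> X a \<longleftrightarrow> X b"
    by (rule tameE[OF assms]) blast
  obtain \<I> where I: "finite \<I>" "\<And>I. I \<in> \<I> \<Longrightarrow> open_interval I" "\<Union>\<I> = - F"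
    using finite_complement_intervals[OF F(1)] by blast
  have X_le: "X a \<longleftrightarrow> X b" if "I \<in> \<I>" "a \<in> I" "b \<in> I" "a \<le> b" for I a b
  proof (rule F(2)[OF that(4)])
    have "{a..b} \<subseteq> I" using open_interval_convex[OF I(2)[OF that(1)] that(2,3)] by auto
    moreover have "I \<inter> F = {}" using I(3) that(1) by blast
    ultimately show "{a..b} \<inter> F = {}" by blast
  qed
  have X_sub: "I \<subseteq> Collect X" if "I \<in> \<I>" "a \<in> I" "X a" for I a
  proof
    fix b assume "b \<in> I"
    thus "b \<in> Collect X"
      using X_le[OF that(1,2) \<open>b \<in> I\<close>] X_le[OF that(1) \<open>b \<in> I\<close> that(2)] that(3) linear[of a b] by blast
  qed
  have "Collect X = (Collect X \<inter> F) \<union> \<Union>{I \<in> \<I>. I \<subseteq> Collect X}"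
  proof (intro equalityI subsetI)
    fix a assume a: "a \<in> Collect X"
    show "a \<in> (Collect X \<inter> F) \<union> \<Union>{I \<in> \<I>. I \<subseteq> Collect X}"
    proof (cases "a \<in> F")
      case False
      then obtain I where "I \<in> \<I>" "a \<in> I" using I(3) by blast
      thus ?thesis using X_sub a by blast
    qed (use a in blast)
  qed blast
  thus ?thesis using F(1) I(1,2) by (intro exI[of _ "Collect X \<inter> F"] exI[of _ "{I \<in> \<I>. I \<subseteq> Collect X}"]) auto
qed

lemma defpred_mem_finite: "finite A \<Longrightarrow> defpred (\<lambda>e. v (e 0) \<in> A)"
proof (induction A rule: finite_induct)
  case (insert a A)
  obtain c where "v c = a" using v_surj by blast
  moreover have "defpred (\<lambda>e. v (e 0) = v c \<or> v (e 0) \<in> A)" by (intro insert.IH def_intros)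
  ultimately show ?case by simp
next
  case empty
  have "defpred (\<lambda>e. e 0 \<noteq> e 0)" by (intro def_intros)
  thus ?case by simp
qed

text \<open>Making rationality a conditional property of each segment lets one decomposition serve
  both claims about the image.\<close>

definition segments :: "('g \<times> 'g) set \<Rightarrow> bool" where
  "segments A \<longleftrightarrow> (\<exists>P S. finite P \<and> finite S \<and> (\<forall>s\<in>S. line_segment L M v s \<and>
    (no_exotic_automorphisms L M v \<longrightarrow> rational_slope s)) \<and> A = P \<union> \<Union>S)"

lemma segments_Un: "segments A \<Longrightarrow> segments B \<Longrightarrow> segments (A \<union> B)"
proof -
  assume "segments A" "segments B"
  then obtain P S P' S' where "finite P" "finite S" "A = P \<union> \<Union>S" "finite P'" "finite S'" "B = P' \<union> \<Union>S'"
    "\<forall>s\<in>S. line_segment L M v s \<and> (no_exotic_automorphisms L M v \<longrightarrow> rational_slope s)"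
    "\<forall>s\<in>S'. line_segment L M v s \<and> (no_exotic_automorphisms L M v \<longrightarrow> rational_slope s)"
    unfolding segments_def by (elim exE conjE)
  thus ?thesis unfolding segments_def by (intro exI[of _ "P \<union> P'"] exI[of _ "S \<union> S'"]) auto
qed

lemma segments_UN: "finite I \<Longrightarrow> (\<And>i. i \<in> I \<Longrightarrow> segments (A i)) \<Longrightarrow> segments (\<Union>i\<in>I. A i)"
proof (induction I rule: finite_induct)
  case empty
  show ?case unfolding segments_def by (intro exI[of _ "{}"]) simp
next
  case (insert i I)
  have "segments (A i \<union> (\<Union>i\<in>I. A i))" using insert.IH insert.prems by (intro segments_Un) blast+
  thus ?case by simp
qed

definition translates :: "('m set \<times> 'm set) set \<Rightarrow> bool" where
  "translates Y \<longleftrightarrow> (\<exists>H. one_dim_definable_subgroup L M v H \<and> finite_union_of_translates v H Y)"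

end

context small_relation
begin

section \<open>Vertical lines of the image\<close>

lemma val_image_eq: "val_image v (rv_rel T) = {(a, b). TG a b}"
proof (intro equalityI subsetI)
  fix p assume "p \<in> val_image v (rv_rel T)"
  then obtain x y where "T x y" "p = (rv_val v (rv v x), rv_val v (rv v y))"
    unfolding val_image_def rv_rel_def by auto
  thus "p \<in> {(a, b). TG a b}"
    unfolding TG_def using T_nonzero[of x y] rv_val_rv[OF val, of x] rv_val_rv[OF val, of y] by auto
next
  fix p assume "p \<in> {(a, b). TG a b}"
  then obtain x y where T: "T x y" "p = (v x, v y)" unfolding TG_def by auto
  hence "p = map_prod (rv_val v) (rv_val v) (rv v x, rv v y)"
    using T_nonzero[OF T(1)] rv_val_rv[OF val, of x] rv_val_rv[OF val, of y] by simp
  thus "p \<in> val_image v (rv_rel T)" unfolding val_image_def rv_rel_def using T(1) by blast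
qed

lemma fiber_eq: "fiber v (rv_rel T) a b = rv_rel (\<lambda>x y. T x y \<and> v x = a \<and> v y = b)"
proof (intro equalityI subsetI)
  fix p assume "p \<in> fiber v (rv_rel T) a b"
  then obtain x y x' y' where p: "T x y" "p = (rv v x, rv v y)" "rv v x = rv v x'" "v x' = a" "rv v y = rv v y'" "v y' = b"
    unfolding fiber_def RV_fiber_eq rv_rel_def by blast
  thus "p \<in> rv_rel (\<lambda>x y. T x y \<and> v x = a \<and> v y = b)"
    using rv_eq_v[OF p(3)] rv_eq_v[OF p(5)] unfolding rv_rel_def by blast
next
  fix p assume "p \<in> rv_rel (\<lambda>x y. T x y \<and> v x = a \<and> v y = b)"
  then obtain x y where p: "T x y" "p = (rv v x, rv v y)" "v x = a" "v y = b" unfolding rv_rel_def by blast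
  thus "p \<in> fiber v (rv_rel T) a b"
    using T_nonzero[OF p(1)] unfolding fiber_def RV_fiber_eq rv_rel_def by blast
qed

lemma fiber_iff:
  "p \<in> fiber v (rv_rel T) a b \<longleftrightarrow> (\<exists>x y. p = (rv v x, rv v y) \<and> T x y \<and> v x = a \<and> v y = b)"
  unfolding fiber_eq unfolding rv_rel_def by blast

text \<open>This relation presents the subgroup \<open>1 \<times> k\<^sup>\<times>\<close>, which is
  the group needed for full columns.\<close>

lemma rel_group_vertical: "rel_group (\<lambda>w z. rv v w = rv v 1 \<and> unit_elt z)"
proof -
  have u1: "unit_elt 1" unfolding unit_elt_def by simp
  have unit: "unit_elt x" if "rv v x = rv v 1" for x by (rule unit_elt_cong[OF that u1])
  have mult: "rv v (x * x') = rv v 1" if "rv v x = rv v 1" "rv v x' = rv v 1" for x x'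
    using rv_mult_cong[OF that] by simp
  have div: "rv v (1 / x) = rv v 1" if "rv v x = rv v 1" for x
    using rv_divide_cong[OF refl that, of 1] by simp
  have unit_div: "unit_elt (1 / x)" if "unit_elt x" for x
    using unit_elt_divide[of 1 x] that unfolding unit_elt_def by simp
  have cong: "unit_elt y'" if "rv v y = rv v y'" "unit_elt y" for y y'
    using that(2) by (rule unit_elt_cong[OF that(1)[symmetric]])
  show ?thesis unfolding rel_group_def
  proof (intro conjI allI impI)
    fix x y assume xy: "rv v x = rv v 1 \<and> unit_elt y"
    show "unit_elt x" "unit_elt y" "rv v (1 / x) = rv v 1" "unit_elt (1 / y)"
      using xy unit div unit_div by blast+
    fix x' y'
    show "rv v (x * x') = rv v 1" "unit_elt (y * y')" if "rv v x' = rv v 1 \<and> unit_elt y'"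
      using xy that mult unit_elt_mult by blast+
    show "rv v x' = rv v 1" if "rv v x = rv v x'" using xy that by simp
    show "unit_elt y'" if "rv v y = rv v y'" using xy cong[OF that] by blast
  qed (rule refl u1)+
qed

text \<open>When all nonempty columns over \<open>(a, b)\<close> are full, there are only finitely
  many of them by \<open>T_small\<close>, and each is a translate of
  \<open>1 \<times> k\<^sup>\<times>\<close>.\<close>

lemma translates_vertical:
  assumes full: "\<And>x y. x \<noteq> 0 \<Longrightarrow> v x = a \<Longrightarrow> v y = b \<Longrightarrow> T x y \<Longrightarrow> full x b"
  shows "translates (fiber v (rv_rel T) a b)"
proof -
  define R where "R w z \<longleftrightarrow> rv v w = rv v 1 \<and> unit_elt z" for w z
  have R: "rel_group R" unfolding R_def by (rule rel_group_vertical)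
  have "one_dim_definable_subgroup L M v (rv_rel R)"
  proof (rule one_dim_rv_rel[OF R])
    show "defpred (\<lambda>e. R (e 0) (e 1))" unfolding R_def by (intro defpred_unit_elt def_intros)
    have "rv v ` {x. x \<noteq> 0 \<and> v x = 0} \<subseteq> snd ` rv_rel R" unfolding rv_rel_def R_def unit_elt_def by force
    thus "infinite (rv_rel R)" using infinite_units by (meson finite_imageI finite_subset)
    have "rv v ` {x. R x 1} \<subseteq> {rv v 1}" unfolding R_def by auto
    thus "finite (rv v ` {y. R 1 y}) \<or> finite (rv v ` {x. R x 1})" by (meson finite.emptyI finite.insertI finite_subset)
  qed
  moreover have "finite_union_of_translates v (rv_rel R) (fiber v (rv_rel T) a b)"
  proof -
    obtain d where d: "d \<noteq> 0" "v d = b" using v_surj by blast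
    define A where "A = {x. v x = a \<and> (\<exists>y. v y = b \<and> T x y)}"
    have A_full: "T x y" if "x \<in> A" "y \<noteq> 0" "v y = b" for x y
      using that full T_nonzero unfolding A_def full_def by blast
    have "A \<subseteq> {x. x \<noteq> 0 \<and> v x = a \<and> infinite (rv v ` {y. v y = b \<and> T x y})}"
    proof
      fix x assume x: "x \<in> A"
      have "rv v ` {y. y \<noteq> 0 \<and> v y = b} \<subseteq> rv v ` {y. v y = b \<and> T x y}" using A_full[OF x] by blast
      hence "infinite (rv v ` {y. v y = b \<and> T x y})" using infinite_rv[of b] by (rule infinite_super)
      thus "x \<in> {x. x \<noteq> 0 \<and> v x = a \<and> infinite (rv v ` {y. v y = b \<and> T x y})}"
        using x T_nonzero unfolding A_def by blast
    qed
    hence "finite (rv v ` A)" using T_small[of a b] by (meson finite_subset image_mono)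
    hence fin: "finite ((\<lambda>B. (B, rv v d)) ` rv v ` A)" by simp
    have A0: "x \<noteq> 0" if "x \<in> A" for x using that T_nonzero unfolding A_def by blast
    have sub: "(\<lambda>B. (B, rv v d)) ` rv v ` A \<subseteq> carrier (RV v \<times>\<times> RV v)"
      unfolding DirProd_def carrier_RV using A0 d(1) by auto
    have "fiber v (rv_rel T) a b = (\<Union>x\<in>A. {(rv v (w * x), rv v (z * d)) | w z. R w z})"
    proof (intro equalityI subsetI)
      fix p assume "p \<in> fiber v (rv_rel T) a b"
      then obtain x y where p: "p = (rv v x, rv v y)" "T x y" "v x = a" "v y = b"
        unfolding fiber_iff by blast
      have "R 1 (y / d)" unfolding R_def using unit_elt_divide[of y d] T_nonzero[OF p(2)] d p(4) by simp
      moreover have "p = (rv v (1 * x), rv v (y / d * d))" using p(1) d(1) by simp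
      moreover have "x \<in> A" unfolding A_def using p by blast
      ultimately show "p \<in> (\<Union>x\<in>A. {(rv v (w * x), rv v (z * d)) | w z. R w z})" by blast
    next
      fix p assume "p \<in> (\<Union>x\<in>A. {(rv v (w * x), rv v (z * d)) | w z. R w z})"
      then obtain x w z where x: "x \<in> A" and p: "p = (rv v (w * x), rv v (z * d))" and "R w z" by blast
      hence w: "rv v w = rv v 1" and z: "z \<noteq> 0" "v z = 0" unfolding R_def unit_elt_def by auto
      have "rv v (w * x) = rv v (1 * x)" by (rule rv_mult_cong[OF w refl])
      hence "p = (rv v x, rv v (z * d))" using p by simp
      moreover have "T x (z * d)" "v (z * d) = b" using A_full[OF x, of "z * d"] z d by (simp_all add: v_mult)
      moreover have "v x = a" using x unfolding A_def by blast
      ultimately show "p \<in> fiber v (rv_rel T) a b" unfolding fiber_iff by blast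
    qed
    also have "\<dots> = (\<Union>x\<in>A. rv_rel R #>\<^bsub>RV v \<times>\<times> RV v\<^esub> (rv v x, rv v d))"
      using translate_rv_rel[OF R A0 d(1)] by (intro SUP_cong) auto
    finally show ?thesis unfolding finite_union_of_translates_def
      using fin sub by (intro exI[of _ "(\<lambda>B. (B, rv v d)) ` rv v ` A"]) auto
  qed
  ultimately show ?thesis unfolding translates_def by blast
qed

lemma segments_vertical: "segments ({a} \<times> Collect (TG a))"
proof -
  obtain c where c: "v c = a" using v_surj by blast
  have "defpred (\<lambda>e. TG (v c) (v (e 0)))" by (intro defpred_vv[OF TG_def'] def_intros)
  hence "tame (TG a)" unfolding c by (rule definable_tame)
  then obtain F \<J> where F: "finite F" "finite \<J>" "\<And>J. J \<in> \<J> \<Longrightarrow> open_interval J" "Collect (TG a) = F \<union> \<Union>\<J>"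
    using tame_intervals[of "TG a"] by blast
  have "vertical_segment ({a} \<times> J)" if "J \<in> \<J>" for J
    unfolding vertical_segment_def using F(3)[OF that] by blast
  hence "\<forall>s\<in>(\<times>) {a} ` \<J>. line_segment L M v s \<and> (no_exotic_automorphisms L M v \<longrightarrow> rational_slope s)"
    unfolding line_segment_def rational_slope_def by blast
  moreover have "{a} \<times> Collect (TG a) = {a} \<times> F \<union> \<Union>((\<times>) {a} ` \<J>)" unfolding F(4) by blast
  ultimately show ?thesis unfolding segments_def
    using F(1,2) by (intro exI[of _ "{a} \<times> F"] exI[of _ "(\<times>) {a} ` \<J>"]) simp
qed

end

context curve
begin

text \<open>The stabilizer moves every point of the fibre into the column over \<open>x0\<close>, so
  the finitely many points of this column represent all cosets.\<close>

lemma translates_good: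
  assumes a: "good a" and X: "X a"
  shows "translates (fiber v (rv_rel T) a (f a))"
proof -
  obtain x0 where x0: "x0 \<noteq> 0" "v x0 = a" using v_surj by blast
  have C_iff: "C x y \<longleftrightarrow> T x y \<and> v y = f a" if "v x = a" for x y unfolding C_def that using X by blast
  have fin: "finite (Pair (rv v x0) ` rv v ` Collect (C x0))" using good_finite[OF a x0] by simp
  have sub: "Pair (rv v x0) ` rv v ` Collect (C x0) \<subseteq> carrier (RV v \<times>\<times> RV v)"
    unfolding DirProd_def carrier_RV using x0(1) C_nonzero by auto
  have "fiber v (rv_rel T) a (f a) = (\<Union>y\<in>Collect (C x0). {(rv v (w * x0), rv v (z * y)) | w z. H a w z})"
  proof (intro equalityI subsetI)
    fix p assume "p \<in> fiber v (rv_rel T) a (f a)"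
    then obtain x y where p: "p = (rv v x, rv v y)" "v x = a" "C x y"
      unfolding fiber_iff using C_iff by blast
    obtain w z where wz: "H a w z" "w * x = x0" "C x0 (z * y)" using H_translate[OF a p(3,2) x0] by blast
    have "w \<noteq> 0" "z \<noteq> 0" using rel_groupD(1)[OF rel_group_H wz(1)] unfolding unit_elt_def by blast+
    hence "x = 1 / w * x0" "y = 1 / z * (z * y)" unfolding wz(2)[symmetric] by simp_all
    hence "p = (rv v (1 / w * x0), rv v (1 / z * (z * y)))" using p(1) by simp
    moreover have "H a (1 / w) (1 / z)" by (rule rel_groupD(4)[OF rel_group_H wz(1)])
    ultimately show "p \<in> (\<Union>y\<in>Collect (C x0). {(rv v (w * x0), rv v (z * y)) | w z. H a w z})"
      using wz(3) by blast
  next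
    fix p assume "p \<in> (\<Union>y\<in>Collect (C x0). {(rv v (w * x0), rv v (z * y)) | w z. H a w z})"
    then obtain y w z where p: "C x0 y" "p = (rv v (w * x0), rv v (z * y))" and h: "H a w z" by blast
    have "v (w * x0) = a"
      using rel_groupD(1)[OF rel_group_H h] x0 unfolding unit_elt_def by (simp add: v_mult)
    moreover have "C (w * x0) (z * y)" by (rule H_apply[OF h x0(2) p(1)])
    ultimately show "p \<in> fiber v (rv_rel T) a (f a)"
      unfolding fiber_iff p(2) using C_iff by blast
  qed
  also have "\<dots> = (\<Union>y\<in>Collect (C x0). rv_rel (H a) #>\<^bsub>RV v \<times>\<times> RV v\<^esub> (rv v x0, rv v y))"
    using translate_rv_rel[OF rel_group_H x0(1), of _ a] C_nonzero by (intro SUP_cong) auto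
  finally have "finite_union_of_translates v (rv_rel (H a)) (fiber v (rv_rel T) a (f a))"
    unfolding finite_union_of_translates_def
    using fin sub by (intro exI[of _ "Pair (rv v x0) ` rv v ` Collect (C x0)"]) auto
  thus ?thesis unfolding translates_def using one_dim_H[OF a] by blast
qed

lemma finite_not_translates: "finite {a. X a \<and> \<not> translates (fiber v (rv_rel T) a (f a))}"
  using finite_bad by (rule rev_finite_subset) (use translates_good in blast)

lemma segments_graph: "segments {(x, f x) | x. X x}"
proof -
  obtain F \<J> where F: "finite F" "finite \<J>" "Collect X = F \<union> \<Union>\<J>"
    "\<forall>K\<in>\<J>. line_segment L M v {(x, f x) | x. x \<in> K} \<and>
      (no_exotic_automorphisms L M v \<longrightarrow> rational_slope {(x, f x) | x. x \<in> K})"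
    using graph_decomposition by (elim exE conjE)
  have "{(x, f x) | x. X x} = (\<lambda>x. (x, f x)) ` Collect X" by blast
  also have "\<dots> = (\<lambda>x. (x, f x)) ` F \<union> \<Union>((\<lambda>K. {(x, f x) | x. x \<in> K}) ` \<J>)" unfolding F(3) by blast
  finally show ?thesis unfolding segments_def
    using F by (intro exI[of _ "(\<lambda>x. (x, f x)) ` F"] exI[of _ "(\<lambda>K. {(x, f x) | x. x \<in> K}) ` \<J>"]) simp
qed

end

context small_relation
begin

text \<open>The image consists of the vertical lines over \<open>V\<close> and of finitely many
  branches. Exceptional points are those on the vertical lines with a column that is neither full
  nor empty, and those over bad values of a branch.\<close>

lemma decomposition:
  "segments (val_image v (rv_rel T))"
  "finite {(x, y) \<in> val_image v (rv_rel T). \<not> translates (fiber v (rv_rel T) x y)}"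
proof -
  define V where "V = {a. infinite {b. TG a b}}"
  have V: "finite V" unfolding V_def by (rule finite_vertical)
  define R where "R a b \<longleftrightarrow> a \<notin> V \<and> TG a b" for a b
  have Rd: "defpred (\<lambda>e. R (v (e 0)) (v (e 1)))" unfolding R_def
    by (intro defpred_v1[OF defpred_mem_finite[OF V]] defpred_vv[OF TG_def'] def_intros)
  have Rfin: "finite (Collect (R a))" for a
  proof (cases "a \<in> V")
    case True
    thus ?thesis unfolding R_def by simp
  next
    case False
    hence "finite {b. TG a b}" unfolding V_def by simp
    thus ?thesis unfolding R_def by simp
  qed
  obtain N where N: "\<And>x. card (Collect (R x)) \<le> N" using uniform_finite_Gamma[OF Rd Rfin] by blast
  obtain fs Xs where fX: "\<And>i. i < N \<Longrightarrow> defpred (\<lambda>e. v (e 0) = fs i (v (e 1)))"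
    "\<And>i. i < N \<Longrightarrow> defpred (\<lambda>e. Xs i (v (e 0)))" "\<And>x y. R x y \<longleftrightarrow> (\<exists>i<N. Xs i x \<and> y = fs i x)"
    using definable_branches[OF Rd Rfin N] by (elim exE conjE) blast
  have cu: "curve L M v \<kappa> T (fs i) (Xs i)" if i: "i < N" for i
  proof
    fix a assume "Xs i a"
    hence "R a (fs i a)" unfolding fX(3) using i by blast
    thus "TG a (fs i a)" unfolding R_def by blast
  qed (fact fX(1)[OF i] fX(2)[OF i])+
  have TG_eq: "TG a b \<longleftrightarrow> a \<in> V \<and> TG a b \<or> (\<exists>i<N. Xs i a \<and> b = fs i a)" for a b
    unfolding fX(3)[symmetric] R_def by blast
  have "{(a, b). TG a b} = (\<Union>a\<in>V. {a} \<times> Collect (TG a)) \<union> (\<Union>i\<in>{..<N}. {(x, fs i x) | x. Xs i x})"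
  proof (intro equalityI subsetI)
    fix p assume "p \<in> {(a, b). TG a b}"
    then obtain a b where "p = (a, b)" "TG a b" by blast
    thus "p \<in> (\<Union>a\<in>V. {a} \<times> Collect (TG a)) \<union> (\<Union>i\<in>{..<N}. {(x, fs i x) | x. Xs i x})"
      using TG_eq[of a b] by blast
  next
    fix p assume "p \<in> (\<Union>a\<in>V. {a} \<times> Collect (TG a)) \<union> (\<Union>i\<in>{..<N}. {(x, fs i x) | x. Xs i x})"
    thus "p \<in> {(a, b). TG a b}" using curve.X_TG[OF cu] by blast
  qed
  thus "segments (val_image v (rv_rel T))" unfolding val_image_eq
    using segments_Un[OF segments_UN[OF V segments_vertical] segments_UN[of "{..<N}" "\<lambda>i. {(x, fs i x) | x. Xs i x}"]]
      curve.segments_graph[OF cu] by simp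
  define B where "B i = {a. Xs i a \<and> \<not> translates (fiber v (rv_rel T) a (fs i a))}" for i
  define E where "E a = {b. \<exists>x y. x \<noteq> 0 \<and> v x = a \<and> v y = b \<and> T x y \<and> \<not> full x b}" for a
  have "finite (B i)" if "i < N" for i unfolding B_def by (rule curve.finite_not_translates[OF cu[OF that]])
  hence fin1: "finite (\<Union>i\<in>{..<N}. (\<lambda>x. (x, fs i x)) ` B i)" by blast
  have fin2: "finite (\<Union>a\<in>V. {a} \<times> E a)" using V full_or_empty unfolding E_def by blast
  have cover: "p \<in> (\<Union>a\<in>V. {a} \<times> E a) \<union> (\<Union>i\<in>{..<N}. (\<lambda>x. (x, fs i x)) ` B i)"
    if p: "p = (a, b)" "TG a b" "\<not> translates (fiber v (rv_rel T) a b)" for p a b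
  proof (cases "a \<in> V")
    case True
    have "b \<in> E a"
    proof (rule ccontr)
      assume "b \<notin> E a"
      hence "translates (fiber v (rv_rel T) a b)" unfolding E_def by (intro translates_vertical) blast
      thus False using p(3) by blast
    qed
    thus ?thesis using True p(1) by blast
  next
    case False
    then obtain i where "i < N" "Xs i a" "b = fs i a" using TG_eq[of a b] p(2) by blast
    hence "a \<in> B i" "p = (a, fs i a)" unfolding B_def using p by auto
    thus ?thesis using \<open>i < N\<close> by blast
  qed
  have "{(x, y) \<in> val_image v (rv_rel T). \<not> translates (fiber v (rv_rel T) x y)} \<subseteq>
      (\<Union>a\<in>V. {a} \<times> E a) \<union> (\<Union>i\<in>{..<N}. (\<lambda>x. (x, fs i x)) ` B i)"
  proof
    fix p assume "p \<in> {(x, y) \<in> val_image v (rv_rel T). \<not> translates (fiber v (rv_rel T) x y)}"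
    then obtain a b where "p = (a, b)" "TG a b" "\<not> translates (fiber v (rv_rel T) a b)"
      unfolding val_image_eq by auto
    thus "p \<in> (\<Union>a\<in>V. {a} \<times> E a) \<union> (\<Union>i\<in>{..<N}. (\<lambda>x. (x, fs i x)) ` B i)" by (rule cover)
  qed
  then show "finite {(x, y) \<in> val_image v (rv_rel T). \<not> translates (fiber v (rv_rel T) x y)}"
    by (rule finite_subset) (use fin1 fin2 in simp)
qed

end

theorem theorem4p20:
  fixes L :: "('f, 'r) lang"
    and M :: "('f, 'r, 'm::alg_closed_field) fo_struct"
    and v :: "'m \<Rightarrow> 'g::linordered_ab_group_add"
    and \<kappa> :: "'c rel"
    and t :: 'f
    and D :: "('m set \<times> 'm set) set"
  assumes "expands_ACVF L M v"
    and "C_minimal L M v"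
    and "monster_model L M \<kappa>"
    and "t \<in> funs L" and "farity L t = 0" and "fint M t [] \<noteq> 0" and "0 < v (fint M t [])"
    and "definable_RV2 L M v D"
    and "small_over_\<Gamma>2 L M v D"
  shows
    "(\<exists>P S. finite P \<and> finite S \<and> (\<forall>s\<in>S. line_segment L M v s) \<and>
        val_image v D = P \<union> \<Union>S)
     \<and>
     (no_exotic_automorphisms L M v \<longrightarrow>
        (\<exists>P S. finite P \<and> finite S \<and> (\<forall>s\<in>S. line_segment L M v s \<and> rational_slope s) \<and>
           val_image v D = P \<union> \<Union>S))
     \<and>
     finite {(x, y) \<in> val_image v D.
        \<not> (\<exists>H. one_dim_definable_subgroup L M v H \<and>
               finite_union_of_translates v H (fiber v D x y))}"
proof -
  interpret C_min_ACVF L M v \<kappa> by unfold_locales (fact assms(1-3))+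
  define T where "T x y \<longleftrightarrow> x \<noteq> 0 \<and> y \<noteq> 0 \<and> (rv v x, rv v y) \<in> D" for x y
  have D: "D \<subseteq> rv v ` (UNIV - {0}) \<times> rv v ` (UNIV - {0})"
    "definable L M 2 {[x, y] | x y. x \<in> UNIV - {0} \<and> y \<in> UNIV - {0} \<and> (rv v x, rv v y) \<in> D}"
    using assms(8) unfolding definable_quot2_def by blast+
  have "{[x, y] | x y. x \<in> UNIV - {0} \<and> y \<in> UNIV - {0} \<and> (rv v x, rv v y) \<in> D} = {[x, y] | x y. T x y}"
    unfolding T_def by simp
  hence Td: "defpred (\<lambda>e. T (e 0) (e 1))" using D(2) defpred_of_definable_pairs by simp
  have D_eq: "D = rv_rel T"
  proof (intro equalityI subsetI)
    fix p assume p: "p \<in> D"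
    then obtain x y where "x \<noteq> 0" "y \<noteq> 0" "p = (rv v x, rv v y)" using D(1) by blast
    thus "p \<in> rv_rel T" unfolding rv_rel_def T_def using p by blast
  next
    fix p assume "p \<in> rv_rel T"
    thus "p \<in> D" unfolding rv_rel_def T_def by blast
  qed
  have T0: "x \<noteq> 0 \<and> y \<noteq> 0" if "T x y" for x y using that unfolding T_def by blast
  interpret small_relation L M v \<kappa> T
  proof
    show "T x y = T x' y'" if "rv v x = rv v x'" "rv v y = rv v y'" for x x' y y'
      unfolding T_def that rv_eq_0[OF that(1)] rv_eq_0[OF that(2)] ..
    show "finite (rv v ` {x. x \<noteq> 0 \<and> v x = a \<and> infinite (rv v ` {y. v y = b \<and> T x y})})" for a b
      by (rule small_fibers[OF Td T0 assms(9)[unfolded D_eq]])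
  qed (fact Td T0)+
  obtain P S where PS: "finite P" "finite S"
    "\<forall>s\<in>S. line_segment L M v s \<and> (no_exotic_automorphisms L M v \<longrightarrow> rational_slope s)"
    "val_image v D = P \<union> \<Union>S"
    using decomposition(1) unfolding segments_def D_eq by (elim exE conjE)
  show ?thesis
  proof (intro conjI impI)
    show "\<exists>P S. finite P \<and> finite S \<and> (\<forall>s\<in>S. line_segment L M v s) \<and> val_image v D = P \<union> \<Union>S"
      using PS by blast
    show "\<exists>P S. finite P \<and> finite S \<and> (\<forall>s\<in>S. line_segment L M v s \<and> rational_slope s) \<and>
        val_image v D = P \<union> \<Union>S" if ne: "no_exotic_automorphisms L M v"
      using PS ne by blast
    show "finite {(x, y) \<in> val_image v D. \<not> (\<exists>H. one_dim_definable_subgroup L M v H \<and>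
        finite_union_of_translates v H (fiber v D x y))}"
      using decomposition(2) unfolding D_eq translates_def .
  qed
qed

end
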